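(* Suppose that the time step sizes satisfy $\tau_1\le c_1\tau_2$ and $\tau_m\le c_2\tau_{m-1}$ for $m=2,\dots,N$, with fixed positive constants $c_1,c_2$. Let $\overline p_{\tau,h}$ be the pressure post-processed by interpolation (PI) and let $\boldsymbol e^{\boldsymbol u}_{\tau,h}=\widehat{\boldsymbol u}_{\tau,h}-\boldsymbol u_{\tau,h}$. Then there is a constant $C>0$, independent of the mesh sizes in space and time, such that $\overline p_{\tau,h}$ and its right-sided limits $\overline p_{\tau,h}^{\,+}(t_{m-1})$ satisfy $$\sum_{m=1}^N\tau_m\|p(t_{m-1})-\overline p_{\tau,h}^{\,+}(t_{m-1})\|^2\le C\big(\|\nabla\boldsymbol e^{\boldsymbol u}_{\tau,h}(0)\|^2+\tau^4+h^{2r}\big),$$ $$\Big(\int_0^T\|p(t)-\overline p_{\tau,h}(t)\|^2\,dt\Big)^{1/2}\le C\big(\|\nabla\boldsymbol e^{\boldsymbol u}_{\tau,h}(0)\|+\tau^2+h^r\big).$$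
   Context: Let $d\in\{2,3\}$, $\Omega\subset\mathbb R^d$ an open bounded domain, $T>0$, $I=(0,T]$, $\overline I=[0,T]$; $\langle\cdot,\cdot\rangle$ and $\|\cdot\|$ are the inner product and norm of $L^2(\Omega)$ (scalar-, vector- or matrix-valued), $\|\cdot\|_m$ the norm of $H^m(\Omega)$. $\boldsymbol V=H^1_0(\Omega)^d$, $Q=\{q\in L^2(\Omega):\int_\Omega q\,dx=0\}$, $\boldsymbol V^{\mathrm{div}}=\{\boldsymbol v\in\boldsymbol V:\langle\nabla\cdot\boldsymbol v,q\rangle=0\ \forall q\in Q\}$. Time mesh: $0=t_0<\dots<t_N=T$ with $N\ge2$, $I_n=(t_{n-1},t_n]$, $\tau_n=t_n-t_{n-1}$, $\tau=\max_n\tau_n$, $\bar t_n=(t_{n-1}+t_n)/2$. $\mathbb P_k(J;B)$: $B$-valued polynomials in $t\in J$ of degree at most $k$. $w^+$ denotes right-sided limits. Continuous problem: $\partial_t\boldsymbol u-\Delta\boldsymbol u+\nabla p=\boldsymbol f$, $\nabla\cdot\boldsymbol u=0$ in $\Omega\times(0,T]$, $\boldsymbol u(0)=\boldsymbol u_0$ in $\Omega$, $\boldsymbol u=\boldsymbol 0$ on $\partial\Omega\times[0,T]$, with $\boldsymbol u(t)\in\boldsymbol V^{\mathrm{div}}$, $p(t)\in Q$. Standing assumptions: the solution is sufficiently regular up to $t=0$, i.e. $\boldsymbol u\in C^k(\overline I;H^k(\Omega)^d)$, $p\in C^k(\overline I;H^k(\Omega))$ for a sufficiently large $k$ depending only on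 $r$ (and $\boldsymbol f$ is correspondingly regular); the stationary Stokes problem on $\Omega$ is $H^2$-regular, i.e. for every $\boldsymbol g\in L^2(\Omega)^d$ the solution $(\boldsymbol w,s)\in\boldsymbol V\times Q$ of $-\Delta\boldsymbol w+\nabla s=\boldsymbol g$, $\nabla\cdot\boldsymbol w=0$ lies in $H^2\times H^1$ and $\|\boldsymbol w\|_2+\|s\|_1\le C\|\boldsymbol g\|$. Constants $C$ are independent of $h$ and of the time mesh, but may depend on $c_1,c_2$, $T$, the data (including $\Omega$), the solution $(\boldsymbol u,p)$, the shape regularity of the space meshes, and the polynomial degree in space. Finite elements: $\{\mathcal T_h\}$ is a shape-regular family of meshes of $\Omega$ with mesh size $h$, and $\boldsymbol V_h=\{\boldsymbol v\in\boldsymbol V:\boldsymbol v|_K\in\boldsymbol V(K)\ \forall K\in\mathcal T_h\}$, $Q_h=\{q\in Q:q|_K\in Q(K)\ \forall K\in\mathcal T_h\}$ with local spaces of mapped polynomials of uniformly bounded degree. Assumption: with $\beta$ independent of $h$, $0<\beta\le\inf_{q_h\in Q_h\setminus\{0\}}\sup_{\boldsymbol v_h\in\boldsymbol V_h\setminus\{0\}}\frac{-\langle\nabla\cdot\boldsymbol v_h,q_h\rangle}{\|\boldsymbol v_h\|_1\|q_h\|}$; and for $\boldsymbol v\in\boldsymbol V\cap H^{r+1}(\Omega)^d$, $q\in Q\cap H^r(\Omega)$ there are $i_h\boldsymbol v\in\boldsymbol V_h$, $j_hq\in Q_h$ with $\|\boldsymbol v-i_h\boldsymbol v\|+h\|\nabla(\boldsymbol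 v-i_h\boldsymbol v)\|\le Ch^{r+1}\|\boldsymbol v\|_{r+1}$, $\|q-j_hq\|\le Ch^r\|q\|_r$. $\boldsymbol V_h^{\mathrm{div}}=\{\boldsymbol v_h\in\boldsymbol V_h:\langle\nabla\cdot\boldsymbol v_h,q_h\rangle=0\ \forall q_h\in Q_h\}$. Operators: $\langle A_h\boldsymbol u,\boldsymbol v_h\rangle=\langle\nabla\boldsymbol u,\nabla\boldsymbol v_h\rangle$, $\langle B_h\boldsymbol v,q_h\rangle=-\langle\nabla\cdot\boldsymbol v,q_h\rangle$, $\langle B_h'q,\boldsymbol v_h\rangle=-\langle\nabla\cdot\boldsymbol v_h,q\rangle$. Scheme (G): let $\boldsymbol u_{\tau,h}(0)=\boldsymbol u_{0,h}\in\boldsymbol V_h^{\mathrm{div}}$ be an approximation of $\boldsymbol u_0$. Successively for $n=1,\dots,N$, $(\boldsymbol u_{\tau,h},p_{\tau,h})|_{I_n}\in\mathbb P_1(I_n;\boldsymbol V_h)\times\mathbb P_1(I_n;Q_h)$ satisfies $\boldsymbol u_{\tau,h}^+(t_{n-1})=\boldsymbol u_{\tau,h}(t_{n-1})$ and $$\int_{I_n}\langle\partial_t\boldsymbol u_{\tau,h}+A_h\boldsymbol u_{\tau,h}+B_h'p_{\tau,h},\boldsymbol v_h\rangle dt=\tfrac{\tau_n}{2}\langle\boldsymbol f(t_{n-1})+\boldsymbol f(t_n),\boldsymbol v_h\rangle,\qquad\int_{I_n}\langle B_h\boldsymbol u_{\tau,h},q_h\rangle dt=0$$ for all $(\boldsymbol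 v_h,q_h)\in\boldsymbol V_h\times Q_h$. The velocity $\boldsymbol u_{\tau,h}$ and the values $p_{\tau,h}(\bar t_n)$ are uniquely determined, while $p^+_{\tau,h}(t_{n-1})\in Q_h$ is arbitrary; $p_{\tau,h}$ denotes any of the resulting pressure solutions. Interpolants: the Stokes projection $R_h(\boldsymbol w,s)=(R_h^{\boldsymbol u}(\boldsymbol w,s),R_h^p(\boldsymbol w,s))=(\widehat{\boldsymbol w}_h,\widehat s_h)\in\boldsymbol V_h\times Q_h$ of $(\boldsymbol w,s)\in\boldsymbol V^{\mathrm{div}}\times Q$ is defined by $\langle A_h\widehat{\boldsymbol w}_h+B_h'\widehat s_h,\boldsymbol v_h\rangle=\langle A_h\boldsymbol w+B_h's,\boldsymbol v_h\rangle$ and $\langle B_h\widehat{\boldsymbol w}_h,q_h\rangle=0$ for all $\boldsymbol v_h\in\boldsymbol V_h$, $q_h\in Q_h$. For continuous $v$ on $\overline I$, $R^1_\tau v$ is given on each $I_n$ by the polynomial of degree at most 1 in $t$ with value $v(t_{n-1})$ at $t_{n-1}$ and time derivative at $\bar t_n$ equal to that of the quadratic Lagrange interpolant of $v$ at $t_{n-1},\bar t_n,t_n$; $R^1_\tau v(0)=v(0)$. Set $\widehat{\boldsymbol u}_{\tau,h}=R_h^{\boldsymbol u}(R^1_\tau\boldsymbol u,R^1_\tau p)$. Post-processing by interpolation (PI): for $n\ge2$ and $t\in[t_{n-2},t_n]$ let $J_nq(t)=q(\bar t_{n-1})+\frac{t-\bar t_{n-1}}{\bar t_n-\bar t_{n-1}}\big(q(\bar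 t_n)-q(\bar t_{n-1})\big)$. Define $\overline p_{\tau,h}(t)=J_2p_{\tau,h}(t)$ for $t\in\overline I_1=[t_0,t_1]$ and $\overline p_{\tau,h}(t)=J_np_{\tau,h}(t)$ for $t\in I_n$, $n\ge2$. *)

theory Defs
  imports "HOL-Analysis.Analysis"
begin

text \<open>
  Functions on \<Omega> are represented by total functions on \<^typ>\<open>real ^ 'd\<close>; only their values on \<Omega>, up to
  null sets, matter.  The value type \<open>'b\<close> is \<^typ>\<open>real\<close>, \<^typ>\<open>real ^ 'd\<close> or \<^typ>\<open>real ^ 'd ^ 'd\<close>
  for scalar, vector and matrix fields; on the latter, the inner product is the Frobenius one.
\<close>

section \<open>Lebesgue and Sobolev spaces\<close>

definition ae_eq :: "(real ^ 'd) set \<Rightarrow> (real ^ 'd \<Rightarrow> 'b) \<Rightarrow> (real ^ 'd \<Rightarrow> 'b) \<Rightarrow> bool"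
  where "ae_eq \<Omega> f g \<longleftrightarrow> (AE x in lebesgue_on \<Omega>. f x = g x)"

definition L2 :: "(real ^ 'd) set \<Rightarrow> (real ^ 'd \<Rightarrow> 'b::euclidean_space) set"
  where "L2 \<Omega> = {f \<in> borel_measurable (lebesgue_on \<Omega>).
                    integrable (lebesgue_on \<Omega>) (\<lambda>x. (norm (f x))\<^sup>2)}"

definition ip :: "(real ^ 'd) set \<Rightarrow> (real ^ 'd \<Rightarrow> 'b::euclidean_space) \<Rightarrow> (real ^ 'd \<Rightarrow> 'b) \<Rightarrow> real"
  where "ip \<Omega> f g = (\<integral>x. f x \<bullet> g x \<partial>lebesgue_on \<Omega>)"

definition L2norm :: "(real ^ 'd) set \<Rightarrow> (real ^ 'd \<Rightarrow> 'b::euclidean_space) \<Rightarrow> real"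
  where "L2norm \<Omega> f = sqrt (ip \<Omega> f f)"

definition partial :: "'d::finite \<Rightarrow> (real ^ 'd \<Rightarrow> 'b::real_normed_vector) \<Rightarrow> real ^ 'd \<Rightarrow> 'b"
  where "partial i f x = frechet_derivative f (at x) (axis i 1)"

fun partials :: "'d::finite list \<Rightarrow> (real ^ 'd \<Rightarrow> 'b::real_normed_vector) \<Rightarrow> real ^ 'd \<Rightarrow> 'b"
  where
    "partials [] f = f"
  | "partials (i # is) f = partial i (partials is f)"

definition smooth :: "(real ^ 'd::finite \<Rightarrow> 'b::real_normed_vector) \<Rightarrow> bool"
  where "smooth f \<longleftrightarrow> (\<forall>is x. partials is f differentiable (at x))"

definition test_functions :: "(real ^ 'd::finite) set \<Rightarrow> (real ^ 'd \<Rightarrow> 'b::real_normed_vector) set"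
  where "test_functions \<Omega> =
    {\<phi>. smooth \<phi> \<and> (\<exists>K. compact K \<and> K \<subseteq> \<Omega> \<and> (\<forall>x. x \<notin> K \<longrightarrow> \<phi> x = 0))}"

definition multi_indices :: "nat \<Rightarrow> ('d::finite \<Rightarrow> nat) set"
  where "multi_indices m = {\<alpha>. (\<Sum>i\<in>UNIV. \<alpha> i) \<le> m}"

text \<open>
  A classical derivative \<open>D\<^sup>\<alpha> \<phi>\<close> of a smooth function is obtained from any list of directions in
  which every \<open>i\<close> occurs \<open>\<alpha> i\<close> times; the order is irrelevant.
\<close>

definition is_weak_deriv ::
    "(real ^ 'd::finite) set \<Rightarrow> ('d \<Rightarrow> nat) \<Rightarrow>
     (real ^ 'd \<Rightarrow> 'b::euclidean_space) \<Rightarrow> (real ^ 'd \<Rightarrow> 'b) \<Rightarrow> bool"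
  where "is_weak_deriv \<Omega> \<alpha> f g \<longleftrightarrow>
    (\<forall>\<phi> \<in> test_functions \<Omega> :: (real ^ 'd \<Rightarrow> real) set. \<forall>is. (\<forall>i. count_list is i = \<alpha> i) \<longrightarrow>
       (\<integral>x. partials is \<phi> x *\<^sub>R f x \<partial>lebesgue_on \<Omega>)
         = (- 1) ^ (\<Sum>i\<in>UNIV. \<alpha> i) *\<^sub>R (\<integral>x. \<phi> x *\<^sub>R g x \<partial>lebesgue_on \<Omega>))"

definition wderiv ::
    "(real ^ 'd::finite) set \<Rightarrow> ('d \<Rightarrow> nat) \<Rightarrow>
     (real ^ 'd \<Rightarrow> 'b::euclidean_space) \<Rightarrow> real ^ 'd \<Rightarrow> 'b"
  where "wderiv \<Omega> \<alpha> f = (SOME g. g \<in> L2 \<Omega> \<and> is_weak_deriv \<Omega> \<alpha> f g)"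

definition sobolev :: "(real ^ 'd::finite) set \<Rightarrow> nat \<Rightarrow> (real ^ 'd \<Rightarrow> 'b::euclidean_space) set"
  where "sobolev \<Omega> m =
    {f \<in> L2 \<Omega>. \<forall>\<alpha> \<in> multi_indices m. \<exists>g \<in> L2 \<Omega>. is_weak_deriv \<Omega> \<alpha> f g}"

definition sobolev_norm ::
    "(real ^ 'd::finite) set \<Rightarrow> nat \<Rightarrow> (real ^ 'd \<Rightarrow> 'b::euclidean_space) \<Rightarrow> real"
  where "sobolev_norm \<Omega> m f = sqrt (\<Sum>\<alpha> \<in> multi_indices m. (L2norm \<Omega> (wderiv \<Omega> \<alpha> f))\<^sup>2)"

text \<open>Row \<open>j\<close> of the gradient is the derivative in direction \<open>j\<close>.\<close>

definition grad ::
    "(real ^ 'd::finite) set \<Rightarrow> (real ^ 'd \<Rightarrow> 'b::euclidean_space) \<Rightarrow> real ^ 'd \<Rightarrow> 'b ^ 'd"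
  where "grad \<Omega> v x = (\<chi> j. wderiv \<Omega> (\<lambda>i. if i = j then 1 else 0) v x)"

definition divergence ::
    "(real ^ 'd::finite) set \<Rightarrow> (real ^ 'd \<Rightarrow> real ^ 'd) \<Rightarrow> real ^ 'd \<Rightarrow> real"
  where "divergence \<Omega> v x = (\<Sum>i\<in>UNIV. grad \<Omega> v x $ i $ i)"

definition laplacian ::
    "(real ^ 'd::finite) set \<Rightarrow> (real ^ 'd \<Rightarrow> 'b::euclidean_space) \<Rightarrow> real ^ 'd \<Rightarrow> 'b"
  where "laplacian \<Omega> v x = (\<Sum>j\<in>UNIV. wderiv \<Omega> (\<lambda>i. if i = j then 2 else 0) v x)"

definition V :: "(real ^ 'd::finite) set \<Rightarrow> (real ^ 'd \<Rightarrow> real ^ 'd) set"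
  where "V \<Omega> = {v \<in> sobolev \<Omega> 1.
    \<forall>\<epsilon>>0. \<exists>\<phi> \<in> test_functions \<Omega>. sobolev_norm \<Omega> 1 (\<lambda>x. v x - \<phi> x) < \<epsilon>}"

definition Q :: "(real ^ 'd::finite) set \<Rightarrow> (real ^ 'd \<Rightarrow> real) set"
  where "Q \<Omega> = {q \<in> L2 \<Omega>. (\<integral>x. q x \<partial>lebesgue_on \<Omega>) = 0}"

definition Vdiv :: "(real ^ 'd::finite) set \<Rightarrow> (real ^ 'd \<Rightarrow> real ^ 'd) set"
  where "Vdiv \<Omega> = {v \<in> V \<Omega>. \<forall>q \<in> Q \<Omega>. ip \<Omega> (divergence \<Omega> v) q = 0}"

text \<open>The forms behind \<open>A\<^sub>h\<close> and \<open>B\<^sub>h\<close>, \<open>B\<^sub>h'\<close>: the operators are only ever tested with discrete functions.\<close>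

definition a_form ::
    "(real ^ 'd::finite) set \<Rightarrow> (real ^ 'd \<Rightarrow> real ^ 'd) \<Rightarrow> (real ^ 'd \<Rightarrow> real ^ 'd) \<Rightarrow> real"
  where "a_form \<Omega> u v = ip \<Omega> (grad \<Omega> u) (grad \<Omega> v)"

definition b_form ::
    "(real ^ 'd::finite) set \<Rightarrow> (real ^ 'd \<Rightarrow> real ^ 'd) \<Rightarrow> (real ^ 'd \<Rightarrow> real) \<Rightarrow> real"
  where "b_form \<Omega> v q = - ip \<Omega> (divergence \<Omega> v) q"

section \<open>Functions of time with values in function spaces\<close>

text \<open>Time derivatives and one-sided limits are taken in \<open>L\<^sup>2(\<Omega>)\<close>.\<close>

definition tderiv ::
    "(real ^ 'd) set \<Rightarrow> real set \<Rightarrow> (real \<Rightarrow> real ^ 'd \<Rightarrow> 'b::euclidean_space) \<Rightarrow>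
     real \<Rightarrow> real ^ 'd \<Rightarrow> 'b"
  where "tderiv \<Omega> J w t = (SOME g. g \<in> L2 \<Omega> \<and>
    ((\<lambda>s. L2norm \<Omega> (\<lambda>x. (w s x - w t x) /\<^sub>R (s - t) - g x)) \<longlongrightarrow> 0) (at t within J))"

definition right_limit ::
    "(real ^ 'd) set \<Rightarrow> (real \<Rightarrow> real ^ 'd \<Rightarrow> 'b::euclidean_space) \<Rightarrow> real \<Rightarrow> real ^ 'd \<Rightarrow> 'b"
  where "right_limit \<Omega> w t = (SOME g. g \<in> L2 \<Omega> \<and>
    ((\<lambda>s. L2norm \<Omega> (\<lambda>x. w s x - g x)) \<longlongrightarrow> 0) (at_right t))"

text \<open>\<open>w \<in> C\<^sup>k(J; H\<^sup>m(\<Omega>))\<close>, where \<open>W j\<close> is the \<open>j\<close>-th time derivative in \<open>H\<^sup>m(\<Omega>)\<close>.\<close>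

definition ck_sobolev ::
    "(real ^ 'd::finite) set \<Rightarrow> real set \<Rightarrow> nat \<Rightarrow> nat \<Rightarrow>
     (real \<Rightarrow> real ^ 'd \<Rightarrow> 'b::euclidean_space) \<Rightarrow> bool"
  where "ck_sobolev \<Omega> J k m w \<longleftrightarrow>
    (\<exists>W. W 0 = w \<and>
      (\<forall>j\<le>k. \<forall>t\<in>J. W j t \<in> sobolev \<Omega> m \<and>
         ((\<lambda>s. sobolev_norm \<Omega> m (\<lambda>x. W j s x - W j t x)) \<longlongrightarrow> 0) (at t within J)) \<and>
      (\<forall>j<k. \<forall>t\<in>J.
         ((\<lambda>s. sobolev_norm \<Omega> m (\<lambda>x. (W j s x - W j t x) /\<^sub>R (s - t) - W (Suc j) t x)) \<longlongrightarrow> 0)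
           (at t within J)))"

definition P1 ::
    "(real ^ 'd) set \<Rightarrow> real set \<Rightarrow> (real ^ 'd \<Rightarrow> 'b::euclidean_space) set \<Rightarrow>
     (real \<Rightarrow> real ^ 'd \<Rightarrow> 'b) set"
  where "P1 \<Omega> J B = {w. \<exists>a\<in>B. \<exists>b\<in>B. \<forall>t\<in>J. ae_eq \<Omega> (w t) (\<lambda>x. a x + t *\<^sub>R b x)}"

section \<open>The Stokes problem\<close>

definition stokes_solution ::
    "(real ^ 'd::finite) set \<Rightarrow> real \<Rightarrow> (real \<Rightarrow> real ^ 'd \<Rightarrow> real ^ 'd) \<Rightarrow> (real ^ 'd \<Rightarrow> real ^ 'd) \<Rightarrow>
     (real \<Rightarrow> real ^ 'd \<Rightarrow> real ^ 'd) \<Rightarrow> (real \<Rightarrow> real ^ 'd \<Rightarrow> real) \<Rightarrow> bool"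
  where "stokes_solution \<Omega> T f u0 u p \<longleftrightarrow>
    (\<forall>t\<in>{0..T}. u t \<in> Vdiv \<Omega> \<and> p t \<in> Q \<Omega>) \<and>
    ae_eq \<Omega> (u 0) u0 \<and>
    (\<forall>t\<in>{0<..T}.
       ae_eq \<Omega> (\<lambda>x. tderiv \<Omega> {0..T} u t x - laplacian \<Omega> (u t) x + grad \<Omega> (p t) x) (f t) \<and>
       ae_eq \<Omega> (divergence \<Omega> (u t)) (\<lambda>x. 0))"

definition stationary_stokes ::
    "(real ^ 'd::finite) set \<Rightarrow> (real ^ 'd \<Rightarrow> real ^ 'd) \<Rightarrow>
     (real ^ 'd \<Rightarrow> real ^ 'd) \<Rightarrow> (real ^ 'd \<Rightarrow> real) \<Rightarrow> bool"
  where "stationary_stokes \<Omega> g w s \<longleftrightarrow> w \<in> V \<Omega> \<and> s \<in> Q \<Omega> \<and>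
    (\<forall>v \<in> V \<Omega>. a_form \<Omega> w v + b_form \<Omega> v s = ip \<Omega> g v) \<and>
    (\<forall>q \<in> Q \<Omega>. b_form \<Omega> w q = 0)"

definition stokes_H2_regular :: "(real ^ 'd::finite) set \<Rightarrow> bool"
  where "stokes_H2_regular \<Omega> \<longleftrightarrow> (\<exists>C. \<forall>g \<in> L2 \<Omega>.
    (\<exists>w s. stationary_stokes \<Omega> g w s) \<and>
    (\<forall>w s. stationary_stokes \<Omega> g w s \<longrightarrow>
       w \<in> sobolev \<Omega> 2 \<and> s \<in> sobolev \<Omega> 1 \<and>
       sobolev_norm \<Omega> 2 w + sobolev_norm \<Omega> 1 s \<le> C * L2norm \<Omega> g))"

section \<open>Finite element spaces\<close>

text \<open>
  A discretization consists of the set of (closed) mesh cells and, for every cell \<open>K\<close>, its reference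
  cell, the map from the reference cell onto \<open>K\<close>, and the local spaces \<open>V(K)\<close> and \<open>Q(K)\<close>.
\<close>

record ('d::finite) discretization =
  cells :: "(real ^ 'd) set set"
  ref_cell :: "(real ^ 'd) set \<Rightarrow> (real ^ 'd) set"
  cell_map :: "(real ^ 'd) set \<Rightarrow> real ^ 'd \<Rightarrow> real ^ 'd"
  V_loc :: "(real ^ 'd) set \<Rightarrow> (real ^ 'd \<Rightarrow> real ^ 'd) set"
  Q_loc :: "(real ^ 'd) set \<Rightarrow> (real ^ 'd \<Rightarrow> real) set"

definition mesh_of :: "(real ^ 'd::finite) set \<Rightarrow> 'd discretization \<Rightarrow> bool"
  where "mesh_of \<Omega> D \<longleftrightarrow>
    finite (cells D) \<and> \<Union>(cells D) = closure \<Omega> \<and>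
    (\<forall>K \<in> cells D. compact K \<and> interior K \<noteq> {} \<and> cell_map D K ` ref_cell D K = K) \<and>
    (\<forall>K \<in> cells D. \<forall>L \<in> cells D. K \<noteq> L \<longrightarrow> interior K \<inter> interior L = {})"

definition mesh_size :: "'d::finite discretization \<Rightarrow> real"
  where "mesh_size D = Max (diameter ` cells D)"

text \<open>
  Shape regularity: up to scaling with the cell diameter, the cells are uniformly bi-Lipschitz images
  of finitely many reference polytopes.  For affine maps this amounts to a uniform bound on the
  ratio of the diameter of \<open>K\<close> and the diameter of the largest ball in \<open>K\<close>.
\<close>

definition shape_regular :: "'d::finite discretization set \<Rightarrow> bool"
  where "shape_regular F \<longleftrightarrow> (\<exists>R \<sigma>. finite R \<and> (\<forall>P\<in>R. polytope P \<and> interior P \<noteq> {}) \<and> \<sigma> > 0 \<and>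
    (\<forall>D\<in>F. \<forall>K \<in> cells D. ref_cell D K \<in> R \<and>
      (\<forall>x \<in> ref_cell D K. \<forall>y \<in> ref_cell D K.
         diameter K / \<sigma> * dist x y \<le> dist (cell_map D K x) (cell_map D K y) \<and>
         dist (cell_map D K x) (cell_map D K y) \<le> \<sigma> * diameter K * dist x y)))"

definition polys :: "nat \<Rightarrow> (real ^ 'd::finite \<Rightarrow> 'b::real_vector) set"
  where "polys l = {g. \<exists>c. g = (\<lambda>x. \<Sum>\<alpha> \<in> multi_indices l. (\<Prod>i\<in>UNIV. (x $ i) ^ \<alpha> i) *\<^sub>R c \<alpha>)}"

definition fun_subspace :: "('a \<Rightarrow> 'b::real_vector) set \<Rightarrow> bool"
  where "fun_subspace S \<longleftrightarrow> (\<lambda>x. 0) \<in> S \<and>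
    (\<forall>f\<in>S. \<forall>g\<in>S. (\<lambda>x. f x + g x) \<in> S) \<and> (\<forall>c. \<forall>f\<in>S. (\<lambda>x. c *\<^sub>R f x) \<in> S)"

definition mapped_polys ::
    "nat \<Rightarrow> 'd::finite discretization \<Rightarrow> (real ^ 'd) set \<Rightarrow> (real ^ 'd \<Rightarrow> 'b::real_vector) set"
  where "mapped_polys l D K = {w. \<exists>g \<in> polys l. \<forall>x \<in> ref_cell D K. w (cell_map D K x) = g x}"

definition mapped_polynomial_spaces :: "'d::finite discretization set \<Rightarrow> bool"
  where "mapped_polynomial_spaces F \<longleftrightarrow> (\<exists>l. \<forall>D\<in>F. \<forall>K \<in> cells D.
    fun_subspace (V_loc D K) \<and> V_loc D K \<subseteq> mapped_polys l D K \<and>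
    fun_subspace (Q_loc D K) \<and> Q_loc D K \<subseteq> mapped_polys l D K)"

definition Vh :: "(real ^ 'd::finite) set \<Rightarrow> 'd discretization \<Rightarrow> (real ^ 'd \<Rightarrow> real ^ 'd) set"
  where "Vh \<Omega> D = {v \<in> V \<Omega>. \<forall>K \<in> cells D. \<exists>w \<in> V_loc D K. ae_eq (K \<inter> \<Omega>) v w}"

definition Qh :: "(real ^ 'd::finite) set \<Rightarrow> 'd discretization \<Rightarrow> (real ^ 'd \<Rightarrow> real) set"
  where "Qh \<Omega> D = {q \<in> Q \<Omega>. \<forall>K \<in> cells D. \<exists>w \<in> Q_loc D K. ae_eq (K \<inter> \<Omega>) q w}"

definition Vhdiv :: "(real ^ 'd::finite) set \<Rightarrow> 'd discretization \<Rightarrow> (real ^ 'd \<Rightarrow> real ^ 'd) set"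
  where "Vhdiv \<Omega> D = {v \<in> Vh \<Omega> D. \<forall>q \<in> Qh \<Omega> D. ip \<Omega> (divergence \<Omega> v) q = 0}"

text \<open>
  The infimum and supremum are taken in \<^typ>\<open>ereal\<close>, so that they have their usual meaning also for
  empty index sets.
\<close>

definition uniform_inf_sup :: "(real ^ 'd::finite) set \<Rightarrow> 'd discretization set \<Rightarrow> bool"
  where "uniform_inf_sup \<Omega> F \<longleftrightarrow> (\<exists>\<beta>>0. \<forall>D\<in>F. ereal \<beta> \<le>
    (INF q \<in> {q \<in> Qh \<Omega> D. \<not> ae_eq \<Omega> q (\<lambda>x. 0)}.
     SUP v \<in> {v \<in> Vh \<Omega> D. \<not> ae_eq \<Omega> v (\<lambda>x. 0)}.
       ereal (- ip \<Omega> (divergence \<Omega> v) q / (sobolev_norm \<Omega> 1 v * L2norm \<Omega> q))))"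

definition approximation_property :: "(real ^ 'd::finite) set \<Rightarrow> nat \<Rightarrow> 'd discretization set \<Rightarrow> bool"
  where "approximation_property \<Omega> r F \<longleftrightarrow> (\<exists>C. \<forall>D\<in>F.
    (\<forall>v \<in> V \<Omega> \<inter> sobolev \<Omega> (r + 1). \<exists>v' \<in> Vh \<Omega> D.
       L2norm \<Omega> (\<lambda>x. v x - v' x) + mesh_size D * L2norm \<Omega> (grad \<Omega> (\<lambda>x. v x - v' x))
         \<le> C * mesh_size D ^ (r + 1) * sobolev_norm \<Omega> (r + 1) v) \<and>
    (\<forall>q \<in> Q \<Omega> \<inter> sobolev \<Omega> r. \<exists>q' \<in> Qh \<Omega> D.
       L2norm \<Omega> (\<lambda>x. q x - q' x) \<le> C * mesh_size D ^ r * sobolev_norm \<Omega> r q))"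

definition fe_family :: "(real ^ 'd::finite) set \<Rightarrow> nat \<Rightarrow> 'd discretization set \<Rightarrow> bool"
  where "fe_family \<Omega> r F \<longleftrightarrow> (\<forall>D\<in>F. mesh_of \<Omega> D) \<and> shape_regular F \<and> mapped_polynomial_spaces F \<and>
    uniform_inf_sup \<Omega> F \<and> approximation_property \<Omega> r F"

definition is_stokes_projection ::
    "(real ^ 'd::finite) set \<Rightarrow> 'd discretization \<Rightarrow>
     (real ^ 'd \<Rightarrow> real ^ 'd) \<Rightarrow> (real ^ 'd \<Rightarrow> real) \<Rightarrow>
     (real ^ 'd \<Rightarrow> real ^ 'd) \<Rightarrow> (real ^ 'd \<Rightarrow> real) \<Rightarrow> bool"
  where "is_stokes_projection \<Omega> D w s w' s' \<longleftrightarrow> w' \<in> Vh \<Omega> D \<and> s' \<in> Qh \<Omega> D \<and>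
    (\<forall>v \<in> Vh \<Omega> D. a_form \<Omega> w' v + b_form \<Omega> v s' = a_form \<Omega> w v + b_form \<Omega> v s) \<and>
    (\<forall>q \<in> Qh \<Omega> D. b_form \<Omega> w' q = 0)"

text \<open>The velocity part of the Stokes projection, which is unique up to null sets.\<close>

definition Rh_u ::
    "(real ^ 'd::finite) set \<Rightarrow> 'd discretization \<Rightarrow>
     (real ^ 'd \<Rightarrow> real ^ 'd) \<Rightarrow> (real ^ 'd \<Rightarrow> real) \<Rightarrow> real ^ 'd \<Rightarrow> real ^ 'd"
  where "Rh_u \<Omega> D w s = fst (SOME (w', s'). is_stokes_projection \<Omega> D w s w' s')"

section \<open>Time discretization\<close>

definition time_mesh :: "real \<Rightarrow> nat \<Rightarrow> (nat \<Rightarrow> real) \<Rightarrow> bool"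
  where "time_mesh T N t \<longleftrightarrow> N \<ge> 2 \<and> t 0 = 0 \<and> t N = T \<and> (\<forall>n<N. t n < t (Suc n))"

definition step :: "(nat \<Rightarrow> real) \<Rightarrow> nat \<Rightarrow> real"
  where "step t n = t n - t (n - 1)"

definition max_step :: "nat \<Rightarrow> (nat \<Rightarrow> real) \<Rightarrow> real"
  where "max_step N t = Max (step t ` {1..N})"

definition midpt :: "(nat \<Rightarrow> real) \<Rightarrow> nat \<Rightarrow> real"
  where "midpt t n = (t (n - 1) + t n) / 2"

definition subint :: "(nat \<Rightarrow> real) \<Rightarrow> nat \<Rightarrow> real set"
  where "subint t n = {t (n - 1)<..t n}"

definition subint_index :: "nat \<Rightarrow> (nat \<Rightarrow> real) \<Rightarrow> real \<Rightarrow> nat"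
  where "subint_index N t s = (THE n. n \<in> {1..N} \<and> s \<in> subint t n)"

definition lagrange2 ::
    "real \<Rightarrow> real \<Rightarrow> real \<Rightarrow> (real \<Rightarrow> 'b::real_normed_vector) \<Rightarrow> real \<Rightarrow> 'b"
  where "lagrange2 a m b v s =
      ((s - m) * (s - b) / ((a - m) * (a - b))) *\<^sub>R v a
    + ((s - a) * (s - b) / ((m - a) * (m - b))) *\<^sub>R v m
    + ((s - a) * (s - m) / ((b - a) * (b - m))) *\<^sub>R v b"

definition R1 ::
    "nat \<Rightarrow> (nat \<Rightarrow> real) \<Rightarrow> (real \<Rightarrow> 'a \<Rightarrow> 'b::real_normed_vector) \<Rightarrow> real \<Rightarrow> 'a \<Rightarrow> 'b"
  where "R1 N t w s x =
    (if s = 0 then w 0 x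
     else let n = subint_index N t s in
       w (t (n - 1)) x + (s - t (n - 1)) *\<^sub>R
         vector_derivative (lagrange2 (t (n - 1)) (midpt t n) (t n) (\<lambda>\<sigma>. w \<sigma> x)) (at (midpt t n)))"

definition u_hat ::
    "(real ^ 'd::finite) set \<Rightarrow> 'd discretization \<Rightarrow> nat \<Rightarrow> (nat \<Rightarrow> real) \<Rightarrow>
     (real \<Rightarrow> real ^ 'd \<Rightarrow> real ^ 'd) \<Rightarrow> (real \<Rightarrow> real ^ 'd \<Rightarrow> real) \<Rightarrow>
     real \<Rightarrow> real ^ 'd \<Rightarrow> real ^ 'd"
  where "u_hat \<Omega> D N t u p s = Rh_u \<Omega> D (R1 N t u s) (R1 N t p s)"

text \<open>The initial value \<open>uh 0\<close> belongs to no subinterval; on each \<open>I\<^sub>n\<close> the discrete velocity continues its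
  previous value, whereas nothing fixes the pressure at \<open>t\<^sub>n\<^sub>-\<^sub>1\<close> from the right.\<close>

definition scheme_G ::
    "(real ^ 'd::finite) set \<Rightarrow> 'd discretization \<Rightarrow> nat \<Rightarrow> (nat \<Rightarrow> real) \<Rightarrow>
     (real \<Rightarrow> real ^ 'd \<Rightarrow> real ^ 'd) \<Rightarrow> (real ^ 'd \<Rightarrow> real ^ 'd) \<Rightarrow>
     (real \<Rightarrow> real ^ 'd \<Rightarrow> real ^ 'd) \<Rightarrow> (real \<Rightarrow> real ^ 'd \<Rightarrow> real) \<Rightarrow> bool"
  where "scheme_G \<Omega> D N t f u0h uh ph \<longleftrightarrow>
    ae_eq \<Omega> (uh 0) u0h \<and>
    (\<forall>n\<in>{1..N}.
       uh \<in> P1 \<Omega> (subint t n) (Vh \<Omega> D) \<and>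
       ph \<in> P1 \<Omega> (subint t n) (Qh \<Omega> D) \<and>
       ae_eq \<Omega> (right_limit \<Omega> uh (t (n - 1))) (uh (t (n - 1))) \<and>
       (\<forall>v \<in> Vh \<Omega> D.
          (LBINT s:subint t n.
             ip \<Omega> (tderiv \<Omega> (subint t n) uh s) v + a_form \<Omega> (uh s) v + b_form \<Omega> v (ph s))
          = step t n / 2 * ip \<Omega> (\<lambda>x. f (t (n - 1)) x + f (t n) x) v) \<and>
       (\<forall>q \<in> Qh \<Omega> D. (LBINT s:subint t n. b_form \<Omega> (uh s) q) = 0))"

definition J_interp ::
    "(nat \<Rightarrow> real) \<Rightarrow> nat \<Rightarrow> (real \<Rightarrow> 'a \<Rightarrow> real) \<Rightarrow> real \<Rightarrow> 'a \<Rightarrow> real"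
  where "J_interp t n q s x = q (midpt t (n - 1)) x +
    (s - midpt t (n - 1)) / (midpt t n - midpt t (n - 1)) *
      (q (midpt t n) x - q (midpt t (n - 1)) x)"

definition p_bar ::
    "nat \<Rightarrow> (nat \<Rightarrow> real) \<Rightarrow> (real \<Rightarrow> 'a \<Rightarrow> real) \<Rightarrow> real \<Rightarrow> 'a \<Rightarrow> real"
  where "p_bar N t q s =
    (if s \<le> t 1 then J_interp t 2 q s else J_interp t (subint_index N t s) q s)"

end

theory Submission
  imports Defs "HOL-Library.Function_Algebras" "HOL-Library.Multiset"
begin

text \<open>
  Integrated over a time step, the scheme is the Crank-Nicolson method.  With the values \<open>U\<^sub>n\<close> of the
  discrete velocity at \<open>t\<^sub>n\<close> and \<open>P\<^sub>n\<close> of the discrete pressure at the midpoint of \<open>I\<^sub>n\<close>, it reads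
  \<open>\<langle>(U\<^sub>n - U\<^sub>n\<^sub>-\<^sub>1) / \<tau>\<^sub>n, v\<rangle> + a((U\<^sub>n + U\<^sub>n\<^sub>-\<^sub>1) / 2, v) + b(v, P\<^sub>n) = \<langle>f(t\<^sub>n\<^sub>-\<^sub>1) + f(t\<^sub>n), v\<rangle> / 2\<close>
  for all discrete \<open>v\<close> (\<open>scheme_step\<close>).  Let \<open>(w\<^sub>n, s\<^sub>n)\<close> be the Stokes projection of \<open>(u(t\<^sub>n), p(t\<^sub>n))\<close>.
  The average of the Stokes equations at \<open>t\<^sub>n\<^sub>-\<^sub>1\<close> and \<open>t\<^sub>n\<close> shows that \<open>e\<^sub>n = w\<^sub>n - U\<^sub>n\<close> and
  \<open>\<pi>\<^sub>n = (s\<^sub>n + s\<^sub>n\<^sub>-\<^sub>1) / 2 - P\<^sub>n\<close> satisfy the same equation with the right-hand side \<open>\<langle>\<rho>\<^sub>n, v\<rangle>\<close>, where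
  \<open>\<rho>\<^sub>n = (w\<^sub>n - w\<^sub>n\<^sub>-\<^sub>1) / \<tau>\<^sub>n - (u'(t\<^sub>n\<^sub>-\<^sub>1) + u'(t\<^sub>n)) / 2\<close>.  This is the error of the trapezoidal rule, of
  order \<open>\<tau>\<^sup>2\<close>, minus the error of the Stokes projection of a difference quotient of the solution.
  The gradient of the latter is of order \<open>h\<^sup>r\<close>, and so is the function itself by Poincare's inequality.

  Tested with the difference quotient of \<open>e\<close>, which is discretely divergence free, the equation
  loses its pressure term.  This bounds the sum of \<open>\<tau>\<^sub>n \<parallel>(e\<^sub>n - e\<^sub>n\<^sub>-\<^sub>1) / \<tau>\<^sub>n\<parallel>\<^sup>2\<close> and the maximum of
  \<open>\<parallel>\<nabla>e\<^sub>n\<parallel>\<^sup>2\<close> by \<open>\<parallel>\<nabla>e\<^sub>0\<parallel>\<^sup>2\<close> plus terms of order \<open>\<tau>\<^sup>4 + h\<^sup>2\<^sup>r\<close> (\<open>energy_estimate\<close>).  The inf-sup condition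
  then bounds \<open>\<pi>\<^sub>n\<close> by the other terms of the equation (\<open>pressure_estimate\<close>), which yields the error of
  the pressure at the midpoints (\<open>midpoint_pressure_error\<close>).  The initial error is the one of the
  theorem, because the interpolation in time reproduces the value at \<open>0\<close>.

  On each step the post-processed pressure is the straight line through the values at two adjacent
  midpoints, evaluated somewhere in the two steps around these midpoints.  For the exact pressure
  this costs an error of order \<open>\<tau>\<^sup>2\<close>, and errors of the midpoint values are amplified at most by the
  factor 2 (\<open>interpolation_error\<close>).  The bounds on the ratios of adjacent steps allow each midpoint
  error to be counted with the length of its own step (\<open>weighted_sum_shift\<close>), so that both estimates
  follow from the one at the midpoints (\<open>postprocessing_error\<close>).

  The analysis behind this starts from the definition of weak derivatives.  They are unique
  (\<open>fundamental_lemma\<close>); integration by parts carries over from test functions to \<open>H\<^sup>1\<^sub>0\<close> by density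
  (\<open>green\<close>), which gives Poincare's inequality (\<open>poincare\<close>) and the weak form of the Stokes equation
  (\<open>weak_formulation\<close>).  Functions that agree almost everywhere are not identified, so all inner
  products are only semidefinite and the finite element spaces have finite dimension only modulo
  null functions.  Riesz' theorem survives this (\<open>riesz\<close>) and yields the Stokes projection
  (\<open>saddle_point_exists\<close>); its error is bounded by the inf-sup condition (\<open>stokes_projection_error\<close>).
  Time derivatives are limits in a seminorm, and the estimates of Taylor type for them are reduced to
  real functions by pairing with a fixed function (\<open>nrm_le_dual\<close>).
\<close>

section \<open>Semi-inner products on spaces of functions\<close>

text \<open>
  With pointwise scaling the functions on a domain form a real vector space, and subspaces and
  spans make sense for sets of representatives. Functions that agree almost everywhere remain
  different vectors, so the inner products of interest are only semidefinite.
\<close>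

instantiation "fun" :: (type, real_vector) real_vector
begin

definition scaleR_fun_def: "scaleR c f = (\<lambda>x. c *\<^sub>R f x)"

instance
  by standard (auto simp: scaleR_fun_def plus_fun_def zero_fun_def fun_Compl_def fun_diff_def algebra_simps)

end

lemma scaleR_fun_apply [simp]: "(c *\<^sub>R f) x = c *\<^sub>R f x"
  by (simp add: scaleR_fun_def)

locale semi_inner =
  fixes S :: "'v::real_vector set" and B :: "'v \<Rightarrow> 'v \<Rightarrow> real"
  assumes subspace_S: "subspace S"
    and add_left: "\<lbrakk>x \<in> S; y \<in> S; z \<in> S\<rbrakk> \<Longrightarrow> B (x + y) z = B x z + B y z"
    and scale_left: "\<lbrakk>x \<in> S; z \<in> S\<rbrakk> \<Longrightarrow> B (c *\<^sub>R x) z = c * B x z"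
    and sym: "\<lbrakk>x \<in> S; y \<in> S\<rbrakk> \<Longrightarrow> B x y = B y x"
    and nonneg: "x \<in> S \<Longrightarrow> 0 \<le> B x x"
begin

definition nrm :: "'v \<Rightarrow> real" where "nrm x = sqrt (B x x)"

lemma S_add: "x \<in> S \<Longrightarrow> y \<in> S \<Longrightarrow> x + y \<in> S"
  using subspace_S by (rule subspace_add)
lemma S_diff: "x \<in> S \<Longrightarrow> y \<in> S \<Longrightarrow> x - y \<in> S"
  using subspace_S by (rule subspace_diff)
lemma S_scale: "x \<in> S \<Longrightarrow> c *\<^sub>R x \<in> S"
  using subspace_S by (rule subspace_scale)
lemma S_0: "0 \<in> S"
  using subspace_S by (rule subspace_0)

lemmas S_intros = S_add S_diff S_scale S_0

lemma add_right: "\<lbrakk>x \<in> S; y \<in> S; z \<in> S\<rbrakk> \<Longrightarrow> B z (x + y) = B z x + B z y"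
  by (simp add: sym[of z] add_left S_intros)

lemma scale_right: "\<lbrakk>x \<in> S; z \<in> S\<rbrakk> \<Longrightarrow> B z (c *\<^sub>R x) = c * B z x"
  by (simp add: sym[of z] scale_left S_intros)

lemma diff_left: "\<lbrakk>x \<in> S; y \<in> S; z \<in> S\<rbrakk> \<Longrightarrow> B (x - y) z = B x z - B y z"
  using add_left[of "x - y" y z] by (simp add: S_intros)

lemma diff_right: "\<lbrakk>x \<in> S; y \<in> S; z \<in> S\<rbrakk> \<Longrightarrow> B z (x - y) = B z x - B z y"
  by (simp add: sym[of z] diff_left S_intros)

lemma zero_left: "z \<in> S \<Longrightarrow> B 0 z = 0"
  using scale_left[of 0 z 0] S_0 by simp

lemma zero_right: "z \<in> S \<Longrightarrow> B z 0 = 0"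
  using scale_right[of 0 z 0] S_0 by simp

lemmas bilin = zero_left zero_right add_left add_right diff_left diff_right scale_left scale_right

lemma nrm_nonneg: "x \<in> S \<Longrightarrow> 0 \<le> nrm x"
  by (simp add: nrm_def nonneg)

lemma nrm_sq: "x \<in> S \<Longrightarrow> (nrm x)\<^sup>2 = B x x"
  by (simp add: nrm_def nonneg)

lemma nrm_self: "x \<in> S \<Longrightarrow> B x x = nrm x * nrm x"
  by (simp add: nrm_def nonneg)

lemma Cauchy_Schwarz_sq:
  assumes "x \<in> S" "y \<in> S"
  shows "(B x y)\<^sup>2 \<le> B x x * B y y"
proof -
  have q: "0 \<le> B x x - 2 * c * B x y + c\<^sup>2 * B y y" for c
  proof -
    have "0 \<le> B (x - c *\<^sub>R y) (x - c *\<^sub>R y)"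
      using assms by (intro nonneg S_intros)
    also have "\<dots> = B x x - 2 * c * B x y + c\<^sup>2 * B y y"
      using assms by (simp add: bilin S_intros sym[of y x] algebra_simps power2_eq_square)
    finally show ?thesis .
  qed
  show ?thesis
  proof (cases "B y y = 0")
    case True
    have "B x y = 0"
    proof (rule ccontr)
      assume "B x y \<noteq> 0"
      with q[of "(B x x + 1) / (2 * B x y)"] True show False by simp
    qed
    with True show ?thesis by simp
  next
    case False
    hence pos: "B y y > 0" using nonneg[OF assms(2)] by simp
    have "0 \<le> B x x - (B x y)\<^sup>2 / B y y"
      using q[of "B x y / B y y"] pos by (simp add: field_simps power2_eq_square)
    thus ?thesis using pos by (simp add: field_simps)
  qed
qed

lemma Cauchy_Schwarz: "x \<in> S \<Longrightarrow> y \<in> S \<Longrightarrow> \<bar>B x y\<bar> \<le> nrm x * nrm y"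
  using Cauchy_Schwarz_sq[of x y] by (auto simp: nrm_def nonneg real_sqrt_mult[symmetric] intro!: real_le_rsqrt)

lemma nrm_triangle:
  assumes "x \<in> S" "y \<in> S"
  shows "nrm (x + y) \<le> nrm x + nrm y"
proof (rule power2_le_imp_le)
  have "(nrm (x + y))\<^sup>2 = B x x + 2 * B x y + B y y"
    using assms by (simp add: nrm_sq S_intros bilin sym[of y x])
  also have "\<dots> \<le> (nrm x)\<^sup>2 + 2 * (nrm x * nrm y) + (nrm y)\<^sup>2"
    using Cauchy_Schwarz[OF assms] assms by (simp add: nrm_sq)
  finally show "(nrm (x + y))\<^sup>2 \<le> (nrm x + nrm y)\<^sup>2"
    by (simp add: power2_sum)
qed (use assms nrm_nonneg in auto)

lemma nrm_scale: "x \<in> S \<Longrightarrow> nrm (c *\<^sub>R x) = \<bar>c\<bar> * nrm x"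
  by (simp add: nrm_def bilin S_intros real_sqrt_mult flip: mult.assoc power2_eq_square)

lemma nrm_minus_commute: "x \<in> S \<Longrightarrow> y \<in> S \<Longrightarrow> nrm (x - y) = nrm (y - x)"
  using nrm_scale[of "x - y" "-1"] by (simp add: S_intros)

lemma nrm_diff_triangle: "x \<in> S \<Longrightarrow> y \<in> S \<Longrightarrow> nrm (x - y) \<le> nrm x + nrm y"
  using nrm_triangle[of x "(-1) *\<^sub>R y"] nrm_scale[of y "-1"] S_scale[of y "-1"] by simp

lemma nrm_diff_ineq: "x \<in> S \<Longrightarrow> y \<in> S \<Longrightarrow> \<bar>nrm x - nrm y\<bar> \<le> nrm (x - y)"
  using nrm_triangle[of "x - y" y] nrm_triangle[of "y - x" x]
  by (simp add: S_intros nrm_minus_commute[of x y])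

lemma null_left: "\<lbrakk>x \<in> S; y \<in> S; B x x = 0\<rbrakk> \<Longrightarrow> B x y = 0"
  using Cauchy_Schwarz_sq[of x y] by simp

text \<open>
  Tested with the vector itself, a uniform bound for all functionals \<open>B _ g\<close> becomes a bound for
  the seminorm. Thus a statement on curves in \<open>S\<close> follows from one on real functions.
\<close>

lemma nrm_le_dual:
  assumes "x \<in> S" "\<And>g. g \<in> S \<Longrightarrow> \<bar>B x g\<bar> \<le> K * nrm g" "0 \<le> K"
  shows "nrm x \<le> K"
  using assms(2)[OF assms(1)] assms(1,3) nrm_nonneg[OF assms(1)]
  by (cases "nrm x = 0") (auto simp: nrm_self)

end

subsection \<open>Riesz representation\<close>

context semi_inner
begin

text \<open>
  Gram-Schmidt orthogonalization, one generator at a time: \<open>p\<close> is the projection of the new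
  generator \<open>g\<close> to the span of the old ones, and \<open>y = g - p\<close> is orthogonal to that span. If \<open>y\<close> is
  a null vector, then \<open>l\<close> vanishes on it as well and nothing has to be added.
\<close>

lemma riesz_span:
  assumes "finite G" "G \<subseteq> S"
    and add: "\<And>x y. x \<in> S \<Longrightarrow> y \<in> S \<Longrightarrow> l (x + y) = l x + l y"
    and scale: "\<And>c x. x \<in> S \<Longrightarrow> l (c *\<^sub>R x) = c * l x"
    and null: "\<And>x. x \<in> S \<Longrightarrow> B x x = 0 \<Longrightarrow> l x = 0"
  shows "\<exists>w \<in> span G. \<forall>x \<in> span G. B w x = l x"
  using assms
proof (induction G arbitrary: l)
  case empty
  have "l 0 = 0" using empty(3)[of 0 0] S_0 by simp
  moreover have "B 0 0 = 0" using scale_left[of 0 0 0] S_0 by simp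
  ultimately show ?case by simp
next
  case (insert g G)
  have GS: "span G \<subseteq> S" "g \<in> S"
    using insert.prems span_minimal[of G S] subspace_S by auto
  obtain w0 where w0: "w0 \<in> span G" "\<forall>x \<in> span G. B w0 x = l x"
    using insert.IH[of l] insert.prems by auto
  have "\<exists>p \<in> span G. \<forall>x \<in> span G. B p x = B g x"
  proof (rule insert.IH[of "B g"])
    show "\<And>x. x \<in> S \<Longrightarrow> B x x = 0 \<Longrightarrow> B g x = 0"
      using GS by (subst sym) (auto intro: null_left)
  qed (use insert.prems GS in \<open>auto simp: bilin\<close>)
  then obtain p where p: "p \<in> span G" "\<forall>x \<in> span G. B p x = B g x" by blast
  define y where "y = g - p"
  have S: "w0 \<in> S" "p \<in> S" "y \<in> S" using w0 p GS by (auto simp: y_def intro: S_intros)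
  have orth: "B y x = 0" if "x \<in> span G" for x
    using that p GS S by (auto simp: y_def bilin subset_iff)
  define w where "w = w0 + (if B y y = 0 then 0 else ((l y - B w0 y) / B y y) *\<^sub>R y)"
  have y_sp: "y \<in> span (insert g G)"
    unfolding y_def using p(1) by (meson insertI1 span_base span_diff span_mono subsetD subset_insertI)
  have w0_sp: "w0 \<in> span (insert g G)" using w0(1) by (meson span_mono subsetD subset_insertI)
  have wS: "w \<in> S" using S by (auto simp: w_def intro: S_intros)
  have "B w x = l x" if "x \<in> span (insert g G)" for x
  proof -
    from that obtain k where k: "x - k *\<^sub>R g \<in> span G" by (auto simp: span_insert)
    define z where "z = x - k *\<^sub>R g + k *\<^sub>R p"
    have z: "z \<in> span G" using k p(1) by (auto simp: z_def intro: span_add span_scale)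
    have x: "x = z + k *\<^sub>R y" by (simp add: z_def y_def algebra_simps)
    have zS: "z \<in> S" using z GS by auto
    have wz: "B w z = l z"
      using w0 z zS S orth[OF z] by (auto simp: w_def bilin S_intros)
    have wy: "B w y = l y"
    proof (cases "B y y = 0")
      case True
      hence "l y = 0" "B w0 y = 0" using insert.prems S null_left[of y w0] sym[of y w0] by auto
      with True show ?thesis by (simp add: w_def)
    next
      case False
      thus ?thesis using S by (simp add: w_def bilin S_intros field_simps)
    qed
    show ?thesis using wz wy zS S wS insert.prems by (simp add: x bilin S_intros)
  qed
  moreover have "w \<in> span (insert g G)"
    using y_sp w0_sp by (auto simp: w_def intro: span_add span_scale)
  ultimately show ?case by blast
qed

end

text \<open>
  Finite dimension of the quotient of \<open>S\<close> by \<open>Z\<close>. A space of functions that is closed under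
  changes on null sets is never finite-dimensional itself, unlike its quotient by the null
  functions.
\<close>

definition finite_dim_mod :: "'v::real_vector set \<Rightarrow> 'v set \<Rightarrow> bool"
  where "finite_dim_mod Z S \<longleftrightarrow> (\<exists>G. finite G \<and> (\<forall>x\<in>S. \<exists>g\<in>span G. x - g \<in> Z))"

lemma finite_dim_mod_subset: "finite_dim_mod Z S \<Longrightarrow> R \<subseteq> S \<Longrightarrow> finite_dim_mod Z R"
  unfolding finite_dim_mod_def by (meson subsetD)

text \<open>
  The generators can be moved into \<open>S\<close>, the domain of the semi-inner product. In the induction
  step the elements of \<open>S\<close> that can be represented without \<open>h\<close> form a subspace \<open>S'\<close> of codimension
  at most one, so a single vector of \<open>S\<close> outside \<open>S'\<close> replaces \<open>h\<close>.
\<close>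

lemma finite_dim_mod_inner:
  assumes "finite_dim_mod Z S" "subspace S" "subspace Z"
  obtains G where "finite G" "G \<subseteq> S" "\<And>x. x \<in> S \<Longrightarrow> \<exists>g\<in>span G. x - g \<in> Z"
proof -
  from assms(1) obtain H where "finite H" "\<forall>x\<in>S. \<exists>g\<in>span H. x - g \<in> Z"
    by (auto simp: finite_dim_mod_def)
  hence "\<exists>G. finite G \<and> G \<subseteq> S \<and> (\<forall>x\<in>S. \<exists>g\<in>span G. x - g \<in> Z)"
    using assms(2)
  proof (induction H arbitrary: S)
    case empty
    thus ?case by (intro exI[of _ "{}"]) simp
  next
    case (insert h H)
    define S' where "S' = S \<inter> {a + z |a z. a \<in> span H \<and> z \<in> Z}"
    have "subspace S'"
      unfolding S'_def using insert.prems assms(3) by (intro subspace_inter subspace_sums) auto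
    moreover have "\<forall>x\<in>S'. \<exists>g\<in>span H. x - g \<in> Z"
    proof
      fix x assume "x \<in> S'"
      then obtain a z where "x = a + z" "a \<in> span H" "z \<in> Z" by (auto simp: S'_def)
      thus "\<exists>g\<in>span H. x - g \<in> Z" by (intro bexI[of _ a]) auto
    qed
    ultimately have "\<exists>G. finite G \<and> G \<subseteq> S' \<and> (\<forall>x\<in>S'. \<exists>g\<in>span G. x - g \<in> Z)"
      using insert.IH[of S'] by simp
    then obtain G where G: "finite G" "G \<subseteq> S'" "\<forall>x\<in>S'. \<exists>g\<in>span G. x - g \<in> Z"
      by (elim exE conjE)
    show ?case
    proof (cases "S \<subseteq> S'")
      case True
      thus ?thesis using G by (intro exI[of _ G]) (auto simp: S'_def)
    next
      case False
      then obtain s where s: "s \<in> S" "s \<notin> S'" by blast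
      have rep: "\<exists>k a z. x = k *\<^sub>R h + a + z \<and> a \<in> span H \<and> z \<in> Z" if xS: "x \<in> S" for x
      proof -
        from insert.prems xS obtain g where g: "g \<in> span (insert h H)" "x - g \<in> Z" by blast
        then obtain k where "g - k *\<^sub>R h \<in> span H" by (auto simp: span_insert)
        with g show ?thesis
          by (intro exI[of _ k] exI[of _ "g - k *\<^sub>R h"] exI[of _ "x - g"]) auto
      qed
      from rep[OF s(1)] obtain k a z where k: "s = k *\<^sub>R h + a + z" "a \<in> span H" "z \<in> Z" by blast
      have k0: "k \<noteq> 0"
      proof
        assume "k = 0"
        hence "s = a + z" using k by simp
        with s k show False unfolding S'_def by blast
      qed
      have "\<exists>g\<in>span (insert s G). x - g \<in> Z" if x: "x \<in> S" for x
      proof -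
        from rep[OF x] obtain k' a' z' where k': "x = k' *\<^sub>R h + a' + z'" "a' \<in> span H" "z' \<in> Z" by blast
        define y where "y = x - (k' / k) *\<^sub>R s"
        have "y = (a' - (k' / k) *\<^sub>R a) + (z' - (k' / k) *\<^sub>R z)"
          using k0 by (simp add: y_def k(1) k'(1) algebra_simps)
        moreover have "a' - (k' / k) *\<^sub>R a \<in> span H" using k k' by (intro span_diff span_scale)
        moreover have "z' - (k' / k) *\<^sub>R z \<in> Z" using k k' assms(3) by (intro subspace_diff subspace_scale)
        moreover have "y \<in> S" unfolding y_def using x s insert.prems by (intro subspace_diff subspace_scale)
        ultimately have "y \<in> S'" by (auto simp: S'_def)
        then obtain g where g: "g \<in> span G" "y - g \<in> Z" using G by blast
        have "g \<in> span (insert s G)" using g(1) by (meson span_mono subsetD subset_insertI)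
        hence "g + (k' / k) *\<^sub>R s \<in> span (insert s G)"
          by (intro span_add span_scale) (auto intro: span_base)
        moreover have "x - (g + (k' / k) *\<^sub>R s) \<in> Z" using g(2) by (simp add: y_def algebra_simps)
        ultimately show ?thesis by blast
      qed
      thus ?thesis using G s by (intro exI[of _ "insert s G"]) (auto simp: S'_def)
    qed
  qed
  thus ?thesis using that by blast
qed

text \<open>
  Every element of \<open>S\<close> differs from one of a finitely generated subspace by a null vector, which
  is invisible to both \<open>B\<close> and \<open>l\<close>.
\<close>

lemma (in semi_inner) riesz:
  assumes "finite_dim_mod Z S" "subspace Z"
    and Z: "\<And>z. z \<in> S \<Longrightarrow> z \<in> Z \<Longrightarrow> B z z = 0"
    and add: "\<And>x y. x \<in> S \<Longrightarrow> y \<in> S \<Longrightarrow> l (x + y) = l x + l y"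
    and scale: "\<And>c x. x \<in> S \<Longrightarrow> l (c *\<^sub>R x) = c * l x"
    and null: "\<And>x. x \<in> S \<Longrightarrow> B x x = 0 \<Longrightarrow> l x = 0"
  obtains w where "w \<in> S" "\<And>x. x \<in> S \<Longrightarrow> B w x = l x"
proof -
  obtain G where G: "finite G" "G \<subseteq> S" "\<And>x. x \<in> S \<Longrightarrow> \<exists>g\<in>span G. x - g \<in> Z"
    using finite_dim_mod_inner[OF assms(1) subspace_S assms(2)] by blast
  obtain w where w: "w \<in> span G" "\<forall>x \<in> span G. B w x = l x"
    using riesz_span[OF G(1,2) add scale null] by blast
  have sp: "span G \<subseteq> S" using G subspace_S by (intro span_minimal)
  have "B w x = l x" if x: "x \<in> S" for x
  proof -
    obtain g where g: "g \<in> span G" "x - g \<in> Z" using G(3)[OF x] by blast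
    have gS: "g \<in> S" and wS: "w \<in> S" using g sp w by auto
    have z: "B (x - g) (x - g) = 0" using g gS x by (intro Z S_intros)
    have "l x = l (x - g) + l g" using add[of "x - g" g] x gS by (simp add: S_intros)
    also have "l (x - g) = 0" using null z x gS by (simp add: S_intros)
    also have "l g = B w g" using w g by simp
    also have "B w (x - g) = 0"
      using null_left[OF _ wS z] x gS wS sym[OF wS] by (simp add: S_intros)
    hence "B w g = B w x" using x gS wS by (simp add: bilin)
    finally show ?thesis by simp
  qed
  thus ?thesis using that w sp by blast
qed

subsection \<open>Existence of saddle points\<close>

text \<open>
  Riesz' theorem is applied three times. On the kernel \<open>K\<close> of \<open>b\<close> the multiplier disappears, and
  the equation determines \<open>w\<close>. On the whole space the residual \<open>l - a w\<close> is represented by some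
  \<open>L\<close>, and each \<open>b _ q\<close> by some \<open>R q\<close>. The multiplier \<open>s\<close> solves \<open>a (R s) (R q) = b L q\<close> for all
  \<open>q\<close>. Then \<open>z = R s - L\<close> lies in \<open>K\<close>, where both \<open>a (R s)\<close> and \<open>a L\<close> vanish; so \<open>z\<close> is a null
  vector, and \<open>R s\<close> represents the residual as well as \<open>L\<close> does.
\<close>

lemma saddle_point_exists:
  fixes a :: "'v::real_vector \<Rightarrow> 'v \<Rightarrow> real" and b :: "'v \<Rightarrow> 'q::real_vector \<Rightarrow> real"
  assumes "semi_inner X a" "subspace M"
    and X: "finite_dim_mod Z X" "subspace Z" "\<And>z. z \<in> X \<Longrightarrow> z \<in> Z \<Longrightarrow> a z z = 0"
    and M: "finite_dim_mod Y M" "subspace Y" "\<And>q v. q \<in> M \<Longrightarrow> q \<in> Y \<Longrightarrow> v \<in> X \<Longrightarrow> b v q = 0"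
    and b_add1: "\<And>v w q. v \<in> X \<Longrightarrow> w \<in> X \<Longrightarrow> q \<in> M \<Longrightarrow> b (v + w) q = b v q + b w q"
    and b_scale1: "\<And>c v q. v \<in> X \<Longrightarrow> q \<in> M \<Longrightarrow> b (c *\<^sub>R v) q = c * b v q"
    and b_add2: "\<And>v q s. v \<in> X \<Longrightarrow> q \<in> M \<Longrightarrow> s \<in> M \<Longrightarrow> b v (q + s) = b v q + b v s"
    and b_scale2: "\<And>c v q. v \<in> X \<Longrightarrow> q \<in> M \<Longrightarrow> b v (c *\<^sub>R q) = c * b v q"
    and b_null: "\<And>v q. v \<in> X \<Longrightarrow> q \<in> M \<Longrightarrow> a v v = 0 \<Longrightarrow> b v q = 0"
    and l_add: "\<And>x y. x \<in> X \<Longrightarrow> y \<in> X \<Longrightarrow> l (x + y) = l x + l y"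
    and l_scale: "\<And>c x. x \<in> X \<Longrightarrow> l (c *\<^sub>R x) = c * l x"
    and l_null: "\<And>x. x \<in> X \<Longrightarrow> a x x = 0 \<Longrightarrow> l x = 0"
  shows "\<exists>w\<in>X. \<exists>s\<in>M. (\<forall>v\<in>X. a w v + b v s = l v) \<and> (\<forall>q\<in>M. b w q = 0)"
proof -
  interpret X: semi_inner X a by fact
  define K where "K = {v \<in> X. \<forall>q\<in>M. b v q = 0}"
  have b0: "b 0 q = 0" if "q \<in> M" for q using b_scale1[of 0 q 0] that X.S_0 by simp
  have "subspace K"
    unfolding K_def using X.S_intros by (intro subspaceI) (auto simp: b_add1 b_scale1 b0)
  then interpret K: semi_inner K a
    by unfold_locales (auto simp: K_def X.bilin X.sym X.nonneg)
  have KV: "K \<subseteq> X" by (auto simp: K_def)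
  obtain w where w: "w \<in> K" "\<And>x. x \<in> K \<Longrightarrow> a w x = l x"
  proof (rule K.riesz[where Z = Z and l = l])
    show "finite_dim_mod Z K" using X(1) KV by (rule finite_dim_mod_subset)
  next
    show "\<And>w. w \<in> K \<Longrightarrow> (\<And>x. x \<in> K \<Longrightarrow> a w x = l x) \<Longrightarrow> thesis"
      by (rule that)
  qed (simp_all add: X l_add l_scale l_null subsetD[OF KV])
  have wV: "w \<in> X" using w KV by auto
  obtain L where L: "L \<in> X" "\<And>x. x \<in> X \<Longrightarrow> a L x = l x - a w x"
  proof (rule X.riesz[where Z = Z and l = "\<lambda>x. l x - a w x"])
    fix x assume "x \<in> X" "a x x = 0"
    thus "l x - a w x = 0" using l_null X.null_left[of x w] X.sym[of x w] wV by simp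
  next
    show "\<And>x y. x \<in> X \<Longrightarrow> y \<in> X \<Longrightarrow> l (x + y) - a w (x + y) = l x - a w x + (l y - a w y)"
      using wV by (simp add: l_add X.bilin)
    show "\<And>c x. x \<in> X \<Longrightarrow> l (c *\<^sub>R x) - a w (c *\<^sub>R x) = c * (l x - a w x)"
      using wV by (simp add: l_scale X.bilin algebra_simps)
  next
    show "\<And>L. L \<in> X \<Longrightarrow> (\<And>x. x \<in> X \<Longrightarrow> a L x = l x - a w x) \<Longrightarrow> thesis"
      by (rule that)
  qed (simp_all add: X)
  have "\<exists>R\<in>X. \<forall>x\<in>X. a R x = b x q" if q: "q \<in> M" for q
  proof -
    obtain R where "R \<in> X" "\<And>x. x \<in> X \<Longrightarrow> a R x = b x q"
      by (rule X.riesz[where Z = Z and l = "\<lambda>x. b x q"]) (simp_all add: X q b_null b_add1 b_scale1)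
    thus ?thesis by blast
  qed
  then obtain R where R: "\<And>q. q \<in> M \<Longrightarrow> R q \<in> X" "\<And>q x. q \<in> M \<Longrightarrow> x \<in> X \<Longrightarrow> a (R q) x = b x q"
    by metis
  have R': "a x (R q) = b x q" if "q \<in> M" "x \<in> X" for q x
    using R that X.sym by metis
  have sM: "subspace M" by fact
  interpret M: semi_inner M "\<lambda>q s. a (R q) (R s)"
  proof
    show "subspace M" by fact
    show "a (R (x + y)) (R z) = a (R x) (R z) + a (R y) (R z)" if "x \<in> M" "y \<in> M" "z \<in> M" for x y z
      using that by (simp add: R subspace_add[OF sM] b_add2)
    show "a (R (c *\<^sub>R x)) (R z) = c * a (R x) (R z)" if "x \<in> M" "z \<in> M" for c x z
      using that by (simp add: R subspace_scale[OF sM] b_scale2)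
    show "a (R x) (R y) = a (R y) (R x)" if "x \<in> M" "y \<in> M" for x y
      using that R by (intro X.sym)
    show "0 \<le> a (R x) (R x)" if "x \<in> M" for x
      using that R by (intro X.nonneg)
  qed
  obtain s where s: "s \<in> M" "\<And>q. q \<in> M \<Longrightarrow> a (R s) (R q) = b L q"
  proof (rule M.riesz[where Z = Y and l = "b L"])
    fix x assume x: "x \<in> M" "a (R x) (R x) = 0"
    have "b L x = a (R x) L" using R(2) x L by simp
    also have "\<dots> = 0" using X.null_left x R L by blast
    finally show "b L x = 0" .
  next
    fix z assume "z \<in> M" "z \<in> Y"
    thus "a (R z) (R z) = 0" using R M(3) by auto
  next
    show "\<And>s. s \<in> M \<Longrightarrow> (\<And>q. q \<in> M \<Longrightarrow> a (R s) (R q) = b L q) \<Longrightarrow> thesis"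
      by (rule that)
  qed (simp_all add: M L b_add2 b_scale2)
  define z where "z = R s - L"
  have zV: "z \<in> X" using s L R by (auto simp: z_def intro: X.S_intros)
  have "b z q = 0" if q: "q \<in> M" for q
    using s(2)[OF q] R'[OF q zV] R'[OF q] q L R s by (simp add: z_def X.bilin)
  hence zK: "z \<in> K" using zV by (auto simp: K_def)
  have "a z z = a (R s) z - a L z" using zV R s L by (simp add: z_def X.bilin X.S_intros)
  also have "\<dots> = 0" using zK w(2)[OF zK] s R(2)[OF s(1) zV] L(2)[OF zV] by (auto simp: K_def)
  finally have zz: "a z z = 0" .
  have "a w v + b v s = l v" if v: "v \<in> X" for v
  proof -
    have "a z v = 0" using X.null_left[OF zV v zz] .
    hence "b v s = l v - a w v" using R s L v by (simp add: z_def X.bilin)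
    thus ?thesis by simp
  qed
  thus ?thesis using wV s w(1) by (auto simp: K_def)
qed

section \<open>Estimates of Taylor type\<close>

lemma real_increment_bound:
  fixes \<phi> \<phi>' :: "real \<Rightarrow> real"
  assumes der: "\<And>t. t \<in> {a..b} \<Longrightarrow> (\<phi> has_real_derivative \<phi>' t) (at t within {a..b})"
    and bnd: "\<And>t. t \<in> {a..b} \<Longrightarrow> \<bar>\<phi>' t\<bar> \<le> K"
    and "x \<in> {a..b}" "y \<in> {a..b}"
  shows "\<bar>\<phi> y - \<phi> x\<bar> \<le> K * \<bar>y - x\<bar>"
  using field_differentiable_bound[of "{a..b}" \<phi> \<phi>' K y x] assms by auto

text \<open>
  The difference of the function and its tangent at \<open>c\<close> has a derivative of absolute value at most
  \<open>K * (b - a)\<close>.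
\<close>

lemma real_taylor1_bound:
  fixes \<phi> \<phi>' \<phi>'' :: "real \<Rightarrow> real"
  assumes d1: "\<And>t. t \<in> {a..b} \<Longrightarrow> (\<phi> has_real_derivative \<phi>' t) (at t within {a..b})"
    and d2: "\<And>t. t \<in> {a..b} \<Longrightarrow> (\<phi>' has_real_derivative \<phi>'' t) (at t within {a..b})"
    and bnd: "\<And>t. t \<in> {a..b} \<Longrightarrow> \<bar>\<phi>'' t\<bar> \<le> K"
    and x: "x \<in> {a..b}" and c: "c \<in> {a..b}"
  shows "\<bar>\<phi> x - \<phi> c - \<phi>' c * (x - c)\<bar> \<le> K * (b - a) * \<bar>x - c\<bar>"
proof -
  have K: "0 \<le> K" using bnd[OF x] by linarith
  have "\<bar>(\<phi> x - \<phi>' c * x) - (\<phi> c - \<phi>' c * c)\<bar> \<le> (K * (b - a)) * \<bar>x - c\<bar>"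
  proof (rule real_increment_bound[where \<phi> = "\<lambda>t. \<phi> t - \<phi>' c * t" and \<phi>' = "\<lambda>t. \<phi>' t - \<phi>' c" and a = a and b = b])
    fix t assume t: "t \<in> {a..b}"
    show "((\<lambda>t. \<phi> t - \<phi>' c * t) has_real_derivative \<phi>' t - \<phi>' c) (at t within {a..b})"
      by (auto intro!: derivative_eq_intros d1[OF t])
    have "\<bar>\<phi>' t - \<phi>' c\<bar> \<le> K * \<bar>t - c\<bar>"
      using real_increment_bound[OF d2 bnd c t] .
    also have "\<dots> \<le> K * (b - a)" using t c K by (intro mult_left_mono) auto
    finally show "\<bar>\<phi>' t - \<phi>' c\<bar> \<le> K * (b - a)" .
  qed (use x c in auto)
  thus ?thesis by (simp add: algebra_simps)
qed

text \<open>
  Up to a constant, \<open>g t\<close> is the error of the trapezoidal rule on \<open>{a..t}\<close>. Its derivative is half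
  a remainder of first order in the Taylor expansion of \<open>\<phi>'\<close> at \<open>t\<close>, hence bounded by
  \<open>K * (b - a)\<^sup>2\<close>.
\<close>

lemma real_trapezoid_bound:
  fixes \<phi> \<phi>' \<phi>'' \<phi>''' :: "real \<Rightarrow> real"
  assumes d1: "\<And>t. t \<in> {a..b} \<Longrightarrow> (\<phi> has_real_derivative \<phi>' t) (at t within {a..b})"
    and d2: "\<And>t. t \<in> {a..b} \<Longrightarrow> (\<phi>' has_real_derivative \<phi>'' t) (at t within {a..b})"
    and d3: "\<And>t. t \<in> {a..b} \<Longrightarrow> (\<phi>'' has_real_derivative \<phi>''' t) (at t within {a..b})"
    and bnd: "\<And>t. t \<in> {a..b} \<Longrightarrow> \<bar>\<phi>''' t\<bar> \<le> K"
    and ab: "a \<le> b"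
  shows "\<bar>\<phi> b - \<phi> a - (b - a) * ((\<phi>' a + \<phi>' b) / 2)\<bar> \<le> K * (b - a) ^ 3"
proof -
  have aab: "a \<in> {a..b}" "b \<in> {a..b}" using ab by auto
  have K: "0 \<le> K" using bnd[OF aab(1)] by linarith
  define g where "g t = \<phi> t - (t - a) / 2 * (\<phi>' t + \<phi>' a)" for t
  define g' where "g' t = (\<phi>' t - \<phi>' a - (t - a) * \<phi>'' t) / 2" for t
  have "\<bar>g b - g a\<bar> \<le> (K * (b - a)\<^sup>2) * \<bar>b - a\<bar>"
  proof (rule real_increment_bound[where \<phi>' = g' and a = a and b = b])
    fix t assume t: "t \<in> {a..b}"
    show "(g has_real_derivative g' t) (at t within {a..b})"
      unfolding g_def g'_def
      by (rule derivative_eq_intros d1[OF t] d2[OF t] refl | simp add: field_simps)+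
    have "\<bar>\<phi>' a - \<phi>' t - \<phi>'' t * (a - t)\<bar> \<le> K * (b - a) * \<bar>a - t\<bar>"
      using real_taylor1_bound[OF d2 d3 bnd aab(1) t] .
    also have "\<dots> \<le> K * (b - a) * (b - a)" using t K ab by (intro mult_left_mono) auto
    finally have "\<bar>\<phi>' a - \<phi>' t - \<phi>'' t * (a - t)\<bar> \<le> K * (b - a)\<^sup>2"
      by (simp add: power2_eq_square mult.assoc)
    moreover have "\<phi>' t - \<phi>' a - (t - a) * \<phi>'' t = - (\<phi>' a - \<phi>' t - \<phi>'' t * (a - t))"
      by (simp add: algebra_simps)
    ultimately show "\<bar>g' t\<bar> \<le> K * (b - a)\<^sup>2"
      by (simp add: g'_def abs_minus_cancel del: diff_minus_eq_add minus_diff_eq)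
  qed (use aab in auto)
  also have "K * (b - a)\<^sup>2 * \<bar>b - a\<bar> = K * (b - a) ^ 3"
    using ab by (simp add: power2_eq_square power3_eq_cube)
  finally show ?thesis by (simp add: g_def algebra_simps)
qed

text \<open>
  Extrapolation is included, as \<open>x\<close> may lie outside of \<open>{c..d}\<close>: the Taylor remainder at \<open>d\<close>
  enters with the factor \<open>\<bar>x - c\<bar> / \<bar>d - c\<bar>\<close>, whose denominator is cancelled by the factor
  \<open>\<bar>d - c\<bar>\<close> of its bound.
\<close>

lemma real_interpolation_bound:
  fixes \<phi> \<phi>' \<phi>'' :: "real \<Rightarrow> real"
  assumes d1: "\<And>t. t \<in> {a..b} \<Longrightarrow> (\<phi> has_real_derivative \<phi>' t) (at t within {a..b})"
    and d2: "\<And>t. t \<in> {a..b} \<Longrightarrow> (\<phi>' has_real_derivative \<phi>'' t) (at t within {a..b})"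
    and bnd: "\<And>t. t \<in> {a..b} \<Longrightarrow> \<bar>\<phi>'' t\<bar> \<le> K"
    and x: "x \<in> {a..b}" and c: "c \<in> {a..b}" and d: "d \<in> {a..b}" and cd: "c < d"
  shows "\<bar>\<phi> x - (\<phi> c + (x - c) / (d - c) * (\<phi> d - \<phi> c))\<bar> \<le> 2 * K * (b - a)\<^sup>2"
proof -
  have K: "0 \<le> K" using bnd[OF x] by linarith
  let ?R = "\<lambda>x. \<phi> x - \<phi> c - \<phi>' c * (x - c)"
  have R: "\<bar>?R y\<bar> \<le> K * (b - a) * \<bar>y - c\<bar>" if "y \<in> {a..b}" for y
    using real_taylor1_bound[OF d1 d2 bnd that c] .
  have "\<phi> x - (\<phi> c + (x - c) / (d - c) * (\<phi> d - \<phi> c)) = ?R x - (x - c) / (d - c) * ?R d"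
    using cd by (simp add: field_simps)
  also have "\<bar>\<dots>\<bar> \<le> \<bar>?R x\<bar> + \<bar>(x - c) / (d - c)\<bar> * \<bar>?R d\<bar>"
    by (metis abs_triangle_ineq4 abs_mult)
  also have "\<dots> \<le> K * (b - a) * \<bar>x - c\<bar> + \<bar>(x - c) / (d - c)\<bar> * (K * (b - a) * \<bar>d - c\<bar>)"
    by (intro add_mono mult_left_mono R x d) auto
  also have "\<dots> = 2 * (K * (b - a) * \<bar>x - c\<bar>)"
    using cd by (simp add: abs_divide)
  also have "\<dots> \<le> 2 * (K * (b - a) * (b - a))"
    using x c K by (intro mult_left_mono) auto
  finally show ?thesis by (simp add: power2_eq_square mult.assoc)
qed

context semi_inner
begin

text \<open>
  The seminorm belongs to \<open>B\<close> and not to the type of the vectors, so the derivative is expressed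
  by difference quotients.
\<close>

definition has_sderiv :: "(real \<Rightarrow> 'v) \<Rightarrow> (real \<Rightarrow> 'v) \<Rightarrow> real set \<Rightarrow> bool"
  where "has_sderiv w w' J \<longleftrightarrow> (\<forall>t\<in>J. w t \<in> S \<and> w' t \<in> S \<and>
    ((\<lambda>s. nrm ((w s - w t) /\<^sub>R (s - t) - w' t)) \<longlongrightarrow> 0) (at t within J))"

lemma has_sderivD:
  assumes "has_sderiv w w' J" "t \<in> J"
  shows "w t \<in> S" "w' t \<in> S"
    "((\<lambda>s. nrm ((w s - w t) /\<^sub>R (s - t) - w' t)) \<longlongrightarrow> 0) (at t within J)"
  using assms by (auto simp: has_sderiv_def)

text \<open>
  By the Cauchy-Schwarz inequality, the difference quotients still converge after the pairing with
  \<open>g\<close>.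
\<close>

lemma has_sderiv_dual:
  assumes w: "has_sderiv w w' J" and g: "g \<in> S" and t: "t \<in> J"
  shows "((\<lambda>t. B (w t) g) has_real_derivative B (w' t) g) (at t within J)"
proof -
  note D = has_sderivD[OF w]
  have "((\<lambda>s. (B (w s) g - B (w t) g) / (s - t) - B (w' t) g) \<longlongrightarrow> 0) (at t within J)"
  proof (rule Lim_null_comparison)
    show "\<forall>\<^sub>F s in at t within J. norm ((B (w s) g - B (w t) g) / (s - t) - B (w' t) g)
        \<le> nrm ((w s - w t) /\<^sub>R (s - t) - w' t) * nrm g"
    proof (rule eventually_at_topological[THEN iffD2], intro exI[of _ UNIV] conjI ballI impI)
      fix s assume s: "s \<in> J"
      have "(B (w s) g - B (w t) g) / (s - t) - B (w' t) g = B ((w s - w t) /\<^sub>R (s - t) - w' t) g"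
        using D(1,2)[OF s] D(1,2)[OF t] g by (simp add: bilin S_intros divide_inverse)
      thus "norm ((B (w s) g - B (w t) g) / (s - t) - B (w' t) g)
        \<le> nrm ((w s - w t) /\<^sub>R (s - t) - w' t) * nrm g"
        using Cauchy_Schwarz[of "(w s - w t) /\<^sub>R (s - t) - w' t" g] D(1,2)[OF s] D(1,2)[OF t] g
        by (simp add: S_intros)
    qed auto
    show "((\<lambda>s. nrm ((w s - w t) /\<^sub>R (s - t) - w' t) * nrm g) \<longlongrightarrow> 0) (at t within J)"
      using tendsto_mult_left_zero[OF D(3)[OF t]] .
  qed
  thus ?thesis
    unfolding has_field_derivative_iff by (rule LIM_zero_cancel)
qed

lemma has_sderiv_dual_subset:
  assumes "has_sderiv w w' J" "g \<in> S" "t \<in> {a..b}" "{a..b} \<subseteq> J"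
  shows "((\<lambda>t. B (w t) g) has_real_derivative B (w' t) g) (at t within {a..b})"
  using has_sderiv_dual[OF assms(1,2), of t] assms(3,4) DERIV_subset by blast

lemma dual_bound: "x \<in> S \<Longrightarrow> g \<in> S \<Longrightarrow> nrm x \<le> M \<Longrightarrow> \<bar>B x g\<bar> \<le> M * nrm g"
  by (meson Cauchy_Schwarz mult_right_mono nrm_nonneg order_trans)

text \<open>
  The next three estimates hold for the real functions \<open>t \<mapsto> B (w t) g\<close> with constants proportional
  to the seminorm of \<open>g\<close>, which is all that \<open>nrm_le_dual\<close> needs.
\<close>

lemma increment_bound:
  assumes w: "has_sderiv w w' J" and J: "{a..b} \<subseteq> J" and ab: "a \<le> b"
    and M: "\<And>t. t \<in> J \<Longrightarrow> nrm (w' t) \<le> M"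
  shows "nrm (w b - w a) \<le> M * (b - a)"
proof (rule nrm_le_dual)
  have mem: "a \<in> J" "b \<in> J" using J ab by auto
  note D = has_sderivD(1,2)[OF w]
  show "w b - w a \<in> S" using D mem by (intro S_intros)
  have M0: "0 \<le> M" using M[OF mem(1)] nrm_nonneg[OF D(2)[OF mem(1)]] by linarith
  thus "0 \<le> M * (b - a)" using ab by simp
  fix g assume g: "g \<in> S"
  have "\<bar>B (w b) g - B (w a) g\<bar> \<le> (M * nrm g) * \<bar>b - a\<bar>"
  proof (rule real_increment_bound[where \<phi> = "\<lambda>t. B (w t) g" and \<phi>' = "\<lambda>t. B (w' t) g" and a = a and b = b])
    fix t assume "t \<in> {a..b}"
    thus "\<bar>B (w' t) g\<bar> \<le> M * nrm g" using J D g M by (intro dual_bound) auto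
  qed (use has_sderiv_dual_subset[OF w g _ J] ab in auto)
  thus "\<bar>B (w b - w a) g\<bar> \<le> M * (b - a) * nrm g"
    using g D mem ab by (simp add: bilin S_intros mult_ac)
qed

lemma trapezoid_bound:
  assumes w: "has_sderiv w w' J" "has_sderiv w' w'' J" "has_sderiv w'' w''' J"
    and J: "{a..b} \<subseteq> J" and ab: "a < b"
    and M: "\<And>t. t \<in> J \<Longrightarrow> nrm (w''' t) \<le> M"
  shows "nrm ((w b - w a) /\<^sub>R (b - a) - (1/2) *\<^sub>R (w' a + w' b)) \<le> M * (b - a)\<^sup>2"
proof (rule nrm_le_dual)
  have mem: "a \<in> J" "b \<in> J" using J ab by auto
  note D = has_sderivD(1,2)[OF w(1)] has_sderivD(2)[OF w(3)]
  show "(w b - w a) /\<^sub>R (b - a) - (1/2) *\<^sub>R (w' a + w' b) \<in> S" using D mem by (intro S_intros)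
  have M0: "0 \<le> M" using M[OF mem(1)] nrm_nonneg[OF D(3)[OF mem(1)]] by linarith
  thus "0 \<le> M * (b - a)\<^sup>2" using ab by simp
  fix g assume g: "g \<in> S"
  have "\<bar>B (w b) g - B (w a) g - (b - a) * ((B (w' a) g + B (w' b) g) / 2)\<bar> \<le> (M * nrm g) * (b - a) ^ 3"
  proof (rule real_trapezoid_bound[where \<phi> = "\<lambda>t. B (w t) g" and \<phi>' = "\<lambda>t. B (w' t) g" and
      \<phi>'' = "\<lambda>t. B (w'' t) g" and \<phi>''' = "\<lambda>t. B (w''' t) g"])
    fix t assume "t \<in> {a..b}"
    thus "\<bar>B (w''' t) g\<bar> \<le> M * nrm g" using J D g M by (intro dual_bound) auto
  qed (use has_sderiv_dual_subset[OF w(1) g _ J] has_sderiv_dual_subset[OF w(2) g _ J]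
      has_sderiv_dual_subset[OF w(3) g _ J] ab in auto)
  moreover have "B (w b) g - B (w a) g - (b - a) * ((B (w' a) g + B (w' b) g) / 2)
     = (b - a) * B ((w b - w a) /\<^sub>R (b - a) - (1/2) *\<^sub>R (w' a + w' b)) g"
  proof -
    have "B ((w b - w a) /\<^sub>R (b - a) - (1/2) *\<^sub>R (w' a + w' b)) g
        = inverse (b - a) * (B (w b) g - B (w a) g) - (B (w' a) g + B (w' b) g) / 2"
      using g D mem by (simp add: bilin S_intros)
    also have "(b - a) * \<dots> = (b - a) * inverse (b - a) * (B (w b) g - B (w a) g)
        - (b - a) * ((B (w' a) g + B (w' b) g) / 2)"
      by (simp only: right_diff_distrib mult.assoc)
    also have "(b - a) * inverse (b - a) = 1" using ab by simp
    finally show ?thesis by simp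
  qed
  ultimately have "(b - a) * \<bar>B ((w b - w a) /\<^sub>R (b - a) - (1/2) *\<^sub>R (w' a + w' b)) g\<bar>
     \<le> (b - a) * (M * (b - a)\<^sup>2 * nrm g)"
    using ab by (simp add: abs_mult power2_eq_square power3_eq_cube mult_ac)
  thus "\<bar>B ((w b - w a) /\<^sub>R (b - a) - (1/2) *\<^sub>R (w' a + w' b)) g\<bar> \<le> M * (b - a)\<^sup>2 * nrm g"
    using ab by simp
qed

lemma interpolation_bound:
  assumes w: "has_sderiv w w' J" "has_sderiv w' w'' J"
    and J: "{a..b} \<subseteq> J"
    and M: "\<And>t. t \<in> J \<Longrightarrow> nrm (w'' t) \<le> M"
    and x: "x \<in> {a..b}" and c: "c \<in> {a..b}" and d: "d \<in> {a..b}" and cd: "c < d"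
  shows "nrm (w x - (w c + ((x - c) / (d - c)) *\<^sub>R (w d - w c))) \<le> 2 * M * (b - a)\<^sup>2"
proof (rule nrm_le_dual)
  have mem: "x \<in> J" "c \<in> J" "d \<in> J" using J x c d by auto
  note D = has_sderivD(1,2)[OF w(1)] has_sderivD(2)[OF w(2)]
  show "w x - (w c + ((x - c) / (d - c)) *\<^sub>R (w d - w c)) \<in> S" using D mem by (intro S_intros)
  have M0: "0 \<le> M" using M[OF mem(1)] nrm_nonneg[OF D(3)[OF mem(1)]] by linarith
  thus "0 \<le> 2 * M * (b - a)\<^sup>2" by simp
  fix g assume g: "g \<in> S"
  have "\<bar>B (w x) g - (B (w c) g + (x - c) / (d - c) * (B (w d) g - B (w c) g))\<bar> \<le> 2 * (M * nrm g) * (b - a)\<^sup>2"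
  proof (rule real_interpolation_bound[where \<phi> = "\<lambda>t. B (w t) g" and \<phi>' = "\<lambda>t. B (w' t) g" and
      \<phi>'' = "\<lambda>t. B (w'' t) g"])
    fix t assume "t \<in> {a..b}"
    thus "\<bar>B (w'' t) g\<bar> \<le> M * nrm g" using J D g M by (intro dual_bound) auto
  qed (use has_sderiv_dual_subset[OF w(1) g _ J] has_sderiv_dual_subset[OF w(2) g _ J] x c d cd in auto)
  thus "\<bar>B (w x - (w c + ((x - c) / (d - c)) *\<^sub>R (w d - w c))) g\<bar> \<le> 2 * M * (b - a)\<^sup>2 * nrm g"
    using g D mem by (simp add: bilin S_intros mult_ac)
qed

lemma continuous_nrm_bounded:
  assumes S: "\<And>t. t \<in> {a..b::real} \<Longrightarrow> w t \<in> S"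
    and c: "\<And>t. t \<in> {a..b} \<Longrightarrow> ((\<lambda>s. nrm (w s - w t)) \<longlongrightarrow> 0) (at t within {a..b})"
  obtains M where "0 \<le> M" "\<And>t. t \<in> {a..b} \<Longrightarrow> nrm (w t) \<le> M"
proof -
  have "continuous_on {a..b} (\<lambda>t. nrm (w t))"
    unfolding continuous_on_def
  proof
    fix t assume t: "t \<in> {a..b}"
    have "((\<lambda>s. nrm (w s) - nrm (w t)) \<longlongrightarrow> 0) (at t within {a..b})"
    proof (rule Lim_null_comparison[OF _ c[OF t]])
      show "\<forall>\<^sub>F s in at t within {a..b}. norm (nrm (w s) - nrm (w t)) \<le> nrm (w s - w t)"
        using S t by (auto simp: eventually_at_topological intro!: exI[of _ UNIV] nrm_diff_ineq)
    qed
    thus "((\<lambda>t. nrm (w t)) \<longlongrightarrow> nrm (w t)) (at t within {a..b})" by (rule LIM_zero_cancel)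
  qed
  hence "bounded ((\<lambda>t. nrm (w t)) ` {a..b})"
    by (intro compact_imp_bounded compact_continuous_image) auto
  then obtain M where "\<forall>t\<in>{a..b}. \<bar>nrm (w t)\<bar> \<le> M" by (auto simp: bounded_iff)
  thus ?thesis using that[of "max 0 M"] by fastforce
qed

end

section \<open>Square-integrable functions\<close>

lemma ae_eq_refl [simp]: "ae_eq \<Omega> f f"
  by (simp add: ae_eq_def)

lemma ae_eq_sym: "ae_eq \<Omega> f g \<Longrightarrow> ae_eq \<Omega> g f"
  unfolding ae_eq_def by (elim eventually_mono) auto

lemma ae_eq_trans: "ae_eq \<Omega> f g \<Longrightarrow> ae_eq \<Omega> g h \<Longrightarrow> ae_eq \<Omega> f h"
  unfolding ae_eq_def by (elim eventually_elim2) auto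

lemma ae_eq_add: "ae_eq \<Omega> f f' \<Longrightarrow> ae_eq \<Omega> g g' \<Longrightarrow> ae_eq \<Omega> (f + g) (f' + g')"
  unfolding ae_eq_def plus_fun_def by (elim eventually_elim2) auto

lemma ae_eq_diff: "ae_eq \<Omega> f f' \<Longrightarrow> ae_eq \<Omega> g g' \<Longrightarrow> ae_eq \<Omega> (f - g) (f' - g')"
  unfolding ae_eq_def fun_diff_def by (elim eventually_elim2) auto

lemma ae_eq_scaleR: "ae_eq \<Omega> f g \<Longrightarrow> ae_eq \<Omega> (c *\<^sub>R f) (c *\<^sub>R g)"
  unfolding ae_eq_def scaleR_fun_def by (elim eventually_mono) auto

lemma ae_eq_compose: "ae_eq \<Omega> f g \<Longrightarrow> ae_eq \<Omega> (\<lambda>x. h x (f x)) (\<lambda>x. h x (g x))"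
  unfolding ae_eq_def by (elim eventually_mono) auto

lemma ae_eq_diff_0: "ae_eq \<Omega> (f - g) 0 \<longleftrightarrow> ae_eq \<Omega> f (g :: _ \<Rightarrow> 'b::real_vector)"
  by (simp add: ae_eq_def fun_diff_def zero_fun_def)

locale bounded_open =
  fixes \<Omega> :: "(real ^ 'd::finite) set"
  assumes open_\<Omega>: "open \<Omega>" and bounded_\<Omega>: "bounded \<Omega>"
begin

lemma \<Omega>_lmeasurable: "\<Omega> \<in> lmeasurable"
  by (simp add: bounded_\<Omega> lmeasurable_open open_\<Omega>)

lemma \<Omega>_sets [measurable, simp]: "\<Omega> \<in> sets lebesgue"
  using \<Omega>_lmeasurable by (rule fmeasurableD)

lemma finite_measure_\<Omega>: "finite_measure (lebesgue_on \<Omega>)"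
  by (rule finite_measure_lebesgue_on[OF \<Omega>_lmeasurable])

lemma AE_\<Omega>_iff: "(AE x in lebesgue_on \<Omega>. P x) \<longleftrightarrow> (AE x in lebesgue. x \<in> \<Omega> \<longrightarrow> P x)"
  by (rule AE_restrict_space_iff) simp

text \<open>
  Lebesgue measure is complete, so changing a function on a null set preserves measurability.
\<close>

lemma measurable_cong_ae:
  fixes f g :: "real ^ 'd \<Rightarrow> 'b::euclidean_space"
  assumes "f \<in> borel_measurable (lebesgue_on \<Omega>)" "ae_eq \<Omega> f g"
  shows "g \<in> borel_measurable (lebesgue_on \<Omega>)"
proof -
  have "(\<lambda>x. if x \<in> \<Omega> then f x else 0) \<in> borel_measurable lebesgue"
    using assms(1) by (simp add: borel_measurable_if)
  moreover have "AE x in lebesgue. (if x \<in> \<Omega> then f x else 0) = (if x \<in> \<Omega> then g x else 0)"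
    using assms(2) unfolding ae_eq_def AE_\<Omega>_iff by (elim eventually_mono) auto
  ultimately have "(\<lambda>x. if x \<in> \<Omega> then g x else 0) \<in> borel_measurable lebesgue"
    by (rule borel_measurable_AE)
  thus ?thesis by (simp add: borel_measurable_if)
qed

lemma integrable_cong_ae:
  fixes f g :: "real ^ 'd \<Rightarrow> 'b::euclidean_space"
  assumes "ae_eq \<Omega> f g"
  shows "integrable (lebesgue_on \<Omega>) f \<longleftrightarrow> integrable (lebesgue_on \<Omega>) g"
proof -
  have "integrable (lebesgue_on \<Omega>) g"
    if "integrable (lebesgue_on \<Omega>) f" "ae_eq \<Omega> f g" for f g :: "real ^ 'd \<Rightarrow> 'b"
    by (rule integrable_cong_AE_imp[OF that(1) measurable_cong_ae[OF _ that(2)]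
          that(2)[unfolded ae_eq_def]]) (rule borel_measurable_integrable[OF that(1)])
  from this[OF _ assms] this[OF _ ae_eq_sym[OF assms]] show ?thesis by blast
qed

lemma integral_cong_ae:
  fixes f g :: "real ^ 'd \<Rightarrow> 'b::euclidean_space"
  assumes "ae_eq \<Omega> f g"
  shows "integral\<^sup>L (lebesgue_on \<Omega>) f = integral\<^sup>L (lebesgue_on \<Omega>) g"
proof (cases "integrable (lebesgue_on \<Omega>) f")
  case True
  hence "integrable (lebesgue_on \<Omega>) g" using integrable_cong_ae[OF assms] by simp
  with True assms show ?thesis
    unfolding ae_eq_def by (intro integral_cong_AE) auto
next
  case False
  hence "\<not> integrable (lebesgue_on \<Omega>) g" using integrable_cong_ae[OF assms] by simp
  with False show ?thesis by (simp add: not_integrable_integral_eq)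
qed

lemma L2_cong:
  assumes "ae_eq \<Omega> f g" "f \<in> L2 \<Omega>"
  shows "g \<in> L2 \<Omega>"
  using assms measurable_cong_ae[of f g]
    integrable_cong_ae[of "\<lambda>x. (norm (f x))\<^sup>2" "\<lambda>x. (norm (g x))\<^sup>2"]
    ae_eq_compose[OF assms(1), of "\<lambda>x y. (norm y)\<^sup>2"]
  by (auto simp: L2_def)

lemma ip_cong:
  assumes "ae_eq \<Omega> f f'" "ae_eq \<Omega> g g'"
  shows "ip \<Omega> f g = ip \<Omega> f' g'"
  unfolding ip_def using assms
  by (intro integral_cong_ae) (auto simp: ae_eq_def elim: eventually_elim2)

lemma L2norm_cong: "ae_eq \<Omega> f g \<Longrightarrow> L2norm \<Omega> f = L2norm \<Omega> g"
  unfolding L2norm_def using ip_cong by metis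

lemma L2D:
  assumes "f \<in> L2 \<Omega>"
  shows "f \<in> borel_measurable (lebesgue_on \<Omega>)" "integrable (lebesgue_on \<Omega>) (\<lambda>x. (norm (f x))\<^sup>2)"
  using assms by (auto simp: L2_def)

lemma L2_bounded_by:
  fixes f :: "real ^ 'd \<Rightarrow> 'b::euclidean_space" and g :: "real ^ 'd \<Rightarrow> real"
  assumes "f \<in> borel_measurable (lebesgue_on \<Omega>)" "integrable (lebesgue_on \<Omega>) g"
    "\<And>x. x \<in> \<Omega> \<Longrightarrow> (norm (f x))\<^sup>2 \<le> g x"
  shows "f \<in> L2 \<Omega>"
proof -
  have "integrable (lebesgue_on \<Omega>) (\<lambda>x. (norm (f x))\<^sup>2)"
  proof (rule Bochner_Integration.integrable_bound[OF assms(2)])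
    show "(\<lambda>x. (norm (f x))\<^sup>2) \<in> borel_measurable (lebesgue_on \<Omega>)" using assms(1) by measurable
    show "AE x in lebesgue_on \<Omega>. norm ((norm (f x))\<^sup>2) \<le> norm (g x)"
      using assms(3) by (intro AE_I2) (auto intro: order_trans[OF _ abs_ge_self])
  qed
  with assms(1) show ?thesis by (simp add: L2_def)
qed

lemma norm_add_sq_le: "(norm (a + b))\<^sup>2 \<le> 2 * (norm a)\<^sup>2 + 2 * (norm (b::'b::real_normed_vector))\<^sup>2"
proof -
  have "(norm (a + b))\<^sup>2 \<le> (norm a + norm b)\<^sup>2" by (intro power_mono norm_triangle_ineq) auto
  also have "\<dots> \<le> 2 * (norm a)\<^sup>2 + 2 * (norm b)\<^sup>2"
    using sum_squares_bound[of "norm a" "norm b"] by (simp add: power2_sum)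
  finally show ?thesis .
qed

lemma L2_add: "f \<in> L2 \<Omega> \<Longrightarrow> g \<in> L2 \<Omega> \<Longrightarrow> f + g \<in> L2 \<Omega>"
  unfolding plus_fun_def
  by (rule L2_bounded_by[of _ "\<lambda>x. 2 * (norm (f x))\<^sup>2 + 2 * (norm (g x))\<^sup>2"])
    (use L2D[of f] L2D[of g] in \<open>auto intro: norm_add_sq_le\<close>)

lemma L2_bounded_linear:
  assumes "bounded_linear T" "f \<in> L2 \<Omega>"
  shows "(\<lambda>x. T (f x)) \<in> L2 \<Omega>"
proof -
  interpret T: bounded_linear T by fact
  obtain K where K: "\<And>x. norm (T x) \<le> norm x * K" using T.bounded by blast
  have "(\<lambda>x. T (f x)) \<in> borel_measurable (lebesgue_on \<Omega>)"
    by (rule borel_measurable_continuous_on[OF T.continuous_on[OF continuous_on_id] L2D(1)[OF assms(2)]])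
  moreover have "integrable (lebesgue_on \<Omega>) (\<lambda>x. K\<^sup>2 * (norm (f x))\<^sup>2)"
    using L2D(2)[OF assms(2)] by simp
  ultimately show ?thesis
  proof (rule L2_bounded_by)
    fix x
    have "(norm (T (f x)))\<^sup>2 \<le> (norm (f x) * K)\<^sup>2" using K by (intro power_mono) auto
    thus "(norm (T (f x)))\<^sup>2 \<le> K\<^sup>2 * (norm (f x))\<^sup>2" by (simp add: power_mult_distrib mult.commute)
  qed
qed

lemma L2_scaleR: "f \<in> L2 \<Omega> \<Longrightarrow> c *\<^sub>R f \<in> L2 \<Omega>"
  unfolding scaleR_fun_def by (rule L2_bounded_linear) (rule bounded_linear_scaleR_right)

lemma L2_zero: "0 \<in> L2 \<Omega>"
  unfolding zero_fun_def by (simp add: L2_def)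

lemma subspace_L2: "subspace (L2 \<Omega>)"
  by (intro subspaceI L2_zero L2_add L2_scaleR)

lemma L2_sum: "(\<And>i. i \<in> A \<Longrightarrow> f i \<in> L2 \<Omega>) \<Longrightarrow> (\<lambda>x. \<Sum>i\<in>A. f i x) \<in> L2 \<Omega>"
proof (induction A rule: infinite_finite_induct)
  case (insert a A)
  thus ?case using L2_add[of "f a" "\<lambda>x. \<Sum>i\<in>A. f i x"] by (simp add: plus_fun_def)
qed (use L2_zero in \<open>simp_all add: zero_fun_def\<close>)

lemma integrable_inner:
  fixes f g :: "real ^ 'd \<Rightarrow> 'b::euclidean_space"
  assumes "f \<in> L2 \<Omega>" "g \<in> L2 \<Omega>"
  shows "integrable (lebesgue_on \<Omega>) (\<lambda>x. f x \<bullet> g x)"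
proof (rule Bochner_Integration.integrable_bound[of _ "\<lambda>x. (norm (f x))\<^sup>2 + (norm (g x))\<^sup>2"])
  show "(\<lambda>x. f x \<bullet> g x) \<in> borel_measurable (lebesgue_on \<Omega>)"
    using L2D[OF assms(1)] L2D[OF assms(2)] by auto
  show "AE x in lebesgue_on \<Omega>. norm (f x \<bullet> g x) \<le> norm ((norm (f x))\<^sup>2 + (norm (g x))\<^sup>2)"
  proof (intro AE_I2)
    fix x
    have "\<bar>f x \<bullet> g x\<bar> \<le> norm (f x) * norm (g x)" by (rule Cauchy_Schwarz_ineq2)
    also have "\<dots> \<le> (norm (f x))\<^sup>2 + (norm (g x))\<^sup>2"
    proof -
      have "0 \<le> norm (f x) * norm (g x)" by simp
      with sum_squares_bound[of "norm (f x)" "norm (g x)"] show ?thesis by linarith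
    qed
    finally show "norm (f x \<bullet> g x) \<le> norm ((norm (f x))\<^sup>2 + (norm (g x))\<^sup>2)" by simp
  qed
qed (use L2D[OF assms(1)] L2D[OF assms(2)] in \<open>auto\<close>)

lemma L2_integrable:
  fixes f :: "real ^ 'd \<Rightarrow> 'b::euclidean_space"
  assumes "f \<in> L2 \<Omega>"
  shows "integrable (lebesgue_on \<Omega>) f"
proof (rule Bochner_Integration.integrable_bound[of _ "\<lambda>x. 1 + (norm (f x))\<^sup>2"])
  interpret finite_measure "lebesgue_on \<Omega>" by (rule finite_measure_\<Omega>)
  show "integrable (lebesgue_on \<Omega>) (\<lambda>x. 1 + (norm (f x))\<^sup>2)" using L2D[OF assms(1)] by auto
  show "AE x in lebesgue_on \<Omega>. norm (f x) \<le> norm (1 + (norm (f x))\<^sup>2)"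
  proof (intro AE_I2)
    fix x
    have "norm (f x) \<le> 1 + (norm (f x))\<^sup>2"
      using sum_squares_bound[of 1 "norm (f x)"] norm_ge_zero[of "f x"] by (simp del: norm_ge_zero)
    thus "norm (f x) \<le> norm (1 + (norm (f x))\<^sup>2)" by simp
  qed
qed (use L2D[OF assms(1)] in \<open>auto\<close>)

lemma L2_bounded_mult:
  fixes f :: "real ^ 'd \<Rightarrow> 'b::euclidean_space" and g :: "real ^ 'd \<Rightarrow> real"
  assumes "f \<in> L2 \<Omega>" "g \<in> borel_measurable (lebesgue_on \<Omega>)" "\<And>x. x \<in> \<Omega> \<Longrightarrow> \<bar>g x\<bar> \<le> K"
  shows "(\<lambda>x. g x *\<^sub>R f x) \<in> L2 \<Omega>"
proof (rule L2_bounded_by)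
  show "(\<lambda>x. g x *\<^sub>R f x) \<in> borel_measurable (lebesgue_on \<Omega>)"
    using L2D[OF assms(1)] assms(2) by auto
  show "integrable (lebesgue_on \<Omega>) (\<lambda>x. K\<^sup>2 * (norm (f x))\<^sup>2)"
    using L2D[OF assms(1)] assms(2) by auto
  fix x assume "x \<in> \<Omega>"
  hence "\<bar>g x\<bar>\<^sup>2 \<le> K\<^sup>2" using assms(3) by (intro power_mono) auto
  thus "(norm (g x *\<^sub>R f x))\<^sup>2 \<le> K\<^sup>2 * (norm (f x))\<^sup>2"
    by (simp add: power_mult_distrib mult_right_mono)
qed

lemma L2_continuous:
  fixes f :: "real ^ 'd \<Rightarrow> 'b::euclidean_space"
  assumes "continuous_on UNIV f"
  shows "f \<in> L2 \<Omega>"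
proof -
  interpret finite_measure "lebesgue_on \<Omega>" by (rule finite_measure_\<Omega>)
  have m: "f \<in> borel_measurable (lebesgue_on \<Omega>)"
    using borel_measurable_continuous_onI[OF assms]
    by (intro measurable_restrict_space1 measurable_completion) simp
  have "compact (closure \<Omega>)" using bounded_\<Omega> by (simp add: compact_closure)
  hence "bounded (f ` closure \<Omega>)"
    using assms by (intro compact_imp_bounded compact_continuous_image) (auto intro: continuous_on_subset)
  then obtain K where K: "\<forall>x\<in>closure \<Omega>. norm (f x) \<le> K" by (auto simp: bounded_iff)
  show ?thesis
  proof (rule L2_bounded_by[OF m, of "\<lambda>_. K\<^sup>2"])
    fix x assume "x \<in> \<Omega>"
    thus "(norm (f x))\<^sup>2 \<le> K\<^sup>2" using K closure_subset by (intro power_mono) auto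
  qed simp
qed

sublocale L2: semi_inner "L2 \<Omega> :: (real ^ 'd \<Rightarrow> 'b::euclidean_space) set" "ip \<Omega>"
proof
  show "subspace (L2 \<Omega> :: (real ^ 'd \<Rightarrow> 'b) set)" by (rule subspace_L2)
  fix x y z :: "real ^ 'd \<Rightarrow> 'b" and c
  show "ip \<Omega> (x + y) z = ip \<Omega> x z + ip \<Omega> y z" if "x \<in> L2 \<Omega>" "y \<in> L2 \<Omega>" "z \<in> L2 \<Omega>"
    unfolding ip_def plus_fun_def using that
    by (simp add: inner_add_left integrable_inner)
  show "ip \<Omega> (c *\<^sub>R x) z = c * ip \<Omega> x z"
    by (simp add: ip_def)
  show "ip \<Omega> x y = ip \<Omega> y x"
    by (simp add: ip_def inner_commute)
  show "0 \<le> ip \<Omega> x x"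
    by (simp add: ip_def)
qed

lemma L2norm_eq_nrm: "L2norm \<Omega> = L2.nrm"
  by (simp add: fun_eq_iff L2norm_def L2.nrm_def)

lemma ip_self_eq_0_iff:
  assumes "f \<in> L2 \<Omega>"
  shows "ip \<Omega> f f = 0 \<longleftrightarrow> ae_eq \<Omega> f 0"
proof -
  have "ip \<Omega> f f = 0 \<longleftrightarrow> (AE x in lebesgue_on \<Omega>. f x \<bullet> f x = 0)"
    unfolding ip_def by (intro integral_nonneg_eq_0_iff_AE integrable_inner assms) auto
  thus ?thesis by (simp add: ae_eq_def zero_fun_def)
qed

lemma L2norm_eq_0_iff: "f \<in> L2 \<Omega> \<Longrightarrow> L2norm \<Omega> f = 0 \<longleftrightarrow> ae_eq \<Omega> f 0"
  by (simp add: L2norm_def ip_self_eq_0_iff)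

lemma L2_vec_nth: "f \<in> L2 \<Omega> \<Longrightarrow> (\<lambda>x. f x $ j) \<in> L2 \<Omega>"
  by (rule L2_bounded_linear) (rule bounded_linear_vec_nth)

lemma L2_vecI:
  fixes f :: "real ^ 'd \<Rightarrow> 'b::euclidean_space ^ 'n"
  assumes "\<And>j. (\<lambda>x. f x $ j) \<in> L2 \<Omega>"
  shows "f \<in> L2 \<Omega>"
proof -
  have bl: "bounded_linear (axis j :: 'b \<Rightarrow> 'b ^ 'n)" for j
    by (intro linear_conv_bounded_linear[THEN iffD1] linearI) (auto simp: vec_eq_iff axis_def)
  have "f = (\<lambda>x. \<Sum>j\<in>UNIV. axis j (f x $ j))"
    by (auto simp: fun_eq_iff vec_eq_iff axis_def if_distrib cong: if_cong)
  moreover have "(\<lambda>x. \<Sum>j\<in>UNIV. axis j (f x $ j)) \<in> L2 \<Omega>"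
    by (intro L2_sum L2_bounded_linear[OF bl] assms)
  ultimately show ?thesis by simp
qed

lemma ip_vec:
  fixes f g :: "real ^ 'd \<Rightarrow> 'b::euclidean_space ^ 'n"
  assumes "f \<in> L2 \<Omega>" "g \<in> L2 \<Omega>"
  shows "ip \<Omega> f g = (\<Sum>j\<in>UNIV. ip \<Omega> (\<lambda>x. f x $ j) (\<lambda>x. g x $ j))"
  unfolding ip_def inner_vec_def
  by (rule Bochner_Integration.integral_sum) (intro integrable_inner L2_vec_nth assms)

end

section \<open>Smooth functions\<close>

lemma partials_append: "partials (is @ js) f = partials is (partials js f)"
  by (induction "is") auto

lemma smooth_differentiable: "smooth f \<Longrightarrow> f differentiable (at x)"
  unfolding smooth_def by (metis partials.simps(1))

lemma smooth_partials: "smooth f \<Longrightarrow> smooth (partials js f)"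
  unfolding smooth_def by (metis partials_append)

lemma smooth_partial: "smooth f \<Longrightarrow> smooth (partial i f)"
  using smooth_partials[of f "[i]"] by simp

lemma smooth_continuous: "smooth f \<Longrightarrow> continuous_on UNIV f"
  by (meson continuous_at_imp_continuous_on differentiable_imp_continuous_within smooth_differentiable)

lemma partial_eq: "(f has_derivative f') (at x) \<Longrightarrow> partial i f x = f' (axis i 1)"
  unfolding partial_def by (metis frechet_derivative_at)

lemma frechet_derivative_worksI: "f differentiable F \<Longrightarrow> (f has_derivative frechet_derivative f F) F"
  by (simp add: frechet_derivative_works)

text \<open>
  Iterated derivatives stay in the class \<open>P\<close>, so only first derivatives have to be computed.
\<close>

lemma smooth_coinduct:
  assumes "P f"
    and "\<And>g x. P g \<Longrightarrow> g differentiable (at x)" "\<And>g i. P g \<Longrightarrow> P (partial i g)"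
  shows "smooth f"
proof -
  have "P (partials is f)" for "is" by (induction "is") (auto simp: assms)
  thus ?thesis using assms(2) by (auto simp: smooth_def)
qed

lemma smooth_zero: "smooth (\<lambda>x::real^'d::finite. 0 :: 'b::real_normed_vector)"
proof (rule smooth_coinduct[where P = "\<lambda>f. f = (\<lambda>x. 0)"])
  fix g :: "real^'d \<Rightarrow> 'b" and i assume g: "g = (\<lambda>x. 0)"
  show "partial i g = (\<lambda>x. 0)" unfolding g by (rule ext) (rule partial_eq[OF has_derivative_const])
qed auto

text \<open>
  The algebra generated by \<open>G\<close>. Derivatives of products are sums of products, so a class of
  functions to which \<open>smooth_coinduct\<close> applies should be closed under both operations.
\<close>

inductive_set falg :: "(real ^ 'd::finite \<Rightarrow> real) set \<Rightarrow> (real ^ 'd \<Rightarrow> real) set"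
  for G where
    falg_base: "g \<in> G \<Longrightarrow> g \<in> falg G"
  | falg_const: "(\<lambda>x. c) \<in> falg G"
  | falg_add: "f \<in> falg G \<Longrightarrow> g \<in> falg G \<Longrightarrow> (\<lambda>x. f x + g x) \<in> falg G"
  | falg_mult: "f \<in> falg G \<Longrightarrow> g \<in> falg G \<Longrightarrow> (\<lambda>x. f x * g x) \<in> falg G"

lemma falg_prod: "(\<And>i. i \<in> A \<Longrightarrow> f i \<in> falg G) \<Longrightarrow> (\<lambda>x. \<Prod>i\<in>A. f i x) \<in> falg G"
  by (induction A rule: infinite_finite_induct) (auto intro: falg_const falg_mult)

text \<open>By the sum and product rules, it is enough to differentiate the generators.\<close>

lemma smooth_falg:
  assumes G: "\<And>g x. g \<in> G \<Longrightarrow> g differentiable (at x)" "\<And>g i. g \<in> G \<Longrightarrow> partial i g \<in> falg G"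
    and f: "f \<in> falg G"
  shows "smooth f"
proof (rule smooth_coinduct[where P = "\<lambda>f. f \<in> falg G"])
  show diff: "g differentiable (at x)" if "g \<in> falg G" for g x
    using that by induction (auto simp: G)
  show "partial i g \<in> falg G" if "g \<in> falg G" for g i
    using that
  proof induction
    case (falg_base g)
    thus ?case by (rule G)
  next
    case (falg_const c)
    have "partial i (\<lambda>x. c) = (\<lambda>x. 0)" by (simp add: fun_eq_iff partial_eq[OF has_derivative_const])
    thus ?case using falg.falg_const[of 0] by simp
  next
    case (falg_add f g)
    have "partial i (\<lambda>x. f x + g x) = (\<lambda>x. partial i f x + partial i g x)"
    proof
      fix x
      show "partial i (\<lambda>x. f x + g x) x = partial i f x + partial i g x"
        using partial_eq[OF has_derivative_add[OF frechet_derivative_worksI[OF diff[OF falg_add(1)]]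
            frechet_derivative_worksI[OF diff[OF falg_add(2)]]], of i x] by (simp only: partial_def)
    qed
    thus ?case using falg_add falg.falg_add by simp
  next
    case (falg_mult f g)
    have "partial i (\<lambda>x. f x * g x) = (\<lambda>x. f x * partial i g x + partial i f x * g x)"
    proof
      fix x
      show "partial i (\<lambda>x. f x * g x) x = f x * partial i g x + partial i f x * g x"
        using partial_eq[OF has_derivative_mult[OF frechet_derivative_worksI[OF diff[OF falg_mult(1)]]
            frechet_derivative_worksI[OF diff[OF falg_mult(2)]]], of i x] by (simp only: partial_def)
    qed
    thus ?case using falg_mult by (auto intro: falg.intros)
  qed
qed (rule f)

section \<open>Bump functions\<close>

text \<open>
  The derivative of \<open>exp (- 1 / s) / s ^ k\<close> is a linear combination of such functions with larger
  \<open>k\<close>, so the whole family generates an algebra that is closed under differentiation.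
\<close>

definition eta :: "nat \<Rightarrow> real \<Rightarrow> real"
  where "eta k s = (if s \<le> 0 then 0 else exp (- 1 / s) / s ^ k)"

lemma eta_tendsto_0: "(eta k \<longlongrightarrow> 0) (at_right 0)"
proof -
  have "((\<lambda>s::real. (inverse s) ^ k / exp (inverse s)) \<longlongrightarrow> 0) (at_right 0)"
    by (rule filterlim_compose[OF tendsto_power_div_exp_0 filterlim_inverse_at_top_right])
  moreover have "\<forall>\<^sub>F s in at_right 0. (inverse s) ^ k / exp (inverse s) = eta k s"
    unfolding eventually_at_right_field
    by (intro exI[of _ 1]) (auto simp: eta_def exp_minus field_simps)
  ultimately show ?thesis by (simp cong: tendsto_cong)
qed

lemma eta_deriv: "(eta k has_real_derivative (eta (k + 2) s - real k * eta (k + 1) s)) (at s)"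
proof -
  consider "s > 0" | "s < 0" | "s = 0" by linarith
  thus ?thesis
  proof cases
    case 1
    have "((\<lambda>s. exp (- 1 / s) / s ^ k) has_real_derivative (eta (k + 2) s - real k * eta (k + 1) s)) (at s)"
    proof (cases k)
      case (Suc m)
      have "((\<lambda>s. exp (- 1 / s) / s ^ Suc m) has_real_derivative
          (exp (- 1 / s) * (1 / s\<^sup>2) * s ^ Suc m - exp (- 1 / s) * (real (Suc m) * s ^ m)) / (s ^ Suc m * s ^ Suc m)) (at s)"
        by (rule derivative_eq_intros refl | use 1 in \<open>simp add: power2_eq_square\<close>)+
      also have "(exp (- 1 / s) * (1 / s\<^sup>2) * s ^ Suc m - exp (- 1 / s) * (real (Suc m) * s ^ m)) / (s ^ Suc m * s ^ Suc m)
          = eta (k + 2) s - real k * eta (k + 1) s"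
        using 1 by (simp add: Suc eta_def diff_divide_distrib power2_eq_square)
      finally show ?thesis by (simp only: Suc)
    qed (use 1 in \<open>auto intro!: derivative_eq_intros simp: eta_def power2_eq_square\<close>)
    thus ?thesis
      by (rule has_field_derivative_transform_within_open[of _ _ _ "{0<..}"])
        (use 1 in \<open>auto simp: eta_def\<close>)
  next
    case 2
    have "((\<lambda>s. 0) has_real_derivative (eta (k + 2) s - real k * eta (k + 1) s)) (at s)"
      using 2 by (simp add: eta_def)
    thus ?thesis
      by (rule has_field_derivative_transform_within_open[of _ _ _ "{..<0}"])
        (use 2 in \<open>auto simp: eta_def\<close>)
  next
    case 3
    have "((\<lambda>h. (eta k h - eta k 0) / (h - 0)) \<longlongrightarrow> 0) (at 0)"
    proof (rule filterlim_split_at)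
      have "\<forall>\<^sub>F h::real in at_left 0. 0 = (eta k h - eta k 0) / (h - 0)"
        unfolding eventually_at_left_field by (intro exI[of _ "-1"]) (auto simp: eta_def)
      thus "((\<lambda>h. (eta k h - eta k 0) / (h - 0)) \<longlongrightarrow> 0) (at_left 0)"
        by (rule Lim_transform_eventually[OF tendsto_const])
      have "\<forall>\<^sub>F h::real in at_right 0. eta (k + 1) h = (eta k h - eta k 0) / (h - 0)"
        unfolding eventually_at_right_field by (intro exI[of _ 1]) (auto simp: eta_def field_simps)
      thus "((\<lambda>h. (eta k h - eta k 0) / (h - 0)) \<longlongrightarrow> 0) (at_right 0)"
        by (rule Lim_transform_eventually[OF eta_tendsto_0])
    qed
    thus ?thesis unfolding 3 has_field_derivative_iff by (simp add: eta_def)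
  qed
qed

text \<open>
  An approximation from below of the indicator of the open box. The shift by \<open>- 1\<close> keeps the
  support at distance \<open>1 / n\<close> from the boundary, so that it is compact in the open box.
\<close>

definition bump :: "real ^ 'd::finite \<Rightarrow> real ^ 'd \<Rightarrow> nat \<Rightarrow> real ^ 'd \<Rightarrow> real"
  where "bump a b n x = (\<Prod>e\<in>Basis.
    eta 0 (real n * (x \<bullet> e - a \<bullet> e) - 1) * eta 0 (real n * (b \<bullet> e - x \<bullet> e) - 1))"

lemma smooth_bump:
  fixes a b :: "real ^ 'd::finite"
  shows "smooth (bump a b n)"
proof -
  define G :: "(real ^ 'd \<Rightarrow> real) set" where "G = {\<lambda>x. eta k (c * (x \<bullet> e) + d) |k c e d. True}"
  have memG: "(\<lambda>x. eta k (c * (x \<bullet> e) + d)) \<in> G" for k c e d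
    unfolding G_def by blast
  have der: "((\<lambda>x. eta k (c * (x \<bullet> e) + d)) has_derivative
      (\<lambda>h. (eta (k + 2) (c * (x \<bullet> e) + d) - real k * eta (k + 1) (c * (x \<bullet> e) + d)) * (c * (h \<bullet> e)))) (at x)"
    for k c d and e x :: "real ^ 'd"
    by (rule has_derivative_compose[OF _ eta_deriv[unfolded has_field_derivative_def], where f = "\<lambda>x. c * (x \<bullet> e) + d"])
      (auto intro!: derivative_eq_intros)
  have "bump a b n = (\<lambda>x. \<Prod>e\<in>Basis.
      eta 0 (real n * (x \<bullet> e) + (- real n * (a \<bullet> e) - 1)) * eta 0 ((- real n) * (x \<bullet> e) + (real n * (b \<bullet> e) - 1)))"
    by (auto simp: bump_def fun_eq_iff algebra_simps)
  also have "\<dots> \<in> falg G"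
    by (intro falg_prod falg_mult falg_base memG)
  finally show ?thesis
  proof (rule smooth_falg[rotated 2])
    fix g x i assume "g \<in> G"
    then obtain k c e d where g: "g = (\<lambda>x. eta k (c * (x \<bullet> e) + d))" by (auto simp: G_def)
    show "g differentiable (at x)" unfolding g differentiable_def by (rule exI) (rule der)
    have "partial i g = (\<lambda>x. (eta (k + 2) (c * (x \<bullet> e) + d) + (- real k) * eta (k + 1) (c * (x \<bullet> e) + d)) * (c * (axis i 1 \<bullet> e)))"
      unfolding g by (auto simp: fun_eq_iff partial_eq[OF der])
    also have "\<dots> \<in> falg G"
      by (intro falg_mult falg_add falg_const falg_base memG)
    finally show "partial i g \<in> falg G" .
  qed
qed

lemma eta_0_bounds: "0 \<le> eta 0 s" "eta 0 s \<le> 1"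
  by (auto simp: eta_def)

lemma bump_bounds: "0 \<le> bump a b n x" "bump a b n x \<le> 1"
  unfolding bump_def using eta_0_bounds
  by (auto intro!: prod_nonneg prod_le_1 mult_nonneg_nonneg mult_le_one)

lemma bump_support:
  assumes "bump a b n x \<noteq> 0"
  shows "n > 0" "x \<in> cbox (a + (1 / n) *\<^sub>R One) (b - (1 / n) *\<^sub>R One)"
proof -
  have *: "real n * (x \<bullet> e - a \<bullet> e) > 1 \<and> real n * (b \<bullet> e - x \<bullet> e) > 1" if "e \<in> Basis" for e
    using assms that by (auto simp: bump_def eta_def split: if_splits)
  obtain e :: "real ^ 'a" where "e \<in> Basis" using nonempty_Basis by blast
  from *[OF this] show n: "n > 0" by (cases n) auto
  show "x \<in> cbox (a + (1 / n) *\<^sub>R One) (b - (1 / n) *\<^sub>R One)"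
    unfolding mem_box
  proof
    fix e :: "real ^ 'a" assume "e \<in> Basis"
    with *[OF this] n show "(a + (1 / n) *\<^sub>R One) \<bullet> e \<le> x \<bullet> e \<and> x \<bullet> e \<le> (b - (1 / n) *\<^sub>R One) \<bullet> e"
      by (auto simp: inner_add_left inner_diff_left field_simps)
  qed
qed

lemma bump_test_function:
  assumes "box a b \<subseteq> \<Omega>"
  shows "bump a b n \<in> test_functions \<Omega>"
proof (cases "n = 0")
  case True
  hence "bump a b n = (\<lambda>x. 0)" using bump_support(1)[of a b n] by auto
  thus ?thesis by (auto simp: test_functions_def smooth_zero intro!: exI[of _ "{}"])
next
  case False
  have "cbox (a + (1 / n) *\<^sub>R One) (b - (1 / n) *\<^sub>R One) \<subseteq> box a b"
  proof
    fix x assume x: "x \<in> cbox (a + (1 / n) *\<^sub>R One) (b - (1 / n) *\<^sub>R One)"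
    have "1 / real n > 0" using False by simp
    show "x \<in> box a b"
      unfolding mem_box
    proof
      fix e :: "real ^ 'a" assume "e \<in> Basis"
      with x have "a \<bullet> e + 1 / real n \<le> x \<bullet> e \<and> x \<bullet> e \<le> b \<bullet> e - 1 / real n"
        by (auto simp: mem_box inner_add_left inner_diff_left)
      with \<open>1 / real n > 0\<close> show "a \<bullet> e < x \<bullet> e \<and> x \<bullet> e < b \<bullet> e" by linarith
    qed
  qed
  hence "\<exists>K. compact K \<and> K \<subseteq> \<Omega> \<and> (\<forall>x. x \<notin> K \<longrightarrow> bump a b n x = 0)"
    using assms bump_support(2)[of a b n] compact_cbox
    by (intro exI[of _ "cbox (a + (1 / n) *\<^sub>R One) (b - (1 / n) *\<^sub>R One)"]) blast
  thus ?thesis using smooth_bump by (simp add: test_functions_def)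
qed

lemma bump_tendsto: "(\<lambda>n. bump a b n x) \<longlonglongrightarrow> indicator (box a b) x"
proof (cases "x \<in> box a b")
  case True
  have lim: "(\<lambda>n. eta 0 (real n * s - 1)) \<longlonglongrightarrow> 1" if s: "s > 0" for s
  proof -
    have "filterlim (\<lambda>n. real n * s - 1) at_top sequentially"
      by (intro filterlim_tendsto_add_at_top[OF tendsto_const, of _ _ "-1", simplified add.commute[of "-1"] add_uminus_conv_diff]
           filterlim_at_top_mult_tendsto_pos[OF tendsto_const s] filterlim_real_sequentially)
    hence "(\<lambda>n. exp (- inverse (real n * s - 1))) \<longlonglongrightarrow> exp (- 0)"
      by (intro tendsto_intros filterlim_compose[OF tendsto_inverse_0_at_top[OF filterlim_ident]])
    moreover have "\<forall>\<^sub>F n in sequentially. exp (- inverse (real n * s - 1)) = eta 0 (real n * s - 1)"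
      using filterlim_at_top_dense[THEN iffD1, OF \<open>filterlim (\<lambda>n. real n * s - 1) at_top sequentially\<close>, rule_format, of 0]
      by (rule eventually_mono) (auto simp: eta_def divide_inverse)
    ultimately show ?thesis using Lim_transform_eventually[of "\<lambda>n. exp (- inverse (real n * s - 1))" 1] by simp
  qed
  have "(\<lambda>n. bump a b n x) \<longlonglongrightarrow> (\<Prod>e\<in>(Basis::(real^'a) set). 1 * 1)"
    unfolding bump_def using True
    by (intro tendsto_prod tendsto_mult lim) (auto simp: mem_box)
  thus ?thesis using True by simp
next
  case False
  then obtain e where e: "e \<in> Basis" "x \<bullet> e \<le> a \<bullet> e \<or> b \<bullet> e \<le> x \<bullet> e" by (auto simp: mem_box not_less)
  have "bump a b n x = 0" for n
  proof -
    have "real n * (x \<bullet> e - a \<bullet> e) \<le> 0 \<or> real n * (b \<bullet> e - x \<bullet> e) \<le> 0"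
      using e by (auto simp: mult_le_0_iff)
    hence "eta 0 (real n * (x \<bullet> e - a \<bullet> e) - 1) * eta 0 (real n * (b \<bullet> e - x \<bullet> e) - 1) = 0"
      by (auto simp: eta_def)
    thus ?thesis unfolding bump_def using e(1) by (intro prod_zero) auto
  qed
  with False show ?thesis by simp
qed

section \<open>The integral of a derivative with compact support\<close>

lemma lborel_integral_translate:
  fixes F :: "'a::euclidean_space \<Rightarrow> 'b::euclidean_space"
  assumes "F \<in> borel_measurable borel"
  shows "(\<integral>x. F (c + x) \<partial>lborel) = (\<integral>x. F x \<partial>lborel)"
proof -
  have "(\<integral>x. F x \<partial>lborel) = (\<integral>x. F x \<partial>distr lborel borel ((+) c))" by (simp add: lborel_distr_plus)
  also have "\<dots> = (\<integral>x. F (c + x) \<partial>lborel)" using assms by (intro integral_distr) auto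
  finally show ?thesis ..
qed

lemma integrable_continuous_compact_support:
  fixes F :: "'a::euclidean_space \<Rightarrow> 'b::euclidean_space"
  assumes "continuous_on UNIV F" "compact K" "\<And>x. x \<notin> K \<Longrightarrow> F x = 0"
  shows "integrable lborel F"
proof -
  have "integrable lborel (\<lambda>x. indicator K x *\<^sub>R F x)"
    using assms(1,2) by (intro borel_integrable_compact) (auto intro: continuous_on_subset)
  moreover have "(\<lambda>x. indicator K x *\<^sub>R F x) = F" using assms(3) by (auto simp: fun_eq_iff indicator_def)
  ultimately show ?thesis by simp
qed

text \<open>
  Since the integral is invariant under translations, the difference quotients \<open>D n\<close> of \<open>F\<close> have
  the integral zero. They are uniformly bounded and supported in a fixed ball, so that the theorem
  of dominated convergence transfers this to their limit.
\<close>

lemma integral_partial_eq_0: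
  fixes F :: "real ^ 'd::finite \<Rightarrow> 'b::euclidean_space"
  assumes diff: "\<And>x. F differentiable (at x)" and cont: "continuous_on UNIV (partial i F)"
    and K: "compact K" "\<And>x. x \<notin> K \<Longrightarrow> F x = 0" "\<And>x. x \<notin> K \<Longrightarrow> partial i F x = 0"
  shows "(\<integral>x. partial i F x \<partial>lborel) = 0"
proof -
  define e :: "real ^ 'd" where "e = axis i 1"
  have contF: "continuous_on UNIV F"
    by (meson continuous_at_imp_continuous_on differentiable_imp_continuous_within diff)
  have meas [measurable]: "F \<in> borel_measurable borel" "partial i F \<in> borel_measurable borel"
    by (intro borel_measurable_continuous_onI contF cont)+
  have intF: "integrable lborel F"
    by (rule integrable_continuous_compact_support[OF contF K(1,2)])
  obtain R where R: "\<And>x. x \<in> K \<Longrightarrow> norm x \<le> R" using compact_imp_bounded[OF K(1)] by (auto simp: bounded_iff)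
  obtain M where M: "\<And>x. norm (partial i F x) \<le> M"
  proof -
    have "bounded (partial i F ` K)"
      using cont K(1) by (intro compact_imp_bounded compact_continuous_image) (auto intro: continuous_on_subset)
    then obtain M where "\<And>x. x \<in> K \<Longrightarrow> norm (partial i F x) \<le> M" by (auto simp: bounded_iff)
    hence "norm (partial i F x) \<le> max M 0" for x using K(3)[of x] by (cases "x \<in> K") force+
    thus ?thesis by (rule that)
  qed
  have M0: "0 \<le> M" using M[of 0] norm_ge_zero order_trans by blast
  have der: "((\<lambda>s. F (x + s *\<^sub>R e)) has_vector_derivative partial i F (x + s *\<^sub>R e)) (at s within A)" for x s A
  proof -
    have "((\<lambda>s. F (x + s *\<^sub>R e)) has_derivative (\<lambda>h. frechet_derivative F (at (x + s *\<^sub>R e)) (h *\<^sub>R e))) (at s)"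
      by (rule has_derivative_compose[OF _ frechet_derivative_worksI[OF diff], where f = "\<lambda>s. x + s *\<^sub>R e"])
        (auto intro!: derivative_eq_intros)
    moreover have "frechet_derivative F (at (x + s *\<^sub>R e)) (h *\<^sub>R e) = h *\<^sub>R partial i F (x + s *\<^sub>R e)" for h
      using linear_frechet_derivative[OF diff] by (simp add: linear_cmul partial_def e_def)
    ultimately have "((\<lambda>s. F (x + s *\<^sub>R e)) has_vector_derivative partial i F (x + s *\<^sub>R e)) (at s)"
      by (simp add: has_vector_derivative_def)
    thus ?thesis by (rule has_vector_derivative_at_within)
  qed
  define D where "D n x = real (Suc n) *\<^sub>R (F ((1 / real (Suc n)) *\<^sub>R e + x) - F x)" for n x
  have D0: "(\<integral>x. D n x \<partial>lborel) = 0" for n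
  proof -
    have "integrable lborel (\<lambda>x. F ((1 / real (Suc n)) *\<^sub>R e + x))"
    proof (rule integrable_distr[where M' = borel and f = F])
      show "integrable (distr lborel borel ((+) ((1 / real (Suc n)) *\<^sub>R e))) F"
        unfolding lborel_distr_plus by (rule intF)
    qed measurable
    hence "(\<integral>x. D n x \<partial>lborel) = real (Suc n) *\<^sub>R
        ((\<integral>x. F ((1 / real (Suc n)) *\<^sub>R e + x) \<partial>lborel) - (\<integral>x. F x \<partial>lborel))"
      unfolding D_def using intF
      by (simp only: integral_scaleR_right Bochner_Integration.integral_diff)
    thus ?thesis by (simp only: lborel_integral_translate[OF meas(1)] diff_self scaleR_zero_right)
  qed
  have "(\<lambda>n. \<integral>x. D n x \<partial>lborel) \<longlonglongrightarrow> (\<integral>x. partial i F x \<partial>lborel)"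
  proof (rule integral_dominated_convergence)
    show "partial i F \<in> borel_measurable lborel" by simp
    show "D n \<in> borel_measurable lborel" for n unfolding D_def by measurable
    show "integrable lborel (\<lambda>x. M * indicator (cball 0 (R + 1)) x :: real)"
      by (intro integrable_mult_right integrable_real_indicator) (auto intro!: emeasure_bounded_finite[unfolded infinity_ennreal_def])
    show "AE x in lborel. (\<lambda>n. D n x) \<longlonglongrightarrow> partial i F x"
    proof (intro AE_I2)
      fix x
      have "((\<lambda>s. (F (x + s *\<^sub>R e) - F x) /\<^sub>R s) \<longlongrightarrow> partial i F x) (at 0)"
      proof (rule LIM_zero_cancel, rule tendsto_norm_zero_cancel)
        have "((\<lambda>h. norm (F (x + h *\<^sub>R e) - F x - h *\<^sub>R partial i F x) / norm h) \<longlongrightarrow> 0) (at 0)"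
          using der[of x 0 UNIV] by (simp add: has_vector_derivative_def has_derivative_at)
        moreover have "\<forall>\<^sub>F h in at 0. norm (F (x + h *\<^sub>R e) - F x - h *\<^sub>R partial i F x) / norm h =
            norm ((F (x + h *\<^sub>R e) - F x) /\<^sub>R h - partial i F x)"
        proof (rule eventually_at_topological[THEN iffD2], intro exI[of _ UNIV] conjI ballI impI)
          fix h :: real assume "h \<noteq> 0"
          hence "(F (x + h *\<^sub>R e) - F x) /\<^sub>R h - partial i F x = (F (x + h *\<^sub>R e) - F x - h *\<^sub>R partial i F x) /\<^sub>R h"
            by (simp add: scaleR_diff_right)
          thus "norm (F (x + h *\<^sub>R e) - F x - h *\<^sub>R partial i F x) / norm h =
            norm ((F (x + h *\<^sub>R e) - F x) /\<^sub>R h - partial i F x)" by (simp add: divide_inverse mult.commute)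
        qed auto
        ultimately show "((\<lambda>h. norm ((F (x + h *\<^sub>R e) - F x) /\<^sub>R h - partial i F x)) \<longlongrightarrow> 0) (at 0)"
          by (rule Lim_transform_eventually)
      qed
      hence "(\<lambda>n. (F (x + (1 / real (Suc n)) *\<^sub>R e) - F x) /\<^sub>R (1 / real (Suc n))) \<longlonglongrightarrow> partial i F x"
        proof (rule filterlim_compose)
        have "(\<lambda>n. 1 / real (Suc n)) \<longlonglongrightarrow> 0"
          using LIMSEQ_inverse_real_of_nat by (simp only: inverse_eq_divide)
        thus "filterlim (\<lambda>n. 1 / real (Suc n)) (at 0) sequentially"
          unfolding filterlim_at by auto
      qed
      thus "(\<lambda>n. D n x) \<longlonglongrightarrow> partial i F x" by (simp add: D_def add.commute)
    qed
    show "AE x in lborel. norm (D n x) \<le> M * indicator (cball 0 (R + 1)) x" for n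
    proof (intro AE_I2)
      fix x
      let ?h = "1 / real (Suc n)"
      have "norm (F (x + ?h *\<^sub>R e) - F (x + 0 *\<^sub>R e)) \<le> M * norm (?h - 0)"
      proof (rule differentiable_bound[where S = UNIV and f' = "\<lambda>s h. h *\<^sub>R partial i F (x + s *\<^sub>R e)"])
        show "onorm (\<lambda>h. h *\<^sub>R partial i F (x + s *\<^sub>R e)) \<le> M" for s
          using M by (intro onorm_le) (simp add: mult.commute[of M] mult_left_mono)
      qed (use der in \<open>auto simp: has_vector_derivative_def\<close>)
      hence "norm (F (?h *\<^sub>R e + x) - F x) \<le> M * ?h" by (simp add: add.commute)
      hence "real (Suc n) * norm (F (?h *\<^sub>R e + x) - F x) \<le> real (Suc n) * (M * ?h)"
        by (intro mult_left_mono) auto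
      also have "real (Suc n) * (M * ?h) = M" by simp
      finally have *: "norm (D n x) \<le> M" unfolding D_def norm_scaleR by (simp only: abs_of_nat)
      show "norm (D n x) \<le> M * indicator (cball 0 (R + 1)) x"
      proof (cases "norm x \<le> R + 1")
        case False
        have "norm (?h *\<^sub>R e) \<le> 1" by (simp add: e_def norm_axis_1)
        hence "norm (?h *\<^sub>R e + x) > R"
          using False norm_triangle_ineq4[of "?h *\<^sub>R e + x" "?h *\<^sub>R e"]
          by (simp only: add_diff_cancel_left')
        hence "?h *\<^sub>R e + x \<notin> K" "x \<notin> K" using R[of x] R[of "?h *\<^sub>R e + x"] False by auto
        thus ?thesis using K M0 by (simp add: D_def)
      qed (use * in auto)
    qed
  qed
  thus ?thesis using D0 LIMSEQ_unique[OF _ tendsto_const] by (simp add: LIMSEQ_const_iff)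
qed

section \<open>Weak derivatives\<close>

lemma test_functionsD:
  assumes "\<phi> \<in> test_functions \<Omega>"
  shows "smooth \<phi>" "\<exists>K. compact K \<and> K \<subseteq> \<Omega> \<and> (\<forall>x. x \<notin> K \<longrightarrow> \<phi> x = 0)"
  using assms by (auto simp: test_functions_def)

lemma partial_eq_0_outside:
  fixes f :: "real ^ 'd::finite \<Rightarrow> 'b::real_normed_vector"
  assumes "closed K" "\<And>x. x \<notin> K \<Longrightarrow> f x = 0" "x \<notin> K"
  shows "partial i f x = 0"
proof (rule partial_eq)
  show "(f has_derivative (\<lambda>h. 0)) (at x)"
    by (rule has_derivative_transform_within_open[OF has_derivative_const, of "- K"])
      (use assms in auto)
qed

lemma test_partial:
  assumes "\<phi> \<in> test_functions \<Omega>"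
  shows "partial i \<phi> \<in> test_functions \<Omega>"
proof -
  obtain K where K: "compact K" "K \<subseteq> \<Omega>" "\<And>x. x \<notin> K \<Longrightarrow> \<phi> x = 0"
    using test_functionsD(2)[OF assms] by blast
  have "partial i \<phi> x = 0" if "x \<notin> K" for x
    using partial_eq_0_outside[OF compact_imp_closed[OF K(1)] K(3) that] .
  thus ?thesis
    using K smooth_partial[OF test_functionsD(1)[OF assms]] by (auto simp: test_functions_def)
qed

lemma finite_multi_indices: "finite (multi_indices m :: ('d::finite \<Rightarrow> nat) set)"
proof (rule finite_subset)
  show "multi_indices m \<subseteq> (UNIV :: 'd set) \<rightarrow>\<^sub>E {..m}"
  proof
    fix \<alpha> :: "'d \<Rightarrow> nat" assume "\<alpha> \<in> multi_indices m"
    hence "\<alpha> i \<le> m" for i using member_le_sum[of i UNIV \<alpha>] by (auto simp: multi_indices_def)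
    thus "\<alpha> \<in> UNIV \<rightarrow>\<^sub>E {..m}" by auto
  qed
qed (auto intro: finite_PiE)

lemma multi_indices_mono: "m \<le> n \<Longrightarrow> multi_indices m \<subseteq> multi_indices n"
  by (auto simp: multi_indices_def)

definition unit_index :: "'d \<Rightarrow> 'd \<Rightarrow> nat"
  where "unit_index j = (\<lambda>i. if i = j then 1 else 0)"

lemma inj_unit_index: "inj unit_index"
  by (auto simp: inj_on_def unit_index_def fun_eq_iff split: if_splits)

lemma unit_index_in: "1 \<le> m \<Longrightarrow> unit_index (j::'d::finite) \<in> multi_indices m"
  by (simp add: multi_indices_def unit_index_def)

lemma zero_index_in: "(\<lambda>_. 0) \<in> multi_indices m"
  by (simp add: multi_indices_def)

lemma multi_indices_1: "multi_indices 1 = insert (\<lambda>_. 0) (range (unit_index :: 'd::finite \<Rightarrow> _))"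
proof
  show "multi_indices 1 \<subseteq> insert (\<lambda>_. 0) (range (unit_index :: 'd \<Rightarrow> _))"
  proof
    fix \<alpha> :: "'d \<Rightarrow> nat" assume "\<alpha> \<in> multi_indices 1"
    hence s: "(\<Sum>i\<in>UNIV. \<alpha> i) \<le> 1" by (simp add: multi_indices_def)
    show "\<alpha> \<in> insert (\<lambda>_. 0) (range unit_index)"
    proof (cases "\<alpha> = (\<lambda>_. 0)")
      case False
      then obtain j where j: "\<alpha> j \<noteq> 0" by auto
      have "\<alpha> j + (\<Sum>i\<in>UNIV - {j}. \<alpha> i) \<le> 1" using s by (simp add: sum.remove[of UNIV j])
      hence "\<alpha> j = 1" "(\<Sum>i\<in>UNIV - {j}. \<alpha> i) = 0" using j by linarith+
      hence "\<alpha> = unit_index j" by (auto simp: fun_eq_iff unit_index_def)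
      thus ?thesis by auto
    qed auto
  qed
qed (use zero_index_in unit_index_in in auto)

text \<open>
  Weak derivatives are tested with the lists of directions that realize a multi-index. Such a list
  always exists, and for multi-indices of order at most one it is unique.
\<close>

lemma list_of_index: "\<exists>is. \<forall>i. count_list is i = (\<alpha> :: 'd::finite \<Rightarrow> nat) i"
proof -
  obtain xs where "mset xs = Abs_multiset \<alpha>" using ex_mset by blast
  hence "count_list xs i = \<alpha> i" for i by (metis count_Abs_multiset count_mset finite)
  thus ?thesis by blast
qed

lemma list_of_zero_index: "(\<forall>i. count_list is i = 0) \<longleftrightarrow> is = []"
  by (cases "is") (auto intro: exI[of _ "hd is"])

lemma list_of_unit_index: "(\<forall>i. count_list is i = unit_index j i) \<longleftrightarrow> is = [j]"
proof
  assume *: "\<forall>i. count_list is i = unit_index j i"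
  then obtain k ks where k: "is = k # ks" by (cases "is") (auto simp: unit_index_def dest: spec[of _ j])
  hence "k = j" using *[rule_format, of k] by (auto simp: unit_index_def split: if_splits)
  hence "\<forall>i. count_list ks i = 0" using * k by (auto simp: unit_index_def split: if_splits)
  thus "is = [j]" using k \<open>k = j\<close> by (simp add: list_of_zero_index)
qed (auto simp: unit_index_def)

context bounded_open
begin

lemma integral_eq_lborel:
  fixes F :: "real ^ 'd \<Rightarrow> 'b::euclidean_space"
  assumes "F \<in> borel_measurable borel" "\<And>x. x \<notin> \<Omega> \<Longrightarrow> F x = 0"
  shows "integral\<^sup>L (lebesgue_on \<Omega>) F = integral\<^sup>L lborel F"
proof -
  have "integral\<^sup>L (lebesgue_on \<Omega>) F = integral\<^sup>L lebesgue (\<lambda>x. indicator \<Omega> x *\<^sub>R F x)"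
    by (rule integral_restrict_space) simp
  also have "(\<lambda>x. indicator \<Omega> x *\<^sub>R F x) = F" using assms(2) by (auto simp: fun_eq_iff indicator_def)
  also have "integral\<^sup>L lebesgue F = integral\<^sup>L lborel F" using assms(1) by (simp add: integral_completion)
  finally show ?thesis .
qed

lemma test_L2: "\<phi> \<in> test_functions \<Omega> \<Longrightarrow> \<phi> \<in> L2 \<Omega>" for \<phi> :: "real ^ 'd \<Rightarrow> 'b::euclidean_space"
  by (intro L2_continuous smooth_continuous test_functionsD)

lemma continuous_mult_L2:
  fixes f :: "real ^ 'd \<Rightarrow> 'b::euclidean_space" and g :: "real ^ 'd \<Rightarrow> real"
  assumes "f \<in> L2 \<Omega>" "continuous_on UNIV g"
  shows "(\<lambda>x. g x *\<^sub>R f x) \<in> L2 \<Omega>"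
proof -
  have "compact (closure \<Omega>)" using bounded_\<Omega> by (simp add: compact_closure)
  hence "bounded (g ` closure \<Omega>)"
    using assms by (intro compact_imp_bounded compact_continuous_image) (auto intro: continuous_on_subset)
  then obtain K where K: "\<forall>x\<in>closure \<Omega>. \<bar>g x\<bar> \<le> K" by (auto simp: bounded_iff)
  show ?thesis
    by (rule L2_bounded_mult[OF assms(1), of _ K])
      (use K closure_subset L2D(1)[OF L2_continuous[OF assms(2)]] in auto)
qed

lemma test_mult_integrable:
  fixes f :: "real ^ 'd \<Rightarrow> 'b::euclidean_space" and \<psi> :: "real ^ 'd \<Rightarrow> real"
  assumes "\<psi> \<in> test_functions \<Omega>" "f \<in> L2 \<Omega>"
  shows "integrable (lebesgue_on \<Omega>) (\<lambda>x. \<psi> x *\<^sub>R f x)"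
  by (intro L2_integrable continuous_mult_L2 assms smooth_continuous test_functionsD(1)[OF assms(1)])

lemma test_partials: "\<phi> \<in> test_functions \<Omega> \<Longrightarrow> partials is \<phi> \<in> test_functions \<Omega>"
  by (induction "is") (auto intro: test_partial)

text \<open>
  The product of both functions has compact support in \<open>\<Omega>\<close>, so its derivative has the integral
  zero.
\<close>

lemma integration_by_parts:
  fixes \<psi> :: "real ^ 'd \<Rightarrow> real" and \<phi> :: "real ^ 'd \<Rightarrow> 'b::euclidean_space"
  assumes \<psi>: "\<psi> \<in> test_functions \<Omega>" and \<phi>: "smooth \<phi>"
  shows "(\<integral>x. partial i \<psi> x *\<^sub>R \<phi> x \<partial>lebesgue_on \<Omega>) = - (\<integral>x. \<psi> x *\<^sub>R partial i \<phi> x \<partial>lebesgue_on \<Omega>)"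
proof -
  obtain K where K: "compact K" "K \<subseteq> \<Omega>" "\<And>x. x \<notin> K \<Longrightarrow> \<psi> x = 0"
    using test_functionsD(2)[OF \<psi>] by blast
  note sm = test_functionsD(1)[OF \<psi>] smooth_partial[OF test_functionsD(1)[OF \<psi>]] \<phi> smooth_partial[OF \<phi>]
  note cont = sm[THEN smooth_continuous]
  define F where "F = (\<lambda>x. \<psi> x *\<^sub>R \<phi> x)"
  have d: "(F has_derivative (\<lambda>h. \<psi> x *\<^sub>R frechet_derivative \<phi> (at x) h + frechet_derivative \<psi> (at x) h *\<^sub>R \<phi> x)) (at x)" for x
    unfolding F_def
    by (intro has_derivative_scaleR frechet_derivative_worksI smooth_differentiable \<phi> sm(1))
  have p: "partial i F = (\<lambda>x. \<psi> x *\<^sub>R partial i \<phi> x + partial i \<psi> x *\<^sub>R \<phi> x)"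
    by (rule ext, subst partial_eq[OF d]) (simp add: partial_def)
  have F0: "F x = 0" "partial i F x = 0" if "x \<notin> K" for x
    using K(3) that partial_eq_0_outside[OF compact_imp_closed[OF K(1)], of F x i] by (auto simp: F_def)
  have cp: "continuous_on UNIV (partial i F)" unfolding p by (intro continuous_intros cont)
  have "0 = (\<integral>x. partial i F x \<partial>lborel)"
    using integral_partial_eq_0[OF differentiableI[OF d] cp K(1)] F0 by auto
  also have "\<dots> = (\<integral>x. partial i F x \<partial>lebesgue_on \<Omega>)"
    using K(2) F0 borel_measurable_continuous_onI[OF cp] by (intro integral_eq_lborel[symmetric]) auto
  also have "\<dots> = (\<integral>x. \<psi> x *\<^sub>R partial i \<phi> x \<partial>lebesgue_on \<Omega>) + (\<integral>x. partial i \<psi> x *\<^sub>R \<phi> x \<partial>lebesgue_on \<Omega>)"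
    unfolding p
    by (intro Bochner_Integration.integral_add test_mult_integrable \<psi> test_partial L2_continuous cont)
  finally show ?thesis by (simp add: eq_neg_iff_add_eq_0 add.commute)
qed

text \<open>The bump functions of the box are test functions that converge to its indicator.\<close>

lemma integral_box_eq_0:
  fixes g :: "real ^ 'd \<Rightarrow> 'b::euclidean_space"
  assumes g: "g \<in> L2 \<Omega>" and box: "box a b \<subseteq> \<Omega>"
    and 0: "\<And>\<psi> :: real ^ 'd \<Rightarrow> real. \<psi> \<in> test_functions \<Omega> \<Longrightarrow> (\<integral>x. \<psi> x *\<^sub>R g x \<partial>lebesgue_on \<Omega>) = 0"
  shows "(\<integral>x. indicator (box a b) x *\<^sub>R g x \<partial>lebesgue_on \<Omega>) = 0"
proof -
  have gm: "g \<in> borel_measurable (lebesgue_on \<Omega>)" using L2D(1)[OF g] .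
  have [measurable]: "box a b \<in> sets (lebesgue_on \<Omega>)"
    using box by (simp add: sets_restrict_space_iff)
  have bm: "bump a b n \<in> borel_measurable (lebesgue_on \<Omega>)" for n
    using L2D(1)[OF test_L2[OF bump_test_function[OF box]]] .
  have "(\<lambda>n. \<integral>x. bump a b n x *\<^sub>R g x \<partial>lebesgue_on \<Omega>) \<longlonglongrightarrow> (\<integral>x. indicator (box a b) x *\<^sub>R g x \<partial>lebesgue_on \<Omega>)"
  proof (rule integral_dominated_convergence)
    show "integrable (lebesgue_on \<Omega>) (\<lambda>x. norm (g x))" using L2_integrable[OF g] by simp
    show "AE x in lebesgue_on \<Omega>. (\<lambda>n. bump a b n x *\<^sub>R g x) \<longlonglongrightarrow> indicator (box a b) x *\<^sub>R g x"
      by (intro AE_I2 tendsto_intros bump_tendsto)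
    show "AE x in lebesgue_on \<Omega>. norm (bump a b n x *\<^sub>R g x) \<le> norm (g x)" for n
      by (intro AE_I2) (auto simp: bump_bounds abs_of_nonneg mult_left_le_one_le)
    show "(\<lambda>x. indicator (box a b) x *\<^sub>R g x) \<in> borel_measurable (lebesgue_on \<Omega>)"
      using gm by measurable
    show "(\<lambda>x. bump a b n x *\<^sub>R g x) \<in> borel_measurable (lebesgue_on \<Omega>)" for n
      using gm bm by (intro borel_measurable_scaleR)
  qed
  moreover have "(\<integral>x. bump a b n x *\<^sub>R g x \<partial>lebesgue_on \<Omega>) = 0" for n
    by (intro 0 bump_test_function box)
  ultimately show ?thesis by (simp add: LIMSEQ_const_iff)
qed

text \<open>
  The boxes generate the Borel sets and are closed under intersections, and the sets over which
  the integral vanishes form a Dynkin system.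
\<close>

lemma integral_borel_eq_0:
  fixes h :: "real ^ 'd \<Rightarrow> 'b::euclidean_space"
  assumes h: "integrable lebesgue h" "\<And>a b. (\<integral>x. indicator (box a b) x *\<^sub>R h x \<partial>lebesgue) = 0"
    "(\<integral>x. h x \<partial>lebesgue) = 0" and A: "A \<in> sets borel"
  shows "(\<integral>x. indicator A x *\<^sub>R h x \<partial>lebesgue) = 0"
proof -
  let ?G = "range (\<lambda>(a, b). box a b :: (real ^ 'd) set)"
  have "Int_stable ?G"
    by (rule Int_stableI) (auto simp: box_Int_box image_iff, blast)
  moreover have "?G \<subseteq> Pow UNIV" by simp
  moreover have "A \<in> sigma_sets UNIV ?G" using A by (simp add: borel_eq_box)
  ultimately show ?thesis
  proof (induction rule: sigma_sets_induct_disjoint)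
    case (basic A)
    thus ?case using h by auto
  next
    case (compl A)
    have [measurable]: "A \<in> sets borel" using compl by (simp add: borel_eq_box)
    have "(\<integral>x. indicator (UNIV - A) x *\<^sub>R h x \<partial>lebesgue) = (\<integral>x. h x - indicator A x *\<^sub>R h x \<partial>lebesgue)"
      by (intro Bochner_Integration.integral_cong) (auto simp: indicator_def)
    also have "\<dots> = (\<integral>x. h x \<partial>lebesgue) - (\<integral>x. indicator A x *\<^sub>R h x \<partial>lebesgue)"
      using h(1) by (intro Bochner_Integration.integral_diff integrable_mult_indicator) auto
    finally show ?case using h compl by simp
  next
    case (union A)
    have A: "A i \<in> sets borel" for i using union by (auto simp: borel_eq_box)
    have "(\<integral>x\<in>(\<Union>i. A i). h x \<partial>lebesgue) = (\<Sum>i. \<integral>x\<in>A i. h x \<partial>lebesgue)"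
    proof (rule lebesgue_integral_countable_add)
      show "A i \<inter> A j = {}" if "i \<noteq> j" for i j using union that by (auto simp: disjoint_family_on_def)
      have "(\<Union>i. A i) \<in> sets lebesgue" using A by (intro sets_completionI_sets) auto
      thus "set_integrable lebesgue (\<Union>i. A i) h"
        using h(1) by (auto simp: set_integrable_def intro!: integrable_mult_indicator)
    qed (use A in auto)
    thus ?case using union by (simp add: set_lebesgue_integral_def)
  qed simp
qed

text \<open>
  This is the fundamental lemma of the calculus of variations. On a box in \<open>\<Omega>\<close>, the integral of
  \<open>g\<close> over every measurable subset vanishes, hence \<open>g\<close> vanishes there almost everywhere; countably
  many boxes cover \<open>\<Omega>\<close>.
\<close>

lemma fundamental_lemma:
  fixes g :: "real ^ 'd \<Rightarrow> 'b::euclidean_space"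
  assumes g: "g \<in> L2 \<Omega>"
    and 0: "\<And>\<psi> :: real ^ 'd \<Rightarrow> real. \<psi> \<in> test_functions \<Omega> \<Longrightarrow> (\<integral>x. \<psi> x *\<^sub>R g x \<partial>lebesgue_on \<Omega>) = 0"
  shows "ae_eq \<Omega> g 0"
proof -
  have box: "AE x in lebesgue. x \<in> box a b \<longrightarrow> g x = 0" if ab: "box a b \<subseteq> \<Omega>" for a b
  proof -
    define h where "h = (\<lambda>x. indicator (box a b) x *\<^sub>R g x)"
    have eq: "(\<integral>x. indicator A x *\<^sub>R h x \<partial>lebesgue) = (\<integral>x. indicator (A \<inter> box a b) x *\<^sub>R g x \<partial>lebesgue_on \<Omega>)" for A
      using ab by (subst integral_restrict_space)
        (auto simp: h_def indicator_def intro!: Bochner_Integration.integral_cong)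
    have [measurable]: "box a b \<in> sets (lebesgue_on \<Omega>)"
      using ab by (simp add: sets_restrict_space_iff)
    have "integrable (lebesgue_on \<Omega>) (\<lambda>x. indicator (box a b) x *\<^sub>R g x)"
      by (intro integrable_mult_indicator L2_integrable g) measurable
    hence "integrable lebesgue (\<lambda>x. indicator \<Omega> x *\<^sub>R (indicator (box a b) x *\<^sub>R g x))"
      by (subst (asm) integrable_restrict_space) auto
    also have "(\<lambda>x. indicator \<Omega> x *\<^sub>R (indicator (box a b) x *\<^sub>R g x)) = h"
      using ab by (auto simp: h_def fun_eq_iff indicator_def)
    finally have h: "integrable lebesgue h" .
    have b0: "(\<integral>x. indicator (box c d) x *\<^sub>R h x \<partial>lebesgue) = 0" for c d
    proof -
      obtain c' d' where cd: "box c d \<inter> box a b = box c' d'" by (auto simp: box_Int_box)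
      hence "box c' d' \<subseteq> \<Omega>" using ab by auto
      thus ?thesis unfolding eq cd by (rule integral_box_eq_0[OF g _ 0])
    qed
    have "(\<integral>x. h x \<partial>lebesgue) = (\<integral>x. indicator (box a b) x *\<^sub>R h x \<partial>lebesgue)"
      by (intro Bochner_Integration.integral_cong) (auto simp: h_def indicator_def)
    hence h0: "(\<integral>x. h x \<partial>lebesgue) = 0" using b0 by simp
    have "AE x in lebesgue. h x = 0"
    proof (rule sigma_finite_measure.density_zero[OF _ h])
      show "sigma_finite_measure (lebesgue :: (real ^ 'd) measure)"
      proof
        obtain \<A> :: "(real ^ 'd) set set" where "countable \<A>" "\<A> \<subseteq> sets lborel" "\<Union>\<A> = space lborel"
          "\<forall>a\<in>\<A>. emeasure lborel a \<noteq> \<infinity>"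
          using lborel.sigma_finite_countable by blast
        thus "\<exists>\<A> :: (real ^ 'd) set set. countable \<A> \<and> \<A> \<subseteq> sets lebesgue \<and> \<Union>\<A> = space lebesgue \<and>
            (\<forall>a\<in>\<A>. emeasure lebesgue a \<noteq> \<infinity>)"
          by (intro exI[of _ \<A>]) (auto simp: subset_iff)
      qed
      fix A :: "(real ^ 'd) set" assume "A \<in> sets lebesgue"
      \<comment> \<open>Up to a null set, a Lebesgue measurable set is a Borel set.\<close>
      then obtain C N where C: "fsigma C" "N \<in> null_sets lebesgue" "C \<union> N = A" "disjnt C N"
        by (rule lebesgue_set_almost_fsigma)
      have "AE x in lebesgue. x \<notin> N"
        using C(2) by (rule AE_not_in)
      hence ae: "AE x in lebesgue. indicator A x *\<^sub>R h x = indicator C x *\<^sub>R h x"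
        using C(3) by (elim eventually_mono) (auto simp: indicator_def)
      have "C \<in> sets borel" using C(1) by (auto simp: fsigma.simps)
      have "(\<integral>x. indicator A x *\<^sub>R h x \<partial>lebesgue) = (\<integral>x. indicator C x *\<^sub>R h x \<partial>lebesgue)"
      proof (rule integral_cong_AE[OF _ _ ae])
        show "(\<lambda>x. indicator A x *\<^sub>R h x) \<in> borel_measurable lebesgue"
          using h \<open>A \<in> sets lebesgue\<close> by (intro borel_measurable_scaleR borel_measurable_indicator) auto
        show "(\<lambda>x. indicator C x *\<^sub>R h x) \<in> borel_measurable lebesgue"
          using h \<open>C \<in> sets borel\<close> by (intro borel_measurable_scaleR borel_measurable_indicator) auto
      qed
      also have "\<dots> = 0" by (rule integral_borel_eq_0[OF h b0 h0 \<open>C \<in> sets borel\<close>])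
      finally show "set_lebesgue_integral lebesgue A h = 0" by (simp add: set_lebesgue_integral_def)
    qed
    thus ?thesis by (elim eventually_mono) (auto simp: h_def indicator_def split: if_splits)
  qed
  have "\<exists>\<D>. countable \<D> \<and> \<D> \<subseteq> Pow \<Omega> \<and> (\<forall>X\<in>\<D>. \<exists>a b. X = box a b) \<and> \<Union>\<D> = \<Omega>"
    by (rule open_countable_Union_open_box[OF open_\<Omega>]) (rule exI, intro conjI ballI; assumption)
  then obtain \<D> where D: "countable \<D>" "\<D> \<subseteq> Pow \<Omega>" "\<forall>X\<in>\<D>. \<exists>a b. X = box a b" "\<Union>\<D> = \<Omega>"
    by (elim exE conjE)
  have "AE x in lebesgue. x \<in> X \<longrightarrow> g x = 0" if X: "X \<in> \<D>" for X
  proof -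
    obtain a b where "X = box a b" using D(3) X by blast
    thus ?thesis using box[of a b] D(2) X by auto
  qed
  hence "AE x in lebesgue. \<forall>X\<in>\<D>. x \<in> X \<longrightarrow> g x = 0"
    unfolding AE_ball_countable[OF D(1)] by (rule ballI)
  hence "AE x in lebesgue. x \<in> \<Omega> \<longrightarrow> g x = 0"
    using D(4) by (elim eventually_mono) auto
  thus ?thesis by (simp add: ae_eq_def AE_\<Omega>_iff zero_fun_def)
qed

end

section \<open>Sobolev spaces\<close>

context bounded_open
begin

lemma weak_derivD:
  fixes \<psi> :: "real ^ 'd \<Rightarrow> real" and f g :: "real ^ 'd \<Rightarrow> 'b::euclidean_space"
  assumes "is_weak_deriv \<Omega> \<alpha> f g" "\<psi> \<in> test_functions \<Omega>" "\<forall>i. count_list is i = \<alpha> i"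
  shows "(\<integral>x. partials is \<psi> x *\<^sub>R f x \<partial>lebesgue_on \<Omega>)
    = (- 1) ^ (\<Sum>i\<in>UNIV. \<alpha> i) *\<^sub>R (\<integral>x. \<psi> x *\<^sub>R g x \<partial>lebesgue_on \<Omega>)"
  using assms(1)[unfolded is_weak_deriv_def, rule_format, OF assms(2), of "is"] assms(3) by blast

lemma weak_deriv_unique:
  fixes f g g' :: "real ^ 'd \<Rightarrow> 'b::euclidean_space"
  assumes w: "is_weak_deriv \<Omega> \<alpha> f g" "is_weak_deriv \<Omega> \<alpha> f g'" and L2: "g \<in> L2 \<Omega>" "g' \<in> L2 \<Omega>"
  shows "ae_eq \<Omega> g g'"
proof -
  obtain "is" where "is": "\<forall>i. count_list is i = \<alpha> i" using list_of_index by blast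
  have "ae_eq \<Omega> (g - g') 0"
  proof (rule fundamental_lemma)
    show "g - g' \<in> L2 \<Omega>" using L2 by (rule L2.S_diff)
    fix \<psi> :: "real ^ 'd \<Rightarrow> real" assume \<psi>: "\<psi> \<in> test_functions \<Omega>"
    let ?n = "\<Sum>i\<in>UNIV. \<alpha> i"
    have "(- 1) ^ ?n *\<^sub>R (\<integral>x. \<psi> x *\<^sub>R g x \<partial>lebesgue_on \<Omega>) = (- 1) ^ ?n *\<^sub>R (\<integral>x. \<psi> x *\<^sub>R g' x \<partial>lebesgue_on \<Omega>)"
      using weak_derivD[OF w(1) \<psi> "is"] weak_derivD[OF w(2) \<psi> "is"] by simp
    hence "(\<integral>x. \<psi> x *\<^sub>R g x \<partial>lebesgue_on \<Omega>) = (\<integral>x. \<psi> x *\<^sub>R g' x \<partial>lebesgue_on \<Omega>)" by simp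
    thus "(\<integral>x. \<psi> x *\<^sub>R (g - g') x \<partial>lebesgue_on \<Omega>) = 0"
      using test_mult_integrable[OF \<psi> L2(1)] test_mult_integrable[OF \<psi> L2(2)]
      by (simp add: fun_diff_def scaleR_diff_right)
  qed
  thus ?thesis by (simp add: ae_eq_diff_0)
qed

lemma weak_deriv_add:
  fixes f g f' g' :: "real ^ 'd \<Rightarrow> 'b::euclidean_space"
  assumes "is_weak_deriv \<Omega> \<alpha> f g" "is_weak_deriv \<Omega> \<alpha> f' g'"
    "f \<in> L2 \<Omega>" "g \<in> L2 \<Omega>" "f' \<in> L2 \<Omega>" "g' \<in> L2 \<Omega>"
  shows "is_weak_deriv \<Omega> \<alpha> (f + f') (g + g')"
  unfolding is_weak_deriv_def
proof (intro ballI allI impI)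
  fix \<psi> :: "real ^ 'd \<Rightarrow> real" and "is"
  assume \<psi>: "\<psi> \<in> test_functions \<Omega>" and "is": "\<forall>i. count_list is i = \<alpha> i"
  have "(\<integral>x. partials is \<psi> x *\<^sub>R (f + f') x \<partial>lebesgue_on \<Omega>) =
      (\<integral>x. partials is \<psi> x *\<^sub>R f x \<partial>lebesgue_on \<Omega>) + (\<integral>x. partials is \<psi> x *\<^sub>R f' x \<partial>lebesgue_on \<Omega>)"
    unfolding plus_fun_def scaleR_add_right
    by (intro Bochner_Integration.integral_add test_mult_integrable test_partials \<psi> assms)
  also have "\<dots> = (- 1) ^ (\<Sum>i\<in>UNIV. \<alpha> i) *\<^sub>R
      ((\<integral>x. \<psi> x *\<^sub>R g x \<partial>lebesgue_on \<Omega>) + (\<integral>x. \<psi> x *\<^sub>R g' x \<partial>lebesgue_on \<Omega>))"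
    unfolding weak_derivD[OF assms(1) \<psi> "is"] weak_derivD[OF assms(2) \<psi> "is"] scaleR_add_right ..
  also have "(\<integral>x. \<psi> x *\<^sub>R g x \<partial>lebesgue_on \<Omega>) + (\<integral>x. \<psi> x *\<^sub>R g' x \<partial>lebesgue_on \<Omega>)
      = (\<integral>x. \<psi> x *\<^sub>R (g + g') x \<partial>lebesgue_on \<Omega>)"
    unfolding plus_fun_def scaleR_add_right
    by (intro Bochner_Integration.integral_add[symmetric] test_mult_integrable \<psi> assms)
  finally show "(\<integral>x. partials is \<psi> x *\<^sub>R (f + f') x \<partial>lebesgue_on \<Omega>) =
      (- 1) ^ (\<Sum>i\<in>UNIV. \<alpha> i) *\<^sub>R (\<integral>x. \<psi> x *\<^sub>R (g + g') x \<partial>lebesgue_on \<Omega>)" .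
qed

lemma weak_deriv_linear:
  fixes f g :: "real ^ 'd \<Rightarrow> 'b::euclidean_space" and L :: "'b \<Rightarrow> 'c::euclidean_space"
  assumes "is_weak_deriv \<Omega> \<alpha> f g" "f \<in> L2 \<Omega>" "g \<in> L2 \<Omega>" "bounded_linear L"
  shows "is_weak_deriv \<Omega> \<alpha> (\<lambda>x. L (f x)) (\<lambda>x. L (g x))"
  unfolding is_weak_deriv_def
proof (intro ballI allI impI)
  interpret L: bounded_linear L by fact
  fix \<psi> :: "real ^ 'd \<Rightarrow> real" and "is"
  assume \<psi>: "\<psi> \<in> test_functions \<Omega>" and "is": "\<forall>i. count_list is i = \<alpha> i"
  have L: "(\<integral>x. \<phi> x *\<^sub>R L (h x) \<partial>lebesgue_on \<Omega>) = L (\<integral>x. \<phi> x *\<^sub>R h x \<partial>lebesgue_on \<Omega>)"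
    if "\<phi> \<in> test_functions \<Omega>" "h \<in> L2 \<Omega>" for \<phi> h
    using integral_bounded_linear[OF assms(4) test_mult_integrable[OF that]] by (simp add: L.scaleR)
  show "(\<integral>x. partials is \<psi> x *\<^sub>R L (f x) \<partial>lebesgue_on \<Omega>) =
      (- 1) ^ (\<Sum>i\<in>UNIV. \<alpha> i) *\<^sub>R (\<integral>x. \<psi> x *\<^sub>R L (g x) \<partial>lebesgue_on \<Omega>)"
    unfolding L[OF test_partials[OF \<psi>] assms(2)] L[OF \<psi> assms(3)]
    unfolding weak_derivD[OF assms(1) \<psi> "is"] L.scaleR ..
qed

lemma weak_deriv_scaleR:
  fixes f g :: "real ^ 'd \<Rightarrow> 'b::euclidean_space"
  assumes "is_weak_deriv \<Omega> \<alpha> f g" "f \<in> L2 \<Omega>" "g \<in> L2 \<Omega>"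
  shows "is_weak_deriv \<Omega> \<alpha> (c *\<^sub>R f) (c *\<^sub>R g)"
  unfolding scaleR_fun_def by (rule weak_deriv_linear[OF assms]) (rule bounded_linear_scaleR_right)

lemma weak_deriv_cong:
  fixes f f' :: "real ^ 'd \<Rightarrow> 'b::euclidean_space"
  assumes "ae_eq \<Omega> f f'"
  shows "is_weak_deriv \<Omega> \<alpha> f = is_weak_deriv \<Omega> \<alpha> f'"
proof -
  have "(\<integral>x. \<phi> x *\<^sub>R f x \<partial>lebesgue_on \<Omega>) = (\<integral>x. \<phi> x *\<^sub>R f' x \<partial>lebesgue_on \<Omega>)" for \<phi> :: "real ^ 'd \<Rightarrow> real"
    by (rule integral_cong_ae, rule ae_eq_compose, rule assms)
  thus ?thesis by (intro ext) (simp only: is_weak_deriv_def)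
qed

text \<open>
  The condition on a weak derivative depends on the class of \<open>f\<close> only, so the choice made by
  \<open>wderiv\<close> is literally the same for both functions.
\<close>

lemma wderiv_cong:
  fixes f f' :: "real ^ 'd \<Rightarrow> 'b::euclidean_space"
  assumes "ae_eq \<Omega> f f'"
  shows "wderiv \<Omega> \<alpha> f = wderiv \<Omega> \<alpha> f'"
  unfolding wderiv_def weak_deriv_cong[OF assms] by (rule refl)

text \<open>
  This turns rules for weak derivatives into rules for the representative chosen by \<open>wderiv\<close>.
\<close>

lemma wderiv_unique:
  fixes f g :: "real ^ 'd \<Rightarrow> 'b::euclidean_space"
  assumes "g \<in> L2 \<Omega>" "is_weak_deriv \<Omega> \<alpha> f g"
  shows "ae_eq \<Omega> (wderiv \<Omega> \<alpha> f) g"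
proof -
  have "wderiv \<Omega> \<alpha> f \<in> L2 \<Omega> \<and> is_weak_deriv \<Omega> \<alpha> f (wderiv \<Omega> \<alpha> f)"
    unfolding wderiv_def by (rule someI[of _ g]) (use assms in simp)
  thus ?thesis using assms by (intro weak_deriv_unique[of \<alpha> f]) auto
qed

lemma sobolev_L2: "f \<in> sobolev \<Omega> m \<Longrightarrow> f \<in> L2 \<Omega>"
  by (simp add: sobolev_def)

lemma wderiv_works:
  assumes "f \<in> sobolev \<Omega> m" "\<alpha> \<in> multi_indices m"
  shows "wderiv \<Omega> \<alpha> f \<in> L2 \<Omega>" "is_weak_deriv \<Omega> \<alpha> f (wderiv \<Omega> \<alpha> f)"
proof -
  from assms have "\<exists>g. g \<in> L2 \<Omega> \<and> is_weak_deriv \<Omega> \<alpha> f g" by (auto simp: sobolev_def)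
  from someI_ex[OF this] show "wderiv \<Omega> \<alpha> f \<in> L2 \<Omega>" "is_weak_deriv \<Omega> \<alpha> f (wderiv \<Omega> \<alpha> f)"
    by (auto simp: wderiv_def)
qed

lemma wderiv_zero_index:
  fixes f :: "real ^ 'd \<Rightarrow> 'b::euclidean_space"
  assumes "f \<in> L2 \<Omega>"
  shows "ae_eq \<Omega> (wderiv \<Omega> (\<lambda>_. 0) f) f"
  by (rule wderiv_unique[OF assms]) (auto simp: is_weak_deriv_def list_of_zero_index)

lemma wderiv_add:
  fixes f g :: "real ^ 'd \<Rightarrow> 'b::euclidean_space"
  assumes "f \<in> sobolev \<Omega> m" "g \<in> sobolev \<Omega> m" "\<alpha> \<in> multi_indices m"
  shows "ae_eq \<Omega> (wderiv \<Omega> \<alpha> (f + g)) (wderiv \<Omega> \<alpha> f + wderiv \<Omega> \<alpha> g)"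
  by (intro wderiv_unique L2_add weak_deriv_add wderiv_works[OF _ assms(3)] sobolev_L2 assms) (use assms sobolev_L2 in auto)

lemma wderiv_scaleR:
  fixes f :: "real ^ 'd \<Rightarrow> 'b::euclidean_space"
  assumes "f \<in> sobolev \<Omega> m" "\<alpha> \<in> multi_indices m"
  shows "ae_eq \<Omega> (wderiv \<Omega> \<alpha> (c *\<^sub>R f)) (c *\<^sub>R wderiv \<Omega> \<alpha> f)"
  by (intro wderiv_unique L2_scaleR weak_deriv_scaleR wderiv_works[OF _ assms(2)] assms sobolev_L2[OF assms(1)])

lemma subspace_sobolev: "subspace (sobolev \<Omega> m :: (real ^ 'd \<Rightarrow> 'b::euclidean_space) set)"
proof (rule subspaceI)
  show "0 \<in> (sobolev \<Omega> m :: (real ^ 'd \<Rightarrow> 'b) set)"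
    using L2_zero by (auto simp: sobolev_def is_weak_deriv_def zero_fun_def intro!: bexI[of _ "\<lambda>_. 0"])
  fix f g :: "real ^ 'd \<Rightarrow> 'b" and c :: real
  assume f: "f \<in> sobolev \<Omega> m"
  show "c *\<^sub>R f \<in> sobolev \<Omega> m"
    using f L2_scaleR weak_deriv_scaleR unfolding sobolev_def by blast
  assume g: "g \<in> sobolev \<Omega> m"
  show "f + g \<in> sobolev \<Omega> m"
    unfolding sobolev_def
  proof (intro CollectI conjI ballI)
    show "f + g \<in> L2 \<Omega>" using f g by (intro L2_add sobolev_L2)
    fix \<alpha> :: "'d \<Rightarrow> nat" assume \<alpha>: "\<alpha> \<in> multi_indices m"
    show "\<exists>h\<in>L2 \<Omega>. is_weak_deriv \<Omega> \<alpha> (f + g) h"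
      by (intro bexI[of _ "wderiv \<Omega> \<alpha> f + wderiv \<Omega> \<alpha> g"] weak_deriv_add L2_add
          wderiv_works[OF f \<alpha>] wderiv_works[OF g \<alpha>] sobolev_L2[OF f] sobolev_L2[OF g])
  qed
qed

lemma sobolev_cong:
  fixes f f' :: "real ^ 'd \<Rightarrow> 'b::euclidean_space"
  assumes "ae_eq \<Omega> f f'" "f \<in> sobolev \<Omega> m"
  shows "f' \<in> sobolev \<Omega> m"
  using assms L2_cong[OF assms(1)] weak_deriv_cong[OF assms(1)] by (auto simp: sobolev_def)

lemma sobolev_mono: "m \<le> n \<Longrightarrow> f \<in> sobolev \<Omega> n \<Longrightarrow> f \<in> sobolev \<Omega> m"
  using multi_indices_mono[of m n] by (auto simp: sobolev_def)

text \<open>The inner product that induces \<open>sobolev_norm\<close>.\<close>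

definition sob_ip :: "nat \<Rightarrow> (real ^ 'd \<Rightarrow> 'b::euclidean_space) \<Rightarrow> (real ^ 'd \<Rightarrow> 'b) \<Rightarrow> real"
  where "sob_ip m f g = (\<Sum>\<alpha>\<in>multi_indices m. ip \<Omega> (wderiv \<Omega> \<alpha> f) (wderiv \<Omega> \<alpha> g))"

sublocale sob: semi_inner "sobolev \<Omega> m :: (real ^ 'd \<Rightarrow> 'b::euclidean_space) set" "sob_ip m" for m
proof
  show "subspace (sobolev \<Omega> m :: (real ^ 'd \<Rightarrow> 'b) set)" by (rule subspace_sobolev)
  fix x y z :: "real ^ 'd \<Rightarrow> 'b" and c
  assume x: "x \<in> sobolev \<Omega> m"
  show "0 \<le> sob_ip m x x" unfolding sob_ip_def
    by (intro sum_nonneg L2.nonneg wderiv_works[OF x])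
  show "sob_ip m x y = sob_ip m y x" if y: "y \<in> sobolev \<Omega> m"
    unfolding sob_ip_def
    by (intro sum.cong refl L2.sym wderiv_works[OF x] wderiv_works[OF y])
  assume z: "z \<in> sobolev \<Omega> m"
  show "sob_ip m (c *\<^sub>R x) z = c * sob_ip m x z"
    unfolding sob_ip_def sum_distrib_left
  proof (rule sum.cong[OF refl])
    fix \<alpha> :: "'d \<Rightarrow> nat" assume \<alpha>: "\<alpha> \<in> multi_indices m"
    show "ip \<Omega> (wderiv \<Omega> \<alpha> (c *\<^sub>R x)) (wderiv \<Omega> \<alpha> z) = c * ip \<Omega> (wderiv \<Omega> \<alpha> x) (wderiv \<Omega> \<alpha> z)"
      using ip_cong[OF wderiv_scaleR[OF x \<alpha>] ae_eq_refl] L2.scale_left[OF wderiv_works(1)[OF x \<alpha>] wderiv_works(1)[OF z \<alpha>]]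
      by simp
  qed
  assume y: "y \<in> sobolev \<Omega> m"
  show "sob_ip m (x + y) z = sob_ip m x z + sob_ip m y z"
    unfolding sob_ip_def sum.distrib[symmetric]
  proof (rule sum.cong[OF refl])
    fix \<alpha> :: "'d \<Rightarrow> nat" assume \<alpha>: "\<alpha> \<in> multi_indices m"
    show "ip \<Omega> (wderiv \<Omega> \<alpha> (x + y)) (wderiv \<Omega> \<alpha> z) =
        ip \<Omega> (wderiv \<Omega> \<alpha> x) (wderiv \<Omega> \<alpha> z) + ip \<Omega> (wderiv \<Omega> \<alpha> y) (wderiv \<Omega> \<alpha> z)"
      using ip_cong[OF wderiv_add[OF x y \<alpha>] ae_eq_refl]
        L2.add_left[OF wderiv_works(1)[OF x \<alpha>] wderiv_works(1)[OF y \<alpha>] wderiv_works(1)[OF z \<alpha>]]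
      by simp
  qed
qed

lemma L2norm_sq: "f \<in> L2 \<Omega> \<Longrightarrow> (L2norm \<Omega> f)\<^sup>2 = ip \<Omega> f f"
  by (simp add: L2norm_eq_nrm L2.nrm_sq)

lemma L2norm_nonneg: "0 \<le> L2norm \<Omega> f" for f :: "real ^ 'd \<Rightarrow> 'b::euclidean_space"
  unfolding L2norm_def ip_def by (auto intro: integral_nonneg_AE)

lemma sobolev_norm_sq:
  assumes "f \<in> sobolev \<Omega> m"
  shows "(sobolev_norm \<Omega> m f)\<^sup>2 = sob_ip m f f"
proof -
  have "(sobolev_norm \<Omega> m f)\<^sup>2 = (\<Sum>\<alpha>\<in>multi_indices m. (L2norm \<Omega> (wderiv \<Omega> \<alpha> f))\<^sup>2)"
    unfolding sobolev_norm_def by (simp add: sum_nonneg)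
  also have "\<dots> = sob_ip m f f"
    unfolding sob_ip_def by (intro sum.cong refl L2norm_sq wderiv_works(1)[OF assms])
  finally show ?thesis .
qed

lemma sobolev_norm_nonneg: "0 \<le> sobolev_norm \<Omega> m f" for f :: "real ^ 'd \<Rightarrow> 'b::euclidean_space"
  unfolding sobolev_norm_def by (simp add: sum_nonneg)

lemma sobolev_norm_eq_nrm:
  assumes "f \<in> sobolev \<Omega> m"
  shows "sobolev_norm \<Omega> m f = sob.nrm m f"
  using sobolev_norm_sq[OF assms] sobolev_norm_nonneg[of m f] by (simp add: sob.nrm_def real_sqrt_unique)

lemma L2norm_wderiv_le:
  fixes f :: "real ^ 'd \<Rightarrow> 'b::euclidean_space"
  assumes "\<alpha> \<in> multi_indices m"
  shows "L2norm \<Omega> (wderiv \<Omega> \<alpha> f) \<le> sobolev_norm \<Omega> m f"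
  unfolding sobolev_norm_def
  by (intro real_le_rsqrt member_le_sum assms finite_multi_indices) auto

lemma L2norm_le_sobolev_norm:
  "f \<in> L2 \<Omega> \<Longrightarrow> L2norm \<Omega> f \<le> sobolev_norm \<Omega> m f" for f :: "real ^ 'd \<Rightarrow> 'b::euclidean_space"
  using L2norm_wderiv_le[OF zero_index_in, of f m] L2norm_cong[OF wderiv_zero_index[of f]] by simp

lemma sobolev_norm_mono:
  "m \<le> n \<Longrightarrow> sobolev_norm \<Omega> m f \<le> sobolev_norm \<Omega> n f" for f :: "real ^ 'd \<Rightarrow> 'b::euclidean_space"
  unfolding sobolev_norm_def
  by (intro real_sqrt_le_mono sum_mono2 finite_multi_indices multi_indices_mono) auto

lemma sobolev_norm_cong:
  "ae_eq \<Omega> f g \<Longrightarrow> sobolev_norm \<Omega> m f = sobolev_norm \<Omega> m g" for f g :: "real ^ 'd \<Rightarrow> 'b::euclidean_space"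
  unfolding sobolev_norm_def using wderiv_cong by metis

subsection \<open>Gradient and divergence\<close>

lemma grad_nth: "grad \<Omega> f x $ j = wderiv \<Omega> (unit_index j) f x"
  by (simp add: grad_def unit_index_def)

lemma unit_in_1: "unit_index j \<in> multi_indices 1" for j :: 'd
  by (rule unit_index_in) simp

lemma grad_L2: "f \<in> sobolev \<Omega> 1 \<Longrightarrow> grad \<Omega> f \<in> L2 \<Omega>" for f :: "real ^ 'd \<Rightarrow> 'b::euclidean_space"
  by (rule L2_vecI) (simp add: grad_nth wderiv_works(1) unit_in_1 del: One_nat_def)

lemma ae_eq_vecI:
  fixes f g :: "real ^ 'd \<Rightarrow> 'b ^ 'n::finite"
  assumes "\<And>j. ae_eq \<Omega> (\<lambda>x. f x $ j) (\<lambda>x. g x $ j)"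
  shows "ae_eq \<Omega> f g"
proof -
  have "AE x in lebesgue_on \<Omega>. \<forall>j\<in>UNIV. f x $ j = g x $ j"
    using assms unfolding ae_eq_def by (intro AE_finite_allI) auto
  thus ?thesis unfolding ae_eq_def by (elim eventually_mono) (simp add: vec_eq_iff)
qed

lemma grad_add:
  fixes f g :: "real ^ 'd \<Rightarrow> 'b::euclidean_space"
  assumes "f \<in> sobolev \<Omega> 1" "g \<in> sobolev \<Omega> 1"
  shows "ae_eq \<Omega> (grad \<Omega> (f + g)) (grad \<Omega> f + grad \<Omega> g)"
  using wderiv_add[OF assms unit_in_1] by (intro ae_eq_vecI) (simp add: grad_nth plus_fun_def)

lemma grad_scaleR:
  fixes f :: "real ^ 'd \<Rightarrow> 'b::euclidean_space"
  assumes "f \<in> sobolev \<Omega> 1"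
  shows "ae_eq \<Omega> (grad \<Omega> (c *\<^sub>R f)) (c *\<^sub>R grad \<Omega> f)"
  using wderiv_scaleR[OF assms unit_in_1] by (intro ae_eq_vecI) (simp add: grad_nth scaleR_fun_def)

lemma grad_cong: "ae_eq \<Omega> f f' \<Longrightarrow> grad \<Omega> f = grad \<Omega> (f' :: real ^ 'd \<Rightarrow> 'b::euclidean_space)"
  by (simp add: grad_def fun_eq_iff wderiv_cong[of f f'])

sublocale gr: semi_inner "sobolev \<Omega> 1 :: (real ^ 'd \<Rightarrow> 'b::euclidean_space) set" "\<lambda>f g. ip \<Omega> (grad \<Omega> f) (grad \<Omega> g)"
proof
  show "subspace (sobolev \<Omega> 1 :: (real ^ 'd \<Rightarrow> 'b) set)" by (rule subspace_sobolev)
  fix x y z :: "real ^ 'd \<Rightarrow> 'b" and c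
  assume x: "x \<in> sobolev \<Omega> 1"
  show "0 \<le> ip \<Omega> (grad \<Omega> x) (grad \<Omega> x)" by (intro L2.nonneg grad_L2 x)
  show "ip \<Omega> (grad \<Omega> x) (grad \<Omega> y) = ip \<Omega> (grad \<Omega> y) (grad \<Omega> x)" if y: "y \<in> sobolev \<Omega> 1"
    by (intro L2.sym grad_L2 x y)
  assume z: "z \<in> sobolev \<Omega> 1"
  show "ip \<Omega> (grad \<Omega> (c *\<^sub>R x)) (grad \<Omega> z) = c * ip \<Omega> (grad \<Omega> x) (grad \<Omega> z)"
    using ip_cong[OF grad_scaleR[OF x] ae_eq_refl] L2.scale_left[OF grad_L2[OF x] grad_L2[OF z]] by simp
  assume y: "y \<in> sobolev \<Omega> 1"
  show "ip \<Omega> (grad \<Omega> (x + y)) (grad \<Omega> z) = ip \<Omega> (grad \<Omega> x) (grad \<Omega> z) + ip \<Omega> (grad \<Omega> y) (grad \<Omega> z)"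
    using ip_cong[OF grad_add[OF x y] ae_eq_refl] L2.add_left[OF grad_L2[OF x] grad_L2[OF y] grad_L2[OF z]] by simp
qed

lemma sobolev_norm_1_sq:
  fixes f :: "real ^ 'd \<Rightarrow> 'b::euclidean_space"
  assumes f: "f \<in> sobolev \<Omega> 1"
  shows "(sobolev_norm \<Omega> 1 f)\<^sup>2 = (L2norm \<Omega> f)\<^sup>2 + (L2norm \<Omega> (grad \<Omega> f))\<^sup>2"
proof -
  have z: "(\<lambda>_. 0) \<notin> range (unit_index :: 'd \<Rightarrow> _)"
  proof
    assume "(\<lambda>_. 0) \<in> range (unit_index :: 'd \<Rightarrow> _)"
    then obtain j :: 'd where "(\<lambda>_. 0) = unit_index j" by blast
    from fun_cong[OF this, of j] show False by (simp add: unit_index_def)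
  qed
  have "(sobolev_norm \<Omega> 1 f)\<^sup>2 = (\<Sum>\<alpha>\<in>multi_indices 1. (L2norm \<Omega> (wderiv \<Omega> \<alpha> f))\<^sup>2)"
    unfolding sobolev_norm_def by (simp add: sum_nonneg)
  also have "\<dots> = (L2norm \<Omega> (wderiv \<Omega> (\<lambda>_. 0) f))\<^sup>2 + (\<Sum>j\<in>UNIV. (L2norm \<Omega> (wderiv \<Omega> (unit_index j) f))\<^sup>2)"
    unfolding multi_indices_1 using z by (simp add: sum.reindex[OF inj_unit_index])
  also have "L2norm \<Omega> (wderiv \<Omega> (\<lambda>_. 0) f) = L2norm \<Omega> f"
    by (intro L2norm_cong wderiv_zero_index sobolev_L2[OF f])
  also have "(\<Sum>j\<in>UNIV. (L2norm \<Omega> (wderiv \<Omega> (unit_index j) f))\<^sup>2) = (L2norm \<Omega> (grad \<Omega> f))\<^sup>2"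
    using grad_L2[OF f] wderiv_works(1)[OF f unit_in_1]
    by (simp add: L2norm_sq ip_vec grad_nth)
  finally show ?thesis .
qed

lemma L2norm_grad_le:
  fixes f :: "real ^ 'd \<Rightarrow> 'b::euclidean_space"
  assumes "f \<in> sobolev \<Omega> 1" "1 \<le> m"
  shows "L2norm \<Omega> (grad \<Omega> f) \<le> sobolev_norm \<Omega> m f"
proof -
  have "L2norm \<Omega> (grad \<Omega> f) \<le> sobolev_norm \<Omega> 1 f"
    by (rule power2_le_imp_le) (simp_all only: sobolev_norm_1_sq[OF assms(1)] sobolev_norm_nonneg zero_le_power2 le_add_same_cancel2)
  also have "\<dots> \<le> sobolev_norm \<Omega> m f" using assms(2) by (rule sobolev_norm_mono)
  finally show ?thesis .
qed

lemma trace_bound: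
  fixes A :: "real ^ 'd ^ 'd"
  shows "norm (\<Sum>i\<in>UNIV. A $ i $ i) \<le> norm A * real CARD('d)"
proof -
  have "norm (\<Sum>i\<in>UNIV. A $ i $ i) \<le> (\<Sum>i\<in>(UNIV :: 'd set). norm A)"
  proof (rule sum_norm_le)
    fix i
    show "norm (A $ i $ i) \<le> norm A" using Finite_Cartesian_Product.norm_nth_le[of "A $ i" i] Finite_Cartesian_Product.norm_nth_le[of A i] by linarith
  qed
  thus ?thesis by (simp add: mult.commute)
qed

lemma bounded_linear_trace: "bounded_linear (\<lambda>A :: real ^ 'd ^ 'd. \<Sum>i\<in>UNIV. A $ i $ i)"
  by (rule bounded_linear_intro[OF _ _ trace_bound]) (auto simp: sum.distrib sum_distrib_left)

lemma divergence_L2: "v \<in> sobolev \<Omega> 1 \<Longrightarrow> divergence \<Omega> v \<in> L2 \<Omega>"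
  using L2_bounded_linear[OF bounded_linear_trace grad_L2[of v]] by (simp add: divergence_def[abs_def])

lemma divergence_cong: "ae_eq \<Omega> v w \<Longrightarrow> divergence \<Omega> v = divergence \<Omega> w"
  by (simp add: divergence_def fun_eq_iff grad_cong[of v w])

lemma divergence_add:
  assumes "v \<in> sobolev \<Omega> 1" "w \<in> sobolev \<Omega> 1"
  shows "ae_eq \<Omega> (divergence \<Omega> (v + w)) (divergence \<Omega> v + divergence \<Omega> w)"
  using ae_eq_compose[OF grad_add[OF assms], of "\<lambda>_ A. \<Sum>i\<in>UNIV. A $ i $ i"]
  by (simp add: divergence_def[abs_def] plus_fun_def sum.distrib)

lemma divergence_scaleR:
  assumes "v \<in> sobolev \<Omega> 1"
  shows "ae_eq \<Omega> (divergence \<Omega> (c *\<^sub>R v)) (c *\<^sub>R divergence \<Omega> v)"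
  using ae_eq_compose[OF grad_scaleR[OF assms], of "\<lambda>_ A. \<Sum>i\<in>UNIV. A $ i $ i"]
  by (simp add: divergence_def[abs_def] scaleR_fun_def sum_distrib_left)

lemma L2norm_divergence_le:
  assumes v: "v \<in> sobolev \<Omega> 1"
  shows "L2norm \<Omega> (divergence \<Omega> v) \<le> real CARD('d) * L2norm \<Omega> (grad \<Omega> v)"
proof (rule power2_le_imp_le)
  have "(L2norm \<Omega> (divergence \<Omega> v))\<^sup>2 = (\<integral>x. (divergence \<Omega> v x)\<^sup>2 \<partial>lebesgue_on \<Omega>)"
    unfolding L2norm_sq[OF divergence_L2[OF v]] ip_def by (simp add: power2_eq_square)
  also have "\<dots> \<le> (\<integral>x. (real CARD('d))\<^sup>2 * (norm (grad \<Omega> v x))\<^sup>2 \<partial>lebesgue_on \<Omega>)"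
  proof (rule integral_mono)
    show "integrable (lebesgue_on \<Omega>) (\<lambda>x. (divergence \<Omega> v x)\<^sup>2)"
      using L2D(2)[OF divergence_L2[OF v]] by simp
    show "integrable (lebesgue_on \<Omega>) (\<lambda>x. (real CARD('d))\<^sup>2 * (norm (grad \<Omega> v x))\<^sup>2)"
      using L2D(2)[OF grad_L2[OF v]] by (rule integrable_mult_right)
    fix x
    have "\<bar>divergence \<Omega> v x\<bar>\<^sup>2 \<le> (norm (grad \<Omega> v x) * real CARD('d))\<^sup>2"
      using trace_bound[of "grad \<Omega> v x"] by (intro power_mono) (auto simp: divergence_def)
    thus "(divergence \<Omega> v x)\<^sup>2 \<le> (real CARD('d))\<^sup>2 * (norm (grad \<Omega> v x))\<^sup>2"
      by (simp add: power_mult_distrib mult.commute)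
  qed
  also have "\<dots> = (real CARD('d) * L2norm \<Omega> (grad \<Omega> v))\<^sup>2"
    unfolding power_mult_distrib L2norm_sq[OF grad_L2[OF v]] ip_def by (simp add: power2_norm_eq_inner)
  finally show "(L2norm \<Omega> (divergence \<Omega> v))\<^sup>2 \<le> (real CARD('d) * L2norm \<Omega> (grad \<Omega> v))\<^sup>2" .
qed (simp add: L2norm_nonneg)

subsection \<open>The bilinear forms\<close>

sublocale a: semi_inner "sobolev \<Omega> 1 :: (real ^ 'd \<Rightarrow> real ^ 'd) set" "a_form \<Omega>"
  unfolding a_form_def[abs_def] by (rule gr.semi_inner_axioms)

lemma a_nrm: "a.nrm v = L2norm \<Omega> (grad \<Omega> v)"
  by (simp add: a.nrm_def a_form_def L2norm_def)

lemma a_form_cong: "ae_eq \<Omega> u u' \<Longrightarrow> ae_eq \<Omega> v v' \<Longrightarrow> a_form \<Omega> u v = a_form \<Omega> u' v'"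
  by (simp add: a_form_def grad_cong[of u u'] grad_cong[of v v'])

lemma b_form_cong: "ae_eq \<Omega> v v' \<Longrightarrow> ae_eq \<Omega> q q' \<Longrightarrow> b_form \<Omega> v q = b_form \<Omega> v' q'"
  by (simp add: b_form_def divergence_cong[of v v'] ip_cong)

lemma b_add1: "\<lbrakk>v \<in> sobolev \<Omega> 1; w \<in> sobolev \<Omega> 1; q \<in> L2 \<Omega>\<rbrakk> \<Longrightarrow> b_form \<Omega> (v + w) q = b_form \<Omega> v q + b_form \<Omega> w q"
  using ip_cong[OF divergence_add ae_eq_refl, of v w q]
  by (simp add: b_form_def L2.bilin divergence_L2 del: One_nat_def)

lemma b_scale1: "\<lbrakk>v \<in> sobolev \<Omega> 1; q \<in> L2 \<Omega>\<rbrakk> \<Longrightarrow> b_form \<Omega> (c *\<^sub>R v) q = c * b_form \<Omega> v q"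
  using ip_cong[OF divergence_scaleR ae_eq_refl, of v c q]
  by (simp add: b_form_def L2.bilin divergence_L2 del: One_nat_def)

lemma b_add2: "\<lbrakk>v \<in> sobolev \<Omega> 1; q \<in> L2 \<Omega>; s \<in> L2 \<Omega>\<rbrakk> \<Longrightarrow> b_form \<Omega> v (q + s) = b_form \<Omega> v q + b_form \<Omega> v s"
  by (simp add: b_form_def L2.bilin divergence_L2 del: One_nat_def)

lemma b_scale2: "\<lbrakk>v \<in> sobolev \<Omega> 1; q \<in> L2 \<Omega>\<rbrakk> \<Longrightarrow> b_form \<Omega> v (c *\<^sub>R q) = c * b_form \<Omega> v q"
  by (simp add: b_form_def L2.bilin divergence_L2 del: One_nat_def)

lemma b_diff1: "\<lbrakk>v \<in> sobolev \<Omega> 1; w \<in> sobolev \<Omega> 1; q \<in> L2 \<Omega>\<rbrakk> \<Longrightarrow> b_form \<Omega> (v - w) q = b_form \<Omega> v q - b_form \<Omega> w q"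
  using b_add1[of "v - w" w q] by (simp add: a.S_diff del: One_nat_def)

lemma b_diff2: "\<lbrakk>v \<in> sobolev \<Omega> 1; q \<in> L2 \<Omega>; s \<in> L2 \<Omega>\<rbrakk> \<Longrightarrow> b_form \<Omega> v (q - s) = b_form \<Omega> v q - b_form \<Omega> v s"
  by (simp add: b_form_def L2.bilin divergence_L2 del: One_nat_def)

lemmas b_bilin = b_add1 b_add2 b_diff1 b_diff2 b_scale1 b_scale2

lemma b_bound:
  assumes v: "v \<in> sobolev \<Omega> 1" and q: "q \<in> L2 \<Omega>"
  shows "\<bar>b_form \<Omega> v q\<bar> \<le> real CARD('d) * L2norm \<Omega> (grad \<Omega> v) * L2norm \<Omega> q"
proof -
  have "\<bar>b_form \<Omega> v q\<bar> \<le> L2norm \<Omega> (divergence \<Omega> v) * L2norm \<Omega> q"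
    unfolding b_form_def abs_minus_cancel L2norm_eq_nrm
    by (intro L2.Cauchy_Schwarz divergence_L2 v q)
  also have "\<dots> \<le> real CARD('d) * L2norm \<Omega> (grad \<Omega> v) * L2norm \<Omega> q"
    by (intro mult_right_mono L2norm_divergence_le v L2norm_nonneg q)
  finally show ?thesis .
qed

end

section \<open>Functions with zero boundary values\<close>

lemma smooth_inner:
  fixes f :: "real ^ 'd::finite \<Rightarrow> 'b::real_inner"
  assumes "smooth f"
  shows "smooth (\<lambda>x. f x \<bullet> b)" "partial i (\<lambda>x. f x \<bullet> b) = (\<lambda>x. partial i f x \<bullet> b)"
proof -
  have der: "((\<lambda>x. g x \<bullet> b) has_derivative (\<lambda>h. frechet_derivative g (at x) h \<bullet> b)) (at x)"
    if "smooth g" for g :: "real ^ 'd \<Rightarrow> 'b" and x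
    using frechet_derivative_worksI[OF smooth_differentiable[OF that]] by (rule has_derivative_inner_left)
  have p: "partial i (\<lambda>x. g x \<bullet> b) = (\<lambda>x. partial i g x \<bullet> b)" if "smooth g" for g :: "real ^ 'd \<Rightarrow> 'b" and i
    by (rule ext, subst partial_eq[OF der[OF that]]) (simp add: partial_def)
  show "partial i (\<lambda>x. f x \<bullet> b) = (\<lambda>x. partial i f x \<bullet> b)" by (rule p) fact
  show "smooth (\<lambda>x. f x \<bullet> b)"
  proof (rule smooth_coinduct[where P = "\<lambda>g. \<exists>f. smooth f \<and> g = (\<lambda>x. f x \<bullet> b)"])
    show "\<exists>f'. smooth f' \<and> (\<lambda>x. f x \<bullet> b) = (\<lambda>x. f' x \<bullet> b)" using assms by blast
    show "\<And>(g :: real ^ 'd \<Rightarrow> real) x. \<exists>f :: real ^ 'd \<Rightarrow> 'b. smooth f \<and> g = (\<lambda>x. f x \<bullet> b) \<Longrightarrow> g differentiable (at x)"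
      using differentiableI[OF der] by auto
    show "\<And>(g :: real ^ 'd \<Rightarrow> real) i. \<exists>f :: real ^ 'd \<Rightarrow> 'b. smooth f \<and> g = (\<lambda>x. f x \<bullet> b) \<Longrightarrow> \<exists>f :: real ^ 'd \<Rightarrow> 'b. smooth f \<and> partial i g = (\<lambda>x. f x \<bullet> b)"
      using p smooth_partial by blast
  qed
qed

lemma partial_coordinate: "partial i (\<lambda>x :: real ^ 'd::finite. x $ j) = (\<lambda>x. axis i 1 $ j)"
  by (rule ext, rule partial_eq) (intro bounded_linear_imp_has_derivative bounded_linear_vec_nth)

lemma smooth_coordinate_mult:
  fixes f :: "real ^ 'd::finite \<Rightarrow> real"
  assumes "smooth f"
  shows "smooth (\<lambda>x. x $ j * f x)"
proof (rule smooth_falg)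
  let ?G = "insert (\<lambda>x :: real ^ 'd. x $ j) {f. smooth f}"
  show "(\<lambda>x. x $ j * f x) \<in> falg ?G"
    by (intro falg_mult falg_base) (use assms in auto)
  show "g differentiable (at x)" if "g \<in> ?G" for g x
    using that smooth_differentiable
    by (auto intro: bounded_linear_imp_differentiable bounded_linear_vec_nth)
  show "partial i g \<in> falg ?G" if "g \<in> ?G" for g i
    using that smooth_partial by (auto simp: partial_coordinate intro: falg_const falg_base)
qed

lemma partial_coordinate_mult:
  fixes f :: "real ^ 'd::finite \<Rightarrow> real"
  assumes "smooth f"
  shows "partial j (\<lambda>x. x $ j * f x) = (\<lambda>x. x $ j * partial j f x + f x)"
proof
  fix x
  have "((\<lambda>x. x $ j * f x) has_derivative (\<lambda>h. x $ j * frechet_derivative f (at x) h + h $ j * f x)) (at x)"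
    by (intro has_derivative_mult bounded_linear_imp_has_derivative bounded_linear_vec_nth
        frechet_derivative_worksI smooth_differentiable assms)
  from partial_eq[OF this, of j]
  show "partial j (\<lambda>x. x $ j * f x) x = x $ j * partial j f x + f x" by (simp add: partial_def)
qed

lemma test_functions_support:
  assumes "\<phi> \<in> test_functions \<Omega>" "smooth g" "\<And>x. \<phi> x = 0 \<Longrightarrow> g x = 0"
  shows "g \<in> test_functions \<Omega>"
proof -
  obtain K where K: "compact K" "K \<subseteq> \<Omega>" "\<forall>x. x \<notin> K \<longrightarrow> \<phi> x = 0"
    using test_functionsD(2)[OF assms(1)] by blast
  hence "\<forall>x. x \<notin> K \<longrightarrow> g x = 0" using assms(3) by simp
  thus ?thesis using K assms(2) unfolding test_functions_def by blast
qed

context bounded_open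
begin

lemma sum_unit_index: "(\<Sum>i\<in>UNIV. unit_index j i) = 1" for j :: 'd
  by (simp add: unit_index_def)

lemma is_weak_deriv_unit_iff:
  fixes f g :: "real ^ 'd \<Rightarrow> 'b::euclidean_space"
  shows "is_weak_deriv \<Omega> (unit_index j) f g \<longleftrightarrow> (\<forall>\<psi> \<in> test_functions \<Omega> :: (real ^ 'd \<Rightarrow> real) set.
    (\<integral>x. partial j \<psi> x *\<^sub>R f x \<partial>lebesgue_on \<Omega>) = - (\<integral>x. \<psi> x *\<^sub>R g x \<partial>lebesgue_on \<Omega>))"
  unfolding is_weak_deriv_def list_of_unit_index sum_unit_index by simp

lemma test_weak_deriv:
  fixes \<phi> :: "real ^ 'd \<Rightarrow> 'b::euclidean_space"
  assumes "\<phi> \<in> test_functions \<Omega>"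
  shows "is_weak_deriv \<Omega> (unit_index j) \<phi> (partial j \<phi>)"
  unfolding is_weak_deriv_unit_iff using integration_by_parts test_functionsD(1)[OF assms] by blast

lemma test_sobolev:
  fixes \<phi> :: "real ^ 'd \<Rightarrow> 'b::euclidean_space"
  assumes "\<phi> \<in> test_functions \<Omega>"
  shows "\<phi> \<in> sobolev \<Omega> 1"
  unfolding sobolev_def multi_indices_1
proof (intro CollectI conjI ballI)
  show "\<phi> \<in> L2 \<Omega>" using assms by (rule test_L2)
  fix \<alpha> assume "\<alpha> \<in> insert (\<lambda>_. 0) (range (unit_index :: 'd \<Rightarrow> _))"
  then consider "\<alpha> = (\<lambda>_. 0)" | j where "\<alpha> = unit_index j" by blast
  thus "\<exists>g\<in>L2 \<Omega>. is_weak_deriv \<Omega> \<alpha> \<phi> g"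
  proof cases
    case 1
    have "is_weak_deriv \<Omega> (\<lambda>_. 0) \<phi> \<phi>" by (auto simp: is_weak_deriv_def list_of_zero_index)
    thus ?thesis using 1 test_L2[OF assms] by blast
  next
    case (2 j)
    thus ?thesis using test_weak_deriv[OF assms] test_L2[OF test_partial[OF assms]] by blast
  qed
qed

lemma wderiv_test:
  fixes \<phi> :: "real ^ 'd \<Rightarrow> 'b::euclidean_space"
  assumes "\<phi> \<in> test_functions \<Omega>"
  shows "ae_eq \<Omega> (wderiv \<Omega> (unit_index j) \<phi>) (partial j \<phi>)"
  by (intro wderiv_unique test_L2 test_partial test_weak_deriv assms)

lemma V_sobolev: "v \<in> V \<Omega> \<Longrightarrow> v \<in> sobolev \<Omega> 1"
  by (simp add: V_def)

lemma V_L2: "v \<in> V \<Omega> \<Longrightarrow> v \<in> L2 \<Omega>"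
  by (rule sobolev_L2[OF V_sobolev])

lemma V_approx:
  assumes "v \<in> V \<Omega>" "0 < \<epsilon>"
  obtains \<phi> where "\<phi> \<in> test_functions \<Omega>" "sobolev_norm \<Omega> 1 (v - \<phi>) < \<epsilon>"
  using assms unfolding V_def fun_diff_def by blast

lemma test_functions_add_scaleR:
  fixes f g :: "real ^ 'd \<Rightarrow> real ^ 'd"
  assumes "f \<in> test_functions \<Omega>" "g \<in> test_functions \<Omega>"
  shows "f + c *\<^sub>R g \<in> test_functions \<Omega>"
proof -
  obtain K L where K: "compact K" "K \<subseteq> \<Omega>" "\<And>x. x \<notin> K \<Longrightarrow> f x = 0"
    and L: "compact L" "L \<subseteq> \<Omega>" "\<And>x. x \<notin> L \<Longrightarrow> g x = 0"
    using test_functionsD(2)[OF assms(1)] test_functionsD(2)[OF assms(2)] by blast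
  have "smooth (f + c *\<^sub>R g)"
  proof (rule smooth_coinduct[where P = "\<lambda>h. \<exists>f g. smooth f \<and> smooth g \<and> h = f + c *\<^sub>R g"])
    have der: "((f + c *\<^sub>R g) has_derivative (\<lambda>h. frechet_derivative f (at x) h + c *\<^sub>R frechet_derivative g (at x) h)) (at x)"
      if "smooth f" "smooth g" for f g :: "real ^ 'd \<Rightarrow> real ^ 'd" and x
      unfolding plus_fun_def scaleR_fun_def
      by (intro has_derivative_add has_derivative_scaleR_right frechet_derivative_worksI smooth_differentiable that)
    show "\<And>(h :: real ^ 'd \<Rightarrow> real ^ 'd) x. \<exists>f g. smooth f \<and> smooth g \<and> h = f + c *\<^sub>R g \<Longrightarrow> h differentiable (at x)"
      using differentiableI[OF der] by blast
    have "partial i (f + c *\<^sub>R g) = partial i f + c *\<^sub>R partial i g"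
      if "smooth f" "smooth g" for f g :: "real ^ 'd \<Rightarrow> real ^ 'd" and i
      by (rule ext, subst partial_eq[OF der[OF that]]) (simp add: partial_def)
    thus "\<And>(h :: real ^ 'd \<Rightarrow> real ^ 'd) i. \<exists>f g. smooth f \<and> smooth g \<and> h = f + c *\<^sub>R g \<Longrightarrow>
        \<exists>f g. smooth f \<and> smooth g \<and> partial i h = f + c *\<^sub>R g"
      using smooth_partial by blast
    show "\<exists>f' g'. smooth f' \<and> smooth g' \<and> f + c *\<^sub>R g = f' + c *\<^sub>R g'"
      using assms[THEN test_functionsD(1)] by blast
  qed
  moreover have "compact (K \<union> L)" "K \<union> L \<subseteq> \<Omega>" "\<And>x. x \<notin> K \<union> L \<Longrightarrow> (f + c *\<^sub>R g) x = 0"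
    using K L by (auto simp: compact_Un)
  ultimately show ?thesis unfolding test_functions_def by blast
qed

lemma zero_test: "(0 :: real ^ 'd \<Rightarrow> real ^ 'd) \<in> test_functions \<Omega>"
  using smooth_zero by (auto simp: test_functions_def zero_fun_def intro!: exI[of _ "{}"])

lemma V_add_scaleR:
  assumes v: "v \<in> V \<Omega>" and w: "w \<in> V \<Omega>"
  shows "v + c *\<^sub>R w \<in> V \<Omega>"
proof -
  note S = V_sobolev[OF v] V_sobolev[OF w]
  have "\<exists>\<phi> \<in> test_functions \<Omega>. sobolev_norm \<Omega> 1 (\<lambda>x. (v + c *\<^sub>R w) x - \<phi> x) < \<epsilon>" if \<epsilon>: "0 < \<epsilon>" for \<epsilon>
  proof -
    obtain \<phi> where \<phi>: "\<phi> \<in> test_functions \<Omega>" "sobolev_norm \<Omega> 1 (v - \<phi>) < \<epsilon> / 2"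
      using V_approx[OF v, of "\<epsilon> / 2"] \<epsilon> by auto
    have "0 < \<epsilon> / (2 * (\<bar>c\<bar> + 1))" using \<epsilon> by simp
    then obtain \<psi> where \<psi>: "\<psi> \<in> test_functions \<Omega>" "sobolev_norm \<Omega> 1 (w - \<psi>) < \<epsilon> / (2 * (\<bar>c\<bar> + 1))"
      using V_approx[OF w] by blast
    note T = test_sobolev[OF \<phi>(1)] test_sobolev[OF \<psi>(1)]
    have D: "v - \<phi> \<in> sobolev \<Omega> 1" "w - \<psi> \<in> sobolev \<Omega> 1" "(v - \<phi>) + c *\<^sub>R (w - \<psi>) \<in> sobolev \<Omega> 1"
      by (intro sob.S_intros S T)+
    have "sobolev_norm \<Omega> 1 ((v - \<phi>) + c *\<^sub>R (w - \<psi>)) \<le> sobolev_norm \<Omega> 1 (v - \<phi>) + \<bar>c\<bar> * sobolev_norm \<Omega> 1 (w - \<psi>)"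
      using sob.nrm_triangle[OF D(1) sob.S_scale[OF D(2)]] sob.nrm_scale[OF D(2)]
      by (simp add: sobolev_norm_eq_nrm D del: One_nat_def)
    also have "\<bar>c\<bar> * sobolev_norm \<Omega> 1 (w - \<psi>) \<le> (\<bar>c\<bar> + 1) * (\<epsilon> / (2 * (\<bar>c\<bar> + 1)))"
      using \<psi>(2) sobolev_norm_nonneg[of 1 "w - \<psi>"] by (intro mult_mono) auto
    also have "\<dots> = \<epsilon> / 2" by (simp add: field_simps)
    finally have "sobolev_norm \<Omega> 1 ((v - \<phi>) + c *\<^sub>R (w - \<psi>)) < \<epsilon>" using \<phi>(2) by linarith
    moreover have "(v - \<phi>) + c *\<^sub>R (w - \<psi>) = (\<lambda>x. (v + c *\<^sub>R w) x - (\<phi> + c *\<^sub>R \<psi>) x)"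
      by (simp add: fun_eq_iff algebra_simps)
    ultimately show ?thesis using test_functions_add_scaleR[OF \<phi>(1) \<psi>(1)] by (intro bexI[of _ "\<phi> + c *\<^sub>R \<psi>"]) (simp_all only:)
  qed
  moreover have "v + c *\<^sub>R w \<in> sobolev \<Omega> 1" by (intro sob.S_intros S)
  ultimately show ?thesis unfolding V_def by blast
qed

lemma zero_V: "0 \<in> V \<Omega>"
proof -
  have S0: "(0 :: real ^ 'd \<Rightarrow> real ^ 'd) \<in> sobolev \<Omega> 1" by (rule sob.S_0)
  have "sobolev_norm \<Omega> 1 (0 :: real ^ 'd \<Rightarrow> real ^ 'd) = 0"
    using sobolev_norm_eq_nrm[OF S0] sob.zero_left[OF S0] by (simp add: sob.nrm_def)
  moreover have "(\<lambda>x. (0 :: real ^ 'd \<Rightarrow> real ^ 'd) x - 0 x) = 0" by (simp add: fun_eq_iff)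
  ultimately show ?thesis
    unfolding V_def using sob.S_0[of 1] zero_test by (auto intro!: bexI[of _ 0] simp del: One_nat_def)
qed

lemma subspace_V: "subspace (V \<Omega>)"
proof (rule subspaceI)
  show "0 \<in> V \<Omega>" by (rule zero_V)
  fix v w :: "real ^ 'd \<Rightarrow> real ^ 'd" and c assume "v \<in> V \<Omega>"
  show "c *\<^sub>R v \<in> V \<Omega>" using V_add_scaleR[OF zero_V \<open>v \<in> V \<Omega>\<close>] by simp
  show "v + w \<in> V \<Omega>" if "w \<in> V \<Omega>" using V_add_scaleR[OF \<open>v \<in> V \<Omega>\<close> that, of 1] by simp
qed

lemma V_cong:
  assumes "ae_eq \<Omega> v w" "v \<in> V \<Omega>"
  shows "w \<in> V \<Omega>"
proof -
  have "sobolev_norm \<Omega> 1 (\<lambda>x. w x - \<phi> x) = sobolev_norm \<Omega> 1 (\<lambda>x. v x - \<phi> x)" for \<phi>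
    by (rule sobolev_norm_cong, rule ae_eq_compose[where h = "\<lambda>x y. y - \<phi> x"], rule ae_eq_sym, rule assms(1))
  thus ?thesis using assms sobolev_cong[OF assms(1), of 1] by (simp add: V_def)
qed

subsection \<open>Green's formula and Poincare's inequality\<close>

text \<open>
  Weak derivatives are tested with real-valued functions, so \<open>\<phi>\<close> is expanded into its components.
\<close>

lemma green_test:
  fixes f g \<phi> :: "real ^ 'd \<Rightarrow> 'b::euclidean_space"
  assumes w: "is_weak_deriv \<Omega> (unit_index j) f g" and f: "f \<in> L2 \<Omega>" and g: "g \<in> L2 \<Omega>"
    and \<phi>: "\<phi> \<in> test_functions \<Omega>"
  shows "ip \<Omega> g \<phi> = - ip \<Omega> f (partial j \<phi>)"
proof -
  have comp: "(\<lambda>x. \<phi> x \<bullet> b) \<in> test_functions \<Omega>" for b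
    by (rule test_functions_support[OF \<phi> smooth_inner(1)[OF test_functionsD(1)[OF \<phi>]]]) simp
  have expand: "ip \<Omega> h \<psi> = (\<Sum>b\<in>Basis. (\<integral>x. (\<psi> x \<bullet> b) *\<^sub>R h x \<partial>lebesgue_on \<Omega>) \<bullet> b)"
    if h: "h \<in> L2 \<Omega>" and \<psi>: "\<And>b. (\<lambda>x. \<psi> x \<bullet> b) \<in> test_functions \<Omega>" for h \<psi> :: "real ^ 'd \<Rightarrow> 'b"
  proof -
    have "ip \<Omega> h \<psi> = (\<integral>x. (\<Sum>b\<in>Basis. ((\<psi> x \<bullet> b) *\<^sub>R h x) \<bullet> b) \<partial>lebesgue_on \<Omega>)"
      unfolding ip_def
    proof (rule Bochner_Integration.integral_cong[OF refl])
      fix x show "h x \<bullet> \<psi> x = (\<Sum>b\<in>Basis. ((\<psi> x \<bullet> b) *\<^sub>R h x) \<bullet> b)"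
        by (subst euclidean_inner) (simp only: inner_scaleR_left mult.commute)
    qed
    also have "\<dots> = (\<Sum>b\<in>Basis. \<integral>x. ((\<psi> x \<bullet> b) *\<^sub>R h x) \<bullet> b \<partial>lebesgue_on \<Omega>)"
      by (intro Bochner_Integration.integral_sum integrable_inner_left test_mult_integrable h \<psi>)
    also have "\<dots> = (\<Sum>b\<in>Basis. (\<integral>x. (\<psi> x \<bullet> b) *\<^sub>R h x \<partial>lebesgue_on \<Omega>) \<bullet> b)"
      by (intro sum.cong refl integral_inner_left test_mult_integrable h \<psi>)
    finally show ?thesis .
  qed
  have "ip \<Omega> g \<phi> = (\<Sum>b\<in>Basis. - (\<integral>x. partial j (\<lambda>x. \<phi> x \<bullet> b) x *\<^sub>R f x \<partial>lebesgue_on \<Omega>) \<bullet> b)"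
    unfolding expand[OF g comp] using w comp by (simp add: is_weak_deriv_unit_iff)
  also have "\<dots> = - ip \<Omega> f (partial j \<phi>)"
    using expand[OF f, of "partial j \<phi>"] test_partial[OF comp, of j]
    by (simp add: smooth_inner(2)[OF test_functionsD(1)[OF \<phi>]] sum_negf)
  finally show ?thesis .
qed

text \<open>
  Both sides are continuous in \<open>v\<close> with respect to the norm of \<open>H\<^sup>1\<close>, and test functions are dense
  in \<open>V\<close>.
\<close>

lemma green:
  assumes w: "is_weak_deriv \<Omega> (unit_index j) f g" and f: "f \<in> L2 \<Omega>" and g: "g \<in> L2 \<Omega>" and v: "v \<in> V \<Omega>"
  shows "ip \<Omega> g v = - ip \<Omega> f (wderiv \<Omega> (unit_index j) v)"
proof -
  define r where "r = \<bar>ip \<Omega> g v + ip \<Omega> f (wderiv \<Omega> (unit_index j) v)\<bar>"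
  let ?D = "wderiv \<Omega> (unit_index j)"
  have bound: "r \<le> (L2norm \<Omega> g + L2norm \<Omega> f) * \<epsilon>" if \<epsilon>: "0 < \<epsilon>" for \<epsilon>
  proof -
    obtain \<phi> where \<phi>: "\<phi> \<in> test_functions \<Omega>" "sobolev_norm \<Omega> 1 (v - \<phi>) < \<epsilon>"
      using V_approx[OF v \<epsilon>] by blast
    note T = test_sobolev[OF \<phi>(1)] and S = V_sobolev[OF v]
    have D: "v - \<phi> \<in> sobolev \<Omega> 1" by (intro sob.S_intros S T)
    have "ip \<Omega> g \<phi> + ip \<Omega> f (?D \<phi>) = 0"
      using green_test[OF w f g \<phi>(1)] ip_cong[OF ae_eq_refl wderiv_test[OF \<phi>(1)], of f j] by simp
    moreover have "ip \<Omega> g v = ip \<Omega> g (v - \<phi>) + ip \<Omega> g \<phi>"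
      using g sobolev_L2[OF S] sobolev_L2[OF T] by (simp add: L2.bilin)
    moreover have "ip \<Omega> f (?D v) = ip \<Omega> f (?D (v - \<phi>)) + ip \<Omega> f (?D \<phi>)"
      using ip_cong[OF ae_eq_refl wderiv_add[OF D T unit_in_1], of f j]
        L2.add_right[OF wderiv_works(1)[OF D unit_in_1] wderiv_works(1)[OF T unit_in_1] f] by simp
    ultimately have "r = \<bar>ip \<Omega> g (v - \<phi>) + ip \<Omega> f (?D (v - \<phi>))\<bar>" by (simp add: r_def)
    also have "\<dots> \<le> \<bar>ip \<Omega> g (v - \<phi>)\<bar> + \<bar>ip \<Omega> f (?D (v - \<phi>))\<bar>" by (rule abs_triangle_ineq)
    also have "\<dots> \<le> L2norm \<Omega> g * L2norm \<Omega> (v - \<phi>) + L2norm \<Omega> f * L2norm \<Omega> (?D (v - \<phi>))"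
      unfolding L2norm_eq_nrm
      by (intro add_mono L2.Cauchy_Schwarz f g sobolev_L2[OF D] wderiv_works(1)[OF D unit_in_1])
    also have "\<dots> \<le> L2norm \<Omega> g * \<epsilon> + L2norm \<Omega> f * \<epsilon>"
      using L2norm_le_sobolev_norm[OF sobolev_L2[OF D], of 1] L2norm_wderiv_le[OF unit_in_1, of j "v - \<phi>"] \<phi>(2)
      by (intro add_mono mult_left_mono L2norm_nonneg) auto
    finally show ?thesis by (simp add: distrib_right)
  qed
  have "r \<le> 0"
  proof (rule field_le_epsilon)
    fix e :: real assume e: "0 < e"
    let ?K = "L2norm \<Omega> g + L2norm \<Omega> f"
    have K: "0 \<le> ?K" by (intro add_nonneg_nonneg L2norm_nonneg)
    have "r \<le> ?K * (e / (?K + 1))" using e K by (intro bound) simp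
    also have "\<dots> \<le> e" using e K by (simp add: field_simps)
    finally show "r \<le> 0 + e" by simp
  qed
  thus ?thesis by (simp add: r_def)
qed

lemma L2norm_mult_le:
  fixes f :: "real ^ 'd \<Rightarrow> 'b::euclidean_space" and c :: "real ^ 'd \<Rightarrow> real"
  assumes f: "f \<in> L2 \<Omega>" and c: "continuous_on UNIV c" "\<And>x. x \<in> \<Omega> \<Longrightarrow> \<bar>c x\<bar> \<le> K" and K: "0 \<le> K"
  shows "L2norm \<Omega> (\<lambda>x. c x *\<^sub>R f x) \<le> K * L2norm \<Omega> f"
proof (rule power2_le_imp_le)
  note cf = continuous_mult_L2[OF f c(1)]
  have "(L2norm \<Omega> (\<lambda>x. c x *\<^sub>R f x))\<^sup>2 = (\<integral>x. (norm (c x *\<^sub>R f x))\<^sup>2 \<partial>lebesgue_on \<Omega>)"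
    unfolding L2norm_sq[OF cf] ip_def power2_norm_eq_inner ..
  also have "\<dots> \<le> (\<integral>x. K\<^sup>2 * (norm (f x))\<^sup>2 \<partial>lebesgue_on \<Omega>)"
  proof (rule integral_mono)
    fix x assume "x \<in> space (lebesgue_on \<Omega>)"
    hence "\<bar>c x\<bar>\<^sup>2 \<le> K\<^sup>2" using c(2) by (intro power_mono) auto
    thus "(norm (c x *\<^sub>R f x))\<^sup>2 \<le> K\<^sup>2 * (norm (f x))\<^sup>2"
      by (simp add: power_mult_distrib mult_right_mono)
  qed (use L2D(2)[OF cf] L2D(2)[OF f] in auto)
  also have "\<dots> = (K * L2norm \<Omega> f)\<^sup>2"
    unfolding power_mult_distrib L2norm_sq[OF f] ip_def by (simp add: power2_norm_eq_inner)
  finally show "(L2norm \<Omega> (\<lambda>x. c x *\<^sub>R f x))\<^sup>2 \<le> (K * L2norm \<Omega> f)\<^sup>2" .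
qed (intro mult_nonneg_nonneg K L2norm_nonneg)

lemma L2norm_wderiv_le_grad:
  fixes f :: "real ^ 'd \<Rightarrow> 'b::euclidean_space"
  assumes f: "f \<in> sobolev \<Omega> 1"
  shows "L2norm \<Omega> (wderiv \<Omega> (unit_index j) f) \<le> L2norm \<Omega> (grad \<Omega> f)"
proof (rule power2_le_imp_le)
  have "ip \<Omega> (wderiv \<Omega> (unit_index j) f) (wderiv \<Omega> (unit_index j) f)
      \<le> (\<Sum>j\<in>UNIV. ip \<Omega> (wderiv \<Omega> (unit_index j) f) (wderiv \<Omega> (unit_index j) f))"
    by (rule member_le_sum[of j UNIV "\<lambda>j. ip \<Omega> (wderiv \<Omega> (unit_index j) f) (wderiv \<Omega> (unit_index j) f)"])
      (auto intro: L2.nonneg wderiv_works(1)[OF f unit_in_1])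
  thus "(L2norm \<Omega> (wderiv \<Omega> (unit_index j) f))\<^sup>2 \<le> (L2norm \<Omega> (grad \<Omega> f))\<^sup>2"
    unfolding L2norm_sq[OF wderiv_works(1)[OF f unit_in_1]] L2norm_sq[OF grad_L2[OF f]]
      ip_vec[OF grad_L2[OF f] grad_L2[OF f]] grad_nth .
qed (rule L2norm_nonneg)

text \<open>
  The derivative of \<open>x\<^sub>j v\<close> in direction \<open>j\<close> is \<open>v + x\<^sub>j \<partial>\<^sub>j v\<close>. Green's formula for this function,
  tested with \<open>v\<close>, gives \<open>\<parallel>v\<parallel>\<^sup>2 = - 2 \<langle>x\<^sub>j v, \<partial>\<^sub>j v\<rangle>\<close>, and \<open>x\<^sub>j\<close> is bounded on \<open>\<Omega>\<close>.
\<close>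

lemma poincare:
  obtains C where "0 \<le> C" "\<And>v. v \<in> V \<Omega> \<Longrightarrow> L2norm \<Omega> v \<le> C * L2norm \<Omega> (grad \<Omega> v)"
proof -
  obtain j :: 'd where True by simp
  obtain R where R: "\<And>x. x \<in> \<Omega> \<Longrightarrow> norm x \<le> R" "0 \<le> R"
    using bounded_\<Omega> unfolding bounded_pos by (metis less_imp_le)
  have cont: "continuous_on UNIV (\<lambda>x :: real ^ 'd. x $ j)" by (intro continuous_intros)
  have "L2norm \<Omega> v \<le> 2 * R * L2norm \<Omega> (grad \<Omega> v)" if v: "v \<in> V \<Omega>" for v
  proof -
    define w where "w = wderiv \<Omega> (unit_index j) v"
    note S = V_sobolev[OF v]
    note L = V_L2[OF v] wderiv_works(1)[OF S unit_in_1, of j, folded w_def]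
    define f where "f = (\<lambda>x. x $ j *\<^sub>R v x)"
    define g where "g = (\<lambda>x. x $ j *\<^sub>R w x)"
    have fg: "f \<in> L2 \<Omega>" "g \<in> L2 \<Omega>" unfolding f_def g_def by (intro continuous_mult_L2 L cont)+
    have wd: "is_weak_deriv \<Omega> (unit_index j) f (g + v)"
      unfolding is_weak_deriv_unit_iff
    proof
      fix \<psi> :: "real ^ 'd \<Rightarrow> real" assume \<psi>: "\<psi> \<in> test_functions \<Omega>"
      note sm = test_functionsD(1)[OF \<psi>]
      have x\<psi>: "(\<lambda>x. x $ j * \<psi> x) \<in> test_functions \<Omega>"
        by (rule test_functions_support[OF \<psi> smooth_coordinate_mult[OF sm]]) simp
      have "(\<integral>x. partial j (\<lambda>x. x $ j * \<psi> x) x *\<^sub>R v x \<partial>lebesgue_on \<Omega>) = - (\<integral>x. (x $ j * \<psi> x) *\<^sub>R w x \<partial>lebesgue_on \<Omega>)"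
        using wderiv_works(2)[OF S unit_in_1, of j, folded w_def] x\<psi> unfolding is_weak_deriv_unit_iff by blast
      moreover have "(\<integral>x. partial j (\<lambda>x. x $ j * \<psi> x) x *\<^sub>R v x \<partial>lebesgue_on \<Omega>)
          = (\<integral>x. partial j \<psi> x *\<^sub>R f x \<partial>lebesgue_on \<Omega>) + (\<integral>x. \<psi> x *\<^sub>R v x \<partial>lebesgue_on \<Omega>)"
        unfolding partial_coordinate_mult[OF sm]
        using test_mult_integrable[OF test_partial[OF \<psi>] fg(1)] test_mult_integrable[OF \<psi> L(1)]
        by (subst Bochner_Integration.integral_add[symmetric]) (auto simp: f_def scaleR_add_left mult.commute)
      moreover have "(\<integral>x. (x $ j * \<psi> x) *\<^sub>R w x \<partial>lebesgue_on \<Omega>) = (\<integral>x. \<psi> x *\<^sub>R g x \<partial>lebesgue_on \<Omega>)"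
        by (simp add: g_def mult.commute)
      moreover have "(\<integral>x. \<psi> x *\<^sub>R (g + v) x \<partial>lebesgue_on \<Omega>) = (\<integral>x. \<psi> x *\<^sub>R g x \<partial>lebesgue_on \<Omega>) + (\<integral>x. \<psi> x *\<^sub>R v x \<partial>lebesgue_on \<Omega>)"
        unfolding plus_fun_def scaleR_add_right
        by (intro Bochner_Integration.integral_add test_mult_integrable \<psi> fg L)
      ultimately show "(\<integral>x. partial j \<psi> x *\<^sub>R f x \<partial>lebesgue_on \<Omega>) = - (\<integral>x. \<psi> x *\<^sub>R (g + v) x \<partial>lebesgue_on \<Omega>)"
        by (simp add: algebra_simps eq_neg_iff_add_eq_0)
    qed
    have "ip \<Omega> (g + v) v = - ip \<Omega> f w"
      using green[OF wd fg(1) L2_add[OF fg(2) L(1)] v] by (simp add: w_def)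
    moreover have "ip \<Omega> (g + v) v = ip \<Omega> g v + ip \<Omega> v v" using fg L by (simp add: L2.bilin)
    moreover have "ip \<Omega> g v = ip \<Omega> f w" unfolding ip_def f_def g_def by (simp add: inner_commute)
    ultimately have "ip \<Omega> v v = - 2 * ip \<Omega> f w" by simp
    also have "\<dots> \<le> 2 * (L2norm \<Omega> f * L2norm \<Omega> w)"
      using L2.Cauchy_Schwarz[OF fg(1) L(2)] by (simp add: L2norm_eq_nrm)
    also have "\<dots> \<le> 2 * ((R * L2norm \<Omega> v) * L2norm \<Omega> (grad \<Omega> v))"
    proof (intro mult_left_mono mult_mono)
      show "L2norm \<Omega> f \<le> R * L2norm \<Omega> v"
        unfolding f_def
        by (rule L2norm_mult_le[OF L(1) cont _ R(2)]) (use R(1) component_le_norm_cart order_trans in blast)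
      show "L2norm \<Omega> w \<le> L2norm \<Omega> (grad \<Omega> v)" unfolding w_def by (rule L2norm_wderiv_le_grad[OF S])
    qed (auto intro: mult_nonneg_nonneg R L2norm_nonneg)
    finally have "L2norm \<Omega> v * L2norm \<Omega> v \<le> L2norm \<Omega> v * (2 * R * L2norm \<Omega> (grad \<Omega> v))"
      using L(1) by (simp add: L2norm_sq[symmetric] power2_eq_square mult_ac)
    thus ?thesis
      using L2norm_nonneg[of v] L2norm_nonneg[of "grad \<Omega> v"] R(2)
      by (cases "L2norm \<Omega> v = 0") auto
  qed
  thus ?thesis using that[of "2 * R"] R(2) by simp
qed

lemma ip_sum_left:
  fixes f :: "'i \<Rightarrow> real ^ 'd \<Rightarrow> 'b::euclidean_space"
  assumes "\<And>i. i \<in> A \<Longrightarrow> f i \<in> L2 \<Omega>" "v \<in> L2 \<Omega>"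
  shows "ip \<Omega> (\<lambda>x. \<Sum>i\<in>A. f i x) v = (\<Sum>i\<in>A. ip \<Omega> (f i) v)"
  unfolding ip_def inner_sum_left
  by (intro Bochner_Integration.integral_sum integrable_inner assms)

lemma double_index_in: "(\<lambda>i. if i = j then 2 else 0) \<in> multi_indices 2" for j :: 'd
  by (simp add: multi_indices_def)

lemma laplacian_L2:
  fixes u :: "real ^ 'd \<Rightarrow> 'b::euclidean_space"
  assumes "u \<in> sobolev \<Omega> 2" shows "laplacian \<Omega> u \<in> L2 \<Omega>"
  unfolding laplacian_def[abs_def] by (intro L2_sum wderiv_works(1)[OF assms double_index_in])

text \<open>
  The pure second derivatives of \<open>u\<close> are weak derivatives of its first derivatives, as one sees by
  testing with derivatives of test functions; so Green's formula applies to the first derivatives.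
\<close>

lemma green_laplacian:
  assumes u: "u \<in> sobolev \<Omega> 2" and v: "v \<in> V \<Omega>"
  shows "ip \<Omega> (laplacian \<Omega> u) v = - a_form \<Omega> u v"
proof -
  have u1: "u \<in> sobolev \<Omega> 1" using u by (rule sobolev_mono[rotated]) simp
  let ?D2 = "\<lambda>j. wderiv \<Omega> (\<lambda>i. if i = j then 2 else 0) u"
  let ?D = "\<lambda>j. wderiv \<Omega> (unit_index j) u"
  have D: "ip \<Omega> (?D2 j) v = - ip \<Omega> (?D j) (wderiv \<Omega> (unit_index j) v)" for j
  proof (rule green[OF _ wderiv_works(1)[OF u1 unit_in_1] wderiv_works(1)[OF u double_index_in] v])
    show "is_weak_deriv \<Omega> (unit_index j) (?D j) (?D2 j)"
      unfolding is_weak_deriv_unit_iff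
    proof
      fix \<psi> :: "real ^ 'd \<Rightarrow> real" assume \<psi>: "\<psi> \<in> test_functions \<Omega>"
      have "(\<integral>x. partial j (partial j \<psi>) x *\<^sub>R u x \<partial>lebesgue_on \<Omega>) = - (\<integral>x. partial j \<psi> x *\<^sub>R ?D j x \<partial>lebesgue_on \<Omega>)"
        using wderiv_works(2)[OF u1 unit_in_1] test_partial[OF \<psi>] unfolding is_weak_deriv_unit_iff by blast
      moreover have "(\<integral>x. partials [j, j] \<psi> x *\<^sub>R u x \<partial>lebesgue_on \<Omega>)
          = (- 1) ^ (\<Sum>i\<in>UNIV. if i = j then 2 else 0) *\<^sub>R (\<integral>x. \<psi> x *\<^sub>R ?D2 j x \<partial>lebesgue_on \<Omega>)"
        by (rule weak_derivD[OF wderiv_works(2)[OF u double_index_in] \<psi>]) auto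
      ultimately have "- (\<integral>x. partial j \<psi> x *\<^sub>R ?D j x \<partial>lebesgue_on \<Omega>) = (\<integral>x. \<psi> x *\<^sub>R ?D2 j x \<partial>lebesgue_on \<Omega>)"
        by simp
      from arg_cong[OF this, of uminus]
      show "(\<integral>x. partial j \<psi> x *\<^sub>R ?D j x \<partial>lebesgue_on \<Omega>) = - (\<integral>x. \<psi> x *\<^sub>R ?D2 j x \<partial>lebesgue_on \<Omega>)"
        by (simp only: minus_minus)
    qed
  qed
  have "ip \<Omega> (laplacian \<Omega> u) v = (\<Sum>j\<in>UNIV. ip \<Omega> (?D2 j) v)"
    unfolding laplacian_def[abs_def]
    by (intro ip_sum_left wderiv_works(1)[OF u double_index_in] V_L2 v)
  also have "\<dots> = - a_form \<Omega> u v"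
    unfolding D a_form_def ip_vec[OF grad_L2[OF u1] grad_L2[OF V_sobolev[OF v]]] grad_nth by (simp add: sum_negf)
  finally show ?thesis .
qed

text \<open>Green's formula for the vector fields \<open>p e\<^sub>j\<close>.\<close>

lemma green_pressure:
  fixes p :: "real ^ 'd \<Rightarrow> real"
  assumes p: "p \<in> sobolev \<Omega> 1" and v: "v \<in> V \<Omega>"
  shows "ip \<Omega> (grad \<Omega> p) v = b_form \<Omega> v p"
proof -
  let ?E = "\<lambda>j r. r *\<^sub>R axis j (1::real) :: real ^ 'd"
  have bl: "bounded_linear (?E j)" for j by (rule bounded_linear_scaleR_left)
  let ?D = "\<lambda>j. wderiv \<Omega> (unit_index j) p"
  note pL = sobolev_L2[OF p] wderiv_works(1)[OF p unit_in_1]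
  have "ip \<Omega> (\<lambda>x. ?E j (?D j x)) v = - ip \<Omega> (\<lambda>x. ?E j (p x)) (wderiv \<Omega> (unit_index j) v)" for j
    by (rule green[OF weak_deriv_linear[OF wderiv_works(2)[OF p unit_in_1] pL(1) pL(2) bl]
          L2_bounded_linear[OF bl pL(1)] L2_bounded_linear[OF bl pL(2)] v])
  hence D: "ip \<Omega> (?D j) (\<lambda>x. v x $ j) = - ip \<Omega> p (\<lambda>x. grad \<Omega> v x $ j $ j)" for j
    unfolding ip_def by (simp add: grad_nth inner_axis')
  have "ip \<Omega> (grad \<Omega> p) v = (\<Sum>j\<in>UNIV. ip \<Omega> (?D j) (\<lambda>x. v x $ j))"
    unfolding ip_vec[OF grad_L2[OF p] V_L2[OF v]] grad_nth ..
  also have "\<dots> = - (\<Sum>j\<in>UNIV. ip \<Omega> (\<lambda>x. grad \<Omega> v x $ j $ j) p)"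
    unfolding D sum_negf by (intro arg_cong[where f = uminus] sum.cong refl L2.sym L2_vec_nth grad_L2 V_sobolev v pL)
  also have "(\<Sum>j\<in>UNIV. ip \<Omega> (\<lambda>x. grad \<Omega> v x $ j $ j) p) = ip \<Omega> (divergence \<Omega> v) p"
    unfolding divergence_def[abs_def]
    by (intro ip_sum_left[symmetric] L2_vec_nth grad_L2 V_sobolev v pL)
  finally show ?thesis by (simp add: b_form_def)
qed

end

section \<open>Finite element spaces\<close>

lemma sum_fun_apply: "(\<Sum>i\<in>A. f i) x = (\<Sum>i\<in>A. f i x)"
  by (induction A rule: infinite_finite_induct) (auto simp: plus_fun_def zero_fun_def)

text \<open>
  The conditions on single cells in the definition of the finite element spaces, which are the
  intersections of such spaces with \<open>V \<Omega>\<close> and \<open>Q \<Omega>\<close>.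
\<close>

definition piecewise ::
    "(real ^ 'd::finite) set \<Rightarrow> (real ^ 'd) set set \<Rightarrow> ((real ^ 'd) set \<Rightarrow> (real ^ 'd \<Rightarrow> 'b::real_vector) set) \<Rightarrow>
     (real ^ 'd \<Rightarrow> 'b) set"
  where "piecewise \<Omega> \<K> L = {v. \<forall>K\<in>\<K>. \<exists>w\<in>L K. ae_eq (K \<inter> \<Omega>) v w}"

lemma subspace_piecewise:
  assumes "\<And>K. K \<in> \<K> \<Longrightarrow> fun_subspace (L K)"
  shows "subspace (piecewise \<Omega> \<K> L)"
proof (rule subspaceI)
  show "0 \<in> piecewise \<Omega> \<K> L"
    unfolding piecewise_def using assms by (auto simp: fun_subspace_def zero_fun_def intro!: bexI[of _ "\<lambda>x. 0"])
  fix f g :: "real ^ 'a \<Rightarrow> 'b" and c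
  assume f: "f \<in> piecewise \<Omega> \<K> L"
  show "c *\<^sub>R f \<in> piecewise \<Omega> \<K> L"
    unfolding piecewise_def
  proof (intro CollectI ballI)
    fix K assume K: "K \<in> \<K>"
    then obtain w where w: "w \<in> L K" "ae_eq (K \<inter> \<Omega>) f w" using f by (auto simp: piecewise_def)
    have "c *\<^sub>R w \<in> L K" using assms[OF K] w by (simp add: fun_subspace_def scaleR_fun_def)
    thus "\<exists>w\<in>L K. ae_eq (K \<inter> \<Omega>) (c *\<^sub>R f) w" using ae_eq_scaleR[OF w(2)] by blast
  qed
  assume g: "g \<in> piecewise \<Omega> \<K> L"
  show "f + g \<in> piecewise \<Omega> \<K> L"
    unfolding piecewise_def
  proof (intro CollectI ballI)
    fix K assume K: "K \<in> \<K>"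
    then obtain w w' where w: "w \<in> L K" "ae_eq (K \<inter> \<Omega>) f w" "w' \<in> L K" "ae_eq (K \<inter> \<Omega>) g w'"
      using f g unfolding piecewise_def by blast
    have "w + w' \<in> L K" using assms[OF K] w by (simp add: fun_subspace_def plus_fun_def)
    thus "\<exists>w\<in>L K. ae_eq (K \<inter> \<Omega>) (f + g) w" using ae_eq_add[OF w(2,4)] by blast
  qed
qed

text \<open>
  If \<open>x\<close> exceeded the bound, then \<open>g \<le> x\<close>, and the right-hand side of the last assumption would be
  at most \<open>(g + 2 * c * g) * x\<close>, which is less than \<open>x * x\<close>.
\<close>

lemma quadratic_bound:
  fixes x g c :: real
  assumes "0 \<le> x" "0 \<le> g" "0 \<le> c" "x * x \<le> g * x + g * (c * (g + x))"
  shows "x \<le> 2 * (1 + c) * g"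
proof (rule ccontr)
  assume "\<not> x \<le> 2 * (1 + c) * g"
  hence x: "2 * (1 + c) * g < x" by simp
  have g: "g \<le> x"
  proof -
    have "0 \<le> c * g" using assms by simp
    hence "g \<le> 2 * (1 + c) * g" using assms(2) by (simp add: algebra_simps)
    thus ?thesis using x by linarith
  qed
  have xpos: "0 < x" using x assms by (smt (verit) mult_nonneg_nonneg)
  have "g * x + g * (c * (g + x)) \<le> g * x + g * (c * (x + x))"
    using assms g by (intro add_left_mono mult_left_mono add_right_mono) auto
  also have "\<dots> = (g + 2 * c * g) * x" by (simp add: algebra_simps)
  also have "\<dots> < x * x"
  proof (rule mult_strict_right_mono[OF _ xpos])
    show "g + 2 * c * g < x" using x assms(2) by (simp add: algebra_simps)
  qed
  finally show False using assms(4) by simp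
qed

context bounded_open
begin

definition null_funs :: "(real ^ 'd \<Rightarrow> 'b::real_vector) set"
  where "null_funs = {z. ae_eq \<Omega> z 0}"

lemma subspace_null_funs: "subspace (null_funs :: (real ^ 'd \<Rightarrow> 'b::real_vector) set)"
proof (rule subspaceI)
  fix f g :: "real ^ 'd \<Rightarrow> 'b" and c
  show "0 \<in> (null_funs :: (real ^ 'd \<Rightarrow> 'b) set)" by (simp add: null_funs_def)
  assume f: "f \<in> null_funs"
  show "c *\<^sub>R f \<in> null_funs" using ae_eq_scaleR[of \<Omega> f 0 c] f by (simp add: null_funs_def)
  assume g: "g \<in> null_funs"
  show "f + g \<in> null_funs" using ae_eq_add[of \<Omega> f 0 g 0] f g by (simp add: null_funs_def)
qed

lemma subspace_Q: "subspace (Q \<Omega>)"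
proof (rule subspaceI)
  fix f g :: "real ^ 'd \<Rightarrow> real" and c
  show "0 \<in> Q \<Omega>" using L2_zero by (auto simp: Q_def zero_fun_def)
  assume f: "f \<in> Q \<Omega>"
  show "c *\<^sub>R f \<in> Q \<Omega>" using f L2_scaleR[of f c] by (simp add: Q_def scaleR_fun_def)
  assume g: "g \<in> Q \<Omega>"
  show "f + g \<in> Q \<Omega>" using f g L2_add[of f g] by (simp add: Q_def plus_fun_def L2_integrable)
qed

lemma Q_L2: "q \<in> Q \<Omega> \<Longrightarrow> q \<in> L2 \<Omega>" by (simp add: Q_def)

lemma Q_cong: "ae_eq \<Omega> q s \<Longrightarrow> q \<in> Q \<Omega> \<Longrightarrow> s \<in> Q \<Omega>"
  using L2_cong[of q s] integral_cong_ae[of q s] by (auto simp: Q_def)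

lemma ae_eq_cell:
  assumes "compact K"
  shows "ae_eq (K \<inter> \<Omega>) f g \<longleftrightarrow> (AE x in lebesgue. x \<in> K \<inter> \<Omega> \<longrightarrow> f x = g x)"
proof -
  have "K \<inter> \<Omega> \<in> sets lebesgue" using assms by (intro sets.Int) (auto intro: lmeasurable_compact fmeasurableD)
  thus ?thesis unfolding ae_eq_def by (subst AE_restrict_space_iff) auto
qed

lemma piecewise_cong:
  assumes "ae_eq \<Omega> v w" "v \<in> piecewise \<Omega> \<K> L" "\<And>K. K \<in> \<K> \<Longrightarrow> compact K"
  shows "w \<in> piecewise \<Omega> \<K> L"
  unfolding piecewise_def
proof (intro CollectI ballI)
  fix K assume K: "K \<in> \<K>"
  then obtain z where z: "z \<in> L K" "ae_eq (K \<inter> \<Omega>) v z" using assms(2) by (auto simp: piecewise_def)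
  have "ae_eq (K \<inter> \<Omega>) w v"
    unfolding ae_eq_cell[OF assms(3)[OF K]] using assms(1) unfolding ae_eq_def AE_\<Omega>_iff
    by (elim eventually_mono) auto
  thus "\<exists>z\<in>L K. ae_eq (K \<inter> \<Omega>) w z" using z ae_eq_trans by blast
qed

text \<open>
  The generators are mapped monomials on a single cell times a basis vector. As closed cells may
  have points in common, each point \<open>y\<close> is assigned to one cell \<open>\<kappa> y\<close> that contains it. The choice
  does not matter, because on each entire cell \<open>v\<close> agrees almost everywhere with the local
  function of that cell.
\<close>

lemma finite_dim_piecewise:
  fixes L :: "(real ^ 'd) set \<Rightarrow> (real ^ 'd \<Rightarrow> 'b::euclidean_space) set"
  assumes mesh: "mesh_of \<Omega> D" and L: "\<And>K. K \<in> cells D \<Longrightarrow> L K \<subseteq> mapped_polys l D K"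
  shows "finite_dim_mod null_funs (piecewise \<Omega> (cells D) L)"
proof -
  let ?I = "cells D \<times> (multi_indices l :: ('d \<Rightarrow> nat) set) \<times> (Basis :: 'b set)"
  define \<kappa> where "\<kappa> y = (SOME K. K \<in> cells D \<and> y \<in> K)" for y
  define iv where "iv K = inv_into (ref_cell D K) (cell_map D K)" for K
  define gen where "gen = (\<lambda>(K, \<alpha> :: 'd \<Rightarrow> nat, b :: 'b) y. if \<kappa> y = K then (\<Prod>i\<in>UNIV. (iv K y $ i) ^ \<alpha> i) *\<^sub>R b else 0)"
  have fin: "finite (cells D)" using mesh by (simp add: mesh_of_def)
  hence fin': "finite ?I" by (intro finite_cartesian_product finite_multi_indices finite_Basis)
  have \<kappa>: "\<kappa> y \<in> cells D \<and> y \<in> \<kappa> y" if "y \<in> \<Omega>" for y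
  proof -
    have "y \<in> \<Union>(cells D)" using that mesh closure_subset by (auto simp: mesh_of_def)
    hence "\<exists>K. K \<in> cells D \<and> y \<in> K" by blast
    thus ?thesis unfolding \<kappa>_def by (rule someI_ex)
  qed
  have "\<exists>g\<in>span (gen ` ?I). v - g \<in> null_funs" if v: "v \<in> piecewise \<Omega> (cells D) L" for v
  proof -
    obtain w where w: "\<And>K. K \<in> cells D \<Longrightarrow> w K \<in> L K \<and> ae_eq (K \<inter> \<Omega>) v (w K)"
      using v unfolding piecewise_def mem_Collect_eq by metis
    have "\<exists>c. \<forall>y\<in>K. w K y = (\<Sum>\<alpha> \<in> multi_indices l. (\<Prod>i\<in>UNIV. (iv K y $ i) ^ \<alpha> i) *\<^sub>R c \<alpha>)"
      if K: "K \<in> cells D" for K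
    proof -
      from w[OF K] L[OF K] have "w K \<in> mapped_polys l D K" by blast
      then obtain c where c: "\<forall>x \<in> ref_cell D K. w K (cell_map D K x) = (\<Sum>\<alpha> \<in> multi_indices l. (\<Prod>i\<in>UNIV. (x $ i) ^ \<alpha> i) *\<^sub>R c \<alpha>)"
        by (auto simp: mapped_polys_def polys_def)
      have im: "cell_map D K ` ref_cell D K = K" using mesh K by (auto simp: mesh_of_def)
      show ?thesis
      proof (intro exI[of _ c] ballI)
        fix y assume "y \<in> K"
        hence "iv K y \<in> ref_cell D K" "cell_map D K (iv K y) = y"
          using im by (auto simp: iv_def inv_into_into f_inv_into_f)
        thus "w K y = (\<Sum>\<alpha> \<in> multi_indices l. (\<Prod>i\<in>UNIV. (iv K y $ i) ^ \<alpha> i) *\<^sub>R c \<alpha>)"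
          using c by metis
      qed
    qed
    then obtain c where c: "\<And>K y. K \<in> cells D \<Longrightarrow> y \<in> K \<Longrightarrow>
        w K y = (\<Sum>\<alpha> \<in> multi_indices l. (\<Prod>i\<in>UNIV. (iv K y $ i) ^ \<alpha> i) *\<^sub>R c K \<alpha>)"
      by metis
    define g where "g = (\<Sum>k\<in>?I. (c (fst k) (fst (snd k)) \<bullet> snd (snd k)) *\<^sub>R gen k)"
    have g_span: "g \<in> span (gen ` ?I)"
      unfolding g_def by (intro span_sum span_scale span_base imageI)
    have g_val: "g y = w (\<kappa> y) y" if y: "y \<in> \<Omega>" for y
    proof -
      let ?m = "\<lambda>\<alpha>. \<Prod>i\<in>UNIV. (iv (\<kappa> y) y $ i) ^ \<alpha> i"
      have "g y = (\<Sum>K\<in>cells D. \<Sum>\<alpha>\<in>multi_indices l. \<Sum>b\<in>Basis. (c K \<alpha> \<bullet> b) *\<^sub>R gen (K, \<alpha>, b) y)"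
        by (simp add: g_def sum_fun_apply sum.cartesian_product case_prod_unfold)
      also have "\<dots> = (\<Sum>K\<in>cells D. if K = \<kappa> y then (\<Sum>\<alpha>\<in>multi_indices l. \<Sum>b\<in>Basis. (c K \<alpha> \<bullet> b) *\<^sub>R (?m \<alpha> *\<^sub>R b)) else 0)"
        by (intro sum.cong refl) (auto simp: gen_def)
      also have "\<dots> = (\<Sum>\<alpha>\<in>multi_indices l. \<Sum>b\<in>Basis. (c (\<kappa> y) \<alpha> \<bullet> b) *\<^sub>R (?m \<alpha> *\<^sub>R b))"
        using \<kappa>[OF y] fin by simp
      also have "\<dots> = (\<Sum>\<alpha>\<in>multi_indices l. ?m \<alpha> *\<^sub>R (\<Sum>b\<in>Basis. (c (\<kappa> y) \<alpha> \<bullet> b) *\<^sub>R b))"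
        by (simp add: scaleR_sum_right mult.commute)
      also have "\<dots> = (\<Sum>\<alpha>\<in>multi_indices l. ?m \<alpha> *\<^sub>R c (\<kappa> y) \<alpha>)"
        by (simp add: euclidean_representation)
      also have "\<dots> = w (\<kappa> y) y" using c \<kappa>[OF y] by simp
      finally show ?thesis .
    qed
    have "AE y in lebesgue. \<forall>K\<in>cells D. y \<in> K \<inter> \<Omega> \<longrightarrow> v y = w K y"
      using w mesh fin by (intro AE_finite_allI) (auto simp: ae_eq_cell mesh_of_def)
    hence "AE y in lebesgue. y \<in> \<Omega> \<longrightarrow> v y = g y"
      by (rule eventually_mono) (use \<kappa> g_val in auto)
    hence "v - g \<in> null_funs" by (simp add: null_funs_def ae_eq_diff_0 ae_eq_def AE_\<Omega>_iff)
    thus ?thesis using g_span by blast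
  qed
  thus ?thesis unfolding finite_dim_mod_def using fin' by blast
qed

lemma Vh_piecewise: "Vh \<Omega> D = V \<Omega> \<inter> piecewise \<Omega> (cells D) (V_loc D)"
  by (auto simp: Vh_def piecewise_def)

lemma Qh_piecewise: "Qh \<Omega> D = Q \<Omega> \<inter> piecewise \<Omega> (cells D) (Q_loc D)"
  by (auto simp: Qh_def piecewise_def)

end

subsection \<open>The discrete Stokes projection\<close>

locale fe_space = bounded_open \<Omega> for \<Omega> :: "(real ^ 'd::finite) set" +
  fixes D :: "'d discretization" and l :: nat
  assumes mesh: "mesh_of \<Omega> D"
    and loc: "\<And>K. K \<in> cells D \<Longrightarrow> fun_subspace (V_loc D K) \<and> V_loc D K \<subseteq> mapped_polys l D K \<and>
        fun_subspace (Q_loc D K) \<and> Q_loc D K \<subseteq> mapped_polys l D K"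
    and nonempty: "\<Omega> \<noteq> {}"
begin

lemma subspace_Vh: "subspace (Vh \<Omega> D)"
  unfolding Vh_piecewise using loc by (intro subspace_inter subspace_V subspace_piecewise) blast

lemma subspace_Qh: "subspace (Qh \<Omega> D)"
  unfolding Qh_piecewise using loc by (intro subspace_inter subspace_Q subspace_piecewise) blast

lemma compact_cell: "K \<in> cells D \<Longrightarrow> compact K"
  using mesh by (auto simp: mesh_of_def)

lemma Vh_cong: "ae_eq \<Omega> v w \<Longrightarrow> v \<in> Vh \<Omega> D \<Longrightarrow> w \<in> Vh \<Omega> D"
  unfolding Vh_piecewise using V_cong piecewise_cong compact_cell by blast

lemma Qh_cong: "ae_eq \<Omega> v w \<Longrightarrow> v \<in> Qh \<Omega> D \<Longrightarrow> w \<in> Qh \<Omega> D"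
  unfolding Qh_piecewise using Q_cong piecewise_cong compact_cell by blast

lemma finite_dim_Vh: "finite_dim_mod null_funs (Vh \<Omega> D)"
  by (rule finite_dim_mod_subset[OF finite_dim_piecewise[OF mesh, of "V_loc D" l]])
    (use loc in \<open>auto simp: Vh_piecewise\<close>)

lemma finite_dim_Qh: "finite_dim_mod null_funs (Qh \<Omega> D)"
  by (rule finite_dim_mod_subset[OF finite_dim_piecewise[OF mesh, of "Q_loc D" l]])
    (use loc in \<open>auto simp: Qh_piecewise\<close>)

lemma Vh_V: "v \<in> Vh \<Omega> D \<Longrightarrow> v \<in> V \<Omega>" by (simp add: Vh_def)
lemma Vh_sobolev: "v \<in> Vh \<Omega> D \<Longrightarrow> v \<in> sobolev \<Omega> 1" by (rule V_sobolev[OF Vh_V])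
lemma Vh_L2: "v \<in> Vh \<Omega> D \<Longrightarrow> v \<in> L2 \<Omega>" by (rule V_L2[OF Vh_V])
lemma Qh_Q: "q \<in> Qh \<Omega> D \<Longrightarrow> q \<in> Q \<Omega>" by (simp add: Qh_def)
lemma Qh_L2: "q \<in> Qh \<Omega> D \<Longrightarrow> q \<in> L2 \<Omega>" by (rule Q_L2[OF Qh_Q])

lemmas Vh_intros = subspace_add[OF subspace_Vh] subspace_diff[OF subspace_Vh] subspace_scale[OF subspace_Vh]
lemmas Qh_intros = subspace_add[OF subspace_Qh] subspace_diff[OF subspace_Qh] subspace_scale[OF subspace_Qh]

lemma mesh_size_pos: "0 < mesh_size D"
proof -
  have ne: "cells D \<noteq> {}" "finite (cells D)"
    using mesh nonempty closure_subset[of \<Omega>] by (auto simp: mesh_of_def)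
  then obtain K where K: "K \<in> cells D" by blast
  hence b: "bounded K" "interior K \<noteq> {}" using mesh by (auto simp: mesh_of_def compact_imp_bounded)
  then obtain x e where x: "0 < e" "ball x e \<subseteq> K" by (meson all_not_in_conv mem_interior)
  define y where "y = x + (e / 2) *\<^sub>R axis (SOME i. True) 1"
  have d: "dist x y = e / 2" using x(1) by (simp add: y_def dist_norm norm_axis_1)
  hence "x \<in> K" "y \<in> K" using x by (auto simp: subset_iff)
  hence "e / 2 \<le> diameter K" using diameter_bounded_bound[OF b(1)] d by metis
  hence "0 < diameter K" using x by linarith
  also have "diameter K \<le> mesh_size D"
    unfolding mesh_size_def using K ne by (intro Max_ge) auto
  finally show ?thesis .
qed

lemma semi_inner_Vh: "semi_inner (Vh \<Omega> D) (a_form \<Omega>)"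
  using subspace_Vh
  by (intro semi_inner.intro) (auto simp: a.bilin a.sym a.nonneg Vh_sobolev simp del: One_nat_def)

lemma a_null: "a_form \<Omega> v v = 0 \<Longrightarrow> L2norm \<Omega> (grad \<Omega> v) = 0"
  by (simp add: L2norm_def a_form_def)

lemma b_null: "v \<in> sobolev \<Omega> 1 \<Longrightarrow> q \<in> L2 \<Omega> \<Longrightarrow> a_form \<Omega> v v = 0 \<Longrightarrow> b_form \<Omega> v q = 0"
  using b_bound[of v q] by (simp add: a_null)

text \<open>
  The projection solves a saddle point problem. A null vector of \<open>a\<close> has a gradient that vanishes
  almost everywhere, so \<open>b\<close> and the right-hand side do not see it.
\<close>

lemma stokes_projection_exists:
  assumes w: "w \<in> sobolev \<Omega> 1" and s: "s \<in> L2 \<Omega>"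
  shows "\<exists>w' s'. is_stokes_projection \<Omega> D w s w' s'"
proof -
  have "\<exists>w'\<in>Vh \<Omega> D. \<exists>s'\<in>Qh \<Omega> D. (\<forall>v\<in>Vh \<Omega> D. a_form \<Omega> w' v + b_form \<Omega> v s' = a_form \<Omega> w v + b_form \<Omega> v s) \<and>
      (\<forall>q\<in>Qh \<Omega> D. b_form \<Omega> w' q = 0)"
  proof (rule saddle_point_exists[where Z = null_funs and Y = null_funs, OF semi_inner_Vh subspace_Qh
        finite_dim_Vh subspace_null_funs _ finite_dim_Qh subspace_null_funs])
    fix z assume "z \<in> Vh \<Omega> D" "z \<in> null_funs"
    hence "a_form \<Omega> z z = a_form \<Omega> 0 0" by (intro a_form_cong) (auto simp: null_funs_def)
    also have "\<dots> = 0" by (rule a.zero_left[OF a.S_0])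
    finally show "a_form \<Omega> z z = 0" .
  next
    fix q v assume q: "q \<in> Qh \<Omega> D" "q \<in> null_funs" and v: "v \<in> Vh \<Omega> D"
    have "b_form \<Omega> v q = b_form \<Omega> v (0 *\<^sub>R q)" using q by (intro b_form_cong) (auto simp: null_funs_def)
    also have "\<dots> = 0" using b_scale2[OF Vh_sobolev[OF v] Qh_L2[OF q(1)], of 0] by simp
    finally show "b_form \<Omega> v q = 0" .
  next
    fix v assume v: "v \<in> Vh \<Omega> D" "a_form \<Omega> v v = 0"
    have "a_form \<Omega> w v = 0"
      using a.null_left[OF Vh_sobolev[OF v(1)] w v(2)] a.sym[OF w Vh_sobolev[OF v(1)]] by simp
    thus "a_form \<Omega> w v + b_form \<Omega> v s = 0" using b_null[OF Vh_sobolev[OF v(1)] s v(2)] by simp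
  qed (use w s in \<open>simp_all add: b_bilin a.bilin b_null Vh_sobolev Qh_L2 distrib_left del: One_nat_def\<close>)
  thus ?thesis by (auto simp: is_stokes_projection_def)
qed

text \<open>
  The inf-sup condition in dual form: the norm of the functional \<open>b_form \<Omega> _ q\<close> controls the norm
  of \<open>q\<close>. Here neither suprema nor quotients occur.
\<close>

definition inf_sup_const :: "real \<Rightarrow> bool"
  where "inf_sup_const \<beta> \<longleftrightarrow> (\<forall>q \<in> Qh \<Omega> D. \<forall>M\<ge>0.
    (\<forall>v \<in> Vh \<Omega> D. b_form \<Omega> v q \<le> M * sobolev_norm \<Omega> 1 v) \<longrightarrow> \<beta> * L2norm \<Omega> q \<le> M)"

lemma inf_sup_constD:
  assumes "inf_sup_const \<beta>" "q \<in> Qh \<Omega> D" "0 \<le> M"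
    and "\<And>v. v \<in> Vh \<Omega> D \<Longrightarrow> b_form \<Omega> v q \<le> M * sobolev_norm \<Omega> 1 v"
  shows "\<beta> * L2norm \<Omega> q \<le> M"
  using assms by (auto simp: inf_sup_const_def simp del: One_nat_def)

lemma inf_sup_constI:
  assumes infsup: "ereal \<beta> \<le> (INF q \<in> {q \<in> Qh \<Omega> D. \<not> ae_eq \<Omega> q (\<lambda>x. 0)}.
     SUP v \<in> {v \<in> Vh \<Omega> D. \<not> ae_eq \<Omega> v (\<lambda>x. 0)}.
       ereal (- ip \<Omega> (divergence \<Omega> v) q / (sobolev_norm \<Omega> 1 v * L2norm \<Omega> q)))"
  shows "inf_sup_const \<beta>"
  unfolding inf_sup_const_def
proof (intro ballI allI impI)
  fix q M assume q: "q \<in> Qh \<Omega> D" and M: "(0::real) \<le> M"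
    and "\<forall>v \<in> Vh \<Omega> D. b_form \<Omega> v q \<le> M * sobolev_norm \<Omega> 1 v"
  hence bnd: "b_form \<Omega> v q \<le> M * sobolev_norm \<Omega> 1 v" if "v \<in> Vh \<Omega> D" for v
    using that by blast
  show "\<beta> * L2norm \<Omega> q \<le> M"
  proof (cases "ae_eq \<Omega> q 0")
    case True
    thus ?thesis using M L2norm_eq_0_iff[OF Qh_L2[OF q]] by simp
  next
    case False
    have qpos: "0 < L2norm \<Omega> q"
      using False L2norm_eq_0_iff[OF Qh_L2[OF q]] L2norm_nonneg[of q] by linarith
    have "ereal \<beta> \<le> (SUP v \<in> {v \<in> Vh \<Omega> D. \<not> ae_eq \<Omega> v (\<lambda>x. 0)}.
         ereal (- ip \<Omega> (divergence \<Omega> v) q / (sobolev_norm \<Omega> 1 v * L2norm \<Omega> q)))"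
      by (rule order_trans[OF infsup INF_lower]) (use q False in \<open>simp add: zero_fun_def\<close>)
    also have "\<dots> \<le> ereal (M / L2norm \<Omega> q)"
    proof (rule SUP_least)
      fix v assume "v \<in> {v \<in> Vh \<Omega> D. \<not> ae_eq \<Omega> v (\<lambda>x. 0)}"
      hence v: "v \<in> Vh \<Omega> D" "\<not> ae_eq \<Omega> v 0" by (auto simp: zero_fun_def)
      have "0 < sobolev_norm \<Omega> 1 v"
        using L2norm_le_sobolev_norm[OF Vh_L2[OF v(1)], of 1] L2norm_nonneg[of v]
          L2norm_eq_0_iff[OF Vh_L2[OF v(1)]] v(2) by linarith
      hence "b_form \<Omega> v q / (sobolev_norm \<Omega> 1 v * L2norm \<Omega> q) \<le> M / L2norm \<Omega> q"
        using bnd[OF v(1)] qpos by (simp add: field_simps)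
      thus "ereal (- ip \<Omega> (divergence \<Omega> v) q / (sobolev_norm \<Omega> 1 v * L2norm \<Omega> q)) \<le> ereal (M / L2norm \<Omega> q)"
        by (simp add: b_form_def)
    qed
    finally have "\<beta> \<le> M / L2norm \<Omega> q" by simp
    thus ?thesis using qpos by (simp add: field_simps)
  qed
qed

text \<open>
  The differences \<open>E = w' - iw\<close> and \<open>P = s' - js\<close> solve a discrete Stokes system whose data are
  the interpolation errors, of size \<open>g\<close>. The inf-sup condition bounds \<open>P\<close> by the data and the
  gradient of \<open>E\<close>. Testing the first equation with \<open>E\<close> leaves the term \<open>b(E, P)\<close>, which equals
  \<open>b(w - iw, P)\<close> because \<open>b(w, P)\<close> and \<open>b(w', P)\<close> vanish, and hence is small, too. What results is
  a quadratic inequality for the norm of the gradient of \<open>E\<close>.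
\<close>

lemma stokes_projection_error:
  assumes w: "w \<in> Vdiv \<Omega>" and s: "s \<in> Q \<Omega>" and proj: "is_stokes_projection \<Omega> D w s w' s'"
    and \<beta>: "0 < \<beta>" and infsup: "inf_sup_const \<beta>"
    and v: "iw \<in> Vh \<Omega> D" "L2norm \<Omega> (grad \<Omega> (w - iw)) \<le> N"
    and q: "js \<in> Qh \<Omega> D" "L2norm \<Omega> (s - js) \<le> N"
  defines "c \<equiv> 1 / \<beta>" and "m \<equiv> 1 + real CARD('d)"
  shows "L2norm \<Omega> (grad \<Omega> (w - w')) \<le> (1 + 2 * (1 + c) * m) * N"
    and "L2norm \<Omega> (s - s') \<le> (1 + c * (m + 2 * (1 + c) * m)) * N"
proof -
  note sL = Q_L2[OF s]
  have wV: "w \<in> V \<Omega>" using w by (simp add: Vdiv_def)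
  note wS = V_sobolev[OF wV]
  have w': "w' \<in> Vh \<Omega> D" and s': "s' \<in> Qh \<Omega> D"
    and eq: "\<And>v. v \<in> Vh \<Omega> D \<Longrightarrow> a_form \<Omega> w' v + b_form \<Omega> v s' = a_form \<Omega> w v + b_form \<Omega> v s"
    and div: "\<And>q. q \<in> Qh \<Omega> D \<Longrightarrow> b_form \<Omega> w' q = 0"
    using proj by (auto simp: is_stokes_projection_def)
  note S = wS sL Vh_sobolev[OF w'] Qh_L2[OF s'] Vh_sobolev[OF v(1)] Qh_L2[OF q(1)]
  define E where "E = w' - iw"
  define P where "P = s' - js"
  have E: "E \<in> Vh \<Omega> D" unfolding E_def by (intro Vh_intros w' v)
  have P: "P \<in> Qh \<Omega> D" unfolding P_def by (intro Qh_intros s' q)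
  have N: "0 \<le> N" using L2norm_nonneg v(2) order_trans by blast
  have c: "0 \<le> c" using \<beta> by (simp add: c_def)
  define g where "g = m * N"
  have g: "0 \<le> g" using N by (simp add: g_def m_def)
  have wi: "w - iw \<in> sobolev \<Omega> 1" and sj: "s - js \<in> L2 \<Omega>" by (intro a.S_diff S L2.S_diff)+
  have eqE: "a_form \<Omega> E v + b_form \<Omega> v P = a_form \<Omega> (w - iw) v + b_form \<Omega> v (s - js)" if "v \<in> Vh \<Omega> D" for v
    using eq[OF that] S Vh_sobolev[OF that] by (simp add: E_def P_def a.bilin b_bilin del: One_nat_def)
  have G: "\<bar>a_form \<Omega> (w - iw) v + b_form \<Omega> v (s - js)\<bar> \<le> g * L2norm \<Omega> (grad \<Omega> v)" if "v \<in> Vh \<Omega> D" for v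
  proof -
    note vS = Vh_sobolev[OF that]
    have "\<bar>a_form \<Omega> (w - iw) v\<bar> \<le> L2norm \<Omega> (grad \<Omega> (w - iw)) * L2norm \<Omega> (grad \<Omega> v)"
      using a.Cauchy_Schwarz[OF wi vS] by (simp add: a_nrm)
    also have "\<dots> \<le> N * L2norm \<Omega> (grad \<Omega> v)" by (intro mult_right_mono v L2norm_nonneg)
    finally have 1: "\<bar>a_form \<Omega> (w - iw) v\<bar> \<le> N * L2norm \<Omega> (grad \<Omega> v)" .
    have "\<bar>b_form \<Omega> v (s - js)\<bar> \<le> real CARD('d) * L2norm \<Omega> (grad \<Omega> v) * L2norm \<Omega> (s - js)"
      by (rule b_bound[OF vS sj])
    also have "\<dots> \<le> real CARD('d) * L2norm \<Omega> (grad \<Omega> v) * N"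
      by (intro mult_left_mono q mult_nonneg_nonneg L2norm_nonneg) simp
    finally show ?thesis using 1 by (simp add: g_def m_def algebra_simps)
  qed
  have bEP: "\<bar>b_form \<Omega> E P\<bar> \<le> g * L2norm \<Omega> P"
  proof -
    have "b_form \<Omega> w P = 0" using w Qh_Q[OF P] by (simp add: Vdiv_def b_form_def)
    hence "b_form \<Omega> E P = b_form \<Omega> (w - iw) P"
      using div[OF P] S Qh_L2[OF P] by (simp add: E_def b_bilin del: One_nat_def)
    also have "\<bar>\<dots>\<bar> \<le> real CARD('d) * L2norm \<Omega> (grad \<Omega> (w - iw)) * L2norm \<Omega> P"
      by (rule b_bound[OF wi Qh_L2[OF P]])
    also have "\<dots> \<le> real CARD('d) * N * L2norm \<Omega> P"
      by (intro mult_right_mono mult_left_mono v L2norm_nonneg) simp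
    also have "\<dots> \<le> g * L2norm \<Omega> P"
      using N by (intro mult_right_mono L2norm_nonneg) (simp add: g_def m_def distrib_right)
    finally show ?thesis .
  qed
  define x where "x = L2norm \<Omega> (grad \<Omega> E)"
  have x: "0 \<le> x" unfolding x_def by (rule L2norm_nonneg)
  have "\<beta> * L2norm \<Omega> P \<le> g + x"
  proof (rule inf_sup_constD[OF infsup P])
    show "0 \<le> g + x" using g x by simp
    fix v assume v: "v \<in> Vh \<Omega> D"
    have "\<bar>a_form \<Omega> E v\<bar> \<le> x * L2norm \<Omega> (grad \<Omega> v)"
      using a.Cauchy_Schwarz[OF Vh_sobolev[OF E] Vh_sobolev[OF v]] by (simp add: a_nrm x_def)
    hence "b_form \<Omega> v P \<le> (g + x) * L2norm \<Omega> (grad \<Omega> v)"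
      using eqE[OF v] G[OF v] by (simp add: distrib_right)
    also have "\<dots> \<le> (g + x) * sobolev_norm \<Omega> 1 v"
      using g x by (intro mult_left_mono L2norm_grad_le Vh_sobolev[OF v]) auto
    finally show "b_form \<Omega> v P \<le> (g + x) * sobolev_norm \<Omega> 1 v" .
  qed
  hence Pb: "L2norm \<Omega> P \<le> c * (g + x)" using \<beta> by (simp add: c_def field_simps)
  have "x * x = a_form \<Omega> E E" using a.nrm_self[OF Vh_sobolev[OF E]] by (simp add: a_nrm x_def)
  also have "\<dots> \<le> g * x + g * L2norm \<Omega> P"
    using eqE[OF E] G[OF E] bEP by (simp add: x_def)
  also have "\<dots> \<le> g * x + g * (c * (g + x))" using Pb g by (intro add_left_mono mult_left_mono)
  finally have xb: "x \<le> 2 * (1 + c) * g" by (rule quadratic_bound[OF x g c])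
  have "L2norm \<Omega> (grad \<Omega> (w - w')) \<le> L2norm \<Omega> (grad \<Omega> (w - iw)) + L2norm \<Omega> (grad \<Omega> E)"
    using a.nrm_diff_triangle[OF wi Vh_sobolev[OF E]] by (simp add: a_nrm E_def)
  also have "\<dots> \<le> N + 2 * (1 + c) * g" using v xb by (simp add: x_def)
  finally show "L2norm \<Omega> (grad \<Omega> (w - w')) \<le> (1 + 2 * (1 + c) * m) * N"
    by (simp add: g_def algebra_simps)
  have "L2norm \<Omega> (s - s') \<le> L2norm \<Omega> (s - js) + L2norm \<Omega> P"
    using L2.nrm_diff_triangle[OF sj Qh_L2[OF P]] by (simp add: L2norm_eq_nrm P_def)
  also have "\<dots> \<le> N + c * (g + 2 * (1 + c) * g)"
  proof -
    have "c * (g + x) \<le> c * (g + 2 * (1 + c) * g)" using xb c by (intro mult_left_mono) auto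
    thus ?thesis using q(2) Pb by linarith
  qed
  finally show "L2norm \<Omega> (s - s') \<le> (1 + c * (m + 2 * (1 + c) * m)) * N"
    by (simp add: g_def algebra_simps)
qed

text \<open>
  The projection is a relation between representatives, and this is the form its linearity takes.
\<close>

lemma stokes_projection_diff:
  assumes "is_stokes_projection \<Omega> D w s w' s'" "is_stokes_projection \<Omega> D z q z' q'"
    and S: "w \<in> sobolev \<Omega> 1" "s \<in> L2 \<Omega>" "z \<in> sobolev \<Omega> 1" "q \<in> L2 \<Omega>"
  shows "is_stokes_projection \<Omega> D (k *\<^sub>R (w - z)) (k *\<^sub>R (s - q)) (k *\<^sub>R (w' - z')) (k *\<^sub>R (s' - q'))"
proof -
  from assms(1,2) have h: "w' \<in> Vh \<Omega> D" "s' \<in> Qh \<Omega> D" "z' \<in> Vh \<Omega> D" "q' \<in> Qh \<Omega> D"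
    by (auto simp: is_stokes_projection_def)
  show ?thesis
    unfolding is_stokes_projection_def
  proof (intro conjI ballI)
    show "k *\<^sub>R (w' - z') \<in> Vh \<Omega> D" "k *\<^sub>R (s' - q') \<in> Qh \<Omega> D"
      using h by (auto intro!: Vh_intros Qh_intros)
    show "b_form \<Omega> (k *\<^sub>R (w' - z')) qq = 0" if "qq \<in> Qh \<Omega> D" for qq
      using assms(1,2) h that
      by (simp add: b_bilin Vh_sobolev Qh_L2 a.S_intros is_stokes_projection_def del: One_nat_def)
    fix v assume v: "v \<in> Vh \<Omega> D"
    have "a_form \<Omega> w' v + b_form \<Omega> v s' = a_form \<Omega> w v + b_form \<Omega> v s"
      "a_form \<Omega> z' v + b_form \<Omega> v q' = a_form \<Omega> z v + b_form \<Omega> v q"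
      using assms(1,2) v by (auto simp: is_stokes_projection_def)
    hence "k * ((a_form \<Omega> w' v + b_form \<Omega> v s') - (a_form \<Omega> z' v + b_form \<Omega> v q')) =
        k * ((a_form \<Omega> w v + b_form \<Omega> v s) - (a_form \<Omega> z v + b_form \<Omega> v q))" by simp
    thus "a_form \<Omega> (k *\<^sub>R (w' - z')) v + b_form \<Omega> v (k *\<^sub>R (s' - q')) =
        a_form \<Omega> (k *\<^sub>R (w - z)) v + b_form \<Omega> v (k *\<^sub>R (s - q))"
      using h v S by (simp add: b_bilin a.bilin Vh_sobolev Qh_L2 a.S_intros L2.S_intros algebra_simps del: One_nat_def)
  qed
qed

end

section \<open>Limits of square-integrable functions\<close>

context bounded_open
begin

text \<open>
  Right-sided limits and time derivatives are defined by a choice among all limits. Uniqueness up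
  to null sets allows any computed limit in place of the chosen one.
\<close>

lemma L2_limit_unique:
  fixes w :: "real \<Rightarrow> real ^ 'd \<Rightarrow> 'b::euclidean_space"
  assumes F: "F \<noteq> bot" and w: "\<forall>\<^sub>F s in F. w s \<in> L2 \<Omega>" and g: "g \<in> L2 \<Omega>" "g' \<in> L2 \<Omega>"
    and l: "((\<lambda>s. L2norm \<Omega> (w s - g)) \<longlongrightarrow> 0) F" "((\<lambda>s. L2norm \<Omega> (w s - g')) \<longlongrightarrow> 0) F"
  shows "ae_eq \<Omega> g g'"
proof -
  have "((\<lambda>s. L2norm \<Omega> (w s - g) + L2norm \<Omega> (w s - g')) \<longlongrightarrow> 0 + 0) F"
    by (intro tendsto_add l)
  moreover have "\<forall>\<^sub>F s in F. L2norm \<Omega> (g - g') \<le> L2norm \<Omega> (w s - g) + L2norm \<Omega> (w s - g')"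
    using w
  proof eventually_elim
    case (elim s)
    have "g - g' = (w s - g') - (w s - g)" by simp
    thus ?case using L2.nrm_diff_triangle[OF L2.S_diff[OF elim g(2)] L2.S_diff[OF elim g(1)]]
      by (simp add: L2norm_eq_nrm add.commute)
  qed
  ultimately have "L2norm \<Omega> (g - g') \<le> 0"
    using F by (intro tendsto_le[OF _ _ tendsto_const, of F]) auto
  hence "L2norm \<Omega> (g - g') = 0" using L2norm_nonneg[of "g - g'"] by simp
  thus ?thesis using L2norm_eq_0_iff[OF L2.S_diff[OF g]] by (simp add: ae_eq_diff_0)
qed

lemma right_limit_unique:
  fixes w :: "real \<Rightarrow> real ^ 'd \<Rightarrow> 'b::euclidean_space"
  assumes w: "\<forall>\<^sub>F s in at_right t. w s \<in> L2 \<Omega>" and g: "g \<in> L2 \<Omega>"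
    and l: "((\<lambda>s. L2norm \<Omega> (w s - g)) \<longlongrightarrow> 0) (at_right t)"
  shows "ae_eq \<Omega> (right_limit \<Omega> w t) g"
proof -
  have "right_limit \<Omega> w t \<in> L2 \<Omega> \<and> ((\<lambda>s. L2norm \<Omega> (\<lambda>x. w s x - right_limit \<Omega> w t x)) \<longlongrightarrow> 0) (at_right t)"
    unfolding right_limit_def by (rule someI[of _ g]) (use g l in \<open>simp add: fun_diff_def\<close>)
  thus ?thesis
    using g l by (intro L2_limit_unique[OF _ w]) (auto simp: fun_diff_def)
qed

lemma tderiv_unique:
  fixes w :: "real \<Rightarrow> real ^ 'd \<Rightarrow> 'b::euclidean_space"
  assumes J: "at t within J \<noteq> bot" "t \<in> J" and w: "\<And>s. s \<in> J \<Longrightarrow> w s \<in> L2 \<Omega>" and g: "g \<in> L2 \<Omega>"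
    and l: "((\<lambda>s. L2norm \<Omega> ((w s - w t) /\<^sub>R (s - t) - g)) \<longlongrightarrow> 0) (at t within J)"
  shows "ae_eq \<Omega> (tderiv \<Omega> J w t) g"
proof -
  have eq: "(w s - w t) /\<^sub>R (s - t) - h = (\<lambda>x. (w s x - w t x) /\<^sub>R (s - t) - h x)" for s h
    by (simp add: fun_eq_iff)
  have "tderiv \<Omega> J w t \<in> L2 \<Omega> \<and>
    ((\<lambda>s. L2norm \<Omega> (\<lambda>x. (w s x - w t x) /\<^sub>R (s - t) - tderiv \<Omega> J w t x)) \<longlongrightarrow> 0) (at t within J)"
    unfolding tderiv_def by (rule someI[of _ g]) (use g l in \<open>simp add: eq\<close>)
  moreover have "\<forall>\<^sub>F s in at t within J. (w s - w t) /\<^sub>R (s - t) \<in> L2 \<Omega>"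
    using w J(2) by (auto simp: eventually_at_topological intro!: exI[of _ UNIV] L2.S_intros)
  ultimately show ?thesis
    using g l by (intro L2_limit_unique[OF J(1), of "\<lambda>s. (w s - w t) /\<^sub>R (s - t)"]) (auto simp: eq)
qed

end

lemma integral_affine:
  fixes \<alpha> \<beta> :: real
  assumes "a \<le> b"
  shows "(LBINT s:{a<..b}. \<alpha> + s * \<beta>) = (b - a) * (\<alpha> + (a + b) / 2 * \<beta>)"
proof -
  have "(LBINT s:{a<..b}. \<alpha> + s * \<beta>) = (LBINT s=ereal a..ereal b. \<alpha> + s * \<beta>)"
    using assms by (simp add: interval_integral_Ioc)
  also have "\<dots> = (\<alpha> * b + b\<^sup>2 / 2 * \<beta>) - (\<alpha> * a + a\<^sup>2 / 2 * \<beta>)"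
    by (rule interval_integral_FTC_finite[where F = "\<lambda>s. \<alpha> * s + s\<^sup>2 / 2 * \<beta>"])
      (auto intro!: continuous_intros derivative_eq_intros simp flip: has_real_derivative_iff_has_vector_derivative)
  finally show ?thesis by (simp add: power2_eq_square field_simps)
qed

section \<open>The scheme as a Crank-Nicolson method\<close>

lemma time_meshD:
  assumes "time_mesh T N t"
  shows "2 \<le> N" "t 0 = 0" "t N = T" "\<And>n. n < N \<Longrightarrow> t n < t (Suc n)"
  using assms by (auto simp: time_mesh_def)

lemma time_mesh_less:
  assumes "time_mesh T N t" "m < n" "n \<le> N"
  shows "t m < t n"
  using assms(2,3)
proof (induction n)
  case (Suc n)
  have "t n < t (Suc n)" using time_meshD(4)[OF assms(1)] Suc.prems by simp
  with Suc show ?case by (cases "m = n") auto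
qed simp

lemma time_mesh_le:
  assumes "time_mesh T N t" "m \<le> n" "n \<le> N"
  shows "t m \<le> t n"
  using time_mesh_less[OF assms(1), of m n] assms(2,3) by (cases "m = n") auto

lemma step_pos: "time_mesh T N t \<Longrightarrow> n \<in> {1..N} \<Longrightarrow> 0 < step t n"
  using time_mesh_less[of T N t "n - 1" n] by (simp add: step_def)

lemma sum_step: "time_mesh T N t \<Longrightarrow> (\<Sum>n=1..N. step t n) = T"
  using sum_telescope''[of 0 N t] time_meshD(2,3)[of T N t] time_meshD(1)[of T N t]
  by (simp add: step_def)

context fe_space
begin

lemma Vhdiv_iff: "v \<in> Vhdiv \<Omega> D \<longleftrightarrow> v \<in> Vh \<Omega> D \<and> (\<forall>q \<in> Qh \<Omega> D. b_form \<Omega> v q = 0)"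
  by (auto simp: Vhdiv_def b_form_def)

lemma subspace_Vhdiv: "subspace (Vhdiv \<Omega> D)"
proof (rule subspaceI)
  show "0 \<in> Vhdiv \<Omega> D"
    using subspace_0[OF subspace_Vh] b_scale1[OF a.S_0, of _ 0] by (auto simp: Vhdiv_iff Qh_L2)
  fix v w and c :: real assume v: "v \<in> Vhdiv \<Omega> D"
  thus "c *\<^sub>R v \<in> Vhdiv \<Omega> D"
    by (auto simp: Vhdiv_iff b_bilin Vh_sobolev Qh_L2 intro: Vh_intros simp del: One_nat_def)
  assume "w \<in> Vhdiv \<Omega> D"
  with v show "v + w \<in> Vhdiv \<Omega> D"
    by (auto simp: Vhdiv_iff b_bilin Vh_sobolev Qh_L2 intro: Vh_intros simp del: One_nat_def)
qed

lemma Vhdiv_cong: "ae_eq \<Omega> v w \<Longrightarrow> v \<in> Vhdiv \<Omega> D \<Longrightarrow> w \<in> Vhdiv \<Omega> D"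
  using Vh_cong[of v w] b_form_cong[of v w q q for q] by (auto simp: Vhdiv_iff)

text \<open>
  On \<open>I\<^sub>n\<close> the velocity is \<open>A + s *\<^sub>R B\<close> with the constant time derivative \<open>B\<close>, and its limit at the
  left end is \<open>uh (t (n - 1))\<close> by the continuity condition. All integrands are affine in time, so
  each integral is the value at the midpoint times the length of the step. For the divergence this
  yields a condition on the mean value of the velocities at both ends, written here as a change of
  sign.
\<close>

lemma scheme_step:
  assumes sch: "scheme_G \<Omega> D N t f u0h uh ph" and tm: "time_mesh T N t" and n: "n \<in> {1..N}"
  shows "uh (t n) \<in> Vh \<Omega> D" "uh (t (n - 1)) \<in> Vh \<Omega> D" "ph (midpt t n) \<in> Qh \<Omega> D"
    "\<And>q. q \<in> Qh \<Omega> D \<Longrightarrow> b_form \<Omega> (uh (t n)) q = - b_form \<Omega> (uh (t (n - 1))) q"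
    "\<And>v. v \<in> Vh \<Omega> D \<Longrightarrow>
       ip \<Omega> ((1 / step t n) *\<^sub>R (uh (t n) - uh (t (n - 1)))) v +
       a_form \<Omega> ((1/2) *\<^sub>R (uh (t n) + uh (t (n - 1)))) v + b_form \<Omega> v (ph (midpt t n))
       = 1 / 2 * ip \<Omega> (f (t (n - 1)) + f (t n)) v"
proof -
  define a where "a = t (n - 1)"
  define b where "b = t n"
  define m where "m = (a + b) / 2"
  define J where "J = subint t n"
  have ab: "a < b" using time_mesh_less[OF tm, of "n - 1" n] n by (simp add: a_def b_def)
  have J: "J = {a<..b}" by (simp add: J_def subint_def a_def b_def)
  have step: "step t n = b - a" by (simp add: step_def a_def b_def)
  have mid: "midpt t n = m" by (simp add: midpt_def m_def a_def b_def)
  have mJ: "m \<in> J" "b \<in> J" using ab by (auto simp: J m_def)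
  from sch n have 
    P1: "uh \<in> P1 \<Omega> J (Vh \<Omega> D)" "ph \<in> P1 \<Omega> J (Qh \<Omega> D)"
    and rl: "ae_eq \<Omega> (right_limit \<Omega> uh a) (uh a)"
    and eq: "\<And>v. v \<in> Vh \<Omega> D \<Longrightarrow>
          (LBINT s:J. ip \<Omega> (tderiv \<Omega> J uh s) v + a_form \<Omega> (uh s) v + b_form \<Omega> v (ph s))
          = step t n / 2 * ip \<Omega> (\<lambda>x. f (t (n - 1)) x + f (t n) x) v"
    and div: "\<And>q. q \<in> Qh \<Omega> D \<Longrightarrow> (LBINT s:J. b_form \<Omega> (uh s) q) = 0"
    by (auto simp: scheme_G_def J_def a_def)
  have aff: "(\<lambda>x. f x + s *\<^sub>R g x) = f + s *\<^sub>R g" for f g :: "real ^ 'd \<Rightarrow> 'b::real_vector" and s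
    by (simp add: fun_eq_iff)
  obtain A B where A: "A \<in> Vh \<Omega> D" and B: "B \<in> Vh \<Omega> D" and u: "\<And>s. s \<in> J \<Longrightarrow> ae_eq \<Omega> (uh s) (A + s *\<^sub>R B)"
    using P1(1) unfolding P1_def aff by blast
  obtain C E where C: "C \<in> Qh \<Omega> D" and E: "E \<in> Qh \<Omega> D" and p: "\<And>s. s \<in> J \<Longrightarrow> ae_eq \<Omega> (ph s) (C + s *\<^sub>R E)"
    using P1(2) unfolding P1_def aff by blast
  have AB: "A + s *\<^sub>R B \<in> Vh \<Omega> D" for s by (intro Vh_intros A B)
  have CE: "C + s *\<^sub>R E \<in> Qh \<Omega> D" for s by (intro Qh_intros C E)
  have uJ: "uh s \<in> L2 \<Omega>" if "s \<in> J" for s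
    using L2_cong[OF ae_eq_sym[OF u[OF that]] Vh_L2[OF AB]] .
  have ua: "ae_eq \<Omega> (uh a) (A + a *\<^sub>R B)"
  proof (rule ae_eq_trans[OF ae_eq_sym[OF rl] right_limit_unique])
    have ev: "\<forall>\<^sub>F s in at_right a. s \<in> J"
      unfolding J using ab by (auto simp: eventually_at_right_field intro!: exI[of _ b])
    show "\<forall>\<^sub>F s in at_right a. uh s \<in> L2 \<Omega>" using ev by eventually_elim (rule uJ)
    have "((\<lambda>s. \<bar>s - a\<bar> * L2norm \<Omega> B) \<longlongrightarrow> \<bar>a - a\<bar> * L2norm \<Omega> B) (at_right a)" by (intro tendsto_intros)
    hence "((\<lambda>s. \<bar>s - a\<bar> * L2norm \<Omega> B) \<longlongrightarrow> 0) (at_right a)" by simp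
    moreover have "\<forall>\<^sub>F s in at_right a. \<bar>s - a\<bar> * L2norm \<Omega> B = L2norm \<Omega> (uh s - (A + a *\<^sub>R B))"
      using ev
    proof eventually_elim
      case (elim s)
      have "ae_eq \<Omega> (uh s - (A + a *\<^sub>R B)) ((A + s *\<^sub>R B) - (A + a *\<^sub>R B))"
        by (intro ae_eq_diff u elim ae_eq_refl)
      also have "(A + s *\<^sub>R B) - (A + a *\<^sub>R B) = (s - a) *\<^sub>R B" by (simp add: algebra_simps)
      finally have "L2norm \<Omega> (uh s - (A + a *\<^sub>R B)) = L2norm \<Omega> ((s - a) *\<^sub>R B)" by (rule L2norm_cong)
      thus ?case using L2.nrm_scale[OF Vh_L2[OF B]] by (simp add: L2norm_eq_nrm)
    qed
    ultimately show "((\<lambda>s. L2norm \<Omega> (uh s - (A + a *\<^sub>R B))) \<longlongrightarrow> 0) (at_right a)"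
      by (rule Lim_transform_eventually)
  qed (rule Vh_L2[OF AB])
  note ub = u[OF mJ(2)]
  show mem: "uh (t n) \<in> Vh \<Omega> D" "uh (t (n - 1)) \<in> Vh \<Omega> D" "ph (midpt t n) \<in> Qh \<Omega> D"
    using Vh_cong[OF ae_eq_sym[OF ub] AB] Vh_cong[OF ae_eq_sym[OF ua] AB] Qh_cong[OF ae_eq_sym[OF p[OF mJ(1)]] CE]
    by (simp_all add: a_def b_def mid)
  have dB: "ae_eq \<Omega> ((1 / step t n) *\<^sub>R (uh (t n) - uh (t (n - 1)))) B"
  proof -
    have eq: "(1 / step t n) *\<^sub>R ((A + b *\<^sub>R B) - (A + a *\<^sub>R B)) = B"
    proof -
      have "(A + b *\<^sub>R B) - (A + a *\<^sub>R B) = (b - a) *\<^sub>R B" by (simp add: algebra_simps)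
      thus ?thesis using ab by (simp add: step)
    qed
    show ?thesis
      using ae_eq_scaleR[OF ae_eq_diff[OF ub ua], of "1 / step t n"] unfolding eq by (simp only: a_def b_def)
  qed
  have avg: "ae_eq \<Omega> ((1/2) *\<^sub>R (uh (t n) + uh (t (n - 1)))) (A + m *\<^sub>R B)"
  proof -
    have eq: "(1/2) *\<^sub>R ((A + b *\<^sub>R B) + (A + a *\<^sub>R B)) = A + m *\<^sub>R B"
    proof -
      have "(A + b *\<^sub>R B) + (A + a *\<^sub>R B) = 2 *\<^sub>R (A + m *\<^sub>R B)"
      proof -
        have "2 * m = a + b" by (simp add: m_def)
        thus ?thesis unfolding scaleR_add_right scaleR_scaleR by (simp add: scaleR_2 scaleR_add_left)
      qed
      thus ?thesis by simp
    qed
    show ?thesis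
      using ae_eq_scaleR[OF ae_eq_add[OF ub ua], of "1/2"] unfolding eq by (simp only: a_def b_def)
  qed
  have td: "ae_eq \<Omega> (tderiv \<Omega> J uh s) B" if s: "s \<in> J" for s
  proof (rule tderiv_unique[OF _ s uJ Vh_L2[OF B]])
    show "at s within J \<noteq> bot"
    proof -
      have "s islimpt J"
      proof (rule connected_imp_perfect)
        have "(a + s) / 2 \<in> J" "(a + s) / 2 \<noteq> s" using s by (auto simp: J)
        thus "\<And>x. J \<noteq> {x}" using s by auto
      qed (use s in \<open>auto simp: J\<close>)
      thus ?thesis by (simp add: trivial_limit_within)
    qed
    show "((\<lambda>r. L2norm \<Omega> ((uh r - uh s) /\<^sub>R (r - s) - B)) \<longlongrightarrow> 0) (at s within J)"
    proof (rule Lim_transform_eventually[OF tendsto_const])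
      have "L2norm \<Omega> ((uh r - uh s) /\<^sub>R (r - s) - B) = 0" if r: "r \<in> J" "r \<noteq> s" for r
      proof -
        have "ae_eq \<Omega> ((uh r - uh s) /\<^sub>R (r - s) - B) (((A + r *\<^sub>R B) - (A + s *\<^sub>R B)) /\<^sub>R (r - s) - B)"
          by (intro ae_eq_diff ae_eq_scaleR u s r ae_eq_refl)
        also have "(A + r *\<^sub>R B) - (A + s *\<^sub>R B) = (r - s) *\<^sub>R B" by (simp add: algebra_simps)
        also have "((r - s) *\<^sub>R B) /\<^sub>R (r - s) - B = 0" using r by simp
        finally show ?thesis
          using L2norm_eq_0_iff L2_cong[OF ae_eq_sym _] L2_zero by blast
      qed
      thus "\<forall>\<^sub>F r in at s within J. 0 = L2norm \<Omega> ((uh r - uh s) /\<^sub>R (r - s) - B)"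
        by (auto simp: eventually_at_topological intro!: exI[of _ UNIV])
    qed
  qed
  have bm: "b_form \<Omega> (A + m *\<^sub>R B) q = 0" if q: "q \<in> Qh \<Omega> D" for q
  proof -
    have "0 = (LBINT s:J. b_form \<Omega> A q + s * b_form \<Omega> B q)"
      unfolding div[OF q, symmetric]
    proof (rule set_lebesgue_integral_cong)
      show "\<forall>s. s \<in> J \<longrightarrow> b_form \<Omega> (uh s) q = b_form \<Omega> A q + s * b_form \<Omega> B q"
        using b_form_cong[OF u ae_eq_refl, of _ q] A B q
        by (auto simp: b_bilin Vh_sobolev Qh_L2 a.S_intros simp del: One_nat_def)
    qed (simp add: J)
    also have "\<dots> = (b - a) * (b_form \<Omega> A q + m * b_form \<Omega> B q)"
      using ab by (simp add: J integral_affine m_def)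
    finally have "b_form \<Omega> A q + m * b_form \<Omega> B q = 0" using ab by simp
    thus ?thesis using A B q by (simp add: b_bilin Vh_sobolev Qh_L2 a.S_intros del: One_nat_def)
  qed
  show "b_form \<Omega> (uh (t n)) q = - b_form \<Omega> (uh (t (n - 1))) q" if q: "q \<in> Qh \<Omega> D" for q
  proof -
    have "b_form \<Omega> ((1/2) *\<^sub>R (uh (t n) + uh (t (n - 1)))) q = 0"
      using b_form_cong[OF avg ae_eq_refl] bm[OF q] by metis
    thus ?thesis using mem q by (simp add: b_bilin Vh_sobolev Qh_L2 a.S_intros del: One_nat_def)
  qed
  show "ip \<Omega> ((1 / step t n) *\<^sub>R (uh (t n) - uh (t (n - 1)))) v +
       a_form \<Omega> ((1/2) *\<^sub>R (uh (t n) + uh (t (n - 1)))) v + b_form \<Omega> v (ph (midpt t n))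
       = 1 / 2 * ip \<Omega> (f (t (n - 1)) + f (t n)) v" if v: "v \<in> Vh \<Omega> D" for v
  proof -
    let ?\<alpha> = "ip \<Omega> B v + a_form \<Omega> A v + b_form \<Omega> v C" and ?\<beta> = "a_form \<Omega> B v + b_form \<Omega> v E"
    have pf: "f (t (n - 1)) + f (t n) = (\<lambda>x. f (t (n - 1)) x + f (t n) x)" by (simp only: plus_fun_def)
    have "step t n / 2 * ip \<Omega> (f (t (n - 1)) + f (t n)) v = (LBINT s:J. ?\<alpha> + s * ?\<beta>)"
      unfolding pf eq[OF v, symmetric]
    proof (rule set_lebesgue_integral_cong)
      show "\<forall>s. s \<in> J \<longrightarrow> ip \<Omega> (tderiv \<Omega> J uh s) v + a_form \<Omega> (uh s) v + b_form \<Omega> v (ph s) = ?\<alpha> + s * ?\<beta>"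
        using ip_cong[OF td ae_eq_refl, of _ v] a_form_cong[OF u ae_eq_refl, of _ v] b_form_cong[OF ae_eq_refl p, of _ v] A B C E v
        by (auto simp: a.bilin b_bilin Vh_sobolev Qh_L2 a.S_intros L2.S_intros algebra_simps simp del: One_nat_def)
    qed (simp add: J)
    also have "\<dots> = step t n * (?\<alpha> + m * ?\<beta>)"
      using ab by (simp add: J integral_affine m_def step)
    also have "?\<alpha> + m * ?\<beta> = ip \<Omega> B v + a_form \<Omega> (A + m *\<^sub>R B) v + b_form \<Omega> v (C + m *\<^sub>R E)"
      using A B C E v
      by (simp add: a.bilin b_bilin Vh_sobolev Qh_L2 a.S_intros L2.S_intros algebra_simps del: One_nat_def)
    also have "\<dots> = ip \<Omega> ((1 / step t n) *\<^sub>R (uh (t n) - uh (t (n - 1)))) v +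
       a_form \<Omega> ((1/2) *\<^sub>R (uh (t n) + uh (t (n - 1)))) v + b_form \<Omega> v (ph (midpt t n))"
      unfolding mid using ip_cong[OF dB ae_eq_refl] a_form_cong[OF avg ae_eq_refl] b_form_cong[OF ae_eq_refl p[OF mJ(1)]]
      by simp
    finally have *: "step t n / 2 * ip \<Omega> (f (t (n - 1)) + f (t n)) v = step t n *
      (ip \<Omega> ((1 / step t n) *\<^sub>R (uh (t n) - uh (t (n - 1)))) v +
       a_form \<Omega> ((1/2) *\<^sub>R (uh (t n) + uh (t (n - 1)))) v + b_form \<Omega> v (ph (midpt t n)))" .
    have "0 < step t n" using ab by (simp add: step)
    hence "y = 1 / 2 * x" if "step t n / 2 * x = step t n * y" for x y :: real using that by simp
    from this[OF *] show ?thesis .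
  qed
qed

text \<open>
  The initial velocity is discretely divergence free, and the change of sign in each step
  preserves this.
\<close>

lemma scheme_Vhdiv:
  assumes sch: "scheme_G \<Omega> D N t f u0h uh ph" and tm: "time_mesh T N t" and u0h: "u0h \<in> Vhdiv \<Omega> D"
  shows "n \<le> N \<Longrightarrow> uh (t n) \<in> Vhdiv \<Omega> D"
proof (induction n)
  case 0
  have "ae_eq \<Omega> u0h (uh 0)" using sch by (auto simp: scheme_G_def intro: ae_eq_sym)
  thus ?case using Vhdiv_cong u0h time_meshD(2)[OF tm] by simp
next
  case (Suc n)
  thus ?case using scheme_step(1,4)[OF sch tm, of "Suc n"] by (simp add: Vhdiv_iff)
qed

subsection \<open>Stability\<close>

lemma half_step_identity: "x + y = z \<Longrightarrow> y = w / (2 * c) \<Longrightarrow> 0 < c \<Longrightarrow> 2 * c * x + w = 2 * c * z" for x y z w c :: real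
  by (simp add: field_simps)

text \<open>
  The difference quotient \<open>d\<close> of \<open>e\<close> is discretely divergence free. As a test function, it removes
  the pressure and turns the form \<open>a\<close> into half the difference quotient of \<open>\<parallel>\<nabla>e\<parallel>\<^sup>2\<close>, which
  telescopes. In the right-hand side, Young's inequality separates \<open>\<rho>\<close> from \<open>d\<close>.
\<close>

lemma energy_estimate:
  fixes e \<rho> :: "nat \<Rightarrow> real ^ 'd \<Rightarrow> real ^ 'd" and \<pi> :: "nat \<Rightarrow> real ^ 'd \<Rightarrow> real" and k :: "nat \<Rightarrow> real"
  assumes e: "\<And>n. n \<le> N \<Longrightarrow> e n \<in> Vhdiv \<Omega> D" and \<pi>: "\<And>n. n \<in> {1..N} \<Longrightarrow> \<pi> n \<in> Qh \<Omega> D"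
    and \<rho>: "\<And>n. n \<in> {1..N} \<Longrightarrow> \<rho> n \<in> L2 \<Omega>" and k: "\<And>n. n \<in> {1..N} \<Longrightarrow> 0 < k n"
    and eq: "\<And>n v. n \<in> {1..N} \<Longrightarrow> v \<in> Vh \<Omega> D \<Longrightarrow>
      ip \<Omega> ((1 / k n) *\<^sub>R (e n - e (n - 1))) v + a_form \<Omega> ((1/2) *\<^sub>R (e n + e (n - 1))) v + b_form \<Omega> v (\<pi> n) = ip \<Omega> (\<rho> n) v"
  shows "n \<le> N \<Longrightarrow> (L2norm \<Omega> (grad \<Omega> (e n)))\<^sup>2 + (\<Sum>i=1..n. k i * (L2norm \<Omega> ((1 / k i) *\<^sub>R (e i - e (i - 1))))\<^sup>2)
     \<le> (L2norm \<Omega> (grad \<Omega> (e 0)))\<^sup>2 + (\<Sum>i=1..n. k i * (L2norm \<Omega> (\<rho> i))\<^sup>2)"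
proof (induction n)
  case (Suc n)
  let ?n = "Suc n"
  define d where "d = (1 / k ?n) *\<^sub>R (e ?n - e n)"
  have n: "?n \<in> {1..N}" using Suc.prems by simp
  note kp = k[OF n]
  have eh: "e ?n \<in> Vh \<Omega> D" "e n \<in> Vh \<Omega> D" using e[of ?n] e[of n] Suc.prems by (auto simp: Vhdiv_iff)
  have "d \<in> Vhdiv \<Omega> D"
    unfolding d_def using e[of ?n] e[of n] Suc.prems
    by (intro subspace_scale[OF subspace_Vhdiv] subspace_diff[OF subspace_Vhdiv]) auto
  hence dh: "d \<in> Vh \<Omega> D" "b_form \<Omega> d (\<pi> ?n) = 0" using \<pi>[OF n] by (auto simp: Vhdiv_iff)
  note S = Vh_sobolev[OF eh(1)] Vh_sobolev[OF eh(2)] Vh_sobolev[OF dh(1)]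
  have "ip \<Omega> d d + a_form \<Omega> ((1/2) *\<^sub>R (e ?n + e n)) d = ip \<Omega> (\<rho> ?n) d"
    using eq[OF n dh(1)] dh(2) by (simp add: d_def)
  moreover have "a_form \<Omega> ((1/2) *\<^sub>R (e ?n + e n)) d = (a_form \<Omega> (e ?n) (e ?n) - a_form \<Omega> (e n) (e n)) / (2 * k ?n)"
    unfolding d_def using S kp a.sym[OF S(1,2)]
    by (simp add: a.bilin a.S_intros algebra_simps add_divide_distrib diff_divide_distrib del: One_nat_def)
  ultimately have "2 * k ?n * ip \<Omega> d d + (a_form \<Omega> (e ?n) (e ?n) - a_form \<Omega> (e n) (e n)) = 2 * k ?n * ip \<Omega> (\<rho> ?n) d"
    using kp by (rule half_step_identity)
  moreover have "2 * ip \<Omega> (\<rho> ?n) d \<le> (L2norm \<Omega> (\<rho> ?n))\<^sup>2 + (L2norm \<Omega> d)\<^sup>2"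
    using L2.Cauchy_Schwarz[OF \<rho>[OF n] Vh_L2[OF dh(1)]] sum_squares_bound[of "L2norm \<Omega> (\<rho> ?n)" "L2norm \<Omega> d"]
    unfolding L2norm_eq_nrm by linarith
  hence "k ?n * (2 * ip \<Omega> (\<rho> ?n) d) \<le> k ?n * ((L2norm \<Omega> (\<rho> ?n))\<^sup>2 + (L2norm \<Omega> d)\<^sup>2)"
    using kp by (intro mult_left_mono) auto
  moreover have "ip \<Omega> d d = (L2norm \<Omega> d)\<^sup>2" by (rule L2norm_sq[OF Vh_L2[OF dh(1)], symmetric])
  moreover have "a_form \<Omega> (e i) (e i) = (L2norm \<Omega> (grad \<Omega> (e i)))\<^sup>2" if "e i \<in> sobolev \<Omega> 1" for i
    using a.nrm_sq[OF that] by (simp add: a_nrm)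
  ultimately have "k ?n * (L2norm \<Omega> d)\<^sup>2 + (L2norm \<Omega> (grad \<Omega> (e ?n)))\<^sup>2
      \<le> (L2norm \<Omega> (grad \<Omega> (e n)))\<^sup>2 + k ?n * (L2norm \<Omega> (\<rho> ?n))\<^sup>2"
    using S by (simp add: algebra_simps del: One_nat_def)
  moreover have sum_Suc: "(\<Sum>i=1..?n. g i) = (\<Sum>i=1..n. g i) + g ?n" for g :: "nat \<Rightarrow> real" by simp
  moreover have d: "d = (1 / k ?n) *\<^sub>R (e ?n - e (?n - 1))" by (simp add: d_def)
  moreover have "n \<le> N" using Suc.prems by simp
  note Suc.IH[OF this]
  ultimately show ?case unfolding sum_Suc d[symmetric] by linarith
qed simp

text \<open>
  By the inf-sup condition \<open>\<pi> n\<close> is bounded by the other terms of the equation: \<open>\<rho> n\<close>, the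
  difference quotient of \<open>e\<close>, and the gradients of \<open>e\<close> at both ends. Weighted with the time steps,
  the squares of the first two sum to at most \<open>W\<close>, for the difference quotients by the energy
  estimate. Each squared gradient is at most \<open>W\<close>, too, and summing this over all steps produces
  the factor \<open>\<Sum>n=1..N. k n\<close>.
\<close>

lemma pressure_estimate:
  fixes e \<rho> :: "nat \<Rightarrow> real ^ 'd \<Rightarrow> real ^ 'd" and \<pi> :: "nat \<Rightarrow> real ^ 'd \<Rightarrow> real" and k :: "nat \<Rightarrow> real"
  assumes e: "\<And>n. n \<le> N \<Longrightarrow> e n \<in> Vhdiv \<Omega> D" and \<pi>: "\<And>n. n \<in> {1..N} \<Longrightarrow> \<pi> n \<in> Qh \<Omega> D"
    and \<rho>: "\<And>n. n \<in> {1..N} \<Longrightarrow> \<rho> n \<in> L2 \<Omega>" and k: "\<And>n. n \<in> {1..N} \<Longrightarrow> 0 < k n"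
    and eq: "\<And>n v. n \<in> {1..N} \<Longrightarrow> v \<in> Vh \<Omega> D \<Longrightarrow>
      ip \<Omega> ((1 / k n) *\<^sub>R (e n - e (n - 1))) v + a_form \<Omega> ((1/2) *\<^sub>R (e n + e (n - 1))) v + b_form \<Omega> v (\<pi> n) = ip \<Omega> (\<rho> n) v"
    and \<beta>: "0 < \<beta>" and infsup: "inf_sup_const \<beta>"
  defines "W \<equiv> (L2norm \<Omega> (grad \<Omega> (e 0)))\<^sup>2 + (\<Sum>i=1..N. k i * (L2norm \<Omega> (\<rho> i))\<^sup>2)"
  shows "(\<Sum>n=1..N. k n * (L2norm \<Omega> (\<pi> n))\<^sup>2) \<le> 4 / \<beta>\<^sup>2 * (2 + (\<Sum>n=1..N. k n)) * W"
proof -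
  define d where "d n = (1 / k n) *\<^sub>R (e n - e (n - 1))" for n
  have dh: "d n \<in> Vh \<Omega> D" if "n \<in> {1..N}" for n
    unfolding d_def using e[of n] e[of "n - 1"] that by (intro Vh_intros) (auto simp: Vhdiv_iff)
  have energy: "(L2norm \<Omega> (grad \<Omega> (e n)))\<^sup>2 + (\<Sum>i=1..n. k i * (L2norm \<Omega> (d i))\<^sup>2)
     \<le> (L2norm \<Omega> (grad \<Omega> (e 0)))\<^sup>2 + (\<Sum>i=1..n. k i * (L2norm \<Omega> (\<rho> i))\<^sup>2)" if "n \<le> N" for n
    unfolding d_def by (rule energy_estimate[of N e \<pi> \<rho> k]) (fact e \<pi> \<rho> k eq that)+
  have grads: "(L2norm \<Omega> (grad \<Omega> (e n)))\<^sup>2 \<le> W" if n: "n \<le> N" for n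
  proof -
    have "(L2norm \<Omega> (grad \<Omega> (e n)))\<^sup>2 \<le> (L2norm \<Omega> (grad \<Omega> (e n)))\<^sup>2 + (\<Sum>i=1..n. k i * (L2norm \<Omega> (d i))\<^sup>2)"
    proof -
      have "0 \<le> (\<Sum>i=1..n. k i * (L2norm \<Omega> (d i))\<^sup>2)"
        by (intro sum_nonneg mult_nonneg_nonneg order.strict_implies_order[OF k] zero_le_power2) (use n in auto)
      thus ?thesis by simp
    qed
    also have "\<dots> \<le> (L2norm \<Omega> (grad \<Omega> (e 0)))\<^sup>2 + (\<Sum>i=1..n. k i * (L2norm \<Omega> (\<rho> i))\<^sup>2)"
      by (rule energy[OF n])
    also have "\<dots> \<le> W"
      unfolding W_def
      by (intro add_left_mono sum_mono2 mult_nonneg_nonneg order.strict_implies_order[OF k] zero_le_power2)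
        (use n in auto)
    finally show ?thesis .
  qed
  have single: "k n * (L2norm \<Omega> (\<pi> n))\<^sup>2 \<le> 4 / \<beta>\<^sup>2 * (k n * (L2norm \<Omega> (\<rho> n))\<^sup>2 + k n * (L2norm \<Omega> (d n))\<^sup>2 + k n * W)"
    if n: "n \<in> {1..N}" for n
  proof -
    have eh: "e n \<in> Vh \<Omega> D" "e (n - 1) \<in> Vh \<Omega> D" using e[of n] e[of "n - 1"] n by (auto simp: Vhdiv_iff)
    let ?r = "L2norm \<Omega> (\<rho> n)" and ?d = "L2norm \<Omega> (d n)"
    let ?x = "L2norm \<Omega> (grad \<Omega> (e n))" and ?y = "L2norm \<Omega> (grad \<Omega> (e (n - 1)))"
    define M where "M = ?r + ?d + ?x / 2 + ?y / 2"
    have M: "0 \<le> M" unfolding M_def by (intro add_nonneg_nonneg) (auto simp: L2norm_nonneg)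
    have "\<beta> * L2norm \<Omega> (\<pi> n) \<le> M"
    proof (rule inf_sup_constD[OF infsup \<pi>[OF n] M])
      fix v assume v: "v \<in> Vh \<Omega> D"
      let ?v = "sobolev_norm \<Omega> 1 v"
      have v1: "L2norm \<Omega> v \<le> ?v" by (rule L2norm_le_sobolev_norm[OF Vh_L2[OF v]])
      have v2: "L2norm \<Omega> (grad \<Omega> v) \<le> ?v" by (rule L2norm_grad_le[OF Vh_sobolev[OF v]]) simp
      have "b_form \<Omega> v (\<pi> n) = ip \<Omega> (\<rho> n) v - ip \<Omega> (d n) v - a_form \<Omega> (e n) v / 2 - a_form \<Omega> (e (n - 1)) v / 2"
        using eq[OF n v] Vh_sobolev[OF eh(1)] Vh_sobolev[OF eh(2)] Vh_sobolev[OF v]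
        unfolding d_def
        by (simp add: a.bilin a.S_intros add_divide_distrib del: One_nat_def)
      also have "\<dots> \<le> ?r * ?v + ?d * ?v + ?x * ?v / 2 + ?y * ?v / 2"
      proof -
        have 1: "\<bar>ip \<Omega> (\<rho> n) v\<bar> \<le> ?r * ?v"
          using L2.Cauchy_Schwarz[OF \<rho>[OF n] Vh_L2[OF v]] mult_left_mono[OF v1 L2norm_nonneg, of "\<rho> n"]
          by (simp add: L2norm_eq_nrm)
        have 2: "\<bar>ip \<Omega> (d n) v\<bar> \<le> ?d * ?v"
          using L2.Cauchy_Schwarz[OF Vh_L2[OF dh[OF n]] Vh_L2[OF v]] mult_left_mono[OF v1 L2norm_nonneg, of "d n"]
          by (simp add: L2norm_eq_nrm)
        have 3: "\<bar>a_form \<Omega> z v\<bar> \<le> L2norm \<Omega> (grad \<Omega> z) * ?v" if z: "z \<in> Vh \<Omega> D" for z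
          using a.Cauchy_Schwarz[OF Vh_sobolev[OF z] Vh_sobolev[OF v]]
            mult_left_mono[OF v2 L2norm_nonneg, of "grad \<Omega> z"] by (simp add: a_nrm)
        show ?thesis using 1 2 3[OF eh(1)] 3[OF eh(2)] by linarith
      qed
      also have "\<dots> = M * ?v" by (simp add: M_def algebra_simps)
      finally show "b_form \<Omega> v (\<pi> n) \<le> M * ?v" .
    qed
    hence "(\<beta> * L2norm \<Omega> (\<pi> n))\<^sup>2 \<le> M\<^sup>2"
      using \<beta> L2norm_nonneg by (intro power_mono mult_nonneg_nonneg) auto
    also have "M\<^sup>2 \<le> 4 * (?r\<^sup>2 + ?d\<^sup>2 + (?x / 2)\<^sup>2 + (?y / 2)\<^sup>2)"
    proof -
      have four: "(p + q + r + s)\<^sup>2 \<le> 4 * (p\<^sup>2 + q\<^sup>2 + r\<^sup>2 + s\<^sup>2)" for p q r s :: real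
      proof -
        have "0 \<le> (p - q)\<^sup>2 + (p - r)\<^sup>2 + (p - s)\<^sup>2 + (q - r)\<^sup>2 + (q - s)\<^sup>2 + (r - s)\<^sup>2" by simp
        thus ?thesis by (simp add: power2_eq_square algebra_simps)
      qed
      show ?thesis unfolding M_def by (rule four)
    qed
    also have "\<dots> \<le> 4 * (?r\<^sup>2 + ?d\<^sup>2 + W)"
    proof -
      have "?x\<^sup>2 \<le> W" "?y\<^sup>2 \<le> W" using grads[of n] grads[of "n - 1"] n by auto
      moreover have "0 \<le> W" using order_trans[OF zero_le_power2 grads[of n]] n by simp
      ultimately show ?thesis unfolding power_divide by simp
    qed
    finally have "\<beta>\<^sup>2 * (L2norm \<Omega> (\<pi> n))\<^sup>2 \<le> 4 * (?r\<^sup>2 + ?d\<^sup>2 + W)" by (simp add: power_mult_distrib)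
    hence "(L2norm \<Omega> (\<pi> n))\<^sup>2 \<le> 4 / \<beta>\<^sup>2 * (?r\<^sup>2 + ?d\<^sup>2 + W)" using \<beta> by (simp add: field_simps)
    hence "k n * (L2norm \<Omega> (\<pi> n))\<^sup>2 \<le> k n * (4 / \<beta>\<^sup>2 * (?r\<^sup>2 + ?d\<^sup>2 + W))"
      using k[OF n] by (intro mult_left_mono) auto
    thus ?thesis by (simp add: algebra_simps)
  qed
  have "(\<Sum>n=1..N. k n * (L2norm \<Omega> (\<pi> n))\<^sup>2) \<le>
      (\<Sum>n=1..N. 4 / \<beta>\<^sup>2 * (k n * (L2norm \<Omega> (\<rho> n))\<^sup>2 + k n * (L2norm \<Omega> (d n))\<^sup>2 + k n * W))"
    by (rule sum_mono) (rule single)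
  also have "\<dots> = 4 / \<beta>\<^sup>2 * ((\<Sum>n=1..N. k n * (L2norm \<Omega> (\<rho> n))\<^sup>2) + (\<Sum>n=1..N. k n * (L2norm \<Omega> (d n))\<^sup>2) + (\<Sum>n=1..N. k n) * W)"
    by (simp only: sum_distrib_left[symmetric] sum_distrib_right[symmetric] sum.distrib)
  also have "\<dots> \<le> 4 / \<beta>\<^sup>2 * (W + W + (\<Sum>n=1..N. k n) * W)"
  proof (intro mult_left_mono add_mono order_refl)
    show "(\<Sum>n=1..N. k n * (L2norm \<Omega> (\<rho> n))\<^sup>2) \<le> W" by (simp add: W_def)
    show "(\<Sum>n=1..N. k n * (L2norm \<Omega> (d n))\<^sup>2) \<le> W"
      using energy[of N] zero_le_power2[of "L2norm \<Omega> (grad \<Omega> (e N))"] unfolding W_def by linarith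
  qed (use k in \<open>auto intro!: sum_nonneg order.strict_implies_order[OF k]\<close>)
  also have "\<dots> = 4 / \<beta>\<^sup>2 * (2 + (\<Sum>n=1..N. k n)) * W"
    by (simp only: mult.assoc distrib_right one_add_one[symmetric] mult_1)
  finally show ?thesis .
qed

end

section \<open>Regularity in time\<close>

lemma tendsto_of_seminorm_bound:
  fixes G \<nu> :: "'v::real_vector \<Rightarrow> real" and w :: "real \<Rightarrow> 'v"
  assumes "\<And>s. s \<in> J \<Longrightarrow> \<bar>G (w s) - G (w t)\<bar> \<le> K * \<nu> (w s - w t)"
    and "((\<lambda>s. \<nu> (w s - w t)) \<longlongrightarrow> 0) (at t within J)"
  shows "((\<lambda>s. G (w s)) \<longlongrightarrow> G (w t)) (at t within J)"
proof (rule LIM_zero_cancel, rule Lim_null_comparison)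
  show "((\<lambda>s. K * \<nu> (w s - w t)) \<longlongrightarrow> 0) (at t within J)" using tendsto_mult_right_zero[OF assms(2)] .
  show "\<forall>\<^sub>F s in at t within J. norm (G (w s) - G (w t)) \<le> K * \<nu> (w s - w t)"
    using assms(1) by (auto simp: eventually_at_topological intro!: exI[of _ UNIV])
qed

context bounded_open
begin

text \<open>
  Derivatives in \<open>H\<^sup>m\<close> are also derivatives in \<open>L\<^sup>2\<close> and in \<open>H\<^sup>n\<close> for \<open>n \<le> m\<close>, because the norms
  decrease. Continuity on the compact time interval gives the bounds.
\<close>

lemma ck_sobolevE:
  fixes w :: "real \<Rightarrow> real ^ 'd \<Rightarrow> 'b::euclidean_space"
  assumes "ck_sobolev \<Omega> {0..T} k m w"
  obtains W where "W 0 = w"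
    "\<And>j t. j \<le> k \<Longrightarrow> t \<in> {0..T} \<Longrightarrow> W j t \<in> sobolev \<Omega> m"
    "\<And>j t. j \<le> k \<Longrightarrow> t \<in> {0..T} \<Longrightarrow>
       ((\<lambda>s. sobolev_norm \<Omega> m (W j s - W j t)) \<longlongrightarrow> 0) (at t within {0..T})"
    "\<And>j. j \<le> k \<Longrightarrow> \<exists>M\<ge>0. \<forall>t\<in>{0..T}. sobolev_norm \<Omega> m (W j t) \<le> M"
    "\<And>j. j < k \<Longrightarrow> L2.has_sderiv (W j) (W (Suc j)) {0..T}"
    "\<And>j n. j < k \<Longrightarrow> n \<le> m \<Longrightarrow> sob.has_sderiv n (W j) (W (Suc j)) {0..T}"
proof -
  from assms obtain W where W: "W 0 = w"
    and mem: "\<And>j t. j \<le> k \<Longrightarrow> t \<in> {0..T} \<Longrightarrow> W j t \<in> sobolev \<Omega> m"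
    and cont: "\<And>j t. j \<le> k \<Longrightarrow> t \<in> {0..T} \<Longrightarrow>
       ((\<lambda>s. sobolev_norm \<Omega> m (\<lambda>x. W j s x - W j t x)) \<longlongrightarrow> 0) (at t within {0..T})"
    and der: "\<And>j t. j < k \<Longrightarrow> t \<in> {0..T} \<Longrightarrow>
       ((\<lambda>s. sobolev_norm \<Omega> m (\<lambda>x. (W j s x - W j t x) /\<^sub>R (s - t) - W (Suc j) t x)) \<longlongrightarrow> 0) (at t within {0..T})"
    unfolding ck_sobolev_def by blast
  have cont': "((\<lambda>s. sobolev_norm \<Omega> m (W j s - W j t)) \<longlongrightarrow> 0) (at t within {0..T})"
    if "j \<le> k" "t \<in> {0..T}" for j t
    using cont[OF that] by (simp only: fun_diff_def)
  have eq: "(\<lambda>x. (W j s x - W j t x) /\<^sub>R (s - t) - W (Suc j) t x) = (W j s - W j t) /\<^sub>R (s - t) - W (Suc j) t" for j s t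
    by (simp add: fun_eq_iff)
  have der': "((\<lambda>s. sobolev_norm \<Omega> m ((W j s - W j t) /\<^sub>R (s - t) - W (Suc j) t)) \<longlongrightarrow> 0) (at t within {0..T})"
    if "j < k" "t \<in> {0..T}" for j t
    using der[OF that] by (simp only: eq)
  have dmem: "(W j s - W j t) /\<^sub>R (s - t) - W (Suc j) t \<in> sobolev \<Omega> m" if "j < k" "t \<in> {0..T}" "s \<in> {0..T}" for j s t
    by (intro sob.S_intros mem) (use that in auto)
  have squeeze: "((\<lambda>s. \<nu> ((W j s - W j t) /\<^sub>R (s - t) - W (Suc j) t)) \<longlongrightarrow> 0) (at t within {0..T})"
    if j: "j < k" "t \<in> {0..T}" and \<nu>: "\<And>f. f \<in> sobolev \<Omega> m \<Longrightarrow> 0 \<le> \<nu> f \<and> \<nu> f \<le> sobolev_norm \<Omega> m f"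
    for \<nu> :: "(real ^ 'd \<Rightarrow> 'b) \<Rightarrow> real" and j t
  proof (rule Lim_null_comparison[OF _ der'[OF j]])
    have "norm (\<nu> ((W j s - W j t) /\<^sub>R (s - t) - W (Suc j) t)) \<le> sobolev_norm \<Omega> m ((W j s - W j t) /\<^sub>R (s - t) - W (Suc j) t)"
      if "s \<in> {0..T}" for s
      using \<nu>[OF dmem[OF j that]] by (simp only: real_norm_def abs_of_nonneg)
    thus "\<forall>\<^sub>F s in at t within {0..T}. norm (\<nu> ((W j s - W j t) /\<^sub>R (s - t) - W (Suc j) t))
        \<le> sobolev_norm \<Omega> m ((W j s - W j t) /\<^sub>R (s - t) - W (Suc j) t)"
      by (intro eventually_at_topological[THEN iffD2] exI[of _ UNIV]) (simp del: minus_apply)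
  qed
  show ?thesis
  proof (rule that[of W, OF W mem cont'])
    fix j assume j: "j \<le> k"
    show "\<exists>M\<ge>0. \<forall>t\<in>{0..T}. sobolev_norm \<Omega> m (W j t) \<le> M"
    proof (rule sob.continuous_nrm_bounded[of 0 T "W j" m])
      show "W j t \<in> sobolev \<Omega> m" if "t \<in> {0..T}" for t using mem[OF j that] .
      show "((\<lambda>s. sob.nrm m (W j s - W j t)) \<longlongrightarrow> 0) (at t within {0..T})" if t: "t \<in> {0..T}" for t
      proof (rule Lim_transform_eventually[OF cont'[OF j t]])
        have "sobolev_norm \<Omega> m (W j s - W j t) = sob.nrm m (W j s - W j t)" if "s \<in> {0..T}" for s
          by (intro sobolev_norm_eq_nrm sob.S_diff mem j t that)
        thus "\<forall>\<^sub>F s in at t within {0..T}. sobolev_norm \<Omega> m (W j s - W j t) = sob.nrm m (W j s - W j t)"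
          by (intro eventually_at_topological[THEN iffD2] exI[of _ UNIV]) (simp del: minus_apply)
      qed
      fix M assume "0 \<le> M" "\<And>t. t \<in> {0..T} \<Longrightarrow> sob.nrm m (W j t) \<le> M"
      thus "\<exists>M\<ge>0. \<forall>t\<in>{0..T}. sobolev_norm \<Omega> m (W j t) \<le> M"
        using sobolev_norm_eq_nrm[OF mem[OF j]] by (intro exI[of _ M]) simp
    qed
  next
    fix j assume j: "j < k"
    have "((\<lambda>s. L2.nrm ((W j s - W j t) /\<^sub>R (s - t) - W (Suc j) t)) \<longlongrightarrow> 0) (at t within {0..T})"
      if t: "t \<in> {0..T}" for t
      by (rule squeeze[OF j t]) (use L2norm_le_sobolev_norm[OF sobolev_L2] L2.nrm_nonneg[OF sobolev_L2] in \<open>auto simp: L2norm_eq_nrm\<close>)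
    thus "L2.has_sderiv (W j) (W (Suc j)) {0..T}"
      unfolding L2.has_sderiv_def using mem[of j, THEN sobolev_L2] mem[of "Suc j", THEN sobolev_L2] j by simp
    fix n assume n: "n \<le> m"
    have "((\<lambda>s. sob.nrm n ((W j s - W j t) /\<^sub>R (s - t) - W (Suc j) t)) \<longlongrightarrow> 0) (at t within {0..T})"
      if t: "t \<in> {0..T}" for t
    proof (rule squeeze[OF j t])
      fix f :: "real ^ 'd \<Rightarrow> 'b" assume "f \<in> sobolev \<Omega> m"
      hence "f \<in> sobolev \<Omega> n" using n by (rule sobolev_mono[rotated])
      thus "0 \<le> sob.nrm n f \<and> sob.nrm n f \<le> sobolev_norm \<Omega> m f"
        using sobolev_norm_mono[OF n, of f] sobolev_norm_eq_nrm[of f n] sob.nrm_nonneg[of f n] by simp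
    qed
    thus "sob.has_sderiv n (W j) (W (Suc j)) {0..T}"
      unfolding sob.has_sderiv_def using mem[of j, THEN sobolev_mono[OF n]] mem[of "Suc j", THEN sobolev_mono[OF n]] j by simp
  qed
qed

text \<open>
  For \<open>t > 0\<close> the differential equation is tested with \<open>v\<close>, and Green's formula is applied. At
  \<open>t = 0\<close> the weak form follows from the continuity of its terms in time.
\<close>

lemma weak_formulation:
  assumes T: "0 < T" and sol: "stokes_solution \<Omega> T f u0 u p"
    and W: "\<And>t. t \<in> {0..T} \<Longrightarrow> ((\<lambda>s. L2norm \<Omega> ((u s - u t) /\<^sub>R (s - t) - W t)) \<longlongrightarrow> 0) (at t within {0..T})"
    and WL: "\<And>t. t \<in> {0..T} \<Longrightarrow> W t \<in> L2 \<Omega>"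
    and Wc: "((\<lambda>s. L2norm \<Omega> (W s - W 0)) \<longlongrightarrow> 0) (at 0 within {0..T})"
    and u: "\<And>t. t \<in> {0..T} \<Longrightarrow> u t \<in> sobolev \<Omega> 2"
    and uc: "((\<lambda>s. sobolev_norm \<Omega> 1 (u s - u 0)) \<longlongrightarrow> 0) (at 0 within {0..T})"
    and p: "\<And>t. t \<in> {0..T} \<Longrightarrow> p t \<in> sobolev \<Omega> 1"
    and pc: "((\<lambda>s. L2norm \<Omega> (p s - p 0)) \<longlongrightarrow> 0) (at 0 within {0..T})"
    and f: "\<And>t. t \<in> {0..T} \<Longrightarrow> f t \<in> L2 \<Omega>"
    and fc: "((\<lambda>s. L2norm \<Omega> (f s - f 0)) \<longlongrightarrow> 0) (at 0 within {0..T})"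
    and v: "v \<in> V \<Omega>" and t: "t \<in> {0..T}"
  shows "ip \<Omega> (f t) v = ip \<Omega> (W t) v + a_form \<Omega> (u t) v + b_form \<Omega> v (p t)"
proof -
  have u1: "u t \<in> sobolev \<Omega> 1" if "t \<in> {0..T}" for t using u[OF that] by (rule sobolev_mono[rotated]) simp
  note vL = V_L2[OF v] and vS = V_sobolev[OF v]
  have pos: "ip \<Omega> (f t) v = ip \<Omega> (W t) v + a_form \<Omega> (u t) v + b_form \<Omega> v (p t)" if t: "t \<in> {0<..T}" for t
  proof -
    have t': "t \<in> {0..T}" using t by simp
    have "t islimpt {0..T}" 
    proof (rule connected_imp_perfect)
      show "\<And>x. {0..T} \<noteq> {x}" using T by auto
    qed (use t in auto)
    hence "ae_eq \<Omega> (tderiv \<Omega> {0..T} u t) (W t)"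
      by (intro tderiv_unique W WL t' sobolev_L2[OF u]) (auto simp: trivial_limit_within)
    hence "ae_eq \<Omega> (\<lambda>x. tderiv \<Omega> {0..T} u t x - laplacian \<Omega> (u t) x + grad \<Omega> (p t) x) (W t - laplacian \<Omega> (u t) + grad \<Omega> (p t))"
      unfolding ae_eq_def by (rule eventually_mono) simp
    moreover have "ae_eq \<Omega> (\<lambda>x. tderiv \<Omega> {0..T} u t x - laplacian \<Omega> (u t) x + grad \<Omega> (p t) x) (f t)"
      using sol t unfolding stokes_solution_def by blast
    ultimately have "ae_eq \<Omega> (f t) (W t - laplacian \<Omega> (u t) + grad \<Omega> (p t))"
      by (rule ae_eq_trans[OF ae_eq_sym, rotated])
    hence "ip \<Omega> (f t) v = ip \<Omega> (W t - laplacian \<Omega> (u t) + grad \<Omega> (p t)) v" by (rule ip_cong) simp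
    also have "\<dots> = ip \<Omega> (W t) v - ip \<Omega> (laplacian \<Omega> (u t)) v + ip \<Omega> (grad \<Omega> (p t)) v"
      using WL[OF t'] laplacian_L2[OF u[OF t']] grad_L2[OF p[OF t']] vL by (simp only: L2.bilin L2.S_intros)
    also have "\<dots> = ip \<Omega> (W t) v + a_form \<Omega> (u t) v + b_form \<Omega> v (p t)"
      by (simp only: green_laplacian[OF u[OF t'] v] green_pressure[OF p[OF t'] v] diff_minus_eq_add)
    finally show ?thesis .
  qed
  show ?thesis
  proof (cases "t = 0")
    case False
    thus ?thesis using t by (intro pos) auto
  next
    case True
    have z: "0 \<in> {0..T}" using T by simp
    have ev: "\<forall>\<^sub>F s in at 0 within {0..T}. s \<in> {0<..T}"
      by (auto simp: eventually_at_topological intro!: exI[of _ UNIV])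
    have lf: "((\<lambda>s. ip \<Omega> (g s) v) \<longlongrightarrow> ip \<Omega> (g 0) v) (at 0 within {0..T})"
      if g: "\<And>s. s \<in> {0..T} \<Longrightarrow> g s \<in> L2 \<Omega>" and gc: "((\<lambda>s. L2norm \<Omega> (g s - g 0)) \<longlongrightarrow> 0) (at 0 within {0..T})" for g
    proof (rule tendsto_of_seminorm_bound[where G = "\<lambda>g. ip \<Omega> g v" and K = "L2norm \<Omega> v", OF _ gc])
      fix s assume "s \<in> {0..T}"
      thus "\<bar>ip \<Omega> (g s) v - ip \<Omega> (g 0) v\<bar> \<le> L2norm \<Omega> v * L2norm \<Omega> (g s - g 0)"
        using L2.Cauchy_Schwarz[OF L2.S_diff[OF g g[OF z]] vL, of s] g[OF z] g[of s] vL
        by (simp add: L2.bilin L2norm_eq_nrm mult.commute)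
    qed
    have la: "((\<lambda>s. a_form \<Omega> (u s) v) \<longlongrightarrow> a_form \<Omega> (u 0) v) (at 0 within {0..T})"
    proof (rule tendsto_of_seminorm_bound[where G = "\<lambda>g. a_form \<Omega> g v" and K = "L2norm \<Omega> (grad \<Omega> v)", OF _ uc])
      fix s assume s: "s \<in> {0..T}"
      have d: "u s - u 0 \<in> sobolev \<Omega> 1" by (intro sob.S_diff u1 s z)
      have "\<bar>a_form \<Omega> (u s) v - a_form \<Omega> (u 0) v\<bar> \<le> L2norm \<Omega> (grad \<Omega> (u s - u 0)) * L2norm \<Omega> (grad \<Omega> v)"
        using a.Cauchy_Schwarz[OF d vS] u1[OF s] u1[OF z] vS by (simp add: a.bilin a_nrm del: One_nat_def)
      also have "\<dots> \<le> sobolev_norm \<Omega> 1 (u s - u 0) * L2norm \<Omega> (grad \<Omega> v)"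
        by (intro mult_right_mono L2norm_grad_le d L2norm_nonneg) simp
      finally show "\<bar>a_form \<Omega> (u s) v - a_form \<Omega> (u 0) v\<bar> \<le> L2norm \<Omega> (grad \<Omega> v) * sobolev_norm \<Omega> 1 (u s - u 0)"
        by (simp only: mult.commute)
    qed
    have lb: "((\<lambda>s. b_form \<Omega> v (p s)) \<longlongrightarrow> b_form \<Omega> v (p 0)) (at 0 within {0..T})"
    proof (rule tendsto_of_seminorm_bound[where G = "b_form \<Omega> v" and K = "real CARD('d) * L2norm \<Omega> (grad \<Omega> v)", OF _ pc])
      fix s assume s: "s \<in> {0..T}"
      have pl: "p s \<in> L2 \<Omega>" "p 0 \<in> L2 \<Omega>" by (intro sobolev_L2[OF p] s z)+
      show "\<bar>b_form \<Omega> v (p s) - b_form \<Omega> v (p 0)\<bar> \<le> real CARD('d) * L2norm \<Omega> (grad \<Omega> v) * L2norm \<Omega> (p s - p 0)"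
        using b_bound[OF vS L2.S_diff[OF pl]] b_diff2[OF vS pl] by simp
    qed
    have "((\<lambda>s. ip \<Omega> (W s) v + a_form \<Omega> (u s) v + b_form \<Omega> v (p s)) \<longlongrightarrow>
        ip \<Omega> (W 0) v + a_form \<Omega> (u 0) v + b_form \<Omega> v (p 0)) (at 0 within {0..T})"
      by (intro tendsto_add lf[OF WL Wc] la lb)
    moreover have "\<forall>\<^sub>F s in at 0 within {0..T}. ip \<Omega> (W s) v + a_form \<Omega> (u s) v + b_form \<Omega> v (p s) = ip \<Omega> (f s) v"
      using ev by (rule eventually_mono) (simp only: pos)
    ultimately have "((\<lambda>s. ip \<Omega> (f s) v) \<longlongrightarrow>
        ip \<Omega> (W 0) v + a_form \<Omega> (u 0) v + b_form \<Omega> v (p 0)) (at 0 within {0..T})"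
      by (rule Lim_transform_eventually)
    moreover have "at 0 within {0..T} \<noteq> bot"
    proof -
      have "(0::real) islimpt {0..T}"
      proof (rule connected_imp_perfect)
        show "\<And>x. {0..T} \<noteq> {x}" using T by auto
      qed (use T in auto)
      thus ?thesis by (simp add: trivial_limit_within)
    qed
    ultimately show ?thesis unfolding True using tendsto_unique[OF _ lf[OF f fc]] by blast
  qed
qed

end

section \<open>The error of the pressure at the midpoints\<close>

lemma step_le_max_step: "n \<in> {1..N} \<Longrightarrow> step t n \<le> max_step N t"
  unfolding max_step_def by (intro Max_ge) auto

lemma max_step_nonneg: "time_mesh T N t \<Longrightarrow> 0 \<le> max_step N t"
  using step_le_max_step[of 1 N t] step_pos[of T N t 1] time_meshD(1)[of T N t] by simp

lemma power2_sum3_le: "(x + y + z)\<^sup>2 \<le> 3 * (x\<^sup>2 + y\<^sup>2 + z\<^sup>2)" for x y z :: real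
proof -
  have "0 \<le> (x - y)\<^sup>2 + (x - z)\<^sup>2 + (y - z)\<^sup>2" by simp
  thus ?thesis by (simp add: power2_eq_square algebra_simps)
qed

text \<open>
  The algebra of the error equation, in which \<open>x\<close>, \<open>y\<close>, \<open>z\<close> are the terms of its left-hand side.
  The equations for \<open>a + b\<close> and \<open>a' + b'\<close> are the projected Stokes equations at the two ends of
  the step, and the last assumption is the scheme.
\<close>

lemma crank_nicolson_algebra:
  fixes a :: real
  assumes "x = dt - du" "y = (a + a') / 2 - c" "z = (b + b') / 2 - d" "r = dt - (w' + w) / 2"
    "a + b = f - w" "a' + b' = f' - w'" "du + c + d = (f' + f) / 2"
  shows "x + y + z = r"
  using assms by argo

lemma (in bounded_open) L2norm_triangle3:
  fixes x y z :: "real ^ 'd \<Rightarrow> 'b::euclidean_space"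
  assumes "x \<in> L2 \<Omega>" "y \<in> L2 \<Omega>" "z \<in> L2 \<Omega>"
  shows "L2norm \<Omega> (x + y + z) \<le> L2norm \<Omega> x + L2norm \<Omega> y + L2norm \<Omega> z"
  using L2.nrm_triangle[OF L2.S_add[OF assms(1,2)] assms(3)] L2.nrm_triangle[OF assms(1,2)]
  unfolding L2norm_eq_nrm by linarith

context fe_space
begin

text \<open>
  The approximation property bounds \<open>h\<close> times the gradient error by a multiple of \<open>h ^ (r + 1)\<close>;
  division by the positive mesh size \<open>h\<close> leaves \<open>h ^ r\<close>.
\<close>

lemma projection_error:
  assumes approx_u: "\<forall>v \<in> V \<Omega> \<inter> sobolev \<Omega> (r + 1). \<exists>v' \<in> Vh \<Omega> D.
       L2norm \<Omega> (\<lambda>x. v x - v' x) + mesh_size D * L2norm \<Omega> (grad \<Omega> (\<lambda>x. v x - v' x))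
         \<le> C * mesh_size D ^ (r + 1) * sobolev_norm \<Omega> (r + 1) v"
    and approx_p: "\<forall>q \<in> Q \<Omega> \<inter> sobolev \<Omega> r. \<exists>q' \<in> Qh \<Omega> D.
       L2norm \<Omega> (\<lambda>x. q x - q' x) \<le> C * mesh_size D ^ r * sobolev_norm \<Omega> r q"
    and \<beta>: "0 < \<beta>" and infsup: "inf_sup_const \<beta>"
    and w: "w \<in> Vdiv \<Omega>" "w \<in> sobolev \<Omega> (r + 1)" "sobolev_norm \<Omega> (r + 1) w \<le> M"
    and s: "s \<in> Q \<Omega>" "s \<in> sobolev \<Omega> r" "sobolev_norm \<Omega> r s \<le> M"
    and proj: "is_stokes_projection \<Omega> D w s w' s'"
  defines "c \<equiv> 1 / \<beta>" and "m \<equiv> 1 + real CARD('d)"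
  shows "L2norm \<Omega> (grad \<Omega> (w - w')) \<le> (1 + 2 * (1 + c) * m) * (\<bar>C\<bar> * M) * mesh_size D ^ r"
    and "L2norm \<Omega> (s - s') \<le> (1 + c * (m + 2 * (1 + c) * m)) * (\<bar>C\<bar> * M) * mesh_size D ^ r"
proof -
  let ?h = "mesh_size D"
  have h: "0 < ?h" by (rule mesh_size_pos)
  have M: "0 \<le> M" using order_trans[OF sobolev_norm_nonneg w(3)] .
  define N where "N = \<bar>C\<bar> * ?h ^ r * M"
  have "w \<in> V \<Omega>" using w(1) by (simp add: Vdiv_def)
  then obtain iw where iw: "iw \<in> Vh \<Omega> D"
    "L2norm \<Omega> (w - iw) + ?h * L2norm \<Omega> (grad \<Omega> (w - iw)) \<le> C * ?h ^ (r + 1) * sobolev_norm \<Omega> (r + 1) w"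
    using approx_u w(2) unfolding fun_diff_def by blast
  have bound: "C * x * y \<le> \<bar>C\<bar> * x * M" if "0 \<le> x" "0 \<le> y" "y \<le> M" for x y
  proof -
    have "C * x * y \<le> \<bar>C\<bar> * x * y" using that by (intro mult_right_mono) auto
    also have "\<dots> \<le> \<bar>C\<bar> * x * M" using that by (intro mult_left_mono) auto
    finally show ?thesis .
  qed
  have "C * ?h ^ (r + 1) * sobolev_norm \<Omega> (r + 1) w \<le> \<bar>C\<bar> * ?h ^ (r + 1) * M"
    by (rule bound) (use h w(3) sobolev_norm_nonneg in auto)
  hence "?h * L2norm \<Omega> (grad \<Omega> (w - iw)) \<le> \<bar>C\<bar> * ?h ^ (r + 1) * M"
    using iw(2) L2norm_nonneg[of "w - iw"] by linarith
  also have "\<dots> = ?h * N" by (simp add: N_def)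
  finally have gw: "L2norm \<Omega> (grad \<Omega> (w - iw)) \<le> N" using h by simp
  obtain js where js: "js \<in> Qh \<Omega> D" "L2norm \<Omega> (s - js) \<le> C * ?h ^ r * sobolev_norm \<Omega> r s"
    using approx_p s(1,2) unfolding fun_diff_def by blast
  have gs: "L2norm \<Omega> (s - js) \<le> N"
    unfolding N_def using js(2) by (rule order_trans, intro bound) (use h s(3) sobolev_norm_nonneg in auto)
  note err = stokes_projection_error[OF w(1) s(1) proj \<beta> infsup iw(1) gw js(1) gs]
  show "L2norm \<Omega> (grad \<Omega> (w - w')) \<le> (1 + 2 * (1 + c) * m) * (\<bar>C\<bar> * M) * mesh_size D ^ r"
    using err(1) unfolding c_def m_def N_def by (simp only: mult_ac)
  show "L2norm \<Omega> (s - s') \<le> (1 + c * (m + 2 * (1 + c) * m)) * (\<bar>C\<bar> * M) * mesh_size D ^ r"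
    using err(2) unfolding c_def m_def N_def by (simp only: mult_ac)
qed

text \<open>
  The error at a midpoint splits into three parts: the difference of \<open>p\<close> from its mean value over
  the ends of the step, the mean projection error of \<open>p\<close>, and the quantity \<open>\<pi> n\<close> bounded by
  \<open>pressure_estimate\<close>. In the residual \<open>\<rho> n\<close>, the time derivative of \<open>u\<close> is compared with its
  difference quotient, and the difference quotient with its Stokes projection.
\<close>

lemma midpoint_pressure_error:
  assumes tm: "time_mesh T N t" and sch: "scheme_G \<Omega> D N t f u0h uh ph" and u0h: "u0h \<in> Vhdiv \<Omega> D"
    and weak: "\<And>s v. s \<in> {0..T} \<Longrightarrow> v \<in> V \<Omega> \<Longrightarrow> ip \<Omega> (f s) v = ip \<Omega> (W s) v + a_form \<Omega> (u s) v + b_form \<Omega> v (p s)"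
    and L: "\<And>s. s \<in> {0..T} \<Longrightarrow> f s \<in> L2 \<Omega>" "\<And>s. s \<in> {0..T} \<Longrightarrow> W s \<in> L2 \<Omega>"
      "\<And>s. s \<in> {0..T} \<Longrightarrow> u s \<in> V \<Omega>" "\<And>s. s \<in> {0..T} \<Longrightarrow> p s \<in> Q \<Omega>"
    and \<beta>: "0 < \<beta>" and infsup: "inf_sup_const \<beta>"
    and poinc: "\<And>v. v \<in> V \<Omega> \<Longrightarrow> L2norm \<Omega> v \<le> P * L2norm \<Omega> (grad \<Omega> v)" "0 \<le> P"
    and proj_p: "\<And>s w' s'. s \<in> {0..T} \<Longrightarrow> is_stokes_projection \<Omega> D (u s) (p s) w' s' \<Longrightarrow> L2norm \<Omega> (p s - s') \<le> \<eta>"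
    and proj_u: "\<And>a b w' s'. 0 \<le> a \<Longrightarrow> a < b \<Longrightarrow> b \<le> T \<Longrightarrow>
      is_stokes_projection \<Omega> D ((1 / (b - a)) *\<^sub>R (u b - u a)) ((1 / (b - a)) *\<^sub>R (p b - p a)) w' s' \<Longrightarrow>
      L2norm \<Omega> (grad \<Omega> ((1 / (b - a)) *\<^sub>R (u b - u a) - w')) \<le> \<eta>"
    and trap: "\<And>a b. 0 \<le> a \<Longrightarrow> a < b \<Longrightarrow> b \<le> T \<Longrightarrow>
      L2norm \<Omega> ((1 / (b - a)) *\<^sub>R (u b - u a) - (1/2) *\<^sub>R (W a + W b)) \<le> M * (b - a)\<^sup>2"
    and pmid: "\<And>a b. 0 \<le> a \<Longrightarrow> a < b \<Longrightarrow> b \<le> T \<Longrightarrow>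
      L2norm \<Omega> (p ((a + b) / 2) - (1/2) *\<^sub>R (p a + p b)) \<le> M * (b - a)\<^sup>2"
    and M: "0 \<le> M" and proj0: "is_stokes_projection \<Omega> D (u 0) (p 0) w0 s0"
  defines "\<tau> \<equiv> max_step N t"
  shows "(\<Sum>n=1..N. step t n * (L2norm \<Omega> (p (midpt t n) - ph (midpt t n)))\<^sup>2)
    \<le> 3 * (T * (M * \<tau>\<^sup>2)\<^sup>2 + T * \<eta>\<^sup>2 +
        4 / \<beta>\<^sup>2 * (2 + T) * ((L2norm \<Omega> (grad \<Omega> (w0 - uh 0)))\<^sup>2 + T * (P * \<eta> + M * \<tau>\<^sup>2)\<^sup>2))"
proof -
  note tmD = time_meshD[OF tm]
  have tin: "t n \<in> {0..T}" if "n \<le> N" for n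
    using time_mesh_le[OF tm, of 0 n] time_mesh_le[OF tm, of n N] that tmD by simp
  have "\<exists>w' s'. is_stokes_projection \<Omega> D (u (t n)) (p (t n)) w' s'" if "n \<le> N" for n
    using tin[OF that] L by (intro stokes_projection_exists V_sobolev Q_L2) auto
  then obtain uu pp where proj': "\<And>n. n \<le> N \<Longrightarrow> is_stokes_projection \<Omega> D (u (t n)) (p (t n)) (uu n) (pp n)"
    by metis
  \<comment> \<open>At time \<open>0\<close> the given projection is taken, since the initial error refers to it.\<close>
  define ut where "ut n = (if n = 0 then w0 else uu n)" for n
  define pt where "pt n = (if n = 0 then s0 else pp n)" for n
  have proj: "is_stokes_projection \<Omega> D (u (t n)) (p (t n)) (ut n) (pt n)" if "n \<le> N" for n
    using proj'[OF that] proj0 tmD(2) by (simp add: ut_def pt_def)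
  have ut: "ut n \<in> Vhdiv \<Omega> D" and pt: "pt n \<in> Qh \<Omega> D" if "n \<le> N" for n
    using proj[OF that] by (auto simp: is_stokes_projection_def Vhdiv_iff)
  define e where "e n = ut n - uh (t n)" for n
  define \<pi> where "\<pi> n = (1/2) *\<^sub>R (pt n + pt (n - 1)) - ph (midpt t n)" for n
  define du where "du n = (1 / step t n) *\<^sub>R (u (t n) - u (t (n - 1)))" for n
  define dut where "dut n = (1 / step t n) *\<^sub>R (ut n - ut (n - 1))" for n
  define \<rho> where "\<rho> n = dut n - (1/2) *\<^sub>R (W (t (n - 1)) + W (t n))" for n
  have n1: "n - 1 \<le> N" "n \<le> N" if "n \<in> {1..N}" for n using that by auto
  have e: "e n \<in> Vhdiv \<Omega> D" if "n \<le> N" for n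
    unfolding e_def by (intro subspace_diff[OF subspace_Vhdiv] ut scheme_Vhdiv[OF sch tm u0h] that)
  have \<pi>: "\<pi> n \<in> Qh \<Omega> D" if "n \<in> {1..N}" for n
    unfolding \<pi>_def using scheme_step(3)[OF sch tm that] pt n1[OF that] by (intro Qh_intros) auto
  have utV: "ut n \<in> Vh \<Omega> D" if "n \<le> N" for n using ut[OF that] by (simp add: Vhdiv_iff)
  have dutV: "dut n \<in> Vh \<Omega> D" if "n \<in> {1..N}" for n
    unfolding dut_def by (intro Vh_intros utV n1[OF that])
  have WL: "W (t n) \<in> L2 \<Omega>" if "n \<le> N" for n by (rule L(2)[OF tin[OF that]])
  have \<rho>: "\<rho> n \<in> L2 \<Omega>" if "n \<in> {1..N}" for n
    unfolding \<rho>_def by (intro L2.S_intros Vh_L2 dutV that WL n1[OF that])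
  have eq: "ip \<Omega> ((1 / step t n) *\<^sub>R (e n - e (n - 1))) v + a_form \<Omega> ((1/2) *\<^sub>R (e n + e (n - 1))) v + b_form \<Omega> v (\<pi> n)
      = ip \<Omega> (\<rho> n) v" if n: "n \<in> {1..N}" and v: "v \<in> Vh \<Omega> D" for n v
  proof -
    let ?U = "uh (t n)" and ?U' = "uh (t (n - 1))"
    note U = scheme_step(1,2)[OF sch tm n] and ph = scheme_step(3)[OF sch tm n]
    note nn = n1[OF n]
    note S = U[THEN Vh_sobolev] utV[OF nn(1), THEN Vh_sobolev] utV[OF nn(2), THEN Vh_sobolev] v[THEN Vh_sobolev]
    note S2 = U[THEN Vh_L2] utV[OF nn(1), THEN Vh_L2] utV[OF nn(2), THEN Vh_L2] v[THEN Vh_L2]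
      WL[OF nn(1)] WL[OF nn(2)] L(1)[OF tin[OF nn(1)]] L(1)[OF tin[OF nn(2)]] dutV[OF n, THEN Vh_L2]
    note S3 = ph[THEN Qh_L2] pt[OF nn(1), THEN Qh_L2] pt[OF nn(2), THEN Qh_L2]
    have p1: "a_form \<Omega> (ut n) v + b_form \<Omega> v (pt n) = ip \<Omega> (f (t n)) v - ip \<Omega> (W (t n)) v"
      using proj[OF nn(2)] v weak[OF tin[OF nn(2)] Vh_V[OF v]] by (simp add: is_stokes_projection_def)
    have p2: "a_form \<Omega> (ut (n - 1)) v + b_form \<Omega> v (pt (n - 1)) = ip \<Omega> (f (t (n - 1))) v - ip \<Omega> (W (t (n - 1))) v"
      using proj[OF nn(1)] v weak[OF tin[OF nn(1)] Vh_V[OF v]] by (simp add: is_stokes_projection_def)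
    have cn: "ip \<Omega> ((1 / step t n) *\<^sub>R (?U - ?U')) v + (a_form \<Omega> ?U v + a_form \<Omega> ?U' v) / 2 + b_form \<Omega> v (ph (midpt t n))
        = (ip \<Omega> (f (t (n - 1))) v + ip \<Omega> (f (t n)) v) / 2"
      using scheme_step(5)[OF sch tm n v] S S2 by (simp add: a.bilin a.S_intros L2.bilin del: One_nat_def)
    have d: "(1 / step t n) *\<^sub>R (e n - e (n - 1)) = dut n - (1 / step t n) *\<^sub>R (?U - ?U')"
      unfolding e_def dut_def by (simp only: scaleR_diff_right) (simp add: algebra_simps)
    have q1: "ip \<Omega> ((1 / step t n) *\<^sub>R (e n - e (n - 1))) v = ip \<Omega> (dut n) v - ip \<Omega> ((1 / step t n) *\<^sub>R (?U - ?U')) v"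
      unfolding d using S2 by (intro L2.diff_left L2.S_intros)
    have q2: "a_form \<Omega> ((1/2) *\<^sub>R (e n + e (n - 1))) v
        = (a_form \<Omega> (ut n) v + a_form \<Omega> (ut (n - 1)) v) / 2 - (a_form \<Omega> ?U v + a_form \<Omega> ?U' v) / 2"
      unfolding e_def using S by (simp add: a.bilin a.S_intros add_divide_distrib diff_divide_distrib del: One_nat_def)
    have q3: "b_form \<Omega> v (\<pi> n) = (b_form \<Omega> v (pt n) + b_form \<Omega> v (pt (n - 1))) / 2 - b_form \<Omega> v (ph (midpt t n))"
      unfolding \<pi>_def using S S3 by (simp add: b_bilin L2.S_intros del: One_nat_def)
    have q4: "ip \<Omega> (\<rho> n) v = ip \<Omega> (dut n) v - (ip \<Omega> (W (t (n - 1))) v + ip \<Omega> (W (t n)) v) / 2"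
      unfolding \<rho>_def using S2 by (simp add: L2.bilin L2.S_intros)
    show ?thesis by (rule crank_nicolson_algebra[OF q1 q2 q3 q4 p1 p2 cn])
  qed
  have \<tau>: "0 \<le> \<tau>" unfolding \<tau>_def by (rule max_step_nonneg[OF tm])
  have T: "0 \<le> T" using tin[of 0] by simp
  have \<eta>: "0 \<le> \<eta>" using order_trans[OF L2norm_nonneg proj_p[OF tin proj, of 0]] by simp
  have small: "M * (step t n)\<^sup>2 \<le> M * \<tau>\<^sup>2" if n: "n \<in> {1..N}" for n
    unfolding \<tau>_def using step_pos[OF tm n] step_le_max_step[OF n, of t] M
    by (intro mult_left_mono power_mono) auto
  have ab: "0 \<le> t (n - 1)" "t (n - 1) < t n" "t n \<le> T" if n: "n \<in> {1..N}" for n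
    using tin[OF n1(1)[OF n]] tin[OF n1(2)[OF n]] time_mesh_less[OF tm, of "n - 1" n] n by auto
  have \<rho>_bound: "L2norm \<Omega> (\<rho> n) \<le> P * \<eta> + M * \<tau>\<^sup>2" if n: "n \<in> {1..N}" for n
  proof -
    note nn = n1[OF n]
    have V: "u (t n) \<in> V \<Omega>" "u (t (n - 1)) \<in> V \<Omega>" by (intro L tin nn)+
    have p: "p (t n) \<in> L2 \<Omega>" "p (t (n - 1)) \<in> L2 \<Omega>" by (intro Q_L2[OF L(4)] tin nn)+
    have duV: "du n \<in> V \<Omega>" unfolding du_def by (intro subspace_scale[OF subspace_V] subspace_diff[OF subspace_V] V)
    have "is_stokes_projection \<Omega> D (du n) ((1 / step t n) *\<^sub>R (p (t n) - p (t (n - 1)))) (dut n)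
        ((1 / step t n) *\<^sub>R (pt n - pt (n - 1)))"
      unfolding du_def dut_def
      by (intro stokes_projection_diff proj nn V_sobolev V p)
    hence g: "L2norm \<Omega> (grad \<Omega> (du n - dut n)) \<le> \<eta>"
      unfolding du_def step_def by (rule proj_u[OF ab[OF n]])
    have ddV: "du n - dut n \<in> V \<Omega>" by (intro subspace_diff[OF subspace_V] duV Vh_V dutV n)
    have 1: "L2norm \<Omega> (du n - dut n) \<le> P * \<eta>"
      using poinc(1)[OF ddV] mult_left_mono[OF g poinc(2)] by linarith
    have 2: "L2norm \<Omega> (du n - (1/2) *\<^sub>R (W (t (n - 1)) + W (t n))) \<le> M * \<tau>\<^sup>2"
      using trap[OF ab[OF n]] small[OF n] unfolding du_def step_def by linarith
    have split: "\<rho> n = (du n - (1/2) *\<^sub>R (W (t (n - 1)) + W (t n))) - (du n - dut n)" by (simp add: \<rho>_def)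
    have "L2norm \<Omega> (\<rho> n) \<le> L2norm \<Omega> (du n - (1/2) *\<^sub>R (W (t (n - 1)) + W (t n))) + L2norm \<Omega> (du n - dut n)"
      unfolding split L2norm_eq_nrm
      by (intro L2.nrm_diff_triangle L2.S_intros V_L2[OF duV] WL nn Vh_L2[OF dutV[OF n]])
    thus ?thesis using 1 2 by linarith
  qed
  have steps: "(\<Sum>n=1..N. step t n * K) = T * K" for K
    using sum_step[OF tm] by (simp add: sum_distrib_right[symmetric])
  let ?E0 = "(L2norm \<Omega> (grad \<Omega> (w0 - uh 0)))\<^sup>2"
  let ?R = "P * \<eta> + M * \<tau>\<^sup>2"
  have e0: "e 0 = w0 - uh 0" by (simp add: e_def ut_def tmD)
  have "(\<Sum>n=1..N. step t n * (L2norm \<Omega> (\<rho> n))\<^sup>2) \<le> (\<Sum>n=1..N. step t n * ?R\<^sup>2)"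
    by (intro sum_mono mult_left_mono power_mono \<rho>_bound order.strict_implies_order[OF step_pos[OF tm]] L2norm_nonneg)
  hence R: "(\<Sum>n=1..N. step t n * (L2norm \<Omega> (\<rho> n))\<^sup>2) \<le> T * ?R\<^sup>2" unfolding steps .
  have "(\<Sum>n=1..N. step t n * (L2norm \<Omega> (\<pi> n))\<^sup>2) \<le>
      4 / \<beta>\<^sup>2 * (2 + (\<Sum>n=1..N. step t n)) * ((L2norm \<Omega> (grad \<Omega> (e 0)))\<^sup>2 + (\<Sum>n=1..N. step t n * (L2norm \<Omega> (\<rho> n))\<^sup>2))"
    by (rule pressure_estimate[of N e \<pi> \<rho> "step t" \<beta>]) (fact e \<pi> \<rho> step_pos[OF tm] eq \<beta> infsup)+
  also have "\<dots> \<le> 4 / \<beta>\<^sup>2 * (2 + T) * (?E0 + T * ?R\<^sup>2)"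
    unfolding sum_step[OF tm] e0 using R T by (intro mult_left_mono add_left_mono) auto
  finally have \<pi>_sum: "(\<Sum>n=1..N. step t n * (L2norm \<Omega> (\<pi> n))\<^sup>2) \<le> 4 / \<beta>\<^sup>2 * (2 + T) * (?E0 + T * ?R\<^sup>2)" .
  have single: "step t n * (L2norm \<Omega> (p (midpt t n) - ph (midpt t n)))\<^sup>2
      \<le> 3 * (step t n * (M * \<tau>\<^sup>2)\<^sup>2 + step t n * \<eta>\<^sup>2 + step t n * (L2norm \<Omega> (\<pi> n))\<^sup>2)" if n: "n \<in> {1..N}" for n
  proof -
    note nn = n1[OF n]
    have pl: "p (t n) \<in> L2 \<Omega>" "p (t (n - 1)) \<in> L2 \<Omega>" by (intro Q_L2[OF L(4)] tin nn)+
    have mid: "midpt t n \<in> {0..T}" using ab[OF n] by (auto simp: midpt_def)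
    have pm: "p (midpt t n) \<in> L2 \<Omega>" by (intro Q_L2[OF L(4)] mid)
    note S = pl pm pt[OF nn(1), THEN Qh_L2] pt[OF nn(2), THEN Qh_L2] \<pi>[OF n, THEN Qh_L2]
    let ?x = "p (midpt t n) - (1/2) *\<^sub>R (p (t (n - 1)) + p (t n))"
    let ?y = "(1/2) *\<^sub>R ((p (t n) - pt n) + (p (t (n - 1)) - pt (n - 1)))"
    have xS: "?x \<in> L2 \<Omega>" "?y \<in> L2 \<Omega>" by (intro L2.S_intros S)+
    have x: "L2norm \<Omega> ?x \<le> M * \<tau>\<^sup>2"
      using pmid[OF ab[OF n]] small[OF n] unfolding midpt_def step_def by linarith
    have "L2norm \<Omega> ?y = 1/2 * L2norm \<Omega> ((p (t n) - pt n) + (p (t (n - 1)) - pt (n - 1)))"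
    proof -
      have "(p (t n) - pt n) + (p (t (n - 1)) - pt (n - 1)) \<in> L2 \<Omega>" by (intro L2.S_intros S)
      from L2.nrm_scale[OF this] show ?thesis unfolding L2norm_eq_nrm by simp
    qed
    also have "\<dots> \<le> 1/2 * (L2norm \<Omega> (p (t n) - pt n) + L2norm \<Omega> (p (t (n - 1)) - pt (n - 1)))"
      unfolding L2norm_eq_nrm by (intro mult_left_mono L2.nrm_triangle L2.S_intros S) simp
    also have "\<dots> \<le> \<eta>"
      using proj_p[OF tin[OF nn(1)] proj[OF nn(1)]] proj_p[OF tin[OF nn(2)] proj[OF nn(2)]] by simp
    finally have y: "L2norm \<Omega> ?y \<le> \<eta>" .
    have split: "p (midpt t n) - ph (midpt t n) = ?x + ?y + \<pi> n"
      by (rule ext) (simp add: \<pi>_def field_simps)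
    have "L2norm \<Omega> (p (midpt t n) - ph (midpt t n)) \<le> L2norm \<Omega> ?x + L2norm \<Omega> ?y + L2norm \<Omega> (\<pi> n)"
      unfolding split by (rule L2norm_triangle3[OF xS S(6)])
    hence "L2norm \<Omega> (p (midpt t n) - ph (midpt t n)) \<le> M * \<tau>\<^sup>2 + \<eta> + L2norm \<Omega> (\<pi> n)" using x y by linarith
    hence "(L2norm \<Omega> (p (midpt t n) - ph (midpt t n)))\<^sup>2 \<le> (M * \<tau>\<^sup>2 + \<eta> + L2norm \<Omega> (\<pi> n))\<^sup>2"
      by (intro power_mono L2norm_nonneg)
    also have "\<dots> \<le> 3 * ((M * \<tau>\<^sup>2)\<^sup>2 + \<eta>\<^sup>2 + (L2norm \<Omega> (\<pi> n))\<^sup>2)" by (rule power2_sum3_le)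
    finally have "step t n * (L2norm \<Omega> (p (midpt t n) - ph (midpt t n)))\<^sup>2
        \<le> step t n * (3 * ((M * \<tau>\<^sup>2)\<^sup>2 + \<eta>\<^sup>2 + (L2norm \<Omega> (\<pi> n))\<^sup>2))"
      using step_pos[OF tm n] by (intro mult_left_mono) auto
    thus ?thesis by (simp only: distrib_left mult_ac)
  qed
  have "(\<Sum>n=1..N. step t n * (L2norm \<Omega> (p (midpt t n) - ph (midpt t n)))\<^sup>2)
      \<le> (\<Sum>n=1..N. 3 * (step t n * (M * \<tau>\<^sup>2)\<^sup>2 + step t n * \<eta>\<^sup>2 + step t n * (L2norm \<Omega> (\<pi> n))\<^sup>2))"
    by (rule sum_mono) (rule single)
  also have "\<dots> = 3 * (T * (M * \<tau>\<^sup>2)\<^sup>2 + T * \<eta>\<^sup>2 + (\<Sum>n=1..N. step t n * (L2norm \<Omega> (\<pi> n))\<^sup>2))"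
    by (simp only: sum_distrib_left[symmetric] sum.distrib steps)
  also have "\<dots> \<le> 3 * (T * (M * \<tau>\<^sup>2)\<^sup>2 + T * \<eta>\<^sup>2 + 4 / \<beta>\<^sup>2 * (2 + T) * (?E0 + T * ?R\<^sup>2))"
    using \<pi>_sum by simp
  finally show ?thesis .
qed

end

section \<open>Post-processing\<close>

lemma subint_index_eq:
  assumes tm: "time_mesh T N t" and n: "n \<in> {1..N}" and s: "s \<in> subint t n"
  shows "subint_index N t s = n"
  unfolding subint_index_def
proof (rule the_equality)
  show "n \<in> {1..N} \<and> s \<in> subint t n" using n s by simp
  fix m assume m: "m \<in> {1..N} \<and> s \<in> subint t m"
  show "m = n"
  proof (rule ccontr)
    assume "m \<noteq> n"
    then consider "m \<le> n - 1" | "n \<le> m - 1" by linarith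
    thus False
    proof cases
      case 1
      hence "t m \<le> t (n - 1)" using n by (intro time_mesh_le[OF tm]) auto
      thus False using m s by (simp add: subint_def)
    next
      case 2
      hence "t n \<le> t (m - 1)" using m by (intro time_mesh_le[OF tm]) auto
      thus False using m s by (simp add: subint_def)
    qed
  qed
qed

text \<open>The first step shares the line of the second one, hence \<open>max n 2\<close>.\<close>

lemma p_bar_eq:
  assumes tm: "time_mesh T N t" and n: "n \<in> {1..N}" and s: "s \<in> subint t n"
  shows "p_bar N t q s = J_interp t (max n 2) q s"
proof (cases "n = 1")
  case True
  hence "max n 2 = 2" "s \<le> t 1" using s by (auto simp: subint_def)
  thus ?thesis by (simp only: p_bar_def if_True)
next
  case False
  have "t 1 \<le> t (n - 1)" using False n by (intro time_mesh_le[OF tm]) auto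
  hence "\<not> s \<le> t 1" using s by (simp add: subint_def)
  moreover have "max n 2 = n" using False n by auto
  ultimately show ?thesis by (simp only: p_bar_def if_False subint_index_eq[OF tm n s])
qed

text \<open>
  In step \<open>n\<close> the errors at the midpoints with the numbers \<open>i - 1\<close> and \<open>i\<close> occur, where
  \<open>i = max n 2\<close>. The bounds on the step ratios replace the weight of step \<open>n\<close> by that of step
  \<open>n - 1\<close>, and the weight of the first step by that of the second.
\<close>

lemma weighted_sum_shift:
  assumes tm: "time_mesh T N t" and c: "step t 1 \<le> c1 * step t 2" "\<forall>m\<in>{2..N}. step t m \<le> c2 * step t (m - 1)"
    and c0: "0 \<le> c1" "0 \<le> c2" and d: "\<And>n. 0 \<le> d n"
  shows "(\<Sum>n=1..N. step t n * (d (max n 2 - 1) + d (max n 2))) \<le> (1 + c1 + c2) * (\<Sum>n=1..N. step t n * d n)"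
proof -
  note N = time_meshD(1)[OF tm]
  let ?S = "\<Sum>n=1..N. step t n * d n"
  have nn: "0 \<le> step t n * d n" if "n \<in> {1..N}" for n using step_pos[OF tm that] d by simp
  have split: "(\<Sum>n=1..N. g n) = g 1 + (\<Sum>n=2..N. g n)" for g :: "nat \<Rightarrow> real"
    using sum.atLeast_Suc_atMost[of 1 N g] N by (simp add: numeral_2_eq_2)
  have "(\<Sum>n=1..N. step t n * (d (max n 2 - 1) + d (max n 2)))
      = step t 1 * (d 1 + d 2) + (\<Sum>n=2..N. step t n * (d (n - 1) + d n))"
  proof -
    have "(\<Sum>n=2..N. step t n * (d (max n 2 - 1) + d (max n 2))) = (\<Sum>n=2..N. step t n * (d (n - 1) + d n))"
      by (intro sum.cong refl) (simp add: max_absorb1)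
    moreover have "max (1::nat) 2 = 2" "(2::nat) - 1 = 1" by simp_all
    ultimately show ?thesis unfolding split by (simp only:)
  qed
  also have "\<dots> = ?S + step t 1 * d 2 + (\<Sum>n=2..N. step t n * d (n - 1))"
    unfolding split[of "\<lambda>n. step t n * d n"] by (simp add: distrib_left sum.distrib)
  also have "step t 1 * d 2 \<le> c1 * ?S"
  proof -
    have "step t 1 * d 2 \<le> c1 * step t 2 * d 2" by (intro mult_right_mono c d)
    also have "\<dots> \<le> c1 * ?S"
      using member_le_sum[of 2 "{1..N}" "\<lambda>n. step t n * d n"] nn N c0
      by (simp add: mult.assoc mult_left_mono)
    finally show ?thesis .
  qed
  also have "(\<Sum>n=2..N. step t n * d (n - 1)) \<le> c2 * ?S"
  proof -
    have "(\<Sum>n=2..N. step t n * d (n - 1)) \<le> (\<Sum>n=2..N. c2 * (step t (n - 1) * d (n - 1)))"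
    proof (rule sum_mono)
      fix n assume "n \<in> {2..N}"
      hence "step t n * d (n - 1) \<le> c2 * step t (n - 1) * d (n - 1)" using c d by (intro mult_right_mono) auto
      thus "step t n * d (n - 1) \<le> c2 * (step t (n - 1) * d (n - 1))" by (simp add: mult.assoc)
    qed
    also have "\<dots> = c2 * (\<Sum>n=2..N. step t (n - 1) * d (n - 1))" by (simp add: sum_distrib_left)
    also have "(\<Sum>n=2..N. step t (n - 1) * d (n - 1)) = (\<Sum>n=1..N - 1. step t n * d n)"
      by (rule sum.reindex_bij_witness[of _ Suc "\<lambda>n. n - 1"]) auto
    also have "c2 * \<dots> \<le> c2 * ?S" using c0 nn by (intro mult_left_mono sum_mono2) auto
    finally show ?thesis .
  qed
  finally show ?thesis by (simp add: algebra_simps)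
qed

text \<open>
  If \<open>F\<close> is not integrable, its integral is zero by convention, and the claim holds because the
  \<open>B n\<close> are nonnegative. The time \<open>0\<close> belongs to no subinterval and is assigned to the first one.
\<close>

lemma set_integral_le_sum:
  assumes tm: "time_mesh T N t" and F: "\<And>n s. n \<in> {1..N} \<Longrightarrow> s \<in> subint t n \<Longrightarrow> F s \<le> B n"
    and F0: "F 0 \<le> B 1" and B: "\<And>n. n \<in> {1..N} \<Longrightarrow> 0 \<le> B n"
  shows "(LBINT s:{0..T}. F s) \<le> (\<Sum>n=1..N. step t n * B n)"
proof -
  let ?G = "\<lambda>s. \<Sum>n=1..N. indicator {t (n - 1)..t n} s * B n"
  have le: "t (n - 1) \<le> t n" if "n \<in> {1..N}" for n using that by (intro time_mesh_le[OF tm]) auto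
  have cover: "\<exists>n\<in>{1..N}. s \<in> {t (n - 1)..t n} \<and> F s \<le> B n" if s: "s \<in> {0..T}" for s
  proof -
    define n where "n = (LEAST n. s \<le> t n)"
    have ex: "s \<le> t N" using s time_meshD(3)[OF tm] by simp
    have n: "s \<le> t n" "n \<le> N" unfolding n_def using LeastI[of "\<lambda>n. s \<le> t n", OF ex] Least_le[of "\<lambda>n. s \<le> t n", OF ex] by auto
    show ?thesis
    proof (cases "n = 0")
      case True
      hence "s = 0" using n s time_meshD(2)[OF tm] by simp
      thus ?thesis using time_meshD(1,2)[OF tm] le[of 1] F0 by (intro bexI[of _ 1]) auto
    next
      case False
      hence "\<not> s \<le> t (n - 1)" using not_less_Least[of "n - 1" "\<lambda>n. s \<le> t n"] by (simp add: n_def)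
      thus ?thesis using n False F[of n s] by (intro bexI[of _ n]) (auto simp: subint_def)
    qed
  qed
  have G0: "0 \<le> ?G s" for s using B by (intro sum_nonneg mult_nonneg_nonneg) auto
  have int: "integrable lborel (\<lambda>s. indicator {t (n - 1)..t n} s * B n)" for n
    by (intro integrable_mult_left integrable_real_indicator)
      (auto intro!: emeasure_bounded_finite[unfolded infinity_ennreal_def])
  have "(LBINT s:{0..T}. F s) \<le> (\<integral>s. ?G s \<partial>lborel)"
    unfolding set_lebesgue_integral_def
  proof (rule integral_mono')
    show "integrable lborel ?G" by (intro Bochner_Integration.integrable_sum int)
    fix s :: real
    show "indicator {0..T} s *\<^sub>R F s \<le> ?G s"
    proof (cases "s \<in> {0..T}")
      case True
      then obtain n where n: "n \<in> {1..N}" "s \<in> {t (n - 1)..t n}" "F s \<le> B n" using cover by blast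
      have "F s \<le> indicator {t (n - 1)..t n} s * B n" using n(2,3) by simp
      also have "\<dots> \<le> ?G s"
        using n(1) B by (intro member_le_sum[of n "{1..N}" "\<lambda>n. indicator {t (n - 1)..t n} s * B n"]) auto
      finally show ?thesis using True by simp
    qed (use G0 in simp)
  qed (rule G0)
  also have "\<dots> = (\<Sum>n=1..N. \<integral>s. indicator {t (n - 1)..t n} s * B n \<partial>lborel)"
    by (rule Bochner_Integration.integral_sum) (rule int)
  also have "\<dots> = (\<Sum>n=1..N. step t n * B n)"
    using le by (intro sum.cong refl) (simp add: step_def)
  finally show ?thesis .
qed

context bounded_open
begin

text \<open>
  Let \<open>c\<close> and \<open>d\<close> be the two midpoints. Whatever the ratio of the two steps around them, \<open>d - c\<close>
  is half their total length, so \<open>s = c + \<theta> (d - c)\<close> with \<open>\<theta>\<close> between \<open>-1\<close> and \<open>2\<close>. Hence the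
  errors of the values at \<open>c\<close> and \<open>d\<close>, which enter with the factors \<open>1 - \<theta>\<close> and \<open>\<theta>\<close>, are at most
  doubled.
\<close>

lemma interpolation_error:
  assumes tm: "time_mesh T N t" and p: "\<And>s. s \<in> {0..T} \<Longrightarrow> p s \<in> L2 \<Omega>"
    and q: "\<And>n. n \<in> {1..N} \<Longrightarrow> q (midpt t n) \<in> L2 \<Omega>"
    and interp: "\<And>a b c d s. \<lbrakk>{a..b} \<subseteq> {0..T}; s \<in> {a..b}; c \<in> {a..b}; d \<in> {a..b}; c < d\<rbrakk> \<Longrightarrow>
      L2norm \<Omega> (p s - (p c + ((s - c) / (d - c)) *\<^sub>R (p d - p c))) \<le> K * (b - a)\<^sup>2" and K: "0 \<le> K"
    and i: "i \<in> {2..N}" and s: "s \<in> {t (i - 2)..t i}"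
  defines "\<tau> \<equiv> max_step N t" and "\<delta> \<equiv> \<lambda>n. L2norm \<Omega> (p (midpt t n) - q (midpt t n))"
  shows "(L2norm \<Omega> (p s - J_interp t i q s))\<^sup>2 \<le> 48 * K\<^sup>2 * (\<tau>\<^sup>2)\<^sup>2 + 12 * ((\<delta> (i - 1))\<^sup>2 + (\<delta> i)\<^sup>2)"
    and "J_interp t i q s \<in> L2 \<Omega>"
proof -
  define a0 a1 a2 where "a0 = t (i - 2)" and "a1 = t (i - 1)" and "a2 = t i"
  have less: "a0 < a1" "a1 < a2" unfolding a0_def a1_def a2_def
    using i by (auto intro!: time_mesh_less[OF tm])
  have range: "{a0..a2} \<subseteq> {0..T}"
    using time_mesh_le[OF tm, of 0 "i - 2"] time_mesh_le[OF tm, of i N] i time_meshD(2,3)[OF tm]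
    by (auto simp: a0_def a2_def)
  define c d where "c = midpt t (i - 1)" and "d = midpt t i"
  have i2: "i - 1 - 1 = i - 2" by simp
  have c: "c = (a0 + a1) / 2" and d: "d = (a1 + a2) / 2"
    by (simp_all only: c_def d_def midpt_def a0_def a1_def a2_def i2)
  have cd: "c < d" "c \<in> {a0..a2}" "d \<in> {a0..a2}" using less by (auto simp: c d)
  have sa: "s \<in> {a0..a2}" using s by (simp add: a0_def a2_def)
  define \<theta> where "\<theta> = (s - c) / (d - c)"
  have \<theta>: "\<bar>\<theta>\<bar> \<le> 2" "\<bar>1 - \<theta>\<bar> \<le> 2"
  proof -
    have "s - c \<le> 2 * (d - c)" "- (d - c) \<le> s - c" using sa less unfolding c d by (auto simp: field_simps)
    hence "\<theta> \<le> 2" "-1 \<le> \<theta>" using cd(1) by (simp_all add: \<theta>_def field_simps)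
    thus "\<bar>\<theta>\<bar> \<le> 2" "\<bar>1 - \<theta>\<bar> \<le> 2" by auto
  qed
  have J: "J_interp t i q s = q c + \<theta> *\<^sub>R (q d - q c)"
    by (simp add: fun_eq_iff J_interp_def c_def d_def \<theta>_def)
  have pS: "p s \<in> L2 \<Omega>" "p c \<in> L2 \<Omega>" "p d \<in> L2 \<Omega>" using range sa cd by (auto intro!: p)
  have qS: "q c \<in> L2 \<Omega>" "q d \<in> L2 \<Omega>" using i by (auto simp: c_def d_def intro!: q)
  show "J_interp t i q s \<in> L2 \<Omega>" unfolding J by (intro L2.S_intros qS)
  have \<tau>: "a2 - a0 \<le> 2 * \<tau>"
  proof -
    have "a2 - a1 \<le> \<tau>" using step_le_max_step[of i N t] i by (simp add: \<tau>_def step_def a1_def a2_def)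
    moreover have "step t (i - 1) \<le> \<tau>" unfolding \<tau>_def using i by (intro step_le_max_step) auto
    hence "a1 - a0 \<le> \<tau>" unfolding step_def i2 a0_def a1_def .
    ultimately show ?thesis by linarith
  qed
  let ?x = "p s - (p c + \<theta> *\<^sub>R (p d - p c))" and ?y = "(1 - \<theta>) *\<^sub>R (p c - q c)" and ?z = "\<theta> *\<^sub>R (p d - q d)"
  have S: "?x \<in> L2 \<Omega>" "?y \<in> L2 \<Omega>" "?z \<in> L2 \<Omega>" by (intro L2.S_intros pS qS)+
  have "L2norm \<Omega> ?x \<le> K * (a2 - a0)\<^sup>2" unfolding \<theta>_def by (rule interp[OF range sa cd(2,3,1)])
  also have "\<dots> \<le> K * (2 * \<tau>)\<^sup>2" using \<tau> less K by (intro mult_left_mono power_mono) auto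
  finally have x: "L2norm \<Omega> ?x \<le> 4 * K * \<tau>\<^sup>2" by (simp add: power_mult_distrib)
  have y: "L2norm \<Omega> ?y \<le> 2 * \<delta> (i - 1)"
    using L2.nrm_scale[OF L2.S_diff[OF pS(2) qS(1)], of "1 - \<theta>"]
      mult_right_mono[OF \<theta>(2) L2norm_nonneg[of "p c - q c"]] by (simp add: L2norm_eq_nrm \<delta>_def c_def)
  have z: "L2norm \<Omega> ?z \<le> 2 * \<delta> i"
    using L2.nrm_scale[OF L2.S_diff[OF pS(3) qS(2)], of \<theta>]
      mult_right_mono[OF \<theta>(1) L2norm_nonneg[of "p d - q d"]] by (simp add: L2norm_eq_nrm \<delta>_def d_def)
  have split: "p s - J_interp t i q s = ?x + ?y + ?z"
    unfolding J by (rule ext) (simp add: algebra_simps)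
  have "L2norm \<Omega> (p s - J_interp t i q s) \<le> L2norm \<Omega> ?x + L2norm \<Omega> ?y + L2norm \<Omega> ?z"
    unfolding split by (rule L2norm_triangle3[OF S])
  hence "L2norm \<Omega> (p s - J_interp t i q s) \<le> 4 * K * \<tau>\<^sup>2 + 2 * \<delta> (i - 1) + 2 * \<delta> i" using x y z by linarith
  hence "(L2norm \<Omega> (p s - J_interp t i q s))\<^sup>2 \<le> (4 * K * \<tau>\<^sup>2 + 2 * \<delta> (i - 1) + 2 * \<delta> i)\<^sup>2"
    by (intro power_mono L2norm_nonneg)
  also have "\<dots> \<le> 3 * ((4 * K * \<tau>\<^sup>2)\<^sup>2 + (2 * \<delta> (i - 1))\<^sup>2 + (2 * \<delta> i)\<^sup>2)" by (rule power2_sum3_le)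
  finally show "(L2norm \<Omega> (p s - J_interp t i q s))\<^sup>2 \<le> 48 * K\<^sup>2 * (\<tau>\<^sup>2)\<^sup>2 + 12 * ((\<delta> (i - 1))\<^sup>2 + (\<delta> i)\<^sup>2)"
    by (simp add: power_mult_distrib)
qed

text \<open>
  The bound \<open>B n\<close> holds at all times of the closed step. It therefore applies to the time integral
  as well as to the right-sided limit at the left end of the step, which is the value of the line
  there.
\<close>

lemma postprocessing_error:
  assumes tm: "time_mesh T N t" and p: "\<And>s. s \<in> {0..T} \<Longrightarrow> p s \<in> L2 \<Omega>"
    and q: "\<And>n. n \<in> {1..N} \<Longrightarrow> q (midpt t n) \<in> L2 \<Omega>"
    and interp: "\<And>a b c d s. \<lbrakk>{a..b} \<subseteq> {0..T}; s \<in> {a..b}; c \<in> {a..b}; d \<in> {a..b}; c < d\<rbrakk> \<Longrightarrow>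
      L2norm \<Omega> (p s - (p c + ((s - c) / (d - c)) *\<^sub>R (p d - p c))) \<le> K * (b - a)\<^sup>2" and K: "0 \<le> K"
    and c: "step t 1 \<le> c1 * step t 2" "\<forall>m\<in>{2..N}. step t m \<le> c2 * step t (m - 1)" "0 \<le> c1" "0 \<le> c2"
  defines "\<tau> \<equiv> max_step N t" and "\<delta> \<equiv> \<lambda>n. L2norm \<Omega> (p (midpt t n) - q (midpt t n))"
  defines "X \<equiv> 48 * T * K\<^sup>2 * (\<tau>\<^sup>2)\<^sup>2 + 12 * (1 + c1 + c2) * (\<Sum>n=1..N. step t n * (\<delta> n)\<^sup>2)"
  shows "(\<Sum>m=1..N. step t m * (L2norm \<Omega> (\<lambda>x. p (t (m - 1)) x - right_limit \<Omega> (p_bar N t q) (t (m - 1)) x))\<^sup>2) \<le> X"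
    and "(LBINT s:{0..T}. (L2norm \<Omega> (\<lambda>x. p s x - p_bar N t q s x))\<^sup>2) \<le> X"
proof -
  define B where "B n = 48 * K\<^sup>2 * (\<tau>\<^sup>2)\<^sup>2 + 12 * ((\<delta> (max n 2 - 1))\<^sup>2 + (\<delta> (max n 2))\<^sup>2)" for n
  have B0: "0 \<le> B n" for n by (simp add: B_def)
  have "(\<Sum>n=1..N. step t n * B n) = (\<Sum>n=1..N. step t n) * (48 * K\<^sup>2 * (\<tau>\<^sup>2)\<^sup>2)
      + 12 * (\<Sum>n=1..N. step t n * ((\<delta> (max n 2 - 1))\<^sup>2 + (\<delta> (max n 2))\<^sup>2))"
    unfolding B_def sum_distrib_left sum_distrib_right sum.distrib[symmetric]
    by (intro sum.cong refl) (simp add: algebra_simps)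
  also have "\<dots> \<le> T * (48 * K\<^sup>2 * (\<tau>\<^sup>2)\<^sup>2) + 12 * ((1 + c1 + c2) * (\<Sum>n=1..N. step t n * (\<delta> n)\<^sup>2))"
    unfolding sum_step[OF tm]
    by (intro add_left_mono mult_left_mono weighted_sum_shift[OF tm c, of "\<lambda>n. (\<delta> n)\<^sup>2"]) auto
  also have "\<dots> = X" unfolding X_def by (simp only: mult_ac)
  finally have BX: "(\<Sum>n=1..N. step t n * B n) \<le> X" .
  have N: "2 \<le> N" by (rule time_meshD(1)[OF tm])
  have incl: "max n 2 \<in> {2..N}" "{t (n - 1)..t n} \<subseteq> {t (max n 2 - 2)..t (max n 2)}" if n: "n \<in> {1..N}" for n
  proof -
    show "max n 2 \<in> {2..N}" using n N by auto
    hence "t n \<le> t (max n 2)" "t (max n 2 - 2) \<le> t (n - 1)"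
      using n by (auto intro!: time_mesh_le[OF tm])
    thus "{t (n - 1)..t n} \<subseteq> {t (max n 2 - 2)..t (max n 2)}" by auto
  qed
  have err: "(L2norm \<Omega> (p s - J_interp t i q s))\<^sup>2 \<le> 48 * K\<^sup>2 * (\<tau>\<^sup>2)\<^sup>2 + 12 * ((\<delta> (i - 1))\<^sup>2 + (\<delta> i)\<^sup>2)"
    "J_interp t i q s \<in> L2 \<Omega>" if i: "i \<in> {2..N}" and s: "s \<in> {t (i - 2)..t i}" for i s
    unfolding \<tau>_def \<delta>_def
    by (rule interpolation_error(1)[where T = T and p = p and q = q and K = K]; fact tm p q interp K i s)
      (rule interpolation_error(2)[where T = T and p = p and q = q and K = K]; fact tm p q interp K i s)
  have bound: "(L2norm \<Omega> (p s - J_interp t (max n 2) q s))\<^sup>2 \<le> B n" and JL: "J_interp t (max n 2) q s \<in> L2 \<Omega>"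
    if n: "n \<in> {1..N}" and s: "s \<in> {t (n - 1)..t n}" for n s
    using err[OF incl(1)[OF n] subsetD[OF incl(2)[OF n] s]] unfolding B_def by auto
  have tin: "t n \<in> {0..T}" if "n \<le> N" for n
    using time_mesh_le[OF tm, of 0 n] time_mesh_le[OF tm, of n N] that time_meshD[OF tm] by simp
  have rl: "ae_eq \<Omega> (right_limit \<Omega> (p_bar N t q) (t (n - 1))) (J_interp t (max n 2) q (t (n - 1)))"
    if n: "n \<in> {1..N}" for n
  proof -
    let ?a = "t (n - 1)" and ?J = "J_interp t (max n 2) q"
    have less: "?a < t n" using n by (intro time_mesh_less[OF tm]) auto
    have ev: "\<forall>\<^sub>F s in at_right ?a. s \<in> subint t n"
      unfolding subint_def using less by (auto simp: eventually_at_right_field intro!: exI[of _ "t n"])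
    define c d where "c = midpt t (max n 2 - 1)" and "d = midpt t (max n 2)"
    define k where "k = q d - q c"
    have kL: "k \<in> L2 \<Omega>" unfolding k_def c_def d_def using n N by (intro L2.S_diff q) auto
    have Jd: "?J s - ?J ?a = ((s - ?a) / (d - c)) *\<^sub>R k" for s
      by (rule ext) (simp add: J_interp_def c_def d_def k_def diff_divide_distrib algebra_simps)
    show ?thesis
    proof (rule right_limit_unique)
      show "\<forall>\<^sub>F s in at_right ?a. p_bar N t q s \<in> L2 \<Omega>"
        using ev
      proof eventually_elim
        case (elim s)
        thus ?case using JL[OF n, of s] p_bar_eq[OF tm n elim, of q] by (simp add: subint_def)
      qed
      show "?J ?a \<in> L2 \<Omega>" by (rule JL[OF n]) (use less in simp)
      have "((\<lambda>s. \<bar>(s - ?a) / (d - c)\<bar> * L2norm \<Omega> k) \<longlongrightarrow> \<bar>(?a - ?a) * inverse (d - c)\<bar> * L2norm \<Omega> k) (at_right ?a)"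
        unfolding divide_inverse by (intro tendsto_intros)
      hence "((\<lambda>s. \<bar>(s - ?a) / (d - c)\<bar> * L2norm \<Omega> k) \<longlongrightarrow> 0) (at_right ?a)" by simp
      moreover have "\<forall>\<^sub>F s in at_right ?a. \<bar>(s - ?a) / (d - c)\<bar> * L2norm \<Omega> k = L2norm \<Omega> (p_bar N t q s - ?J ?a)"
        using ev
      proof eventually_elim
        case (elim s)
        have "L2norm \<Omega> (p_bar N t q s - ?J ?a) = L2norm \<Omega> (((s - ?a) / (d - c)) *\<^sub>R k)"
          by (simp only: p_bar_eq[OF tm n elim] Jd)
        thus ?case using L2.nrm_scale[OF kL] by (simp only: L2norm_eq_nrm)
      qed
      ultimately show "((\<lambda>s. L2norm \<Omega> (p_bar N t q s - ?J ?a)) \<longlongrightarrow> 0) (at_right ?a)"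
        by (rule Lim_transform_eventually)
    qed
  qed
  have "(\<Sum>m=1..N. step t m * (L2norm \<Omega> (\<lambda>x. p (t (m - 1)) x - right_limit \<Omega> (p_bar N t q) (t (m - 1)) x))\<^sup>2)
      \<le> (\<Sum>m=1..N. step t m * B m)"
  proof (intro sum_mono mult_left_mono)
    fix m assume m: "m \<in> {1..N}"
    show "0 \<le> step t m" using step_pos[OF tm m] by simp
    have "L2norm \<Omega> (p (t (m - 1)) - right_limit \<Omega> (p_bar N t q) (t (m - 1))) = L2norm \<Omega> (p (t (m - 1)) - J_interp t (max m 2) q (t (m - 1)))"
      by (intro L2norm_cong ae_eq_diff rl m ae_eq_refl)
    moreover have "t (m - 1) \<in> {t (m - 1)..t m}" using time_mesh_le[OF tm, of "m - 1" m] m by auto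
    ultimately show "(L2norm \<Omega> (\<lambda>x. p (t (m - 1)) x - right_limit \<Omega> (p_bar N t q) (t (m - 1)) x))\<^sup>2 \<le> B m"
      using bound[OF m] by (simp only: fun_diff_def)
  qed
  thus "(\<Sum>m=1..N. step t m * (L2norm \<Omega> (\<lambda>x. p (t (m - 1)) x - right_limit \<Omega> (p_bar N t q) (t (m - 1)) x))\<^sup>2) \<le> X"
    using BX by linarith
  have "(LBINT s:{0..T}. (L2norm \<Omega> (\<lambda>x. p s x - p_bar N t q s x))\<^sup>2) \<le> (\<Sum>m=1..N. step t m * B m)"
  proof (rule set_integral_le_sum[OF tm _ _ B0])
    show "(L2norm \<Omega> (\<lambda>x. p s x - p_bar N t q s x))\<^sup>2 \<le> B n" if n: "n \<in> {1..N}" and s: "s \<in> subint t n" for n s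
      using bound[OF n, of s] s p_bar_eq[OF tm n s, of q] by (simp add: fun_diff_def subint_def)
    have one: "1 \<in> {1..N}" and t0: "0 \<le> t 1" using N time_mesh_le[OF tm, of 0 1] time_meshD(2)[OF tm] by auto
    have "max 1 2 = (2::nat)" by simp
    hence "p_bar N t q 0 = J_interp t (max 1 2) q 0" using t0 by (simp only: p_bar_def if_True)
    thus "(L2norm \<Omega> (\<lambda>x. p 0 x - p_bar N t q 0 x))\<^sup>2 \<le> B 1"
      using bound[OF one, of 0] t0 time_meshD(2)[OF tm] by (simp add: fun_diff_def)
  qed
  thus "(LBINT s:{0..T}. (L2norm \<Omega> (\<lambda>x. p s x - p_bar N t q s x))\<^sup>2) \<le> X" using BX by linarith
qed

end

section \<open>Convergence of the post-processed pressure\<close>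

lemma power2_sum2_le: "(x + y)\<^sup>2 \<le> 2 * x\<^sup>2 + 2 * y\<^sup>2" for x y :: real
  using sum_squares_bound[of x y] by (simp add: power2_sum)

text \<open>
  The constant has to be found before the quantities \<open>S\<close>, \<open>E\<close>, \<open>\<tau>\<close> and \<open>\<eta>\<close> are known. After the
  square of the sum has been estimated by \<open>power2_sum2_le\<close>, the bound is linear in \<open>E\<close>, \<open>\<tau>\<^sup>2\<close> and
  \<open>\<eta>\<^sup>2\<close> with the coefficients \<open>A\<close>, \<open>A'\<close> and \<open>A''\<close>. In the application, \<open>\<tau>\<close> is the square of the
  time step and \<open>\<eta>\<close> is \<open>h ^ r\<close>.
\<close>

lemma collect_constants:
  fixes T K M \<kappa> P \<beta> c1 c2 :: real
  assumes "0 \<le> T" "0 < \<beta>" "0 \<le> c1" "0 \<le> c2"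
  obtains C where "0 < C"
    "\<And>S E \<tau> \<eta>. S \<le> 3 * (T * (M * \<tau>)\<^sup>2 + T * (\<kappa> * \<eta>)\<^sup>2 + 4 / \<beta>\<^sup>2 * (2 + T) * (E + T * (P * (\<kappa> * \<eta>) + M * \<tau>)\<^sup>2)) \<Longrightarrow> 0 \<le> E \<Longrightarrow>
      48 * T * K\<^sup>2 * \<tau>\<^sup>2 + 12 * (1 + c1 + c2) * S \<le> C * (E + \<tau>\<^sup>2 + \<eta>\<^sup>2)"
proof -
  define L where "L = 12 * (1 + c1 + c2)"
  define G where "G = 4 / \<beta>\<^sup>2 * (2 + T)"
  have L: "0 \<le> L" and G: "0 \<le> G" using assms by (auto simp: L_def G_def)
  define A where "A = L * (3 * G)"
  define A' where "A' = 48 * T * K\<^sup>2 + L * (3 * (T * M\<^sup>2 + G * T * (2 * M\<^sup>2)))"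
  define A'' where "A'' = L * (3 * (T * \<kappa>\<^sup>2 + G * T * (2 * (P * \<kappa>)\<^sup>2)))"
  have nn: "0 \<le> A" "0 \<le> A'" "0 \<le> A''" using assms L G by (auto simp: A_def A'_def A''_def)
  define C where "C = A + A' + A'' + 1"
  have "48 * T * K\<^sup>2 * \<tau>\<^sup>2 + 12 * (1 + c1 + c2) * S \<le> C * (E + \<tau>\<^sup>2 + \<eta>\<^sup>2)"
    if S: "S \<le> 3 * (T * (M * \<tau>)\<^sup>2 + T * (\<kappa> * \<eta>)\<^sup>2 + 4 / \<beta>\<^sup>2 * (2 + T) * (E + T * (P * (\<kappa> * \<eta>) + M * \<tau>)\<^sup>2))"
      and E: "0 \<le> E" for S E \<tau> \<eta>
  proof -
    have "S \<le> 3 * (T * (M * \<tau>)\<^sup>2 + T * (\<kappa> * \<eta>)\<^sup>2 + G * (E + T * (P * (\<kappa> * \<eta>) + M * \<tau>)\<^sup>2))"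
      using S by (simp add: G_def)
    also have "\<dots> \<le> 3 * (T * (M * \<tau>)\<^sup>2 + T * (\<kappa> * \<eta>)\<^sup>2 + G * (E + T * (2 * (P * (\<kappa> * \<eta>))\<^sup>2 + 2 * (M * \<tau>)\<^sup>2)))"
      using assms G power2_sum2_le by (intro mult_left_mono add_left_mono) auto
    finally have "L * S \<le> L * (3 * (T * (M * \<tau>)\<^sup>2 + T * (\<kappa> * \<eta>)\<^sup>2 + G * (E + T * (2 * (P * (\<kappa> * \<eta>))\<^sup>2 + 2 * (M * \<tau>)\<^sup>2))))"
      using L by (intro mult_left_mono)
    hence "48 * T * K\<^sup>2 * \<tau>\<^sup>2 + L * S \<le> A * E + A' * \<tau>\<^sup>2 + A'' * \<eta>\<^sup>2"
      by (simp add: A_def A'_def A''_def power_mult_distrib algebra_simps)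
    also have "\<dots> \<le> C * E + C * \<tau>\<^sup>2 + C * \<eta>\<^sup>2"
      using nn E by (intro add_mono mult_right_mono) (auto simp: C_def)
    finally show ?thesis by (simp add: L_def distrib_left)
  qed
  moreover have "0 < C" using nn by (simp add: C_def)
  ultimately show ?thesis using that by blast
qed

context bounded_open
begin

lemma subspace_Vdiv: "subspace (Vdiv \<Omega>)"
proof -
  have iff: "v \<in> Vdiv \<Omega> \<longleftrightarrow> v \<in> V \<Omega> \<and> (\<forall>q \<in> Q \<Omega>. b_form \<Omega> v q = 0)" for v
    by (auto simp: Vdiv_def b_form_def)
  show ?thesis
  proof (rule subspaceI)
    show "0 \<in> Vdiv \<Omega>"
      using zero_V b_scale1[OF a.S_0, of _ 0] by (auto simp: iff Q_L2)
    fix v w and c :: real assume v: "v \<in> Vdiv \<Omega>"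
    thus "c *\<^sub>R v \<in> Vdiv \<Omega>"
      by (auto simp: iff b_bilin V_sobolev Q_L2 intro: subspace_scale[OF subspace_V] simp del: One_nat_def)
    assume "w \<in> Vdiv \<Omega>"
    with v show "v + w \<in> Vdiv \<Omega>"
      by (auto simp: iff b_bilin V_sobolev Q_L2 intro: subspace_add[OF subspace_V] simp del: One_nat_def)
  qed
qed

lemma sobolev_norm_limit_mono:
  fixes w :: "real \<Rightarrow> real ^ 'd \<Rightarrow> 'b::euclidean_space"
  assumes "n \<le> m" "((\<lambda>s. sobolev_norm \<Omega> m (w s - w t)) \<longlongrightarrow> 0) (at t within J)"
  shows "((\<lambda>s. sobolev_norm \<Omega> n (w s - w t)) \<longlongrightarrow> 0) (at t within J)"
proof (rule Lim_null_comparison[OF _ assms(2)], rule always_eventually, rule allI)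
  fix s show "norm (sobolev_norm \<Omega> n (w s - w t)) \<le> sobolev_norm \<Omega> m (w s - w t)"
    by (simp only: real_norm_def abs_of_nonneg[OF sobolev_norm_nonneg] sobolev_norm_mono[OF assms(1)])
qed

lemma L2norm_limit_of_sobolev:
  fixes w :: "real \<Rightarrow> real ^ 'd \<Rightarrow> 'b::euclidean_space"
  assumes "\<And>s. s \<in> J \<Longrightarrow> w s \<in> sobolev \<Omega> m" "t \<in> J"
    "((\<lambda>s. sobolev_norm \<Omega> m (w s - w t)) \<longlongrightarrow> 0) (at t within J)"
  shows "((\<lambda>s. L2norm \<Omega> (w s - w t)) \<longlongrightarrow> 0) (at t within J)"
proof (rule Lim_null_comparison[OF _ assms(3)])
  have "norm (L2norm \<Omega> (w s - w t)) \<le> sobolev_norm \<Omega> m (w s - w t)" if "s \<in> J" for s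
    unfolding real_norm_def abs_of_nonneg[OF L2norm_nonneg]
    by (intro L2norm_le_sobolev_norm L2.S_diff sobolev_L2[OF assms(1)] that assms(2))
  thus "\<forall>\<^sub>F s in at t within J. norm (L2norm \<Omega> (w s - w t)) \<le> sobolev_norm \<Omega> m (w s - w t)"
    by (intro eventually_at_topological[THEN iffD2] exI[of _ UNIV]) blast
qed

end

text \<open>The constant \<open>C + 1\<close> dominates both \<open>C\<close> and its square root.\<close>

lemma sqrt_le_of_squares:
  fixes x C g \<tau> \<eta> :: real
  assumes "x \<le> C * (g\<^sup>2 + \<tau>\<^sup>2 + \<eta>\<^sup>2)" "0 < C" "0 \<le> g" "0 \<le> \<tau>" "0 \<le> \<eta>"
  shows "sqrt x \<le> (C + 1) * (g + \<tau> + \<eta>)"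
proof (rule real_le_lsqrt)
  have "C * (g\<^sup>2 + \<tau>\<^sup>2 + \<eta>\<^sup>2) \<le> (C + 1)\<^sup>2 * (g + \<tau> + \<eta>)\<^sup>2"
  proof (rule mult_mono)
    show "C \<le> (C + 1)\<^sup>2" using assms(2) by (simp add: power2_eq_square algebra_simps)
    have "0 \<le> g * \<tau> + g * \<eta> + \<tau> * \<eta>" using assms by simp
    thus "g\<^sup>2 + \<tau>\<^sup>2 + \<eta>\<^sup>2 \<le> (g + \<tau> + \<eta>)\<^sup>2" by (simp add: power2_eq_square algebra_simps)
  qed auto
  thus "x \<le> ((C + 1) * (g + \<tau> + \<eta>))\<^sup>2" using assms(1) by (simp add: power_mult_distrib)
qed (use assms in simp)

theorem theorem5p4:
  fixes r :: nat
  assumes "CARD('d::finite) \<in> {2, 3}"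
  shows "\<exists>k. \<forall>(\<Omega> :: (real ^ 'd) set) (T :: real) f u0 u p (F :: 'd discretization set)
      (c1 :: real) (c2 :: real).
    open \<Omega> \<and> bounded \<Omega> \<and> connected \<Omega> \<and> \<Omega> \<noteq> {} \<and> T > 0 \<and>
    stokes_H2_regular \<Omega> \<and>
    stokes_solution \<Omega> T f u0 u p \<and>
    ck_sobolev \<Omega> {0..T} k k u \<and> ck_sobolev \<Omega> {0..T} k k p \<and>
    ck_sobolev \<Omega> {0..T} (k - 1) (k - 2) f \<and>
    fe_family \<Omega> r F \<and> c1 > 0 \<and> c2 > 0 \<longrightarrow>
    (\<exists>C>0. \<forall>D\<in>F. \<forall>N t u0h uh ph.
       time_mesh T N t \<and>
       step t 1 \<le> c1 * step t 2 \<and> (\<forall>m\<in>{2..N}. step t m \<le> c2 * step t (m - 1)) \<and>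
       u0h \<in> Vhdiv \<Omega> D \<and> scheme_G \<Omega> D N t f u0h uh ph \<longrightarrow>
       (let e = (\<lambda>s x. u_hat \<Omega> D N t u p s x - uh s x);
            pb = p_bar N t ph;
            \<tau> = max_step N t;
            h = mesh_size D
        in (\<Sum>m=1..N. step t m *
              (L2norm \<Omega> (\<lambda>x. p (t (m - 1)) x - right_limit \<Omega> pb (t (m - 1)) x))\<^sup>2)
             \<le> C * ((L2norm \<Omega> (grad \<Omega> (e 0)))\<^sup>2 + \<tau> ^ 4 + h ^ (2 * r)) \<and>
           sqrt (LBINT s:{0..T}. (L2norm \<Omega> (\<lambda>x. p s x - pb s x))\<^sup>2)
             \<le> C * (L2norm \<Omega> (grad \<Omega> (e 0)) + \<tau>\<^sup>2 + h ^ r)))"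
proof (intro exI[of _ "r + 4"] allI impI, elim conjE)
  \<comment> \<open>With \<open>k = r + 4\<close> the solution has the \<open>r + 1\<close> space derivatives of the approximation
      property, the two space derivatives of the Laplacian, and the three time derivatives of the
      trapezoidal rule.\<close>
  fix \<Omega> :: "(real ^ 'd) set" and T c1 c2 :: real and f u0 u p and F :: "'d discretization set"
  let ?k = "r + 4"
  assume "open \<Omega>" "bounded \<Omega>" and ne: "\<Omega> \<noteq> {}" and T: "0 < T"
    and sol: "stokes_solution \<Omega> T f u0 u p"
    and cku: "ck_sobolev \<Omega> {0..T} ?k ?k u" and ckp: "ck_sobolev \<Omega> {0..T} ?k ?k p"
    and ckf: "ck_sobolev \<Omega> {0..T} (?k - 1) (?k - 2) f"
    and fe: "fe_family \<Omega> r F" and c: "0 < c1" "0 < c2"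
  interpret bounded_open \<Omega> by unfold_locales fact+
  have T0: "0 \<in> {0..T}" using T by simp

  obtain W where W: "W 0 = u" "\<And>j t. j \<le> ?k \<Longrightarrow> t \<in> {0..T} \<Longrightarrow> W j t \<in> sobolev \<Omega> ?k"
    "\<And>j t. j \<le> ?k \<Longrightarrow> t \<in> {0..T} \<Longrightarrow> ((\<lambda>s. sobolev_norm \<Omega> ?k (W j s - W j t)) \<longlongrightarrow> 0) (at t within {0..T})"
    "\<And>j. j \<le> ?k \<Longrightarrow> \<exists>M\<ge>0. \<forall>t\<in>{0..T}. sobolev_norm \<Omega> ?k (W j t) \<le> M"
    "\<And>j. j < ?k \<Longrightarrow> L2.has_sderiv (W j) (W (Suc j)) {0..T}"
    "\<And>j n. j < ?k \<Longrightarrow> n \<le> ?k \<Longrightarrow> sob.has_sderiv n (W j) (W (Suc j)) {0..T}"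
    by (rule ck_sobolevE[OF cku]) (rule that; assumption)
  obtain R where R: "R 0 = p" "\<And>j t. j \<le> ?k \<Longrightarrow> t \<in> {0..T} \<Longrightarrow> R j t \<in> sobolev \<Omega> ?k"
    "\<And>j t. j \<le> ?k \<Longrightarrow> t \<in> {0..T} \<Longrightarrow> ((\<lambda>s. sobolev_norm \<Omega> ?k (R j s - R j t)) \<longlongrightarrow> 0) (at t within {0..T})"
    "\<And>j. j \<le> ?k \<Longrightarrow> \<exists>M\<ge>0. \<forall>t\<in>{0..T}. sobolev_norm \<Omega> ?k (R j t) \<le> M"
    "\<And>j. j < ?k \<Longrightarrow> L2.has_sderiv (R j) (R (Suc j)) {0..T}"
    "\<And>j n. j < ?k \<Longrightarrow> n \<le> ?k \<Longrightarrow> sob.has_sderiv n (R j) (R (Suc j)) {0..T}"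
    by (rule ck_sobolevE[OF ckp]) (rule that; assumption)
  obtain Z where Z: "Z 0 = f" "\<And>j t. j \<le> ?k - 1 \<Longrightarrow> t \<in> {0..T} \<Longrightarrow> Z j t \<in> sobolev \<Omega> (?k - 2)"
    "\<And>j t. j \<le> ?k - 1 \<Longrightarrow> t \<in> {0..T} \<Longrightarrow> ((\<lambda>s. sobolev_norm \<Omega> (?k - 2) (Z j s - Z j t)) \<longlongrightarrow> 0) (at t within {0..T})"
    "\<And>j. j \<le> ?k - 1 \<Longrightarrow> \<exists>M\<ge>0. \<forall>t\<in>{0..T}. sobolev_norm \<Omega> (?k - 2) (Z j t) \<le> M"
    "\<And>j. j < ?k - 1 \<Longrightarrow> L2.has_sderiv (Z j) (Z (Suc j)) {0..T}"
    "\<And>j n. j < ?k - 1 \<Longrightarrow> n \<le> ?k - 2 \<Longrightarrow> sob.has_sderiv n (Z j) (Z (Suc j)) {0..T}"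
    by (rule ck_sobolevE[OF ckf]) (rule that; assumption)

  have uS: "u s \<in> sobolev \<Omega> ?k" and pS: "p s \<in> sobolev \<Omega> ?k" and fS: "f s \<in> sobolev \<Omega> (?k - 2)"
    if "s \<in> {0..T}" for s
    using W(2)[of 0 s] R(2)[of 0 s] Z(2)[of 0 s] that unfolding W(1) R(1) Z(1) by simp_all
  have weak: "ip \<Omega> (f s) v = ip \<Omega> (W 1 s) v + a_form \<Omega> (u s) v + b_form \<Omega> v (p s)"
    if s: "s \<in> {0..T}" and v: "v \<in> V \<Omega>" for s v
  proof (rule weak_formulation[OF T sol _ _ _ _ _ _ _ _ _ v s])
    fix s assume s: "s \<in> {0..T}"
    have W01: "L2.has_sderiv (W 0) (W 1) {0..T}" using W(5)[of 0] by simp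
    show "((\<lambda>r. L2norm \<Omega> ((u r - u s) /\<^sub>R (r - s) - W 1 s)) \<longlongrightarrow> 0) (at s within {0..T})"
      using L2.has_sderivD(3)[OF W01 s] by (simp only: L2norm_eq_nrm W(1))
    show "W 1 s \<in> L2 \<Omega>" by (rule L2.has_sderivD(2)[OF W01 s])
    show "u s \<in> sobolev \<Omega> 2" "p s \<in> sobolev \<Omega> 1" "f s \<in> L2 \<Omega>"
      by (rule sobolev_mono[OF _ uS[OF s]] sobolev_mono[OF _ pS[OF s]] sobolev_L2[OF fS[OF s]]; simp)+
  next
    show "((\<lambda>s. L2norm \<Omega> (W 1 s - W 1 0)) \<longlongrightarrow> 0) (at 0 within {0..T})"
    proof (rule L2norm_limit_of_sobolev[OF W(2)])
      show "((\<lambda>s. sobolev_norm \<Omega> ?k (W 1 s - W 1 0)) \<longlongrightarrow> 0) (at 0 within {0..T})"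
        using W(3)[of 1 0] T0 by simp
    qed (use T0 in auto)
    show "((\<lambda>s. sobolev_norm \<Omega> 1 (u s - u 0)) \<longlongrightarrow> 0) (at 0 within {0..T})"
      by (rule sobolev_norm_limit_mono[OF _ W(3)[of 0 0, unfolded W(1)]]) (use T0 in auto)
    show "((\<lambda>s. L2norm \<Omega> (p s - p 0)) \<longlongrightarrow> 0) (at 0 within {0..T})"
      by (rule L2norm_limit_of_sobolev[OF pS T0 R(3)[of 0 0, unfolded R(1)]]) (use T0 in auto)
    show "((\<lambda>s. L2norm \<Omega> (f s - f 0)) \<longlongrightarrow> 0) (at 0 within {0..T})"
      by (rule L2norm_limit_of_sobolev[OF fS T0 Z(3)[of 0 0, unfolded Z(1)]]) (use T0 in auto)
  qed

  obtain M3 where M3: "0 \<le> M3" "\<And>t. t \<in> {0..T} \<Longrightarrow> sobolev_norm \<Omega> ?k (W 3 t) \<le> M3" using W(4)[of 3] by auto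
  obtain M0 where M0: "0 \<le> M0" "\<And>t. t \<in> {0..T} \<Longrightarrow> sobolev_norm \<Omega> ?k (W 0 t) \<le> M0" using W(4)[of 0] by auto
  obtain M1 where M1: "0 \<le> M1" "\<And>t. t \<in> {0..T} \<Longrightarrow> sobolev_norm \<Omega> ?k (W 1 t) \<le> M1" using W(4)[of 1] by auto
  obtain N0 where N0: "0 \<le> N0" "\<And>t. t \<in> {0..T} \<Longrightarrow> sobolev_norm \<Omega> ?k (R 0 t) \<le> N0" using R(4)[of 0] by auto
  obtain N1 where N1: "0 \<le> N1" "\<And>t. t \<in> {0..T} \<Longrightarrow> sobolev_norm \<Omega> ?k (R 1 t) \<le> N1" using R(4)[of 1] by auto
  obtain N2 where N2: "0 \<le> N2" "\<And>t. t \<in> {0..T} \<Longrightarrow> sobolev_norm \<Omega> ?k (R 2 t) \<le> N2" using R(4)[of 2] by auto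
  define K where "K = 2 * N2"
  define M where "M = M3 + K"
  define B where "B = M0 + M1 + N0 + N1"
  have K: "0 \<le> K" and M: "0 \<le> M" using M3 N2 by (auto simp: K_def M_def)

  have trap: "L2norm \<Omega> ((1 / (b - a)) *\<^sub>R (u b - u a) - (1/2) *\<^sub>R (W 1 a + W 1 b)) \<le> M * (b - a)\<^sup>2"
    if ab: "0 \<le> a" "a < b" "b \<le> T" for a b
  proof -
    have "L2.nrm ((W 0 b - W 0 a) /\<^sub>R (b - a) - (1/2) *\<^sub>R (W 1 a + W 1 b)) \<le> M3 * (b - a)\<^sup>2"
    proof (rule L2.trapezoid_bound[where J = "{0..T}"])
      show "L2.has_sderiv (W 0) (W 1) {0..T}" "L2.has_sderiv (W 1) (W 2) {0..T}" "L2.has_sderiv (W 2) (W 3) {0..T}"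
        using W(5)[of 0] W(5)[of 1] W(5)[of 2] by (simp_all add: numeral_2_eq_2 numeral_3_eq_3)
      show "L2.nrm (W 3 s) \<le> M3" if "s \<in> {0..T}" for s
        using L2norm_le_sobolev_norm[OF sobolev_L2[OF W(2)[of 3 s]], of ?k] M3(2)[OF that] that
        by (simp add: L2norm_eq_nrm)
    qed (use ab in auto)
    also have "\<dots> \<le> M * (b - a)\<^sup>2" using K by (intro mult_right_mono) (auto simp: M_def)
    finally show ?thesis by (simp only: L2norm_eq_nrm W(1) inverse_eq_divide)
  qed
  have interp: "L2norm \<Omega> (p s - (p c + ((s - c) / (d - c)) *\<^sub>R (p d - p c))) \<le> K * (b - a)\<^sup>2"
    if "{a..b} \<subseteq> {0..T}" "s \<in> {a..b}" "c \<in> {a..b}" "d \<in> {a..b}" "c < d" for a b c d s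
  proof -
    have "L2.nrm (R 0 s - (R 0 c + ((s - c) / (d - c)) *\<^sub>R (R 0 d - R 0 c))) \<le> 2 * N2 * (b - a)\<^sup>2"
    proof (rule L2.interpolation_bound[where J = "{0..T}"])
      show "L2.has_sderiv (R 0) (R 1) {0..T}" "L2.has_sderiv (R 1) (R 2) {0..T}"
        using R(5)[of 0] R(5)[of 1] by (simp_all add: numeral_2_eq_2)
      show "L2.nrm (R 2 s) \<le> N2" if "s \<in> {0..T}" for s
        using L2norm_le_sobolev_norm[OF sobolev_L2[OF R(2)[of 2 s]], of ?k] N2(2)[OF that] that
        by (simp add: L2norm_eq_nrm)
    qed (use that in auto)
    thus ?thesis by (simp only: L2norm_eq_nrm R(1) K_def)
  qed
  have pmid: "L2norm \<Omega> (p ((a + b) / 2) - (1/2) *\<^sub>R (p a + p b)) \<le> M * (b - a)\<^sup>2"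
    if ab: "0 \<le> a" "a < b" "b \<le> T" for a b
  proof -
    have "L2norm \<Omega> (p ((a + b) / 2) - (p a + (((a + b) / 2 - a) / (b - a)) *\<^sub>R (p b - p a))) \<le> K * (b - a)\<^sup>2"
      by (rule interp) (use ab in auto)
    moreover have "((a + b) / 2 - a) / (b - a) = 1 / 2" using ab by (simp add: field_simps)
    moreover have "p a + (1/2) *\<^sub>R (p b - p a) = (1/2) *\<^sub>R (p a + p b)"
      by (rule ext) (simp add: field_simps)
    moreover have "K * (b - a)\<^sup>2 \<le> M * (b - a)\<^sup>2" using M3 by (intro mult_right_mono) (auto simp: M_def)
    ultimately show ?thesis by (simp only:)
  qed
  \<comment> \<open>The Stokes projection is also applied to difference quotients in time, whose Sobolev norms
      are bounded by those of the time derivatives.\<close>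
  have incr_u: "sobolev_norm \<Omega> (r + 1) ((1 / (b - a)) *\<^sub>R (u b - u a)) \<le> B"
    and incr_p: "sobolev_norm \<Omega> r ((1 / (b - a)) *\<^sub>R (p b - p a)) \<le> B"
    if ab: "0 \<le> a" "a < b" "b \<le> T" for a b
  proof -
    have W1: "sobolev_norm \<Omega> n ((1 / (b - a)) *\<^sub>R (w 0 b - w 0 a)) \<le> L"
      if w: "sob.has_sderiv n (w 0) (w 1) {0..T}" and L: "\<And>s. s \<in> {0..T} \<Longrightarrow> sobolev_norm \<Omega> ?k (w 1 s) \<le> L"
        and n: "n \<le> ?k" and mem: "\<And>s. s \<in> {0..T} \<Longrightarrow> w 0 s \<in> sobolev \<Omega> n" "\<And>s. s \<in> {0..T} \<Longrightarrow> w 1 s \<in> sobolev \<Omega> n"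
      for w :: "nat \<Rightarrow> real \<Rightarrow> real ^ 'd \<Rightarrow> 'b::euclidean_space" and n L
    proof -
      have S: "w 0 b - w 0 a \<in> sobolev \<Omega> n" using ab by (intro sob.S_diff mem) auto
      have "sob.nrm n (w 0 b - w 0 a) \<le> L * (b - a)"
      proof (rule sob.increment_bound[OF w])
        fix s assume s: "s \<in> {0..T}"
        show "sob.nrm n (w 1 s) \<le> L"
          using sobolev_norm_mono[OF n, of "w 1 s"] L[OF s] sobolev_norm_eq_nrm[OF mem(2)[OF s]] by simp
      qed (use ab in auto)
      hence "(1 / (b - a)) * sob.nrm n (w 0 b - w 0 a) \<le> L" using ab by (simp add: field_simps)
      thus ?thesis
        using sob.nrm_scale[OF S, of "1 / (b - a)"] sobolev_norm_eq_nrm[OF sob.S_scale[OF S], of "1 / (b - a)"] ab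
        by simp
    qed
    have "sobolev_norm \<Omega> (r + 1) ((1 / (b - a)) *\<^sub>R (W 0 b - W 0 a)) \<le> M1"
    proof (rule W1)
      show "sob.has_sderiv (r + 1) (W 0) (W 1) {0..T}" using W(6)[of 0 "r + 1"] by simp
      show "W 0 s \<in> sobolev \<Omega> (r + 1)" "W 1 s \<in> sobolev \<Omega> (r + 1)" if "s \<in> {0..T}" for s
        by (rule sobolev_mono[OF _ W(2)[OF _ that]]; simp)+
    qed (use M1 in auto)
    thus "sobolev_norm \<Omega> (r + 1) ((1 / (b - a)) *\<^sub>R (u b - u a)) \<le> B"
      using M0(1) M1(1) N0(1) N1(1) unfolding W(1) B_def by linarith
    have "sobolev_norm \<Omega> r ((1 / (b - a)) *\<^sub>R (R 0 b - R 0 a)) \<le> N1"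
    proof (rule W1)
      show "sob.has_sderiv r (R 0) (R 1) {0..T}" using R(6)[of 0 r] by simp
      show "R 0 s \<in> sobolev \<Omega> r" "R 1 s \<in> sobolev \<Omega> r" if "s \<in> {0..T}" for s
        by (rule sobolev_mono[OF _ R(2)[OF _ that]]; simp)+
    qed (use N1 in auto)
    thus "sobolev_norm \<Omega> r ((1 / (b - a)) *\<^sub>R (p b - p a)) \<le> B"
      using M0(1) M1(1) N0(1) N1(1) unfolding R(1) B_def by linarith
  qed

  obtain \<beta> where \<beta>: "0 < \<beta>" and infsup: "\<And>D. D \<in> F \<Longrightarrow> ereal \<beta> \<le>
    (INF q \<in> {q \<in> Qh \<Omega> D. \<not> ae_eq \<Omega> q (\<lambda>x. 0)}.
     SUP v \<in> {v \<in> Vh \<Omega> D. \<not> ae_eq \<Omega> v (\<lambda>x. 0)}.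
       ereal (- ip \<Omega> (divergence \<Omega> v) q / (sobolev_norm \<Omega> 1 v * L2norm \<Omega> q)))"
    using fe unfolding fe_family_def uniform_inf_sup_def by blast
  obtain l where l: "\<And>D K. D \<in> F \<Longrightarrow> K \<in> cells D \<Longrightarrow> fun_subspace (V_loc D K) \<and> V_loc D K \<subseteq> mapped_polys l D K \<and>
        fun_subspace (Q_loc D K) \<and> Q_loc D K \<subseteq> mapped_polys l D K"
    using fe unfolding fe_family_def mapped_polynomial_spaces_def by blast
  obtain Ca where Ca: "\<And>D. D \<in> F \<Longrightarrow> (\<forall>v \<in> V \<Omega> \<inter> sobolev \<Omega> (r + 1). \<exists>v' \<in> Vh \<Omega> D.
       L2norm \<Omega> (\<lambda>x. v x - v' x) + mesh_size D * L2norm \<Omega> (grad \<Omega> (\<lambda>x. v x - v' x))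
         \<le> Ca * mesh_size D ^ (r + 1) * sobolev_norm \<Omega> (r + 1) v)"
    "\<And>D. D \<in> F \<Longrightarrow> \<forall>q \<in> Q \<Omega> \<inter> sobolev \<Omega> r. \<exists>q' \<in> Qh \<Omega> D.
       L2norm \<Omega> (\<lambda>x. q x - q' x) \<le> Ca * mesh_size D ^ r * sobolev_norm \<Omega> r q"
    using fe unfolding fe_family_def approximation_property_def by blast
  have mesh: "mesh_of \<Omega> D" if "D \<in> F" for D using fe that by (auto simp: fe_family_def)
  obtain P where P: "0 \<le> P" "\<And>v. v \<in> V \<Omega> \<Longrightarrow> L2norm \<Omega> v \<le> P * L2norm \<Omega> (grad \<Omega> v)"
    by (rule poincare) (rule that; assumption)

  \<comment> \<open>The constants of \<open>projection_error\<close> for the gradient of the velocity and for the pressure.\<close>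
  define \<kappa>1 where "\<kappa>1 = (1 + 2 * (1 + 1 / \<beta>) * (1 + real CARD('d))) * (\<bar>Ca\<bar> * B)"
  define \<kappa>2 where "\<kappa>2 = (1 + 1 / \<beta> * ((1 + real CARD('d)) + 2 * (1 + 1 / \<beta>) * (1 + real CARD('d)))) * (\<bar>Ca\<bar> * B)"
  define \<kappa> where "\<kappa> = \<kappa>1 + \<kappa>2"
  have B: "0 \<le> B" using M0 M1 N0 N1 by (simp add: B_def)
  have \<kappa>12: "0 \<le> \<kappa>1" "0 \<le> \<kappa>2" using \<beta> B by (simp_all add: \<kappa>1_def \<kappa>2_def)
  obtain C where C: "0 < C"
    "\<And>S E \<tau> \<eta>. S \<le> 3 * (T * (M * \<tau>)\<^sup>2 + T * (\<kappa> * \<eta>)\<^sup>2 + 4 / \<beta>\<^sup>2 * (2 + T) * (E + T * (P * (\<kappa> * \<eta>) + M * \<tau>)\<^sup>2)) \<Longrightarrow> 0 \<le> E \<Longrightarrow>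
      48 * T * K\<^sup>2 * \<tau>\<^sup>2 + 12 * (1 + c1 + c2) * S \<le> C * (E + \<tau>\<^sup>2 + \<eta>\<^sup>2)"
    using collect_constants[of T \<beta> c1 c2 M \<kappa> P K] T \<beta> c by auto

  \<comment> \<open>All constants have been fixed independently of the discretization. For the second estimate,
      which contains a square root, \<open>C\<close> is enlarged to \<open>C + 1\<close>.\<close>
  show "\<exists>C>0. \<forall>D\<in>F. \<forall>N t u0h uh ph.
       time_mesh T N t \<and>
       step t 1 \<le> c1 * step t 2 \<and> (\<forall>m\<in>{2..N}. step t m \<le> c2 * step t (m - 1)) \<and>
       u0h \<in> Vhdiv \<Omega> D \<and> scheme_G \<Omega> D N t f u0h uh ph \<longrightarrow>
       (let e = (\<lambda>s x. u_hat \<Omega> D N t u p s x - uh s x);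
            pb = p_bar N t ph;
            \<tau> = max_step N t;
            h = mesh_size D
        in (\<Sum>m=1..N. step t m *
              (L2norm \<Omega> (\<lambda>x. p (t (m - 1)) x - right_limit \<Omega> pb (t (m - 1)) x))\<^sup>2)
             \<le> C * ((L2norm \<Omega> (grad \<Omega> (e 0)))\<^sup>2 + \<tau> ^ 4 + h ^ (2 * r)) \<and>
           sqrt (LBINT s:{0..T}. (L2norm \<Omega> (\<lambda>x. p s x - pb s x))\<^sup>2)
             \<le> C * (L2norm \<Omega> (grad \<Omega> (e 0)) + \<tau>\<^sup>2 + h ^ r))"
  proof (rule exI[of _ "C + 1"], intro conjI ballI allI impI, goal_cases)
    case 1
    show ?case using C(1) by simp
  next
    case (2 D N t u0h uh ph)
    hence D: "D \<in> F" and tm: "time_mesh T N t" and s1: "step t 1 \<le> c1 * step t 2"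
      and s2: "\<forall>m\<in>{2..N}. step t m \<le> c2 * step t (m - 1)"
      and u0h: "u0h \<in> Vhdiv \<Omega> D" and sch: "scheme_G \<Omega> D N t f u0h uh ph" by auto
    interpret fe_space \<Omega> D l
      by unfold_locales (use mesh[OF D] l[OF D] ne in auto)
    let ?h = "mesh_size D" and ?\<tau> = "max_step N t"
    define E where "E = L2norm \<Omega> (grad \<Omega> (u_hat \<Omega> D N t u p 0 - uh 0))"
    have isc: "inf_sup_const \<beta>" by (rule inf_sup_constI[OF infsup[OF D]])
    have uV: "u s \<in> Vdiv \<Omega>" and pQ: "p s \<in> Q \<Omega>" if "s \<in> {0..T}" for s
      using sol that by (auto simp: stokes_solution_def)
    have h0: "0 \<le> ?h ^ r" using mesh_size_pos by simp
    have \<kappa>h: "\<kappa>1 * ?h ^ r \<le> \<kappa> * ?h ^ r" "\<kappa>2 * ?h ^ r \<le> \<kappa> * ?h ^ r"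
      using \<kappa>12 h0 by (auto intro!: mult_right_mono simp: \<kappa>_def)
    have pe: "L2norm \<Omega> (grad \<Omega> (w - w')) \<le> \<kappa> * ?h ^ r" "L2norm \<Omega> (s - s') \<le> \<kappa> * ?h ^ r"
      if "w \<in> Vdiv \<Omega>" "w \<in> sobolev \<Omega> (r + 1)" "sobolev_norm \<Omega> (r + 1) w \<le> B"
        "s \<in> Q \<Omega>" "s \<in> sobolev \<Omega> r" "sobolev_norm \<Omega> r s \<le> B" "is_stokes_projection \<Omega> D w s w' s'" for w s w' s'
    proof -
      have "L2norm \<Omega> (grad \<Omega> (w - w')) \<le> \<kappa>1 * ?h ^ r"
        unfolding \<kappa>1_def by (rule projection_error(1)[OF Ca(1)[OF D] Ca(2)[OF D] \<beta> isc that])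
      thus "L2norm \<Omega> (grad \<Omega> (w - w')) \<le> \<kappa> * ?h ^ r" using \<kappa>h(1) by linarith
      have "L2norm \<Omega> (s - s') \<le> \<kappa>2 * ?h ^ r"
        unfolding \<kappa>2_def by (rule projection_error(2)[OF Ca(1)[OF D] Ca(2)[OF D] \<beta> isc that])
      thus "L2norm \<Omega> (s - s') \<le> \<kappa> * ?h ^ r" using \<kappa>h(2) by linarith
    qed
    \<comment> \<open>The interpolation in time keeps the value at \<open>0\<close>, so \<open>u_hat\<close> starts with the velocity of
        a Stokes projection of the initial data; which one depends on a choice, and \<open>w0\<close> denotes
        it.\<close>
    obtain w0 s0 where proj0: "is_stokes_projection \<Omega> D (u 0) (p 0) w0 s0" and w0: "u_hat \<Omega> D N t u p 0 = w0"
    proof -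
      have R1: "R1 N t w 0 = w 0" for w :: "real \<Rightarrow> real ^ 'd \<Rightarrow> 'b::real_normed_vector"
        by (simp add: R1_def fun_eq_iff)
      obtain z where "is_stokes_projection \<Omega> D (u 0) (p 0) (fst z) (snd z)"
        using stokes_projection_exists[OF sobolev_mono[OF _ uS[OF T0]] sobolev_L2[OF pS[OF T0]]] by fastforce
      hence "case (SOME (w', s'). is_stokes_projection \<Omega> D (u 0) (p 0) w' s') of
          (w', s') \<Rightarrow> is_stokes_projection \<Omega> D (u 0) (p 0) w' s'"
        by (intro someI[where P = "\<lambda>(w', s'). is_stokes_projection \<Omega> D (u 0) (p 0) w' s'" and x = z]) (simp add: case_prod_unfold)
      thus ?thesis by (intro that) (simp_all add: case_prod_unfold u_hat_def R1 Rh_u_def)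
    qed
    have mid: "(\<Sum>n=1..N. step t n * (L2norm \<Omega> (p (midpt t n) - ph (midpt t n)))\<^sup>2)
      \<le> 3 * (T * (M * ?\<tau>\<^sup>2)\<^sup>2 + T * (\<kappa> * ?h ^ r)\<^sup>2 +
        4 / \<beta>\<^sup>2 * (2 + T) * ((L2norm \<Omega> (grad \<Omega> (w0 - uh 0)))\<^sup>2 + T * (P * (\<kappa> * ?h ^ r) + M * ?\<tau>\<^sup>2)\<^sup>2))"
    proof (rule midpoint_pressure_error[where W = "W 1" and u = u and p = p and f = f])
      show "f s \<in> L2 \<Omega>" "W 1 s \<in> L2 \<Omega>" "u s \<in> V \<Omega>" "p s \<in> Q \<Omega>" if s: "s \<in> {0..T}" for s
        using sobolev_L2[OF fS[OF s]] sobolev_L2[OF W(2)[of 1 s]] uV[OF s] pQ[OF s] s by (auto simp: Vdiv_def)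
      show "L2norm \<Omega> (p s - s') \<le> \<kappa> * ?h ^ r"
        if s: "s \<in> {0..T}" and proj: "is_stokes_projection \<Omega> D (u s) (p s) w' s'" for s w' s'
      proof (rule pe(2)[OF uV[OF s] _ _ pQ[OF s] _ _ proj])
        show "u s \<in> sobolev \<Omega> (r + 1)" "p s \<in> sobolev \<Omega> r"
          by (rule sobolev_mono[OF _ uS[OF s]] sobolev_mono[OF _ pS[OF s]]; simp)+
        show "sobolev_norm \<Omega> (r + 1) (u s) \<le> B"
          using order_trans[OF sobolev_norm_mono[of "r + 1" ?k] M0(2)[OF s]] M1(1) N0(1) N1(1) by (simp add: W(1) B_def add.assoc)
        show "sobolev_norm \<Omega> r (p s) \<le> B"
          using order_trans[OF sobolev_norm_mono[of r ?k] N0(2)[OF s]] M0(1) M1(1) N1(1) by (simp add: R(1) B_def)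
      qed
      show "L2norm \<Omega> (grad \<Omega> ((1 / (b - a)) *\<^sub>R (u b - u a) - w')) \<le> \<kappa> * ?h ^ r"
        if ab: "0 \<le> a" "a < b" "b \<le> T" and
          proj: "is_stokes_projection \<Omega> D ((1 / (b - a)) *\<^sub>R (u b - u a)) ((1 / (b - a)) *\<^sub>R (p b - p a)) w' s'" for a b w' s'
      proof (rule pe(1)[OF _ _ incr_u[OF ab] _ _ incr_p[OF ab] proj])
        have i: "a \<in> {0..T}" "b \<in> {0..T}" using ab by auto
        show "(1 / (b - a)) *\<^sub>R (u b - u a) \<in> Vdiv \<Omega>"
          by (intro subspace_scale[OF subspace_Vdiv] subspace_diff[OF subspace_Vdiv] uV i)
        show "(1 / (b - a)) *\<^sub>R (p b - p a) \<in> Q \<Omega>"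
          by (intro subspace_scale[OF subspace_Q] subspace_diff[OF subspace_Q] pQ i)
        show "(1 / (b - a)) *\<^sub>R (u b - u a) \<in> sobolev \<Omega> (r + 1)"
          by (intro sob.S_intros sobolev_mono[OF _ uS[OF i(1)]] sobolev_mono[OF _ uS[OF i(2)]]) simp_all
        show "(1 / (b - a)) *\<^sub>R (p b - p a) \<in> sobolev \<Omega> r"
          by (intro sob.S_intros sobolev_mono[OF _ pS[OF i(1)]] sobolev_mono[OF _ pS[OF i(2)]]) simp_all
      qed
    qed (fact tm sch u0h weak \<beta> isc P trap pmid M proj0)+
    have mid': "48 * T * K\<^sup>2 * (?\<tau>\<^sup>2)\<^sup>2 + 12 * (1 + c1 + c2) * (\<Sum>n=1..N. step t n * (L2norm \<Omega> (p (midpt t n) - ph (midpt t n)))\<^sup>2)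
        \<le> C * (E\<^sup>2 + (?\<tau>\<^sup>2)\<^sup>2 + (?h ^ r)\<^sup>2)"
      by (rule C(2)) (use mid in \<open>simp_all add: E_def w0\<close>)
    have E0: "0 \<le> E" unfolding E_def by (rule L2norm_nonneg)
    have ph: "ph (midpt t n) \<in> L2 \<Omega>" if "n \<in> {1..N}" for n
      by (rule Qh_L2[OF scheme_step(3)[OF sch tm that]])
    have pL: "p s \<in> L2 \<Omega>" if "s \<in> {0..T}" for s using Q_L2[OF pQ[OF that]] .
    have c': "0 \<le> c1" "0 \<le> c2" using c by simp_all
    let ?X = "48 * T * K\<^sup>2 * (?\<tau>\<^sup>2)\<^sup>2 + 12 * (1 + c1 + c2) * (\<Sum>n=1..N. step t n * (L2norm \<Omega> (p (midpt t n) - ph (midpt t n)))\<^sup>2)"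
    have pp1: "(\<Sum>m=1..N. step t m * (L2norm \<Omega> (\<lambda>x. p (t (m - 1)) x - right_limit \<Omega> (p_bar N t ph) (t (m - 1)) x))\<^sup>2) \<le> ?X"
      by (rule postprocessing_error(1)[where T = T and K = K]; fact tm pL ph interp K s1 s2 c')
    have pp2: "(LBINT s:{0..T}. (L2norm \<Omega> (\<lambda>x. p s x - p_bar N t ph s x))\<^sup>2) \<le> ?X"
      by (rule postprocessing_error(2)[where T = T and K = K]; fact tm pL ph interp K s1 s2 c')
    have e0: "(\<lambda>x. u_hat \<Omega> D N t u p 0 x - uh 0 x) = u_hat \<Omega> D N t u p 0 - uh 0"
      by (simp only: fun_diff_def)
    have pow: "?\<tau> ^ 4 = (?\<tau>\<^sup>2)\<^sup>2" "?h ^ (2 * r) = (?h ^ r)\<^sup>2"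
      by (simp_all add: power_mult[symmetric] mult.commute)
    show ?case
      unfolding Let_def e0 E_def[symmetric] pow
    proof
      show "(\<Sum>m=1..N. step t m * (L2norm \<Omega> (\<lambda>x. p (t (m - 1)) x - right_limit \<Omega> (p_bar N t ph) (t (m - 1)) x))\<^sup>2)
          \<le> (C + 1) * (E\<^sup>2 + (?\<tau>\<^sup>2)\<^sup>2 + (?h ^ r)\<^sup>2)"
        proof -
        have "0 \<le> E\<^sup>2 + (?\<tau>\<^sup>2)\<^sup>2 + (?h ^ r)\<^sup>2" by simp
        hence "C * (E\<^sup>2 + (?\<tau>\<^sup>2)\<^sup>2 + (?h ^ r)\<^sup>2) \<le> (C + 1) * (E\<^sup>2 + (?\<tau>\<^sup>2)\<^sup>2 + (?h ^ r)\<^sup>2)"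
          by (intro mult_right_mono) simp_all
        from order_trans[OF pp1 order_trans[OF mid' this]] show ?thesis .
      qed
      show "sqrt (LBINT s:{0..T}. (L2norm \<Omega> (\<lambda>x. p s x - p_bar N t ph s x))\<^sup>2) \<le> (C + 1) * (E + ?\<tau>\<^sup>2 + ?h ^ r)"
        by (rule sqrt_le_of_squares[OF order_trans[OF pp2 mid'] C(1) E0 _ h0]) simp
    qed
  qed
qed

end
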